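(* Let $\omega$ be a radial weight. Then the following statements are equivalent: (i) $P_\omega:L^\infty\to\mathcal{B}$ is bounded and onto; (ii) $(A^1_\omega)^\star\simeq\mathcal{B}$ via the $A^2_\omega$-pairing with equivalence of norms; (iii) $\mathcal{B}_0^\star\simeq A^1_\omega$ via the $A^2_\omega$-pairing with equivalence of norms; (iv) $\omega\in\mathcal{D}$; (v) $\omega\in\widehat{\mathcal{D}}\cap\mathcal{M}$.
   Context: $\mathbb{D}$ is the open unit disc of $\mathbb{C}$, $\mathcal{H}(\mathbb{D})$ the space of analytic functions in $\mathbb{D}$, and $dA(z)=\frac{dx\,dy}{\pi}$. A radial weight is a nonnegative function $\omega\in L^1([0,1))$ extended to $\mathbb{D}$ by $\omega(z)=\omega(|z|)$; it is assumed throughout that $\widehat{\omega}(z)=\int_{|z|}^1\omega(s)\,ds>0$ for all $z\in\mathbb{D}$. For $0<p<\infty$, $L^p_\omega$ is the space of measurable $f$ on $\mathbb{D}$ with $\|f\|_{L^p_\omega}^p=\int_{\mathbb{D}}|f(z)|^p\omega(z)\,dA(z)<\infty$, and $A^p_\omega=L^p_\omega\cap\mathcal{H}(\mathbb{D})$. Write $\omega_x=\int_0^1r^x\omega(r)\,dr$ for $x\ge0$. The reproducing kernel of $A^2_\omega$ is $B^\omega_z(\zeta)=\sum_{n=0}^\infty\frac{(\overline{z}\zeta)^n}{2\omega_{2n+1}}$, and the Bergman projection is $P_\omega(f)(z)=\int_{\mathbb{D}}f(\zeta)\overline{B^\omega_z(\zeta)}\,\omega(\zeta)\,dA(\zeta)$.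 $L^\infty$ is the space of (essentially) bounded measurable functions on $\mathbb{D}$. The Bloch space $\mathcal{B}$ consists of $f\in\mathcal{H}(\mathbb{D})$ with $\|f\|_{\mathcal{B}}=\sup_{z\in\mathbb{D}}|f'(z)|(1-|z|^2)+|f(0)|<\infty$; the little Bloch space $\mathcal{B}_0$ (with the norm of $\mathcal{B}$) consists of $f\in\mathcal{H}(\mathbb{D})$ with $f'(z)(1-|z|^2)\to0$ as $|z|\to1^-$. The $A^2_\omega$-pairing is $\langle f,g\rangle_{A^2_\omega}=\lim_{r\to1^-}\int_{\mathbb{D}}f_r(z)\overline{g(z)}\,\omega(z)\,dA(z)$, where $f_r(z)=f(rz)$. "$X^\star\simeq Y$ via the $A^2_\omega$-pairing with equivalence of norms" means that each $g\in Y$ induces a bounded linear functional $L_g(f)=\langle f,g\rangle_{A^2_\omega}$ on $X$, each element of the dual $X^\star$ equals $L_g$ for a unique $g\in Y$, and $\|L_g\|$ and $\|g\|_Y$ are comparable with constants independent of $g$. Classes of radial weights: $\omega\in\widehat{\mathcal{D}}$ if there is $C\ge1$ with $\widehat{\omega}(r)\le C\widehat{\omega}\left(\frac{1+r}{2}\right)$ for all $0\le r<1$; $\omega\in\check{\mathcal{D}}$ if there are $K>1$ and $C>1$ with $\widehat{\omega}(r)\ge C\widehat{\omega}\left(1-\frac{1-r}{K}\right)$ for all $0\le r<1$; $\mathcal{D}=\widehat{\mathcal{D}}\cap\check{\mathcal{D}}$; $\omega\in\mathcal{M}$ if there are $C>1$ and $K>1$ with $\omega_x\ge C\omega_{Kx}$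 for all $x\ge1$. (All constants may depend on $\omega$.) *)

theory Defs
  imports "HOL-Analysis.Analysis" "HOL-Probability.Essential_Supremum"
begin

abbreviation disc :: "complex set" (\<open>\<D>\<close>)
  where "\<D> \<equiv> ball 0 1"

definition dA :: "complex measure"
  where "dA = density (lebesgue_on \<D>) (\<lambda>_. ennreal (1 / pi))"

text \<open>
  A radial weight is represented by its profile on \<open>[0,1)\<close>; its value at a point \<open>z\<close> of
  the disc is \<open>\<omega> (norm z)\<close>, and the values of the profile outside \<open>[0,1)\<close> are never used.
  The same convention applies to the tail integral.
\<close>

definition tail :: "(real \<Rightarrow> real) \<Rightarrow> real \<Rightarrow> real"
  where "tail \<omega> r = (LINT s:{r..<1}|lebesgue. \<omega> s)"

definition radial_weight :: "(real \<Rightarrow> real) \<Rightarrow> bool"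
  where "radial_weight \<omega> \<longleftrightarrow>
    (\<forall>r\<in>{0..<1}. 0 \<le> \<omega> r) \<and>
    set_integrable lebesgue {0..<1} \<omega> \<and>
    (\<forall>r\<in>{0..<1}. 0 < tail \<omega> r)"

definition moment :: "(real \<Rightarrow> real) \<Rightarrow> real \<Rightarrow> real"
  where "moment \<omega> x = (LINT r:{0..<1}|lebesgue. r powr x * \<omega> r)"

definition D_hat :: "(real \<Rightarrow> real) set"
  where "D_hat = {\<omega>. radial_weight \<omega> \<and>
    (\<exists>C\<ge>1. \<forall>r\<in>{0..<1}. tail \<omega> r \<le> C * tail \<omega> ((1 + r) / 2))}"

definition D_check :: "(real \<Rightarrow> real) set"
  where "D_check = {\<omega>. radial_weight \<omega> \<and>
    (\<exists>K>1. \<exists>C>1. \<forall>r\<in>{0..<1}. tail \<omega> r \<ge> C * tail \<omega> (1 - (1 - r) / K))}"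

definition D_class :: "(real \<Rightarrow> real) set"
  where "D_class = D_hat \<inter> D_check"

definition M_class :: "(real \<Rightarrow> real) set"
  where "M_class = {\<omega>. radial_weight \<omega> \<and>
    (\<exists>C>1. \<exists>K>1. \<forall>x\<ge>1. moment \<omega> x \<ge> C * moment \<omega> (K * x))}"

text \<open>
  Functions on the disc are functions on the whole complex plane whose values outside the
  disc are irrelevant: all conditions and norms below depend only on the values in the disc,
  and two such functions are identified when they agree on the disc.
\<close>

definition Lp_space :: "real \<Rightarrow> (real \<Rightarrow> real) \<Rightarrow> (complex \<Rightarrow> complex) set"
  where "Lp_space p \<omega> = {f. f \<in> borel_measurable dA \<and>
    integrable dA (\<lambda>z. norm (f z) powr p * \<omega> (norm z))}"

definition Lp_norm :: "real \<Rightarrow> (real \<Rightarrow> real) \<Rightarrow> (complex \<Rightarrow> complex) \<Rightarrow> real"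
  where "Lp_norm p \<omega> f = (LINT z|dA. norm (f z) powr p * \<omega> (norm z)) powr (1 / p)"

definition Bergman :: "real \<Rightarrow> (real \<Rightarrow> real) \<Rightarrow> (complex \<Rightarrow> complex) set"
  where "Bergman p \<omega> = Lp_space p \<omega> \<inter> {f. f holomorphic_on \<D>}"

definition Linf_space :: "(complex \<Rightarrow> complex) set"
  where "Linf_space = {f. f \<in> borel_measurable dA \<and> (\<exists>C. AE z in dA. norm (f z) \<le> C)}"

definition Linf_norm :: "(complex \<Rightarrow> complex) \<Rightarrow> real"
  where "Linf_norm f = real_of_ereal (esssup dA (\<lambda>z. ereal (norm (f z))))"

definition Bloch :: "(complex \<Rightarrow> complex) set"
  where "Bloch = {f. f holomorphic_on \<D> \<and>
    bdd_above ((\<lambda>z. norm (deriv f z) * (1 - (norm z)\<^sup>2)) ` \<D>)}"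

definition Bloch_norm :: "(complex \<Rightarrow> complex) \<Rightarrow> real"
  where "Bloch_norm f = (SUP z\<in>\<D>. norm (deriv f z) * (1 - (norm z)\<^sup>2)) + norm (f 0)"

text \<open>The filter \<open>filtercomap norm (at_left 1)\<close> expresses that \<open>norm z\<close> tends to 1 from below.\<close>

definition little_Bloch :: "(complex \<Rightarrow> complex) set"
  where "little_Bloch = {f. f holomorphic_on \<D> \<and>
    ((\<lambda>z. deriv f z * of_real (1 - (norm z)\<^sup>2)) \<longlongrightarrow> 0) (filtercomap norm (at_left 1))}"

text \<open>
  The reproducing kernel of \<open>Bergman 2 \<omega>\<close>: in polar coordinates the monomials are orthogonal
  for \<open>\<omega> dA\<close>, and the \<open>n\<close>-th one has squared norm \<open>2 * moment \<omega> (2 * n + 1)\<close>.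
\<close>

definition Bergman_kernel :: "(real \<Rightarrow> real) \<Rightarrow> complex \<Rightarrow> complex \<Rightarrow> complex"
  where "Bergman_kernel \<omega> z \<zeta> =
    (\<Sum>n. (cnj z * \<zeta>) ^ n / of_real (2 * moment \<omega> (2 * real n + 1)))"

definition Bergman_proj :: "(real \<Rightarrow> real) \<Rightarrow> (complex \<Rightarrow> complex) \<Rightarrow> complex \<Rightarrow> complex"
  where "Bergman_proj \<omega> f z =
    (LINT \<zeta>|dA. f \<zeta> * cnj (Bergman_kernel \<omega> z \<zeta>) * of_real (\<omega> (norm \<zeta>)))"

definition bounded_op :: "((complex \<Rightarrow> complex) \<Rightarrow> complex \<Rightarrow> complex) \<Rightarrow>
    (complex \<Rightarrow> complex) set \<Rightarrow> ((complex \<Rightarrow> complex) \<Rightarrow> real) \<Rightarrow>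
    (complex \<Rightarrow> complex) set \<Rightarrow> ((complex \<Rightarrow> complex) \<Rightarrow> real) \<Rightarrow> bool"
  where "bounded_op T X NX Y NY \<longleftrightarrow>
    (\<forall>f\<in>X. T f \<in> Y) \<and> (\<exists>C. \<forall>f\<in>X. NY (T f) \<le> C * NX f)"

definition onto_op :: "((complex \<Rightarrow> complex) \<Rightarrow> complex \<Rightarrow> complex) \<Rightarrow>
    (complex \<Rightarrow> complex) set \<Rightarrow> (complex \<Rightarrow> complex) set \<Rightarrow> bool"
  where "onto_op T X Y \<longleftrightarrow> (\<forall>g\<in>Y. \<exists>f\<in>X. \<forall>z\<in>\<D>. T f z = g z)"

definition pairing_integrand ::
    "(real \<Rightarrow> real) \<Rightarrow> (complex \<Rightarrow> complex) \<Rightarrow> (complex \<Rightarrow> complex) \<Rightarrow> real \<Rightarrow> complex \<Rightarrow> complex"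
  where "pairing_integrand \<omega> f g r z = f (of_real r * z) * cnj (g z) * of_real (\<omega> (norm z))"

definition A2_pairing ::
    "(real \<Rightarrow> real) \<Rightarrow> (complex \<Rightarrow> complex) \<Rightarrow> (complex \<Rightarrow> complex) \<Rightarrow> complex"
  where "A2_pairing \<omega> f g = Lim (at_left 1) (\<lambda>r. LINT z|dA. pairing_integrand \<omega> f g r z)"

text \<open>
  The Bochner integral of a non-integrable function is \<open>0\<close> and \<open>Lim\<close> is unspecified when
  there is no limit, so the existence of both has to be required separately.
\<close>

definition A2_pairing_exists ::
    "(real \<Rightarrow> real) \<Rightarrow> (complex \<Rightarrow> complex) \<Rightarrow> (complex \<Rightarrow> complex) \<Rightarrow> bool"
  where "A2_pairing_exists \<omega> f g \<longleftrightarrow>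
    (\<forall>\<^sub>F r in at_left 1. integrable dA (pairing_integrand \<omega> f g r)) \<and>
    (\<exists>l. ((\<lambda>r. LINT z|dA. pairing_integrand \<omega> f g r z) \<longlongrightarrow> l) (at_left 1))"

text \<open>
  Functionals matter only through their values on \<open>X\<close>. Boundedness forces a linear functional
  to take the same value on functions that agree on the disc.
\<close>

definition dual_space :: "(complex \<Rightarrow> complex) set \<Rightarrow> ((complex \<Rightarrow> complex) \<Rightarrow> real) \<Rightarrow>
    ((complex \<Rightarrow> complex) \<Rightarrow> complex) set"
  where "dual_space X NX = {L.
    (\<forall>f\<in>X. \<forall>h\<in>X. L (\<lambda>z. f z + h z) = L f + L h) \<and>
    (\<forall>c. \<forall>f\<in>X. L (\<lambda>z. c * f z) = c * L f) \<and>
    (\<exists>C. \<forall>f\<in>X. norm (L f) \<le> C * NX f)}"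

definition dual_norm :: "(complex \<Rightarrow> complex) set \<Rightarrow> ((complex \<Rightarrow> complex) \<Rightarrow> real) \<Rightarrow>
    ((complex \<Rightarrow> complex) \<Rightarrow> complex) \<Rightarrow> real"
  where "dual_norm X NX L = (SUP f\<in>{f\<in>X. NX f \<le> 1}. norm (L f))"

definition dual_via_A2_pairing :: "(real \<Rightarrow> real) \<Rightarrow>
    (complex \<Rightarrow> complex) set \<Rightarrow> ((complex \<Rightarrow> complex) \<Rightarrow> real) \<Rightarrow>
    (complex \<Rightarrow> complex) set \<Rightarrow> ((complex \<Rightarrow> complex) \<Rightarrow> real) \<Rightarrow> bool"
  where "dual_via_A2_pairing \<omega> X NX Y NY \<longleftrightarrow>
    (\<forall>g\<in>Y. (\<forall>f\<in>X. A2_pairing_exists \<omega> f g) \<and> (\<lambda>f. A2_pairing \<omega> f g) \<in> dual_space X NX) \<and>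
    (\<forall>L\<in>dual_space X NX. \<exists>g\<in>Y. (\<forall>f\<in>X. L f = A2_pairing \<omega> f g) \<and>
      (\<forall>h\<in>Y. (\<forall>f\<in>X. L f = A2_pairing \<omega> f h) \<longrightarrow> (\<forall>z\<in>\<D>. h z = g z))) \<and>
    (\<exists>a>0. \<exists>b>0. \<forall>g\<in>Y.
      a * NY g \<le> dual_norm X NX (\<lambda>f. A2_pairing \<omega> f g) \<and>
      dual_norm X NX (\<lambda>f. A2_pairing \<omega> f g) \<le> b * NY g)"

end

theory Submission
  imports Defs "HOL-Complex_Analysis.Complex_Analysis" "HOL-Real_Asymp.Real_Asymp"
begin

text \<open>
  Write \<open>m n\<close> for the squared norm \<open>2 * moment \<omega> (2 * n + 1)\<close> of the \<open>n\<close>-th monomial.  The projection sends a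
  bounded \<open>f\<close> to the series with coefficients \<open>(\<integral> f * cnj \<zeta> ^ n d\<nu>) / m n\<close>, and a functional \<open>L\<close> on either space is
  represented by the series with coefficients \<open>cnj (L (\<lambda>z. z ^ n)) / m n\<close>, so all questions become norm estimates
  for power series.

  If \<open>\<omega> \<in> D_hat\<close>, Parseval and a dyadic decomposition bound the \<open>L\<^sup>1(\<nu>)\<close> norm of the derivative of the kernel at
  \<open>z\<close> by a multiple of \<open>1 / (1 - norm z)\<close>.  This makes the projection bounded and bounds the representing
  functions.  If \<open>\<omega> \<in> D_check\<close>, the masses of the annuli shrinking by a fixed hyperbolic factor decay
  geometrically; passing mass from outer to inner annuli by reflected dilations of a Bloch function gives a
  bounded preimage of it, which yields surjectivity and the boundedness of the pairing.

  Conversely, testing boundedness on bounded functions with Fourier coefficients \<open>\<rho> ^ n / n\<close> yields a doubling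
  inequality for the moments, hence \<open>D_hat\<close>.  Testing surjectivity, or the pairing, on sums of \<open>N\<close> dyadic monomials,
  whose Bloch norm is bounded while their \<open>L\<^sup>1\<close> norm is of order \<open>sqrt N\<close>, yields \<open>M_class\<close>; and for
  weights in \<open>D_hat\<close> the conditions \<open>D_check\<close> and \<open>M_class\<close> agree.
\<close>

section \<open>Rotation invariance of the area measure\<close>

text \<open>A radial weight may vanish on whole annuli, so neither pointwise bounds for the kernel
  nor a preimage given by a differential formula is at hand. What is at hand are masses of annuli
  and moments, linked by the principle that the moment of order \<open>x\<close> sees the weight at
  distance about \<open>1 / x\<close> from the circle. Kernel estimates use only sizes of
  coefficients: multiplying the derivative of the kernel by \<open>1 - u\<close> turns its
  coefficients into differences, smaller by a factor of order n, and the factor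
  \<open>1 / (1 - u)\<close> split off is paid for by Cauchy-Schwarz with the tail itself as radial
  weight. Preimages use only masses: in \<open>D_check\<close> every annulus of a suitable geometric
  sequence owns a fixed share of the mass outside its inner radius, so it can carry what is
  transferred to it with bounded multiplicity. Surjectivity comes without control on the size of
  preimages; therefore a single preimage of one infinite lacunary series is used against all finite
  blocks at once.\<close>

lemma nn_integral_lborel_translation:
  fixes f :: "'a::euclidean_space \<Rightarrow> ennreal"
  assumes [measurable]: "f \<in> borel_measurable borel"
  shows "(\<integral>\<^sup>+x. f (a + x) \<partial>lborel) = (\<integral>\<^sup>+x. f x \<partial>lborel)"
proof -
  have "(\<integral>\<^sup>+x. f x \<partial>lborel) = (\<integral>\<^sup>+x. f x \<partial>distr lborel borel ((+) a))"
    by (simp add: lborel_distr_plus)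
  also have "\<dots> = (\<integral>\<^sup>+x. f (a + x) \<partial>lborel)"
    by (subst nn_integral_distr) auto
  finally show ?thesis by simp
qed

text \<open>Translation invariance and Fubini suffice. The double integral of
  \<open>indicator A (c * x) * indicator B (y - c * x)\<close> is evaluated in both orders: one
  gives the rotated measure of A, the other the measure of A, each times the area of the unit ball
  B, because B is itself invariant under rotation.\<close>

lemma lborel_distr_rotation:
  assumes c: "norm (c::complex) = 1"
  shows "distr lborel borel ((*) c) = (lborel :: complex measure)"
proof (rule measure_eqI)
  fix A assume "A \<in> sets (distr lborel borel ((*) c))"
  hence A[measurable]: "A \<in> sets borel" by simp
  define B where "B = ball (0::complex) 1"
  have B[measurable]: "B \<in> sets borel" by (simp add: B_def)
  define p where "p = emeasure lborel B"
  have p: "p = ennreal pi" 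
    by (simp add: p_def B_def emeasure_ball unit_ball_vol_numeral)
  have c0: "c \<noteq> 0" using c by auto
  have pc: "(\<integral>\<^sup>+y. indicator B (y - c * x) \<partial>lborel) = p" for x
    using nn_integral_lborel_translation[of "indicator B" "- c * x"] by (simp add: p_def)
  have shiftA: "(\<integral>\<^sup>+y. indicator A (c * x + y) \<partial>lborel) = emeasure lborel A" for x
    using nn_integral_lborel_translation[of "indicator A" "c * x"] by simp
  have Bsym: "indicator B (- c * x) = (indicator B x :: ennreal)" for x
    using c by (simp add: B_def indicator_def norm_mult)
  have "emeasure (distr lborel borel ((*) c)) A * p = (\<integral>\<^sup>+x. indicator A (c * x) * p \<partial>lborel)"
    using nn_integral_distr[of "(*) c" lborel borel "indicator A"]
    by (subst nn_integral_multc) simp_all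
  also have "\<dots> = (\<integral>\<^sup>+x. (\<integral>\<^sup>+y. indicator A (c * x) * indicator B (y - c * x) \<partial>lborel) \<partial>lborel)"
    by (subst nn_integral_cmult) (auto simp: pc)
  also have "\<dots> = (\<integral>\<^sup>+y. (\<integral>\<^sup>+x. indicator A (c * x) * indicator B (y - c * x) \<partial>lborel) \<partial>lborel)"
    by (rule lborel_pair.Fubini') auto
  \<comment> \<open>Replacing \<open>x\<close> by \<open>y / c + x\<close> moves the dependence on
    \<open>y\<close> from B to A.\<close>
  also have "\<dots> = (\<integral>\<^sup>+y. (\<integral>\<^sup>+x. indicator A (c * (y / c + x)) * indicator B (y - c * (y / c + x)) \<partial>lborel) \<partial>lborel)"
    by (intro nn_integral_cong nn_integral_lborel_translation[symmetric]) auto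
  also have "\<dots> = (\<integral>\<^sup>+y. (\<integral>\<^sup>+x. indicator A (c * x + y) * indicator B x \<partial>lborel) \<partial>lborel)"
    using Bsym by (simp add: distrib_left c0 add.commute mult.commute)
  also have "\<dots> = (\<integral>\<^sup>+x. (\<integral>\<^sup>+y. indicator A (c * x + y) * indicator B x \<partial>lborel) \<partial>lborel)"
    by (rule lborel_pair.Fubini') auto
  also have "\<dots> = (\<integral>\<^sup>+x. emeasure lborel A * indicator B x \<partial>lborel)"
    by (subst nn_integral_multc) (auto simp: shiftA)
  also have "\<dots> = emeasure lborel A * p"
    by (subst nn_integral_cmult) (auto simp: p_def)
  finally have "emeasure (distr lborel borel ((*) c)) A * p = emeasure lborel A * p" .
  moreover have "p \<noteq> 0" "p \<noteq> top" by (simp_all add: p)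
  ultimately show "emeasure (distr lborel borel ((*) c)) A = emeasure lborel A"
    by (metis ennreal_mult_cancel_left mult.commute)
qed simp

lemma lebesgue_distr_rotation:
  assumes c: "norm (c::complex) = 1"
  shows "(*) c \<in> lebesgue \<rightarrow>\<^sub>M lebesgue" "distr lebesgue lebesgue ((*) c) = (lebesgue :: complex measure)"
proof -
  have m: "(*) c \<in> borel_measurable (lebesgue :: complex measure)"
    by (intro measurable_completion) auto
  have eq: "distr lebesgue lborel ((*) c) = (lborel :: complex measure)"
  proof -
    have "distr lebesgue lborel ((*) c) = distr lborel lborel ((*) c)"
      by (rule distr_completion) auto
    also have "\<dots> = distr lborel borel ((*) c)" by (rule distr_cong) auto
    finally show ?thesis using lborel_distr_rotation[OF c] by simp
  qed
  show "(*) c \<in> lebesgue \<rightarrow>\<^sub>M lebesgue"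
    by (rule completion.measurable_completion2) (use m in \<open>simp_all add: eq\<close>)
  have "completion (distr lebesgue lborel ((*) c)) = distr lebesgue lebesgue ((*) c)"
    by (rule completion.completion_distr_eq) (use m in \<open>simp_all add: eq\<close>)
  thus "distr lebesgue lebesgue ((*) c) = (lebesgue :: complex measure)"
    by (simp add: eq)
qed

section \<open>Normalised area on the disc and its radial push-forward\<close>

lemma space_dA[simp]: "space dA = \<D>" by (simp add: dA_def)
lemma sets_dA: "sets dA = sets (lebesgue_on \<D>)" by (simp add: dA_def)

lemma emeasure_dA: "A \<in> sets dA \<Longrightarrow> emeasure dA A = ennreal (1 / pi) * emeasure lebesgue A"
proof -
  assume "A \<in> sets dA"
  hence A: "A \<in> sets (lebesgue_on \<D>)" by (simp add: sets_dA)
  hence "A \<subseteq> \<D>" using sets.sets_into_space by fastforce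
  thus ?thesis using A
    by (simp add: dA_def emeasure_density nn_integral_cmult emeasure_restrict_space
       del: emeasure_completion)
qed

lemma sets_dA_iff: "A \<in> sets dA \<longleftrightarrow> A \<in> sets lebesgue \<and> A \<subseteq> \<D>"
  by (auto simp: sets_dA sets_restrict_space_iff)

lemma dA_rotation:
  assumes c: "norm (c::complex) = 1"
  shows "(*) c \<in> dA \<rightarrow>\<^sub>M dA" "distr dA dA ((*) c) = dA"
proof -
  have pre: "(*) c -` X \<inter> \<D> = (*) c -` X" if "X \<subseteq> \<D>" for X
    using that c by (auto simp: norm_mult subset_iff)
  have pm: "(*) c -` X \<in> sets dA" if "X \<in> sets dA" for X
  proof -
    from that have X: "X \<in> sets lebesgue" "X \<subseteq> \<D>" by (auto simp: sets_dA_iff)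
    from measurable_sets[OF lebesgue_distr_rotation(1)[OF c] X(1)]
    have "(*) c -` X \<in> sets lebesgue" by simp
    moreover have "(*) c -` X \<subseteq> \<D>" using pre[OF X(2)] by blast
    ultimately show ?thesis by (simp add: sets_dA_iff)
  qed
  show m: "(*) c \<in> dA \<rightarrow>\<^sub>M dA"
  proof (rule measurableI)
    fix X assume "X \<in> sets dA"
    thus "(*) c -` X \<inter> space dA \<in> sets dA" using pm pre[of X] by (simp add: sets_dA_iff)
  qed (use c in \<open>auto simp: norm_mult\<close>)
  show "distr dA dA ((*) c) = dA"
  proof (rule measure_eqI)
    fix X assume "X \<in> sets (distr dA dA ((*) c))"
    hence X: "X \<in> sets dA" by simp
    hence Xl: "X \<in> sets lebesgue" "X \<subseteq> \<D>" by (auto simp: sets_dA_iff)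
    have "emeasure lebesgue ((*) c -` X) = emeasure (distr lebesgue lebesgue ((*) c)) X"
      by (subst emeasure_distr) (use lebesgue_distr_rotation(1)[OF c] Xl in auto)
    thus "emeasure (distr dA dA ((*) c)) X = emeasure dA X"
      using X m pm[OF X] pre[OF Xl(2)]
      by (simp add: emeasure_distr emeasure_dA lebesgue_distr_rotation(2)[OF c] del: emeasure_completion)
  qed simp
qed

lemma norm_measurable_dA[measurable]: "norm \<in> borel_measurable dA"
  unfolding dA_def by (auto intro!: measurable_restrict_space1 measurable_completion)

lemma id_measurable_dA[measurable]: "(\<lambda>z. z) \<in> borel_measurable dA"
  unfolding dA_def by (auto intro!: measurable_restrict_space1 measurable_completion)

text \<open>Polar coordinates for radial integrands only, read off from the areas of discs. The
  angular variable is never separated: what it would contribute, the orthogonality of monomials, is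
  derived from rotation invariance.\<close>

lemma distr_dA_norm:
  "distr dA borel norm = density lborel (\<lambda>r. ennreal (2 * r) * indicator {0..<1} r)" (is "?M = ?N")
proof (rule measure_eqI_lessThan)
  fix x :: real
  have disc: "emeasure dA \<D> = 1"
    by (subst emeasure_dA) (auto simp: sets_dA_iff emeasure_ball unit_ball_vol_numeral ennreal_mult[symmetric])
  have pre: "emeasure ?M {x<..} = emeasure dA {z\<in>\<D>. x < norm z}"
    by (subst emeasure_distr) (auto intro!: arg_cong2[where f=emeasure])
  have N: "emeasure ?N {x<..} = (\<integral>\<^sup>+r. ennreal (2 * r) * indicator {max 0 x..1} r \<partial>lborel)"
  proof -
    have "emeasure ?N {x<..} = (\<integral>\<^sup>+r. ennreal (2 * r) * indicator {0..<1} r * indicator {x<..} r \<partial>lborel)"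
      by (subst emeasure_density) auto
    also have "\<dots> = (\<integral>\<^sup>+r. ennreal (2 * r) * indicator {max 0 x..1} r \<partial>lborel)"
      by (rule nn_integral_cong_AE,
          rule eventually_mono[OF eventually_conj[OF AE_lborel_singleton[of x] AE_lborel_singleton[of 1]]])
         (auto split: split_indicator)
    finally show ?thesis .
  qed
  have Nval: "emeasure ?N {x<..} = (if x < 1 then ennreal (1 - (max 0 x)\<^sup>2) else 0)"
  proof (cases "x < 1")
    case True
    have "(\<integral>\<^sup>+r. ennreal (2 * r) * indicator {max 0 x..1} r \<partial>lborel) = ennreal (1\<^sup>2 - (max 0 x)\<^sup>2)"
      using True by (intro nn_integral_FTC_Icc) (auto intro!: derivative_eq_intros)
    thus ?thesis using True N by simp
  next
    case False
    have "(\<integral>\<^sup>+r. ennreal (2 * r) * indicator {max 0 x..1} r \<partial>lborel) = (\<integral>\<^sup>+r. 0 \<partial>(lborel::real measure))"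
      by (rule nn_integral_cong_AE, rule eventually_mono[OF AE_lborel_singleton[of 1]])
         (use False in \<open>auto split: split_indicator\<close>)
    thus ?thesis using False N by simp
  qed
  have Mval: "emeasure ?M {x<..} = (if x < 1 then ennreal (1 - (max 0 x)\<^sup>2) else 0)"
  proof (cases "x < 0")
    case True
    hence "{z\<in>\<D>. x < norm z} = \<D>" by (auto intro: less_le_trans)
    thus ?thesis using pre disc True by simp
  next
    case x0: False
    show ?thesis
    proof (cases "x < 1")
      case True
      have cb: "emeasure dA (cball 0 x) = ennreal (x\<^sup>2)"
        using True x0 by (subst emeasure_dA) (auto simp: sets_dA_iff emeasure_cball unit_ball_vol_numeral ennreal_mult[symmetric] subset_iff)
      have "{z\<in>\<D>. x < norm z} = \<D> - cball 0 x" by auto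
      moreover have "emeasure dA (\<D> - cball 0 x) = emeasure dA \<D> - emeasure dA (cball 0 x)"
        using True by (intro emeasure_Diff) (auto simp: sets_dA_iff subset_iff cb)
      ultimately show ?thesis using cb pre disc True x0 by (simp add: max_def ennreal_minus[of "x\<^sup>2" 1, symmetric])
    next
      case False
      hence empty: "{z\<in>\<D>. x < norm z} = {}" by auto
      show ?thesis unfolding pre empty using False by simp
    qed
  qed
  show "emeasure ?M {x<..} < \<infinity>" using Mval by auto
  show "emeasure ?M {x<..} = emeasure ?N {x<..}" using Mval Nval by simp
qed simp_all

section \<open>Moments and tails of a radial weight\<close>

text \<open>The weight as a finite measure: tails become measures of intervals and moments integrals
  of powers, so both yield to monotonicity and layer-cake arguments.\<close>

definition line_measure :: "(real \<Rightarrow> real) \<Rightarrow> real measure"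
  where "line_measure \<omega> = density (lebesgue_on {0..<1}) (\<lambda>r. ennreal (\<omega> r))"

locale weighted_disc =
  fixes \<omega> :: "real \<Rightarrow> real"
  assumes radial: "radial_weight \<omega>"
begin

abbreviation "\<sigma> \<equiv> line_measure \<omega>"

lemma weight_nonneg: "0 \<le> r \<Longrightarrow> r < 1 \<Longrightarrow> 0 \<le> \<omega> r"
  using radial by (auto simp: radial_weight_def)

lemma tail_pos: "0 \<le> r \<Longrightarrow> r < 1 \<Longrightarrow> 0 < tail \<omega> r"
  using radial by (auto simp: radial_weight_def)

lemma weight_integrable: "integrable (lebesgue_on {0..<1}) \<omega>"
  using radial by (auto simp: radial_weight_def set_integrable_def integrable_restrict_space)

lemma weight_measurable: "\<omega> \<in> borel_measurable (lebesgue_on {0..<1})"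
  using weight_integrable by auto

lemma space_line_measure[simp]: "space \<sigma> = {0..<1}"
  by (simp add: line_measure_def)

lemma sets_line_measure: "sets \<sigma> = sets (lebesgue_on {0..<1})"
  by (simp add: line_measure_def)

lemma measurable_line_measure: "borel_measurable \<sigma> = borel_measurable (lebesgue_on {0..<1})"
  by (rule measurable_cong_sets) (simp_all add: sets_line_measure)

lemma borel_measurable_line_measure[measurable]: "(\<lambda>r. r) \<in> borel_measurable \<sigma>"
  unfolding measurable_line_measure by (auto intro!: measurable_restrict_space1 measurable_completion)

lemma integral_line_measure:
  assumes "f \<in> borel_measurable \<sigma>"
  shows "(LINT r|\<sigma>. f r) = (LINT r:{0..<1}|lebesgue. f r * \<omega> r)"
    "integrable \<sigma> f \<longleftrightarrow> set_integrable lebesgue {0..<1} (\<lambda>r. f r * \<omega> r)"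
proof -
  have 1: "f \<in> borel_measurable (lebesgue_on {0..<1})" using assms by (simp add: measurable_line_measure)
  have 2: "AE r in lebesgue_on {0..<1}. 0 \<le> \<omega> r"
    by (rule AE_I2) (auto simp: weight_nonneg)
  show "(LINT r|\<sigma>. f r) = (LINT r:{0..<1}|lebesgue. f r * \<omega> r)"
    unfolding line_measure_def
    by (subst integral_density[OF 1 weight_measurable 2])
       (simp add: integral_restrict_space set_lebesgue_integral_def mult.commute)
  show "integrable \<sigma> f \<longleftrightarrow> set_integrable lebesgue {0..<1} (\<lambda>r. f r * \<omega> r)"
    unfolding line_measure_def
    by (subst integrable_density[OF 1 weight_measurable 2])
       (simp add: integrable_restrict_space set_integrable_def mult.commute)
qed

lemma finite_line_measure: "finite_measure \<sigma>"
proof (rule finite_measureI)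
  have "emeasure \<sigma> (space \<sigma>) = (\<integral>\<^sup>+r. ennreal (\<omega> r) \<partial>lebesgue_on {0..<1})"
    unfolding line_measure_def using weight_measurable
    by (subst emeasure_density) (auto intro!: nn_integral_cong)
  also have "\<dots> = ennreal (LINT r|lebesgue_on {0..<1}. \<omega> r)"
    by (rule nn_integral_eq_integral[OF weight_integrable]) (auto intro!: AE_I2 weight_nonneg)
  finally show "emeasure \<sigma> (space \<sigma>) \<noteq> \<infinity>" by simp
qed

sublocale line: finite_measure \<sigma> by (rule finite_line_measure)

lemma atLeastLessThan_sets: "0 \<le> r \<Longrightarrow> {r..<1} \<in> sets \<sigma>"
  by (auto simp: sets_line_measure sets_restrict_space_iff)

lemma tail_eq: assumes "0 \<le> r" shows "tail \<omega> r = measure \<sigma> {r..<1}"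
proof -
  have "measure \<sigma> {r..<1} = (LINT s|\<sigma>. indicator {r..<1} s)"
    using assms by (simp add: Int_absorb1)
  also have "\<dots> = (LINT s:{0..<1}|lebesgue. indicator {r..<1} s * \<omega> s)"
    by (rule integral_line_measure) (use atLeastLessThan_sets[OF assms] in measurable)
  also have "\<dots> = tail \<omega> r"
    unfolding tail_def set_lebesgue_integral_def
    by (rule Bochner_Integration.integral_cong) (use assms in \<open>auto split: split_indicator\<close>)
  finally show ?thesis by simp
qed

lemma moment_eq: "moment \<omega> x = (LINT r|\<sigma>. r powr x)"
  unfolding moment_def by (rule integral_line_measure(1)[symmetric]) measurable

lemma powr_integrable: "0 \<le> x \<Longrightarrow> integrable \<sigma> (\<lambda>r. r powr x)"
  by (rule line.integrable_const_bound[where B=1]) (auto intro!: AE_I2 simp: powr_le1)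

lemma tail_antimono: "0 \<le> r \<Longrightarrow> r \<le> s \<Longrightarrow> tail \<omega> s \<le> tail \<omega> r"
  by (simp add: tail_eq) (intro line.finite_measure_mono, auto simp: atLeastLessThan_sets)

lemma tail_nonneg: "0 \<le> r \<Longrightarrow> 0 \<le> tail \<omega> r"
  by (simp add: tail_eq)

lemma moment_nonneg: "0 \<le> moment \<omega> x"
  by (simp add: moment_eq)

lemma moment_antimono: "0 \<le> x \<Longrightarrow> x \<le> y \<Longrightarrow> moment \<omega> y \<le> moment \<omega> x"
  unfolding moment_eq
  by (intro integral_mono powr_integrable) (auto intro: powr_mono')

lemma moment_ge_tail:
  assumes "0 \<le> \<rho>" "0 \<le> x"
  shows "\<rho> powr x * tail \<omega> \<rho> \<le> moment \<omega> x"
proof -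
  have "\<rho> powr x * tail \<omega> \<rho> = (LINT r|\<sigma>. \<rho> powr x * indicator {\<rho>..<1} r)"
    using assms by (simp add: tail_eq Int_absorb1)
  also have "\<dots> \<le> moment \<omega> x"
    unfolding moment_eq using assms atLeastLessThan_sets[OF assms(1)]
    by (intro integral_mono powr_integrable integrable_mult_right integrable_real_indicator)
       (auto split: split_indicator intro: powr_mono2 simp: line.emeasure_finite less_top[symmetric])
  finally show ?thesis .
qed

lemma moment_pos: assumes "0 \<le> x" shows "0 < moment \<omega> x"
proof -
  have "0 < (1/2) powr x * tail \<omega> (1/2)" using tail_pos[of "1/2"] by simp
  also have "\<dots> \<le> moment \<omega> x" using assms by (intro moment_ge_tail) auto
  finally show ?thesis .
qed

text \<open>Above \<open>t\<close> the integrand is at most 1; below \<open>t\<close> the factor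
  \<open>r powr (y - x)\<close> is at most \<open>t powr (y - x)\<close>. For large
  \<open>y - x\<close> the second term becomes small enough to be absorbed.\<close>

lemma moment_split:
  assumes "0 \<le> t" "t < 1" "0 \<le> x" "x \<le> y"
  shows "moment \<omega> y \<le> tail \<omega> t + t powr (y - x) * moment \<omega> x"
proof -
  have "moment \<omega> y \<le> (LINT r|\<sigma>. indicator {t..<1} r + t powr (y - x) * r powr x)"
    unfolding moment_eq
  proof (intro integral_mono powr_integrable Bochner_Integration.integrable_add integrable_mult_right integrable_real_indicator)
    show "{t..<1} \<in> sets \<sigma>" using assms by (intro atLeastLessThan_sets)
    fix r assume r: "r \<in> space \<sigma>"
    show "r powr y \<le> indicator {t..<1} r + t powr (y - x) * r powr x"
    proof (cases "t \<le> r")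
      case True
      have "r powr y \<le> 1" using r assms by (intro powr_le1) auto
      thus ?thesis using True r by (simp add: add_increasing2)
    next
      case False
      have "r powr y = r powr (y - x) * r powr x" using r by (simp add: powr_add[symmetric])
      also have "\<dots> \<le> t powr (y - x) * r powr x" using False r assms
        by (intro mult_right_mono powr_mono2) auto
      finally show ?thesis using False by simp
    qed
  qed (use assms in \<open>auto simp: line.emeasure_finite less_top[symmetric]\<close>)
  also have "\<dots> = tail \<omega> t + t powr (y - x) * moment \<omega> x"
    using assms atLeastLessThan_sets[of t]
    by (subst Bochner_Integration.integral_add)
       (auto simp: moment_eq tail_eq Int_absorb1 powr_integrable line.emeasure_finite less_top[symmetric])
  finally show ?thesis .
qed

text \<open>Expresses the moments of \<open>u\<close> through its distribution function, so that a
  comparison of tails at every level becomes a comparison of moments.\<close>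

lemma layer_cake:
  fixes u :: "real \<Rightarrow> real"
  assumes [measurable]: "u \<in> borel_measurable \<sigma>" and u: "\<And>r. r \<in> {0..<1} \<Longrightarrow> 0 \<le> u r \<and> u r < 1" and n: "0 < n"
  shows "(\<integral>\<^sup>+r. ennreal (u r ^ n) \<partial>\<sigma>) = 
    (\<integral>\<^sup>+t. ennreal (real n * t ^ (n - 1)) * indicator {0..<1} t * emeasure \<sigma> {r\<in>space \<sigma>. t \<le> u r} \<partial>lborel)"
proof -
  interpret pair_sigma_finite \<sigma> lborel ..
  have "(\<integral>\<^sup>+r. ennreal (u r ^ n) \<partial>\<sigma>) = 
    (\<integral>\<^sup>+r. (\<integral>\<^sup>+t. ennreal (real n * t ^ (n - 1)) * indicator {0..<1} t * indicator {s. s \<le> u r} t \<partial>lborel) \<partial>\<sigma>)"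
  proof (rule nn_integral_cong)
    fix r assume r: "r \<in> space \<sigma>"
    have "(\<integral>\<^sup>+t. ennreal (real n * t ^ (n - 1)) * indicator {0..<1} t * indicator {s. s \<le> u r} t \<partial>lborel)
      = (\<integral>\<^sup>+t. ennreal (real n * t ^ (n - 1)) * indicator {0..u r} t \<partial>lborel)"
      using r u[of r] by (intro nn_integral_cong) (auto split: split_indicator)
    also have "\<dots> = ennreal (u r ^ n - 0 ^ n)"
      using r u[of r] by (intro nn_integral_FTC_Icc) (auto intro!: derivative_eq_intros)
    finally show "ennreal (u r ^ n) = (\<integral>\<^sup>+t. ennreal (real n * t ^ (n - 1)) * indicator {0..<1} t * indicator {s. s \<le> u r} t \<partial>lborel)"
      using n by (simp add: zero_power)
  qed
  also have "\<dots> = (\<integral>\<^sup>+t. (\<integral>\<^sup>+r. ennreal (real n * t ^ (n - 1)) * indicator {0..<1} t * indicator {s. s \<le> u r} t \<partial>\<sigma>) \<partial>lborel)"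
    by (rule Fubini'[symmetric]) measurable
  also have "\<dots> = (\<integral>\<^sup>+t. ennreal (real n * t ^ (n - 1)) * indicator {0..<1} t * emeasure \<sigma> {r\<in>space \<sigma>. t \<le> u r} \<partial>lborel)"
  proof (rule nn_integral_cong)
    fix t :: real
    have "(\<integral>\<^sup>+r. ennreal (real n * t ^ (n - 1)) * indicator {0..<1} t * indicator {s. s \<le> u r} t \<partial>\<sigma>)
      = (\<integral>\<^sup>+r. ennreal (real n * t ^ (n - 1)) * indicator {0..<1} t * indicator {r\<in>space \<sigma>. t \<le> u r} r \<partial>\<sigma>)"
      by (intro nn_integral_cong) (auto split: split_indicator)
    also have "\<dots> = ennreal (real n * t ^ (n - 1)) * indicator {0..<1} t * emeasure \<sigma> {r\<in>space \<sigma>. t \<le> u r}"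
      by (rule nn_integral_cmult_indicator) measurable
    finally show "(\<integral>\<^sup>+r. ennreal (real n * t ^ (n - 1)) * indicator {0..<1} t * indicator {s. s \<le> u r} t \<partial>\<sigma>) = 
      ennreal (real n * t ^ (n - 1)) * indicator {0..<1} t * emeasure \<sigma> {r\<in>space \<sigma>. t \<le> u r}" .
  qed
  finally show ?thesis .
qed

lemma moment_nat_eq:
  "n > 0 \<Longrightarrow> ennreal (moment \<omega> (real n)) = (\<integral>\<^sup>+r. ennreal (r ^ n) \<partial>\<sigma>)"
  unfolding moment_eq
  by (subst nn_integral_eq_integral[symmetric]) (auto intro!: powr_integrable nn_integral_cong simp: powr_realpow')

text \<open>The tail condition compares the distribution functions of \<open>r\<close> and \<open>2 r - 1\<close>, and \<open>2 r - 1 \<le> r\<^sup>2\<close>.\<close>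

lemma moment_doubling_nat:
  assumes C: "C \<ge> 0" "\<And>r. r \<in> {0..<1} \<Longrightarrow> tail \<omega> r \<le> C * tail \<omega> ((1 + r) / 2)" and n: "n > 0"
  shows "moment \<omega> (real n) \<le> C * moment \<omega> (real (2 * n))"
proof -
  define v where "v r = max 0 (2 * r - 1)" for r :: real
  have v[measurable]: "v \<in> borel_measurable \<sigma>" unfolding v_def by measurable
  have em: "emeasure \<sigma> {r\<in>space \<sigma>. t \<le> r} \<le> ennreal C * emeasure \<sigma> {r\<in>space \<sigma>. t \<le> v r}" if t: "0 < t" "t < 1" for t
  proof -
    have "{r\<in>space \<sigma>. t \<le> r} = {t..<1}" "{r\<in>space \<sigma>. t \<le> v r} = {(1+t)/2..<1}"
      using t by (auto simp: v_def max_def field_simps)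
    thus ?thesis using C(1) C(2)[of t] t tail_eq[of t] tail_eq[of "(1+t)/2"]
      by (simp add: line.emeasure_eq_measure ennreal_mult[symmetric])
  qed
  have "ennreal (moment \<omega> (real n)) = (\<integral>\<^sup>+r. ennreal (r ^ n) \<partial>\<sigma>)" using moment_nat_eq n by simp
  also have "\<dots> = (\<integral>\<^sup>+t. ennreal (real n * t ^ (n - 1)) * indicator {0..<1} t * emeasure \<sigma> {r\<in>space \<sigma>. t \<le> r} \<partial>lborel)"
    using n by (intro layer_cake) auto
  also have "\<dots> \<le> (\<integral>\<^sup>+t. ennreal C * (ennreal (real n * t ^ (n - 1)) * indicator {0..<1} t * emeasure \<sigma> {r\<in>space \<sigma>. t \<le> v r}) \<partial>lborel)"
    by (rule nn_integral_mono_AE, rule eventually_mono[OF AE_lborel_singleton[of 0]])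
       (use em in \<open>auto split: split_indicator simp: mult.left_commute[of "ennreal C"] intro!: mult_left_mono\<close>)
  also have "\<dots> = ennreal C * (\<integral>\<^sup>+t. (ennreal (real n * t ^ (n - 1)) * indicator {0..<1} t * emeasure \<sigma> {r\<in>space \<sigma>. t \<le> v r}) \<partial>lborel)"
  proof -
    have "(\<lambda>t. emeasure \<sigma> {r\<in>space \<sigma>. t \<le> v r}) \<in> borel_measurable lborel"
      by measurable
    moreover have "(\<lambda>t. ennreal (real n * t ^ (n - 1))) \<in> borel_measurable lborel"
      by (intro measurable_compose[OF _ measurable_ennreal]) simp
    moreover have "indicator {0..<1::real} \<in> borel_measurable lborel" by simp
    ultimately show ?thesis by (intro nn_integral_cmult borel_measurable_times_ennreal)
  qed
  also have "\<dots> = ennreal C * (\<integral>\<^sup>+r. ennreal (v r ^ n) \<partial>\<sigma>)"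
    using n by (subst layer_cake) (auto simp: v_def)
  also have "\<dots> \<le> ennreal C * (\<integral>\<^sup>+r. ennreal (r ^ (2 * n)) \<partial>\<sigma>)"
  proof (intro mult_left_mono nn_integral_mono ennreal_leI)
    fix r assume "r \<in> space \<sigma>"
    have "v r \<le> r\<^sup>2" using zero_le_power2[of "r - 1"] by (simp add: v_def power2_eq_square algebra_simps)
    hence "v r ^ n \<le> (r\<^sup>2) ^ n" by (intro power_mono) (auto simp: v_def)
    thus "v r ^ n \<le> r ^ (2 * n)" by (simp add: power_mult)
  qed simp
  also have "\<dots> = ennreal (C * moment \<omega> (real (2 * n)))"
    using moment_nat_eq[of "2 * n"] n C moment_nonneg by (simp add: ennreal_mult)
  finally show ?thesis using C moment_nonneg by (simp add: ennreal_le_iff)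
qed

section \<open>Doubling of tails and doubling of moments\<close>

definition moment_doubling :: "real \<Rightarrow> bool"
  where "moment_doubling C \<longleftrightarrow> C \<ge> 1 \<and> (\<forall>x\<ge>1. moment \<omega> x \<le> C * moment \<omega> (2 * x))"

text \<open>Between integers the moments are controlled by monotonicity: for n the integer part of x
  one has x <= 2 n, so two integer doublings lead from n past 2 x, hence the square of the
  constant.\<close>

lemma D_hat_moment_doubling:
  assumes "\<omega> \<in> D_hat" obtains C where "moment_doubling C"
proof -
  from assms obtain C where C: "C \<ge> 1" "\<forall>r\<in>{0..<1}. tail \<omega> r \<le> C * tail \<omega> ((1 + r) / 2)"
    by (auto simp: D_hat_def)
  have "moment \<omega> x \<le> C\<^sup>2 * moment \<omega> (2 * x)" if x: "x \<ge> 1" for x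
  proof -
    define n where "n = nat \<lfloor>x\<rfloor>"
    have n: "n \<ge> 1" "real n \<le> x" "x \<le> 2 * real n"
    proof -
      have "\<lfloor>x\<rfloor> \<ge> 1" using x by (simp add: le_floor_iff)
      hence n: "real n = of_int \<lfloor>x\<rfloor>" "n \<ge> 1" unfolding n_def by linarith+
      show "n \<ge> 1" "real n \<le> x" "x \<le> 2 * real n"
        using n \<open>\<lfloor>x\<rfloor> \<ge> 1\<close> floor_correct[of x] by linarith+
    qed
    have "moment \<omega> x \<le> moment \<omega> (real n)" using n by (intro moment_antimono) auto
    also have "\<dots> \<le> C * moment \<omega> (real (2 * n))" using C n by (intro moment_doubling_nat) auto
    also have "\<dots> \<le> C * (C * moment \<omega> (real (2 * (2 * n))))"
      using C n by (intro mult_left_mono moment_doubling_nat) auto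
    also have "\<dots> \<le> C * (C * moment \<omega> (2 * x))"
      using C n x by (intro mult_left_mono moment_antimono) auto
    finally show ?thesis by (simp add: power2_eq_square)
  qed
  hence "moment_doubling (C\<^sup>2)" using C by (auto simp: moment_doubling_def)
  thus thesis ..
qed

lemma moment_doubling_iterate:
  assumes "moment_doubling D" "x \<ge> 1"
  shows "moment \<omega> x \<le> D ^ m * moment \<omega> (2 ^ m * x)"
proof (induction m)
  case (Suc m)
  have "1 * 1 \<le> 2 ^ m * x" using assms by (intro mult_mono) auto
  hence "moment \<omega> (2 ^ m * x) \<le> D * moment \<omega> (2 * (2 ^ m * x))"
    using assms by (auto simp: moment_doubling_def)
  hence "D ^ m * moment \<omega> (2 ^ m * x) \<le> D ^ m * (D * moment \<omega> (2 * (2 ^ m * x)))"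
    using assms by (intro mult_left_mono) (auto simp: moment_doubling_def)
  thus ?case using Suc by (simp add: mult_ac)
qed simp

text \<open>At \<open>t = 1 - 1 / (2 * x)\<close> and order \<open>y = 2 ^ m * x\<close> the power
  \<open>t powr y\<close> is at most \<open>exp (- (2 ^ m / 2))\<close>, so that after one doubling
  the part below \<open>t\<close> accounts for at most half of the moment and is absorbed; only the
  tail is left. Doubling then brings the order back from \<open>y\<close> to \<open>x\<close> at the
  cost of \<open>D ^ m\<close>, with \<open>m\<close> depending on \<open>D\<close> alone.\<close>

lemma moment_le_tail:
  assumes D: "moment_doubling D"
  obtains C where "C > 0" "\<And>x. x \<ge> 1 \<Longrightarrow> moment \<omega> x \<le> C * tail \<omega> (1 - 1 / (2 * x))"
proof -
  have D1: "D \<ge> 1" using D by (simp add: moment_doubling_def)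
  \<comment> \<open>Only \<open>2 * ln (2 * D) <= 2 ^ m\<close> is required;
    \<open>m < 2 ^ m\<close> makes the Archimedean choice sufficient.\<close>
  obtain m :: nat where m: "2 * ln (2 * D) < real m" using reals_Archimedean2 by blast
  have "real m < 2 ^ m" by (rule of_nat_less_two_power)
  hence m': "exp (- (2 ^ m / 2)) \<le> 1 / (2 * D)"
  proof -
    have "ln (2 * D) \<le> 2 ^ m / 2" using m \<open>real m < 2 ^ m\<close> by linarith
    hence "exp (- (2 ^ m / 2)) \<le> exp (- ln (2 * D))" by simp
    also have "\<dots> = 1 / (2 * D)" using D1 by (simp add: exp_minus inverse_eq_divide)
    finally show ?thesis .
  qed
  have "moment \<omega> x \<le> (D ^ m * (2 * D)) * tail \<omega> (1 - 1 / (2 * x))" if x: "x \<ge> 1" for x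
  proof -
    define y where "y = 2 ^ m * x"
    define t where "t = 1 - 1 / (2 * x)"
    have t: "0 < t" "t < 1" using x by (auto simp: t_def field_simps)
    have "1 * 1 \<le> 2 ^ m * x" using x by (intro mult_mono) auto
    hence y1: "y \<ge> 1" by (simp add: y_def)
    have "t powr y = exp (y * ln t)" using t by (simp add: powr_def)
    also have "y * ln t \<le> y * (- 1 / (2 * x))"
      using t y1 ln_le_minus_one[of t] by (intro mult_left_mono) (auto simp: t_def)
    also have "y * (- 1 / (2 * x)) = - (2 ^ m / 2)" using x by (simp add: y_def field_simps)
    finally have ty: "t powr y \<le> 1 / (2 * D)" using m' by simp
    have "moment \<omega> (2 * y) \<le> tail \<omega> t + t powr (2 * y - y) * moment \<omega> y"
      using t y1 by (intro moment_split) auto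
    also have "\<dots> \<le> tail \<omega> t + 1 / (2 * D) * moment \<omega> y"
      using ty moment_nonneg by (intro add_left_mono mult_right_mono) auto
    finally have "D * moment \<omega> (2 * y) \<le> D * (tail \<omega> t + 1 / (2 * D) * moment \<omega> y)"
      using D1 by (intro mult_left_mono) auto
    moreover have "moment \<omega> y \<le> D * moment \<omega> (2 * y)" using D y1 by (simp add: moment_doubling_def)
    moreover have "D * (tail \<omega> t + 1 / (2 * D) * moment \<omega> y) = D * tail \<omega> t + moment \<omega> y / 2"
      using D1 by (simp add: field_simps)
    ultimately have "moment \<omega> y \<le> 2 * D * tail \<omega> t" by linarith
    hence "D ^ m * moment \<omega> y \<le> D ^ m * (2 * D * tail \<omega> t)" using D1 by (intro mult_left_mono) auto
    thus ?thesis using moment_doubling_iterate[OF D x, of m] by (simp add: y_def t_def mult.assoc)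
  qed
  moreover have "D ^ m * (2 * D) > 0" using D1 by simp
  ultimately show thesis using that by blast
qed

lemma tail_le_moment:
  obtains c where "c > 0" "\<And>x. x \<ge> 1 \<Longrightarrow> c * tail \<omega> (1 - 1 / x) \<le> moment \<omega> x"
proof -
  \<comment> \<open>\<open>exp (- 2)\<close> bounds \<open>(1 - 1 / x) powr x\<close> from below for
    \<open>x\<close> at least 2. Near \<open>x = 1\<close> that power degenerates to 0, and the
    second entry, a quotient of fixed positive numbers, takes over.\<close>
  define c where "c = min (exp (- 2)) (moment \<omega> 2 / tail \<omega> 0)"
  have c: "c > 0" using moment_pos[of 2] tail_pos[of 0] by (simp add: c_def)
  have "c * tail \<omega> (1 - 1 / x) \<le> moment \<omega> x" if x: "x \<ge> 1" for x
  proof (cases "x \<ge> 2")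
    case True
    define r where "r = 1 - 1 / x"
    have r: "r \<ge> 1/2" "r < 1" using True by (auto simp: r_def field_simps)
    have xr: "x = 1 / (1 - r)" using x by (simp add: r_def)
    have "ln (1 / r) \<le> 1 / r - 1" using r by (intro ln_le_minus_one) auto
    hence "- ln r \<le> (1 - r) / r" using r by (simp add: ln_div field_simps)
    also have "\<dots> = (1 - r) * (1 / r)" by simp
    also have "\<dots> \<le> (1 - r) * 2" using r by (intro mult_left_mono) (auto simp: field_simps)
    finally have "ln r \<ge> - 2 * (1 - r)" by simp
    hence "x * ln r \<ge> x * (- 2 * (1 - r))" using x by (intro mult_left_mono) auto
    also have "x * (- 2 * (1 - r)) = - 2" using r by (simp add: xr field_simps)
    finally have "exp (- 2) \<le> exp (x * ln r)" by simp
    hence "exp (- 2) \<le> r powr x" using r by (simp add: powr_def)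
    hence "c \<le> r powr x" by (simp add: c_def)
    hence "c * tail \<omega> r \<le> r powr x * tail \<omega> r" using r tail_nonneg by (intro mult_right_mono) auto
    also have "\<dots> \<le> moment \<omega> x" using r x by (intro moment_ge_tail) auto
    finally show ?thesis by (simp add: r_def)
  next
    case False
    have "c * tail \<omega> (1 - 1 / x) \<le> c * tail \<omega> 0" using c x by (intro mult_left_mono tail_antimono) auto
    also have "\<dots> \<le> moment \<omega> 2 / tail \<omega> 0 * tail \<omega> 0"
      using tail_pos[of 0] by (intro mult_right_mono) (auto simp: c_def)
    also have "\<dots> \<le> moment \<omega> x" using tail_pos[of 0] False x moment_antimono[of x 2] by simp
    finally show ?thesis .
  qed
  thus thesis using that c by blast
qed

text \<open>Up to constants the tail at \<open>1 - 1 / x\<close> is below the moment of order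
  \<open>x\<close>, and this is below the tail at \<open>1 - 1 / (2 * x)\<close>. For
  \<open>x = 1 / (1 - r)\<close> the two points are \<open>r\<close> and
  \<open>(1 + r) / 2\<close>.\<close>

lemma moment_doubling_D_hat:
  assumes D: "moment_doubling D"
  shows "\<omega> \<in> D_hat"
proof -
  obtain C where C: "C > 0" "\<And>x. x \<ge> 1 \<Longrightarrow> moment \<omega> x \<le> C * tail \<omega> (1 - 1 / (2 * x))"
    by (rule moment_le_tail[OF D]) blast
  obtain c where c: "c > 0" "\<And>x. x \<ge> 1 \<Longrightarrow> c * tail \<omega> (1 - 1 / x) \<le> moment \<omega> x"
    by (rule tail_le_moment) blast
  have "tail \<omega> r \<le> max 1 (C / c) * tail \<omega> ((1 + r) / 2)" if r: "r \<in> {0..<1}" for r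
  proof -
    define x where "x = 1 / (1 - r)"
    have x: "x \<ge> 1" using r by (simp add: x_def)
    have rx: "r = 1 - 1 / x" "(1 + r) / 2 = 1 - 1 / (2 * x)" using r by (auto simp: x_def field_simps)
    have "c * tail \<omega> r \<le> C * tail \<omega> ((1 + r) / 2)" 
      using order_trans[OF c(2)[OF x] C(2)[OF x]] unfolding rx(1)[symmetric] rx(2)[symmetric] .
    hence "tail \<omega> r \<le> (C / c) * tail \<omega> ((1 + r) / 2)" using c by (simp add: field_simps)
    also have "\<dots> \<le> max 1 (C / c) * tail \<omega> ((1 + r) / 2)"
      using r by (intro mult_right_mono tail_nonneg) auto
    finally show ?thesis .
  qed
  thus ?thesis using radial unfolding D_hat_def by (auto intro!: exI[of _ "max 1 (C / c)"])
qed

section \<open>Reverse doubling of tails and of moments\<close>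

lemma D_check_iterate:
  assumes "K > 1" "C > 1" "\<forall>r\<in>{0..<1}. tail \<omega> r \<ge> C * tail \<omega> (1 - (1 - r) / K)" "r \<in> {0..<1}"
  shows "tail \<omega> r \<ge> C ^ n * tail \<omega> (1 - (1 - r) / K ^ n)"
proof (induction n)
  case (Suc n)
  define s where "s = 1 - (1 - r) / K ^ n"
  define q where "q = (1 - r) / K ^ n"
  have "q \<le> (1 - r) / 1" unfolding q_def using assms by (intro divide_left_mono) auto
  moreover have "0 < q" using assms by (simp add: q_def)
  ultimately have "s \<in> {0..<1}" using assms(4) by (simp add: s_def q_def[symmetric])
  hence "C ^ n * tail \<omega> s \<ge> C ^ n * (C * tail \<omega> (1 - (1 - s) / K))" using assms by (intro mult_left_mono) auto
  moreover have "1 - (1 - s) / K = 1 - (1 - r) / K ^ Suc n" by (simp add: s_def)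
  ultimately show ?case using Suc by (simp add: s_def mult_ac)
qed simp

lemma M_iterate:
  assumes "K > 1" "C > 1" "\<forall>x\<ge>1. moment \<omega> x \<ge> C * moment \<omega> (K * x)" "x \<ge> 1"
  shows "moment \<omega> x \<ge> C ^ n * moment \<omega> (K ^ n * x)"
proof (induction n)
  case (Suc n)
  have "1 * 1 \<le> K ^ n * x" using assms by (intro mult_mono) auto
  hence "C ^ n * moment \<omega> (K ^ n * x) \<ge> C ^ n * (C * moment \<omega> (K * (K ^ n * x)))" 
    using assms by (intro mult_left_mono) auto
  thus ?case using Suc by (simp add: mult_ac)
qed simp

text \<open>For a weight in \<open>D_hat\<close> the moment of order \<open>x\<close> and the tail
  at \<open>1 - 1 / x\<close> are comparable, with constants \<open>B\<close> and \<open>c\<close>.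
  Translating one condition into the other loses a factor \<open>B / c\<close>; iterating beforehand
  until the gain \<open>C ^ n\<close> exceeds \<open>2 * B / c\<close> leaves a gain of 2.\<close>

lemma D_check_iff_M:
  assumes "\<omega> \<in> D_hat"
  shows "\<omega> \<in> D_check \<longleftrightarrow> \<omega> \<in> M_class"
proof -
  obtain D where D: "moment_doubling D" by (rule D_hat_moment_doubling[OF assms]) blast
  obtain B where B: "B > 0" "\<And>x. x \<ge> 1 \<Longrightarrow> moment \<omega> x \<le> B * tail \<omega> (1 - 1 / (2 * x))"
    by (rule moment_le_tail[OF D]) blast
  obtain c where c: "c > 0" "\<And>x. x \<ge> 1 \<Longrightarrow> c * tail \<omega> (1 - 1 / x) \<le> moment \<omega> x"
    by (rule tail_le_moment) blast
  have B': "moment \<omega> x \<le> B * tail \<omega> (1 - 1 / x)" if "x \<ge> 1" for x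
  proof -
    have "tail \<omega> (1 - 1 / (2 * x)) \<le> tail \<omega> (1 - 1 / x)"
      using that by (intro tail_antimono) (auto simp: field_simps)
    hence "B * tail \<omega> (1 - 1 / (2 * x)) \<le> B * tail \<omega> (1 - 1 / x)" using B by simp
    thus ?thesis using B(2)[OF that] by linarith
  qed
  show ?thesis
  proof
    assume "\<omega> \<in> D_check"
    then obtain K C where KC: "K > 1" "C > 1" "\<forall>r\<in>{0..<1}. tail \<omega> r \<ge> C * tail \<omega> (1 - (1 - r) / K)"
      by (auto simp: D_check_def)
    obtain n where n: "2 * B / c < C ^ n" using real_arch_pow[OF KC(2)] by blast
    have "moment \<omega> x \<ge> 2 * moment \<omega> (K ^ Suc n * x)" if x: "x \<ge> 1" for x
    proof -
      have y: "1 \<le> K ^ Suc n * x" using mult_mono[of 1 "K ^ Suc n" 1 x] KC x one_le_power[of K "Suc n"] by simp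
      have "2 * moment \<omega> (K ^ Suc n * x) \<le> 2 * (B * tail \<omega> (1 - 1 / (K ^ Suc n * x)))"
        using B'[OF y] by simp
      also have "\<dots> = (2 * B) * tail \<omega> (1 - 1 / (K ^ Suc n * x))" by simp
      also have "\<dots> \<le> (c * C ^ Suc n) * tail \<omega> (1 - 1 / (K ^ Suc n * x))"
      proof (intro mult_right_mono tail_nonneg)
        have "C ^ n \<le> C ^ Suc n" using KC by (intro power_increasing) auto
        hence "2 * B / c < C ^ Suc n" using n by linarith
        thus "2 * B \<le> c * C ^ Suc n" using c(1) by (simp add: field_simps)
      qed (use y in auto)
      also have "\<dots> = c * (C ^ Suc n * tail \<omega> (1 - 1 / (K ^ Suc n * x)))" by (simp only: mult.assoc)
      also have "\<dots> \<le> c * tail \<omega> (1 - 1 / x)"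
      proof (intro mult_left_mono)
        have e: "1 - (1 - (1 - 1 / x)) / K ^ Suc n = 1 - 1 / (K ^ Suc n * x)" by simp
        show "C ^ Suc n * tail \<omega> (1 - 1 / (K ^ Suc n * x)) \<le> tail \<omega> (1 - 1 / x)"
          using D_check_iterate[OF KC, of "1 - 1 / x" "Suc n"] x unfolding e by simp
      qed (use c in simp)
      also have "\<dots> \<le> moment \<omega> x" using c x by simp
      finally show ?thesis .
    qed
    moreover have "K ^ Suc n > 1" using KC by (intro one_less_power) auto
    ultimately show "\<omega> \<in> M_class" using radial unfolding M_class_def
      by (intro CollectI conjI exI[of _ "2"] exI[of _ "K ^ Suc n"]) auto
  next
    assume "\<omega> \<in> M_class"
    then obtain K C where KC: "K > 1" "C > 1" "\<forall>x\<ge>1. moment \<omega> x \<ge> C * moment \<omega> (K * x)"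
      by (auto simp: M_class_def)
    obtain n where n: "2 * B / c < C ^ n" using real_arch_pow[OF KC(2)] by blast
    have "tail \<omega> r \<ge> 2 * tail \<omega> (1 - (1 - r) / K ^ Suc n)" if r: "r \<in> {0..<1}" for r
    proof -
      define x where "x = 1 / (1 - r)"
      have x: "x \<ge> 1" using r by (simp add: x_def)
      have rx: "r = 1 - 1 / x" "1 - (1 - r) / K ^ Suc n = 1 - 1 / (K ^ Suc n * x)" using r by (auto simp: x_def)
      have y: "1 \<le> K ^ Suc n * x" using mult_mono[of 1 "K ^ Suc n" 1 x] KC x one_le_power[of K "Suc n"] by simp
      have "2 * B * tail \<omega> (1 - 1 / (K ^ Suc n * x)) \<le> c * C ^ Suc n * tail \<omega> (1 - 1 / (K ^ Suc n * x))"
      proof (intro mult_right_mono tail_nonneg)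
        have "C ^ n \<le> C ^ Suc n" using KC by (intro power_increasing) auto
        hence "2 * B / c < C ^ Suc n" using n by linarith
        thus "2 * B \<le> c * C ^ Suc n" using c(1) by (simp add: field_simps)
      qed (use y in auto)
      also have "\<dots> \<le> C ^ Suc n * moment \<omega> (K ^ Suc n * x)"
        using mult_left_mono[OF c(2)[OF y], of "C ^ Suc n"] KC by (simp add: mult_ac)
      also have "\<dots> \<le> moment \<omega> x" using M_iterate[OF KC x] .
      also have "\<dots> \<le> B * tail \<omega> (1 - 1 / x)" by (rule B'[OF x])
      finally have "2 * tail \<omega> (1 - 1 / (K ^ Suc n * x)) \<le> tail \<omega> (1 - 1 / x)" using B(1) by simp
      thus ?thesis by (simp only: rx(2) rx(1)[symmetric])
    qed
    moreover have "K ^ Suc n > 1" using KC by (intro one_less_power) auto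
    ultimately show "\<omega> \<in> D_check" using radial unfolding D_check_def
      by (intro CollectI conjI exI[of _ "2"] exI[of _ "K ^ Suc n"]) auto
  qed
qed

lemma D_class_iff: "\<omega> \<in> D_class \<longleftrightarrow> \<omega> \<in> D_hat \<inter> M_class"
  using D_check_iff_M by (auto simp: D_class_def)


section \<open>Integration against a radial weight\<close>

text \<open>The profile is only Lebesgue measurable, which does not by itself make its composition
  with the norm measurable. A Borel representative composes freely, and the exceptional null set of
  radii lifts to a null set of the disc by \<open>AE_norm_dA\<close>.\<close>

lemma borel_version:
  obtains w where "w \<in> borel_measurable borel" "\<And>r. 0 \<le> w r" "AE r in lborel. r \<in> {0..<1} \<longrightarrow> \<omega> r = w r"
proof -
  have "(\<lambda>r. indicator {0..<1} r *\<^sub>R \<omega> r) \<in> borel_measurable lebesgue"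
    using radial by (auto simp: radial_weight_def set_integrable_def)
  then obtain g where g: "g \<in> borel_measurable lborel" "AE r in lborel. indicator {0..<1} r *\<^sub>R \<omega> r = g r"
    using completion_ex_borel_measurable_real by blast
  show thesis
  proof (rule that[of "\<lambda>r. max 0 (g r)"])
    show "AE r in lborel. r \<in> {0..<1} \<longrightarrow> \<omega> r = max 0 (g r)"
    proof (rule eventually_mono[OF g(2)], rule impI)
      fix r assume "indicator {0..<1} r *\<^sub>R \<omega> r = g r" "r \<in> {0..<1}"
      thus "\<omega> r = max 0 (g r)" using weight_nonneg[of r] by (simp add: max_def)
    qed
  qed (use g in auto)
qed

lemma AE_norm_dA:
  assumes "AE r in lborel. r \<in> {0..<1} \<longrightarrow> P r"
  shows "AE z in dA. P (norm z)"
proof -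
  have "AE r in density lborel (\<lambda>r. ennreal (2 * r) * indicator {0..<1} r). P r"
    by (subst AE_density) (use assms in \<open>auto simp: zero_less_mult_iff elim!: eventually_mono split: split_indicator\<close>)
  hence "AE r in distr dA borel norm. P r" unfolding distr_dA_norm .
  thus ?thesis by (rule AE_distrD[OF norm_measurable_dA])
qed

lemma weight_norm_measurable[measurable]: "(\<lambda>z. \<omega> (norm z)) \<in> borel_measurable dA"
proof -
  obtain w where w: "w \<in> borel_measurable borel" "\<And>r. 0 \<le> w r" "AE r in lborel. r \<in> {0..<1} \<longrightarrow> \<omega> r = w r"
    by (rule borel_version) blast
  have "AE z in dA. \<omega> (norm z) = w (norm z)" by (rule AE_norm_dA[OF w(3)])
  hence "AE z in lebesgue_on \<D>. \<omega> (norm z) = w (norm z)"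
    unfolding dA_def by (subst (asm) AE_density) auto
  hence ae: "AE z in lebesgue. indicator \<D> z *\<^sub>R w (norm z) = indicator \<D> z *\<^sub>R \<omega> (norm z)"
    by (subst (asm) AE_restrict_space_iff) (auto elim!: eventually_mono split: split_indicator)
  have wm: "(\<lambda>z::complex. w (norm z)) \<in> borel_measurable borel" using w(1) by measurable
  have "(\<lambda>z::complex. indicator \<D> z *\<^sub>R w (norm z)) \<in> borel_measurable lebesgue"
    using borel_measurable_times[OF borel_measurable_indicator[of \<D> borel] wm] by (intro measurable_completion) simp
  from borel_measurable_AE[OF this ae]
  have "(\<lambda>z. \<omega> (norm z)) \<in> borel_measurable (lebesgue_on \<D>)"
    by (subst borel_measurable_restrict_space_iff) auto
  moreover have "borel_measurable dA = (borel_measurable (lebesgue_on \<D>) :: (complex \<Rightarrow> real) set)"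
    by (rule measurable_cong_sets) (simp_all add: sets_dA)
  ultimately show ?thesis by simp
qed

definition "\<nu> = density dA (\<lambda>z. ennreal (\<omega> (norm z)))"

lemma space_nu[simp]: "space \<nu> = \<D>" by (simp add: \<nu>_def)
lemma sets_nu: "sets \<nu> = sets dA" by (simp add: \<nu>_def)
lemma measurable_nu: "f \<in> borel_measurable \<nu> \<longleftrightarrow> f \<in> borel_measurable dA"
  by (simp add: \<nu>_def)

lemma measurable_nu_borel:
  fixes f :: "complex \<Rightarrow> 'b::topological_space"
  assumes "f \<in> borel_measurable borel" shows "f \<in> borel_measurable \<nu>"
  using measurable_compose[OF id_measurable_dA assms] by (simp add: measurable_nu)

lemma measurable_nu_continuous:
  fixes f :: "complex \<Rightarrow> complex"
  assumes "continuous_on \<D> f" shows "f \<in> borel_measurable \<nu>"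
proof -
  have "f \<in> borel_measurable (lebesgue_on \<D>)"
    by (intro continuous_imp_measurable_on_sets_lebesgue assms) auto
  moreover have "borel_measurable \<nu> = (borel_measurable (lebesgue_on \<D>) :: (complex \<Rightarrow> complex) set)"
    by (rule measurable_cong_sets) (simp_all add: sets_nu sets_dA)
  ultimately show ?thesis by simp
qed

lemma id_measurable_nu[measurable]: "(\<lambda>z. z) \<in> borel_measurable \<nu>"
  by (simp add: measurable_nu)

lemma weight_norm_nonneg: "AE z in dA. 0 \<le> \<omega> (norm z)"
  by (rule AE_I2) (auto intro: weight_nonneg)

lemma integral_nu:
  fixes f :: "complex \<Rightarrow> 'b::{banach, second_countable_topology}"
  assumes "f \<in> borel_measurable \<nu>"
  shows "(LINT z|\<nu>. f z) = (LINT z|dA. \<omega> (norm z) *\<^sub>R f z)"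
    and "integrable \<nu> f \<longleftrightarrow> integrable dA (\<lambda>z. \<omega> (norm z) *\<^sub>R f z)"
  using integral_density[OF _ weight_norm_measurable weight_norm_nonneg, of f]
    integrable_density[OF _ weight_norm_measurable weight_norm_nonneg, of f] assms
  unfolding measurable_nu unfolding \<nu>_def by auto

text \<open>The detour over a Borel representative and the completed measure is forced because the
  push-forward of \<open>dA\<close> is a Borel measure, while \<sigma> lives on Lebesgue sets. The
  factor \<open>2 * r\<close> is the density from \<open>distr_dA_norm\<close>.\<close>

lemma nn_integral_nu_radial:
  assumes h[measurable]: "h \<in> borel_measurable borel"
  shows "(\<integral>\<^sup>+z. h (norm z) \<partial>\<nu>) = (\<integral>\<^sup>+r. ennreal (2 * r) * h r \<partial>\<sigma>)"
proof -
  obtain w where w[measurable]: "w \<in> borel_measurable borel" and w': "\<And>r. 0 \<le> w r" "AE r in lborel. r \<in> {0..<1} \<longrightarrow> \<omega> r = w r"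
    by (rule borel_version) blast
  have hm: "(\<lambda>z. h (norm z)) \<in> borel_measurable dA" by measurable
  have "(\<integral>\<^sup>+z. h (norm z) \<partial>\<nu>) = (\<integral>\<^sup>+z. ennreal (\<omega> (norm z)) * h (norm z) \<partial>dA)"
    unfolding \<nu>_def by (rule nn_integral_density) (use hm in auto)
  also have "\<dots> = (\<integral>\<^sup>+z. ennreal (w (norm z)) * h (norm z) \<partial>dA)"
    using AE_norm_dA[OF w'(2)] by (intro nn_integral_cong_AE) (auto elim!: eventually_mono)
  also have "\<dots> = (\<integral>\<^sup>+r. ennreal (w r) * h r \<partial>distr dA borel norm)"
    by (subst nn_integral_distr) auto
  also have "\<dots> = (\<integral>\<^sup>+r. (ennreal (2 * r) * indicator {0..<1} r) * (ennreal (w r) * h r) \<partial>lborel)"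
    unfolding distr_dA_norm by (subst nn_integral_density) auto
  also have "\<dots> = (\<integral>\<^sup>+r. (ennreal (2 * r) * indicator {0..<1} r) * (ennreal (w r) * h r) \<partial>lebesgue)"
    by (simp add: nn_integral_completion)
  also have "\<dots> = (\<integral>\<^sup>+r. (ennreal (\<omega> r) * (ennreal (2 * r) * h r)) * indicator {0..<1} r \<partial>lebesgue)"
    using AE_completion[OF w'(2)] 
    by (intro nn_integral_cong_AE) (auto elim!: eventually_mono split: split_indicator simp: mult_ac)
  also have "\<dots> = (\<integral>\<^sup>+r. ennreal (\<omega> r) * (ennreal (2 * r) * h r) \<partial>lebesgue_on {0..<1})"
    by (subst nn_integral_restrict_space) auto
  also have "\<dots> = (\<integral>\<^sup>+r. ennreal (2 * r) * h r \<partial>\<sigma>)"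
  proof -
    have "(\<lambda>r. ennreal (2 * r) * h r) \<in> borel_measurable (lebesgue_on {0..<1})"
      by (intro measurable_restrict_space1 measurable_completion) simp
    thus ?thesis unfolding line_measure_def using weight_measurable
      by (subst nn_integral_density) auto
  qed
  finally show ?thesis .
qed

lemma finite_nu: "finite_measure \<nu>"
proof (rule finite_measureI)
  have "emeasure \<nu> (space \<nu>) = (\<integral>\<^sup>+z. 1 \<partial>\<nu>)" by simp
  also have "\<dots> = (\<integral>\<^sup>+r. ennreal (2 * r) * 1 \<partial>\<sigma>)" by (rule nn_integral_nu_radial) simp
  also have "\<dots> \<le> (\<integral>\<^sup>+r. 2 \<partial>\<sigma>)"
    by (intro nn_integral_mono) (auto simp: ennreal_numeral[symmetric] simp del: ennreal_numeral intro!: ennreal_leI)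
  also have "\<dots> < \<infinity>" 
    using line.emeasure_finite[of "{0..<1}"] by (simp add: ennreal_mult_eq_top_iff less_top[symmetric])
  finally show "emeasure \<nu> (space \<nu>) \<noteq> \<infinity>" by simp
qed

sublocale disc: finite_measure \<nu> by (rule finite_nu)

lemma integrable_iff:
  fixes f :: "'z \<Rightarrow> real"
  assumes "f \<in> borel_measurable M" "AE x in M. 0 \<le> f x"
  shows "integrable M f \<longleftrightarrow> (\<integral>\<^sup>+x. ennreal (f x) \<partial>M) < \<infinity>"
  using integrableI_nonneg[OF assms] nn_integral_eq_integral[of M f] assms by auto

lemma integral_nu_radial:
  fixes h :: "real \<Rightarrow> real"
  assumes h[measurable]: "h \<in> borel_measurable borel" and nn: "\<And>r. r \<in> {0..<1} \<Longrightarrow> 0 \<le> h r"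
  shows "(LINT z|\<nu>. h (norm z)) = 2 * (LINT r|\<sigma>. r * h r)"
    and "integrable \<nu> (\<lambda>z. h (norm z)) \<longleftrightarrow> integrable \<sigma> (\<lambda>r. r * h r)"
proof -
  have m1: "(\<lambda>z. h (norm z)) \<in> borel_measurable \<nu>" by measurable
  have m2: "(\<lambda>r. r * h r) \<in> borel_measurable \<sigma>" by measurable
  have "(\<integral>\<^sup>+z. ennreal (h (norm z)) \<partial>\<nu>) = (\<integral>\<^sup>+r. ennreal (2 * r) * ennreal (h r) \<partial>\<sigma>)"
    by (rule nn_integral_nu_radial) measurable
  also have "\<dots> = (\<integral>\<^sup>+r. 2 * ennreal (r * h r) \<partial>\<sigma>)"
    using nn by (intro nn_integral_cong) (auto simp: ennreal_mult[symmetric] mult_ac ennreal_numeral[symmetric] simp del: ennreal_numeral)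
  also have "\<dots> = 2 * (\<integral>\<^sup>+r. ennreal (r * h r) \<partial>\<sigma>)" using m2 by (subst nn_integral_cmult) auto
  finally have eq: "(\<integral>\<^sup>+z. ennreal (h (norm z)) \<partial>\<nu>) = 2 * (\<integral>\<^sup>+r. ennreal (r * h r) \<partial>\<sigma>)" .
  have n1: "AE z in \<nu>. 0 \<le> h (norm z)" by (rule AE_I2) (use nn in auto)
  have n2: "AE r in \<sigma>. 0 \<le> r * h r" by (rule AE_I2) (use nn in auto)
  show "(LINT z|\<nu>. h (norm z)) = 2 * (LINT r|\<sigma>. r * h r)"
    using integral_eq_nn_integral[OF m1 n1] integral_eq_nn_integral[OF m2 n2] eq by (simp add: enn2real_mult)
  show "integrable \<nu> (\<lambda>z. h (norm z)) \<longleftrightarrow> integrable \<sigma> (\<lambda>r. r * h r)"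
    unfolding integrable_iff[OF m1 n1] integrable_iff[OF m2 n2] eq
    by (auto simp: ennreal_mult_less_top)
qed

text \<open>The Jacobian raises the order by one. The squared norm of the n-th monomial, the case of
  exponent 2 n, is therefore \<open>2 * moment \<omega> (2 * real n + 1)\<close>.\<close>

lemma nu_moment_nat: "(LINT z|\<nu>. norm z ^ n) = 2 * moment \<omega> (real n + 1)"
proof -
  have "(LINT z|\<nu>. norm z ^ n) = 2 * (LINT r|\<sigma>. r * r ^ n)"
    by (rule integral_nu_radial) auto
  also have "(LINT r|\<sigma>. r * r ^ n) = (LINT r|\<sigma>. r powr (real (Suc n)))"
    by (intro Bochner_Integration.integral_cong) (auto simp: powr_realpow' simp del: of_nat_Suc)
  finally show ?thesis by (simp add: moment_eq add.commute)
qed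

section \<open>Rotation invariance and orthogonality of monomials\<close>

lemma nu_rotation:
  assumes c: "norm (c::complex) = 1"
  shows "(*) c \<in> \<nu> \<rightarrow>\<^sub>M \<nu>" "distr \<nu> \<nu> ((*) c) = \<nu>"
proof -
  show m: "(*) c \<in> \<nu> \<rightarrow>\<^sub>M \<nu>"
    using dA_rotation(1)[OF c] by (subst measurable_cong_sets[OF sets_nu sets_nu])
  show "distr \<nu> \<nu> ((*) c) = \<nu>"
  proof (rule measure_eqI)
    fix X assume "X \<in> sets (distr \<nu> \<nu> ((*) c))"
    hence X: "X \<in> sets dA" by (simp add: sets_nu)
    have "emeasure (distr \<nu> \<nu> ((*) c)) X = emeasure \<nu> ((*) c -` X \<inter> space \<nu>)"
      using X m by (subst emeasure_distr) (auto simp: sets_nu)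
    also have "\<dots> = (\<integral>\<^sup>+z. ennreal (\<omega> (norm z)) * indicator ((*) c -` X \<inter> space \<nu>) z \<partial>dA)"
      unfolding \<nu>_def using measurable_sets[OF dA_rotation(1)[OF c] X]
      by (subst emeasure_density) auto
    also have "\<dots> = (\<integral>\<^sup>+z. ennreal (\<omega> (norm (c * z))) * indicator X (c * z) \<partial>dA)"
      using c by (intro nn_integral_cong) (auto simp: norm_mult split: split_indicator)
    also have "\<dots> = (\<integral>\<^sup>+z. ennreal (\<omega> (norm z)) * indicator X z \<partial>distr dA dA ((*) c))"
      using X dA_rotation(1)[OF c] by (subst nn_integral_distr) auto
    also have "\<dots> = emeasure \<nu> X"
      unfolding dA_rotation(2)[OF c] \<nu>_def using X by (subst emeasure_density) auto
    finally show "emeasure (distr \<nu> \<nu> ((*) c)) X = emeasure \<nu> X" .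
  qed simp
qed

lemma integral_nu_rotation:
  fixes f :: "complex \<Rightarrow> 'b::{banach, second_countable_topology}"
  assumes c: "norm (c::complex) = 1" and f: "f \<in> borel_measurable \<nu>"
  shows "(LINT z|\<nu>. f (c * z)) = (LINT z|\<nu>. f z)" "integrable \<nu> (\<lambda>z. f (c * z)) \<longleftrightarrow> integrable \<nu> f"
    "(\<lambda>z. f (c * z)) \<in> borel_measurable \<nu>"
proof -
  show "(LINT z|\<nu>. f (c * z)) = (LINT z|\<nu>. f z)"
    using integral_distr[OF nu_rotation(1)[OF c] f] unfolding nu_rotation(2)[OF c] by simp
  show "integrable \<nu> (\<lambda>z. f (c * z)) \<longleftrightarrow> integrable \<nu> f"
    using integrable_distr_eq[OF nu_rotation(1)[OF c] f] unfolding nu_rotation(2)[OF c] by simp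
  show "(\<lambda>z. f (c * z)) \<in> borel_measurable \<nu>"
    using measurable_compose[OF nu_rotation(1)[OF c] f] by simp
qed

lemma integral_homogeneous_eq_0:
  fixes F :: "complex \<Rightarrow> complex"
  assumes F: "F \<in> borel_measurable \<nu>" and c: "norm c = 1" and d: "d \<noteq> 1"
    and hom: "\<And>z. z \<in> \<D> \<Longrightarrow> F (c * z) = d * F z"
  shows "(LINT z|\<nu>. F z) = 0"
proof -
  have "(LINT z|\<nu>. F z) = (LINT z|\<nu>. F (c * z))" using integral_nu_rotation(1)[OF c F] by simp
  also have "\<dots> = (LINT z|\<nu>. d * F z)" by (rule Bochner_Integration.integral_cong) (auto simp: hom)
  also have "\<dots> = d * (LINT z|\<nu>. F z)" by simp
  finally have "(1 - d) * (LINT z|\<nu>. F z) = 0" by (simp add: algebra_simps)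
  thus ?thesis using d by simp
qed

lemma radial_monomial_measurable:
  fixes \<beta> :: "real \<Rightarrow> complex"
  assumes "\<beta> \<in> borel_measurable borel"
  shows "(\<lambda>z. \<beta> (norm z) * z ^ m * cnj z ^ k) \<in> borel_measurable borel"
proof -
  have "(\<lambda>z::complex. \<beta> (norm z)) \<in> borel_measurable borel"
    using assms by measurable
  thus ?thesis
    by (intro borel_measurable_times) (auto intro!: borel_measurable_continuous_onI continuous_intros)
qed

text \<open>Orthogonality without an angular integral: with j the distance of the two exponents,
  rotation by \<open>cis (pi / j)\<close> multiplies the integrand by -1 and preserves both the
  measure and the radial factor.\<close>

lemma integral_radial_monomial:
  fixes \<beta> :: "real \<Rightarrow> complex"
  assumes [measurable]: "\<beta> \<in> borel_measurable borel" and "m \<noteq> n"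
  shows "(LINT z|\<nu>. \<beta> (norm z) * z ^ m * cnj z ^ n) = 0"
proof -
  define j where "j = (if m > n then m - n else n - m)"
  have j: "j > 0" using assms by (auto simp: j_def)
  define c where "c = cis (pi / real j)"
  have c: "norm c = 1" "c * cnj c = 1" by (auto simp: c_def cis_mult cis_cnj)
  have "cis (pi / real j) ^ j = cis pi" using j by (subst Complex.DeMoivre) simp
  hence cj: "c ^ j = - 1" by (simp add: c_def)
  have d: "c ^ m * cnj c ^ n = - 1"
  proof (cases "m > n")
    case True
    hence "c ^ m = c ^ j * c ^ n" by (simp add: j_def power_add[symmetric])
    hence "c ^ m * cnj c ^ n = c ^ j * (c * cnj c) ^ n" by (simp only: mult.assoc power_mult_distrib)
    thus ?thesis using c cj by simp
  next
    case False
    hence "cnj c ^ n = cnj c ^ j * cnj c ^ m" using assms by (simp add: j_def power_add[symmetric])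
    hence "c ^ m * cnj c ^ n = cnj (c ^ j) * (c * cnj c) ^ m" by (simp add: mult_ac power_mult_distrib)
    thus ?thesis using c cj by simp
  qed
  show ?thesis
  proof (rule integral_homogeneous_eq_0[OF _ c(1), of _ "- 1"])
    show "(\<lambda>z. \<beta> (norm z) * z ^ m * cnj z ^ n) \<in> borel_measurable \<nu>"
      by (intro measurable_nu_borel radial_monomial_measurable assms)
    fix z
    have "\<beta> (norm (c * z)) * (c * z) ^ m * cnj (c * z) ^ n = (c ^ m * cnj c ^ n) * (\<beta> (norm z) * z ^ m * cnj z ^ n)"
      using c by (simp add: norm_mult power_mult_distrib mult_ac)
    thus "\<beta> (norm (c * z)) * (c * z) ^ m * cnj (c * z) ^ n = - 1 * (\<beta> (norm z) * z ^ m * cnj z ^ n)"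
      by (simp add: d)
  qed simp
qed

text \<open>The coefficients may depend on the modulus, so that one formula serves truncated,
  reflected and logarithmic series alike: pairing with \<open>cnj z ^ n\<close> keeps only the term
  of index n, whose angular part cancels.\<close>

lemma coefficient_integral:
  fixes \<beta> :: "nat \<Rightarrow> real \<Rightarrow> complex"
  assumes meas: "\<And>m. \<beta> m \<in> borel_measurable borel"
    and bound: "\<And>m z. z \<in> \<D> \<Longrightarrow> norm (\<beta> m (norm z) * z ^ m) \<le> B m" and B: "summable B"
  shows "integrable \<nu> (\<lambda>z. \<Sum>m. \<beta> m (norm z) * z ^ m)"
    and "(LINT z|\<nu>. (\<Sum>m. \<beta> m (norm z) * z ^ m) * cnj z ^ n) = (LINT z|\<nu>. \<beta> n (norm z) * of_real (norm z ^ (2 * n)))"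
proof -
  note meas[measurable]
  have [measurable]: "(\<lambda>z. \<beta> m (norm z) * z ^ m * cnj z ^ k) \<in> borel_measurable \<nu>" for m k
    by (intro measurable_nu_borel radial_monomial_measurable meas)
  have [measurable]: "(\<lambda>z. \<beta> m (norm z) * z ^ m) \<in> borel_measurable \<nu>" for m
    by (intro measurable_nu_borel) simp
  have B0: "B m \<ge> 0" for m using bound[of 0 m] by (metis centre_in_ball norm_ge_zero order_trans zero_less_one)
  have b2: "norm (\<beta> m (norm z) * z ^ m * cnj z ^ k) \<le> B m" if "z \<in> \<D>" for m k z
  proof -
    have "norm (cnj z ^ k) \<le> 1" using that by (simp add: norm_power power_le_one)
    hence "norm (\<beta> m (norm z) * z ^ m) * norm (cnj z ^ k) \<le> B m * 1"
      using bound[OF that, of m] B0 by (intro mult_mono) auto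
    thus ?thesis by (simp add: norm_mult)
  qed
  have int: "integrable \<nu> (\<lambda>z. \<beta> m (norm z) * z ^ m * cnj z ^ k)" for m k
    by (rule disc.integrable_const_bound[of _ "B m"]) (auto intro!: AE_I2 b2)
  have summ: "summable (\<lambda>m. norm (\<beta> m (norm z) * z ^ m * cnj z ^ k))" if "z \<in> \<D>" for z k
    by (rule summable_comparison_test[OF _ B]) (use b2[OF that] in auto)
  have sumi: "summable (\<lambda>m. LINT z|\<nu>. norm (\<beta> m (norm z) * z ^ m * cnj z ^ k))" for k
  proof (rule summable_comparison_test[OF _ summable_mult[OF B, of "measure \<nu> \<D>"]], intro exI[of _ 0] allI impI)
    fix m
    have "(LINT z|\<nu>. norm (\<beta> m (norm z) * z ^ m * cnj z ^ k)) \<le> (LINT z|\<nu>. B m)"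
      using int b2 by (intro integral_mono integrable_norm) auto
    thus "norm (LINT z|\<nu>. norm (\<beta> m (norm z) * z ^ m * cnj z ^ k)) \<le> measure \<nu> \<D> * B m"
      by simp
  qed
  have "integrable \<nu> (\<lambda>z. \<Sum>m. \<beta> m (norm z) * z ^ m * cnj z ^ 0)"
    by (rule integrable_suminf[OF int]) (use summ[of _ 0] sumi[of 0] in \<open>auto intro!: AE_I2\<close>)
  thus "integrable \<nu> (\<lambda>z. \<Sum>m. \<beta> m (norm z) * z ^ m)" by simp
  have "(LINT z|\<nu>. (\<Sum>m. \<beta> m (norm z) * z ^ m) * cnj z ^ n) = (LINT z|\<nu>. (\<Sum>m. \<beta> m (norm z) * z ^ m * cnj z ^ n))"
  proof (rule Bochner_Integration.integral_cong[OF refl])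
    fix z assume "z \<in> space \<nu>"
    hence "summable (\<lambda>m. norm (\<beta> m (norm z) * z ^ m))" using summ[of z 0] by simp
    thus "(\<Sum>m. \<beta> m (norm z) * z ^ m) * cnj z ^ n = (\<Sum>m. \<beta> m (norm z) * z ^ m * cnj z ^ n)"
      by (rule suminf_mult2[OF summable_norm_cancel])
  qed
  also have "\<dots> = (\<Sum>m. LINT z|\<nu>. \<beta> m (norm z) * z ^ m * cnj z ^ n)"
    by (rule integral_suminf[OF int]) (use summ sumi in \<open>auto intro!: AE_I2\<close>)
  also have "\<dots> = (\<Sum>m\<in>{n}. LINT z|\<nu>. \<beta> m (norm z) * z ^ m * cnj z ^ n)"
    by (rule suminf_finite) (auto intro!: integral_radial_monomial meas)
  also have "\<dots> = (LINT z|\<nu>. \<beta> n (norm z) * of_real (norm z ^ (2 * n)))"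
  proof -
    have e: "z ^ n * cnj z ^ n = of_real (norm z ^ (2 * n))" for z
      by (simp add: power_mult_distrib[symmetric] complex_norm_square[symmetric] power_mult)
    show ?thesis by (simp add: mult.assoc e)
  qed
  finally show "(LINT z|\<nu>. (\<Sum>m. \<beta> m (norm z) * z ^ m) * cnj z ^ n) = (LINT z|\<nu>. \<beta> n (norm z) * of_real (norm z ^ (2 * n)))" .
qed

end

section \<open>Power series in the disc and the Bloch space\<close>

definition disc_series :: "(nat \<Rightarrow> complex) \<Rightarrow> bool"
  where "disc_series c \<longleftrightarrow> (\<forall>\<rho>\<in>{0..<1}. summable (\<lambda>n. norm (c n) * \<rho> ^ n))"

definition psum :: "(nat \<Rightarrow> complex) \<Rightarrow> complex \<Rightarrow> complex"
  where "psum c z = (\<Sum>n. c n * z ^ n)"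

definition taylor :: "(complex \<Rightarrow> complex) \<Rightarrow> nat \<Rightarrow> complex"
  where "taylor f n = (deriv ^^ n) f 0 / fact n"

lemma disc_series_summable:
  assumes "disc_series c" "z \<in> \<D>"
  shows "summable (\<lambda>n. norm (c n * z ^ n))" "summable (\<lambda>n. c n * z ^ n)"
proof -
  show "summable (\<lambda>n. norm (c n * z ^ n))"
    using assms by (auto simp: disc_series_def norm_mult norm_power)
  thus "summable (\<lambda>n. c n * z ^ n)" by (rule summable_norm_cancel)
qed

lemma norm_diffs: "norm (diffs c n :: complex) = (real n + 1) * norm (c (Suc n))"
proof -
  have "norm (diffs c n) = norm (of_nat (Suc n) :: complex) * norm (c (Suc n))"
    by (simp only: diffs_def norm_mult)
  also have "norm (of_nat (Suc n) :: complex) = real n + 1" by (simp only: norm_of_nat)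
  finally show ?thesis .
qed

text \<open>Plain convergence at a radius strictly between \<rho> and 1 gives absolute convergence
  at \<rho>.\<close>

lemma disc_seriesI:
  assumes "\<And>z. z \<in> \<D> \<Longrightarrow> summable (\<lambda>n. c n * z ^ n)"
  shows "disc_series c"
  unfolding disc_series_def
proof
  fix \<rho> :: real assume r: "\<rho> \<in> {0..<1}"
  define K where "K = complex_of_real ((1 + \<rho>) / 2)"
  have nK: "norm K = (1 + \<rho>) / 2" using r unfolding K_def norm_of_real by simp
  have "summable (\<lambda>n. c n * K ^ n)" using r nK by (intro assms) (simp add: dist_norm)
  hence "summable (\<lambda>n. norm (c n * complex_of_real \<rho> ^ n))"
    by (rule powser_insidea) (use r nK in auto)
  thus "summable (\<lambda>n. norm (c n) * \<rho> ^ n)" using r by (simp add: norm_mult norm_power)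
qed

lemma disc_series_diffs:
  assumes "disc_series c" shows "disc_series (diffs c)"
proof (rule disc_seriesI)
  fix z assume "z \<in> \<D>"
  thus "summable (\<lambda>n. diffs c n * z ^ n)"
    using disc_series_summable(2)[OF assms] by (intro termdiff_converges[of z 1]) auto
qed

lemma psum_has_derivative:
  assumes c: "disc_series c" and z: "z \<in> \<D>"
  shows "(psum c has_field_derivative psum (diffs c) z) (at z)"
proof -
  define K where "K = complex_of_real ((1 + norm z) / 2)"
  have nK: "norm K = (1 + norm z) / 2" unfolding K_def norm_of_real by simp
  have "((\<lambda>z. \<Sum>n. c n * z ^ n) has_field_derivative (\<Sum>n. diffs c n * z ^ n)) (at z)"
    by (rule termdiffs_strong[of c K]) (use z nK disc_series_summable(2)[OF c, of K] in auto)
  thus ?thesis by (simp add: psum_def[abs_def])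
qed

lemma psum_holomorphic: "disc_series c \<Longrightarrow> psum c holomorphic_on \<D>"
  by (auto simp: holomorphic_on_def field_differentiable_def
       intro: has_field_derivative_at_within psum_has_derivative)

lemma deriv_psum: "disc_series c \<Longrightarrow> z \<in> \<D> \<Longrightarrow> deriv (psum c) z = psum (diffs c) z"
  by (rule DERIV_imp_deriv[OF psum_has_derivative])

lemma psum_zero: "psum c 0 = c 0"
  unfolding psum_def by (rule powser_zero)

lemma taylor_sums:
  assumes "f holomorphic_on \<D>" "z \<in> \<D>"
  shows "(\<lambda>n. taylor f n * z ^ n) sums f z"
  using holomorphic_power_series[OF assms] by (simp add: taylor_def)

lemma taylor_series:
  assumes "f holomorphic_on \<D>"
  shows "disc_series (taylor f)" "\<And>z. z \<in> \<D> \<Longrightarrow> f z = psum (taylor f) z"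
  using taylor_sums[OF assms] by (auto intro!: disc_seriesI simp: sums_iff psum_def)

lemma deriv_eq_on_disc:
  assumes "\<And>z. z \<in> \<D> \<Longrightarrow> f z = g z" "z \<in> \<D>"
  shows "deriv f z = deriv g z"
  by (rule deriv_cong_ev) (use assms eventually_nhds_in_open[of \<D> z] in \<open>auto elim!: eventually_mono\<close>)

text \<open>Only values in the disc enter, since it is an open neighbourhood of the point 0 at which
  the derivatives are taken. Functions that agree on the disc thus share their coefficients.\<close>

lemma taylor_unique:
  assumes c: "disc_series c" and eq: "\<And>z. z \<in> \<D> \<Longrightarrow> f z = psum c z"
  shows "taylor f n = c n"
proof -
  have ds: "disc_series ((diffs ^^ n) c)" for n
    by (induction n) (auto intro: disc_series_diffs c)
  have d: "(deriv ^^ n) f z = psum ((diffs ^^ n) c) z" if "z \<in> \<D>" for n z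
    using that
  proof (induction n arbitrary: z)
    case (Suc n)
    have "(deriv ^^ Suc n) f z = deriv ((deriv ^^ n) f) z" by simp
    also have "\<dots> = deriv (psum ((diffs ^^ n) c)) z" by (rule deriv_eq_on_disc) (use Suc in auto)
    also have "\<dots> = psum ((diffs ^^ Suc n) c) z" using Suc.prems by (simp add: deriv_psum ds)
    finally show ?case .
  qed (use eq in auto)
  \<comment> \<open>Repeated \<open>diffs\<close> shifts the index and collects a falling factorial;
    at k = 0 this is n! times the n-th coefficient.\<close>
  have f: "(diffs ^^ n) c k = fact (n + k) / fact k * c (n + k)" for k
  proof (induction n arbitrary: k)
    case (Suc n)
    have "(diffs ^^ Suc n) c k = of_nat (Suc k) * (diffs ^^ n) c (Suc k)" by (simp add: diffs_def)
    also have "\<dots> = of_nat (Suc k) * (fact (n + Suc k) / fact (Suc k) * c (n + Suc k))"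
      by (simp only: Suc)
    also have "\<dots> = fact (n + Suc k) / fact k * c (n + Suc k)"
      by (simp add: fact_Suc[of k] del: of_nat_Suc add_Suc_right)
    finally show ?case by simp
  qed simp
  show ?thesis using d[of 0 n] f[of 0] by (simp add: taylor_def psum_zero)
qed

lemma taylor_psum: "disc_series c \<Longrightarrow> taylor (psum c) = c"
  by (rule ext, rule taylor_unique) auto

lemma taylor_cong: "(\<And>z. z \<in> \<D> \<Longrightarrow> f z = g z) \<Longrightarrow> g holomorphic_on \<D> \<Longrightarrow> taylor f = taylor g"
  by (rule ext, rule taylor_unique) (auto simp: taylor_series)

section \<open>Dilations and strongly convergent series\<close>

definition dilate :: "real \<Rightarrow> (complex \<Rightarrow> complex) \<Rightarrow> complex \<Rightarrow> complex"
  where "dilate r f z = f (of_real r * z)"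

lemma dilate_in_disc: "0 \<le> r \<Longrightarrow> r \<le> 1 \<Longrightarrow> z \<in> \<D> \<Longrightarrow> of_real r * z \<in> \<D>"
  using mult_left_le_one_le[of "norm z" r] by (auto simp: norm_mult)

lemma dilate_holomorphic:
  assumes "f holomorphic_on \<D>" "0 \<le> r" "r \<le> 1"
  shows "dilate r f holomorphic_on \<D>"
  unfolding dilate_def[abs_def]
  by (rule holomorphic_on_compose_gen[OF _ assms(1), unfolded o_def])
     (use assms dilate_in_disc in \<open>auto intro!: holomorphic_intros\<close>)

lemma taylor_dilate:
  assumes "f holomorphic_on \<D>" "0 \<le> r" "r \<le> 1"
  shows "taylor (dilate r f) n = taylor f n * of_real r ^ n"
proof (rule taylor_unique)
  have s: "(\<lambda>n. (taylor f n * of_real r ^ n) * z ^ n) sums dilate r f z" if "z \<in> \<D>" for z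
    using taylor_sums[OF assms(1) dilate_in_disc[OF assms(2,3) that]] 
    by (simp add: dilate_def power_mult_distrib mult.assoc)
  show "disc_series (\<lambda>n. taylor f n * of_real r ^ n)" using s by (auto intro!: disc_seriesI simp: sums_iff)
  show "dilate r f z = psum (\<lambda>n. taylor f n * of_real r ^ n) z" if "z \<in> \<D>" for z
    using s[OF that] by (simp add: psum_def sums_iff)
qed

lemma deriv_dilate:
  assumes "f holomorphic_on \<D>" "0 \<le> r" "r \<le> 1" "z \<in> \<D>"
  shows "deriv (dilate r f) z = of_real r * deriv f (of_real r * z)"
proof -
  have "(f has_field_derivative deriv f (of_real r * z)) (at (of_real r * z))"
    using assms dilate_in_disc[OF assms(2-4)] by (auto intro!: holomorphic_derivI)
  hence "((\<lambda>z. f (of_real r * z)) has_field_derivative deriv f (of_real r * z) * of_real r) (at z)"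
    by (rule DERIV_chain2) (auto intro!: derivative_eq_intros)
  thus ?thesis by (simp add: dilate_def[abs_def] DERIV_imp_deriv mult.commute)
qed

text \<open>Series with these coefficients converge absolutely in both spaces of the theorem.\<close>

definition strong_series :: "(nat \<Rightarrow> complex) \<Rightarrow> bool"
  where "strong_series c \<longleftrightarrow> summable (\<lambda>n. (real n + 1) * norm (c n))"

lemma strong_series_norm: "strong_series c \<Longrightarrow> summable (\<lambda>n. norm (c n))"
  unfolding strong_series_def
  by (rule summable_comparison_test[rotated]) (auto intro!: exI[of _ 0] simp: mult_le_cancel_right1)

lemma strong_series_disc: assumes "strong_series c" shows "disc_series c"
  unfolding disc_series_def
proof
  fix \<rho> :: real assume "\<rho> \<in> {0..<1}"
  thus "summable (\<lambda>n. norm (c n) * \<rho> ^ n)"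
    by (intro summable_comparison_test[OF _ strong_series_norm[OF assms]])
       (auto intro!: exI[of _ 0] mult_left_le power_le_one simp: abs_mult)
qed

text \<open>The series of the derivative converges absolutely at radius \<open>r\<close>, which pays
  for the weight \<open>n + 1\<close> up to a shift of the index.\<close>

lemma strong_series_dilate:
  assumes "disc_series c" "0 \<le> r" "r < 1"
  shows "strong_series (\<lambda>n. c n * of_real r ^ n)"
proof -
  have "summable (\<lambda>n. norm (diffs c n * of_real r ^ n))"
    using disc_series_summable(1)[OF disc_series_diffs[OF assms(1)], of "of_real r"] assms by simp
  hence s: "summable (\<lambda>n. (real n + 1) * norm (c (Suc n)) * r ^ n)"
    using assms by (simp add: norm_mult norm_power norm_diffs)
  \<comment> \<open>The summand is doubled because \<open>n + 2 <= 2 * (n + 1)\<close>.\<close>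
  have "summable (\<lambda>n. r * ((real n + 1) * norm (c (Suc n)) * r ^ n) + r * ((real n + 1) * norm (c (Suc n)) * r ^ n))"
    by (intro summable_add summable_mult s)
  hence "summable (\<lambda>n. (real (Suc n) + 1) * norm (c (Suc n) * of_real r ^ Suc n))"
    by (rule summable_comparison_test[rotated])
       (use assms in \<open>auto intro!: exI[of _ 0] simp: norm_mult norm_power algebra_simps abs_mult\<close>)
  thus ?thesis unfolding strong_series_def by (subst summable_Suc_iff[symmetric])
qed

lemma strong_series_taylor_dilate:
  assumes "f holomorphic_on \<D>" "0 \<le> r" "r < 1"
  shows "strong_series (taylor (dilate r f))"
proof -
  have "taylor (dilate r f) = (\<lambda>n. taylor f n * of_real r ^ n)"
    by (rule ext) (use assms taylor_dilate in auto)
  thus ?thesis using strong_series_dilate[OF taylor_series(1)[OF assms(1)] assms(2,3)] by simp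
qed

lemma strong_series_tail:
  "strong_series c \<Longrightarrow> strong_series (\<lambda>n. if n < N then 0 else c n)"
  unfolding strong_series_def
  by (rule summable_comparison_test[rotated]) (auto intro!: exI[of _ 0])

lemma strong_series_finite:
  "finite {n. c n \<noteq> 0} \<Longrightarrow> strong_series c"
  unfolding strong_series_def by (rule summable_finite[of "{n. c n \<noteq> 0}"]) auto

lemma strong_sum_tail_tendsto:
  assumes "strong_series c"
  shows "(\<lambda>N. \<Sum>n. (real n + 1) * norm (if n < N then 0 else c n)) \<longlonglongrightarrow> 0"
proof -
  let ?f = "\<lambda>n. (real n + 1) * norm (c n)"
  have s: "summable ?f" using assms by (simp add: strong_series_def)
  have "(\<Sum>n. (real n + 1) * norm (if n < N then 0 else c n)) = suminf ?f - (\<Sum>n<N. ?f n)" for N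
  proof -
    let ?g = "\<lambda>n. (real n + 1) * norm (if n < N then 0 else c n)"
    have "summable ?g" using strong_series_tail[OF assms, of N] by (simp add: strong_series_def)
    hence "suminf ?g = (\<Sum>n. ?g (n + N)) + (\<Sum>n<N. ?g n)" by (rule suminf_split_initial_segment)
    also have "(\<Sum>n. ?g (n + N)) = (\<Sum>n. ?f (n + N))" by simp
    also have "\<dots> = suminf ?f - (\<Sum>n<N. ?f n)" by (rule suminf_minus_initial_segment[OF s])
    finally show ?thesis by simp
  qed
  moreover have "(\<lambda>N. suminf ?f - (\<Sum>n<N. ?f n)) \<longlonglongrightarrow> suminf ?f - suminf ?f"
    by (intro tendsto_intros summable_LIMSEQ s)
  ultimately show ?thesis by simp
qed

section \<open>Bloch functions\<close>

lemma one_minus_norm_sq: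
  assumes "z \<in> \<D>" shows "0 < 1 - (norm z)\<^sup>2" "1 - (norm z)\<^sup>2 \<le> 1"
  using assms by (auto simp: power_less_one_iff)

lemma Bloch_deriv:
  assumes "f \<in> Bloch" "z \<in> \<D>"
  shows "norm (deriv f z) * (1 - (norm z)\<^sup>2) \<le> Bloch_norm f - norm (f 0)"
  using cSUP_upper[OF assms(2), of "\<lambda>z. norm (deriv f z) * (1 - (norm z)\<^sup>2)"] assms(1)
  by (simp add: Bloch_def Bloch_norm_def)

lemma Bloch_norm_ge:
  assumes "f \<in> Bloch" shows "norm (f 0) \<le> Bloch_norm f" "0 \<le> Bloch_norm f"
proof -
  show "norm (f 0) \<le> Bloch_norm f"
  proof -
    have "norm (deriv f 0) \<le> Bloch_norm f - norm (f 0)" using Bloch_deriv[OF assms, of 0] by simp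
    thus ?thesis using norm_ge_zero[of "deriv f 0"] by linarith
  qed
  thus "0 \<le> Bloch_norm f" using norm_ge_zero[of "f 0"] by linarith
qed

lemma Bloch_deriv_le:
  assumes "f \<in> Bloch" "z \<in> \<D>"
  shows "norm (deriv f z) \<le> Bloch_norm f / (1 - norm z)"
proof -
  have "norm (deriv f z) * (1 - norm z) \<le> norm (deriv f z) * (1 - (norm z)\<^sup>2)"
    using assms power_le_one[of "norm z" 2] by (intro mult_left_mono) (auto simp: power2_eq_square mult_left_le)
  also have "\<dots> \<le> Bloch_norm f" using Bloch_deriv[OF assms] norm_ge_zero[of "f 0"] by linarith
  finally show ?thesis using assms by (simp add: field_simps)
qed

lemma BlochI:
  assumes "f holomorphic_on \<D>" "\<And>z. z \<in> \<D> \<Longrightarrow> norm (deriv f z) * (1 - (norm z)\<^sup>2) \<le> B"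
  shows "f \<in> Bloch" "Bloch_norm f \<le> B + norm (f 0)"
proof -
  show "f \<in> Bloch" using assms by (auto simp: Bloch_def bdd_above_def intro!: exI[of _ B])
  show "Bloch_norm f \<le> B + norm (f 0)"
    unfolding Bloch_norm_def by (intro add_right_mono cSUP_least) (use assms in auto)
qed

lemma Bloch_cong:
  assumes "\<And>z. z \<in> \<D> \<Longrightarrow> f z = g z"
  shows "f \<in> Bloch \<longleftrightarrow> g \<in> Bloch" "Bloch_norm f = Bloch_norm g"
proof -
  have d: "z \<in> \<D> \<Longrightarrow> deriv f z = deriv g z" for z using deriv_eq_on_disc assms by blast
  have "f holomorphic_on \<D> \<longleftrightarrow> g holomorphic_on \<D>" by (rule holomorphic_cong) (use assms in auto)
  moreover have im: "(\<lambda>z. norm (deriv f z) * (1 - (norm z)\<^sup>2)) ` \<D> = (\<lambda>z. norm (deriv g z) * (1 - (norm z)\<^sup>2)) ` \<D>"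
    by (rule image_cong) (use d in auto)
  ultimately show "f \<in> Bloch \<longleftrightarrow> g \<in> Bloch" by (simp add: Bloch_def)
  show "Bloch_norm f = Bloch_norm g" unfolding Bloch_norm_def im using assms[of 0] by simp
qed

text \<open>A Bloch function is Lipschitz for the hyperbolic metric. The bound stays useful up to
  the circle as long as \<open>t - s\<close> is at most a fixed multiple of \<open>1 - t\<close>;
  the radii in the construction of preimages are arranged that way.\<close>

lemma Bloch_ray:
  assumes f: "f \<in> Bloch" and u: "norm u = 1" and st: "0 \<le> s" "s \<le> t" "t < 1"
  shows "norm (f (of_real t * u) - f (of_real s * u)) \<le> Bloch_norm f * ((t - s) / (1 - t))"
proof -
  have h: "f holomorphic_on \<D>" using f by (simp add: Bloch_def)
  have "norm (f (of_real t * u) - f (of_real s * u)) \<le> Bloch_norm f / (1 - t) * norm (of_real t * u - of_real s * u)"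
  proof (rule field_differentiable_bound[of "cball 0 t" f "deriv f"])
    fix z :: complex assume "z \<in> cball 0 t"
    hence z: "z \<in> \<D>" "norm z \<le> t" using st by auto
    show "(f has_field_derivative deriv f z) (at z within cball 0 t)"
      by (rule has_field_derivative_at_within, rule holomorphic_derivI[OF h _ z(1)]) simp
    have "norm (deriv f z) \<le> Bloch_norm f / (1 - norm z)" by (rule Bloch_deriv_le[OF f z(1)])
    also have "\<dots> \<le> Bloch_norm f / (1 - t)"
      using Bloch_norm_ge[OF f] z st by (intro divide_left_mono) auto
    finally show "norm (deriv f z) \<le> Bloch_norm f / (1 - t)" .
  qed (use st u in \<open>auto simp: norm_mult\<close>)
  also have "of_real t * u - of_real s * u = of_real (t - s) * u" by (simp add: algebra_simps)
  also have "norm \<dots> = t - s" using st u by (simp add: norm_mult del: of_real_diff)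
  finally show ?thesis by (simp add: field_simps)
qed

section \<open>The little Bloch space and approximation by dilations\<close>

lemma eventually_norm_to_1:
  "(\<forall>\<^sub>F z in filtercomap norm (at_left 1). P (z::complex)) \<longleftrightarrow> (\<exists>b<1. \<forall>z. b < norm z \<and> norm z < 1 \<longrightarrow> P z)"
  (is "?L \<longleftrightarrow> ?R")
proof
  assume ?L
  then obtain Q where Q: "eventually Q (at_left (1::real))" "\<And>z. Q (norm z) \<Longrightarrow> P z"
    unfolding eventually_filtercomap by blast
  from Q(1) obtain b where "b < 1" "\<And>y. b < y \<Longrightarrow> y < 1 \<Longrightarrow> Q y"
    unfolding eventually_at_left_field by blast
  hence "\<forall>z. b < norm z \<and> norm z < 1 \<longrightarrow> P z" using Q(2) by (simp del: split_paired_All)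
  thus ?R using \<open>b < 1\<close> by (intro exI[of _ b] conjI)
next
  assume ?R
  then obtain b where b: "b < 1" "\<And>z. b < norm z \<Longrightarrow> norm z < 1 \<Longrightarrow> P z" by blast
  have "eventually (\<lambda>y. b < y \<and> y < 1) (at_left (1::real))"
    unfolding eventually_at_left_field using b(1) by blast
  moreover have "\<forall>z. b < norm z \<and> norm z < 1 \<longrightarrow> P z" using b(2) by simp
  ultimately show ?L unfolding eventually_filtercomap by (intro exI[of _ "\<lambda>y. b < y \<and> y < 1"] conjI)
qed

lemma little_Bloch_iff:
  "f \<in> little_Bloch \<longleftrightarrow> f holomorphic_on \<D> \<and>
     (\<forall>e>0. \<exists>d\<in>{0..<1}. \<forall>z. d < norm z \<and> norm z < 1 \<longrightarrow> norm (deriv f z) * (1 - (norm z)\<^sup>2) < e)"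
proof -
  have "((\<lambda>z. deriv f z * of_real (1 - (norm z)\<^sup>2)) \<longlongrightarrow> 0) (filtercomap norm (at_left 1)) \<longleftrightarrow>
     (\<forall>e>0. \<exists>d\<in>{0..<1}. \<forall>z. d < norm z \<and> norm z < 1 \<longrightarrow> norm (deriv f z) * (1 - (norm z)\<^sup>2) < e)"
    (is "?L \<longleftrightarrow> ?R")
  proof -
    have nm: "norm (deriv f z * complex_of_real (1 - (norm z)\<^sup>2)) = norm (deriv f z) * (1 - (norm z)\<^sup>2)" if "norm z < 1" for z
    proof -
      have "0 < 1 - (norm z)\<^sup>2" using that by (intro one_minus_norm_sq) simp
      thus ?thesis by (simp add: norm_mult del: of_real_diff)
    qed
    show ?thesis
    proof
      assume L: ?L
      show ?R
      proof (intro allI impI)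
        fix e :: real assume "e > 0"
        from tendstoD[OF L this] obtain b where b: "b < 1"
          "\<And>z. b < norm z \<Longrightarrow> norm z < 1 \<Longrightarrow> norm (deriv f z * complex_of_real (1 - (norm z)\<^sup>2)) < e"
          unfolding eventually_norm_to_1 dist_norm diff_0_right by blast
        have "norm (deriv f z) * (1 - (norm z)\<^sup>2) < e" if "max 0 b < norm z" "norm z < 1" for z
          using b(2)[of z] nm[of z] that by simp
        thus "\<exists>d\<in>{0..<1}. \<forall>z. d < norm z \<and> norm z < 1 \<longrightarrow> norm (deriv f z) * (1 - (norm z)\<^sup>2) < e"
          using b(1) by (intro bexI[of _ "max 0 b"]) auto
      qed
    next
      assume R: ?R
      show ?L
      proof (rule tendstoI)
        fix e :: real assume "e > 0"
        then obtain d where d: "d \<in> {0..<1}" "\<And>z. d < norm z \<Longrightarrow> norm z < 1 \<Longrightarrow> norm (deriv f z) * (1 - (norm z)\<^sup>2) < e"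
          using R by blast
        have "norm (deriv f z * complex_of_real (1 - (norm z)\<^sup>2)) < e" if "d < norm z" "norm z < 1" for z
          using d(2)[OF that] nm[OF that(2)] by simp
        thus "\<forall>\<^sub>F z in filtercomap norm (at_left 1). dist (deriv f z * of_real (1 - (norm z)\<^sup>2)) 0 < e"
          unfolding eventually_norm_to_1 dist_norm diff_0_right using d(1) by (intro exI[of _ d]) auto
      qed
    qed
  qed
  thus ?thesis by (simp add: little_Bloch_def)
qed

lemma compact_deriv_bound:
  assumes "f holomorphic_on \<D>" "d < 1"
  obtains B where "B > 0" "\<And>z. norm z \<le> d \<Longrightarrow> norm (deriv f z) \<le> B"
proof -
  have "continuous_on (cball 0 d) (deriv f)"
    using assms by (intro holomorphic_on_imp_continuous_on holomorphic_on_subset[OF holomorphic_deriv[OF assms(1)]]) auto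
  hence "compact (deriv f ` cball 0 d)" by (intro compact_continuous_image) auto
  hence "bounded (deriv f ` cball 0 d)" by (rule compact_imp_bounded)
  then obtain B where "B > 0" "\<forall>x\<in>deriv f ` cball 0 d. norm x \<le> B" by (auto simp: bounded_pos)
  thus thesis using that by auto
qed

lemma little_Bloch_subset: "f \<in> little_Bloch \<Longrightarrow> f \<in> Bloch"
proof -
  assume f: "f \<in> little_Bloch"
  hence h: "f holomorphic_on \<D>" by (simp add: little_Bloch_iff)
  obtain d where d: "d \<in> {0..<1}" "\<And>z. d < norm z \<Longrightarrow> norm z < 1 \<Longrightarrow> norm (deriv f z) * (1 - (norm z)\<^sup>2) < 1"
    using f unfolding little_Bloch_iff using zero_less_one by metis
  obtain B where B: "B > 0" "\<And>z. norm z \<le> d \<Longrightarrow> norm (deriv f z) \<le> B"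
    using compact_deriv_bound[OF h, of d] d by auto
  show "f \<in> Bloch"
  proof (rule BlochI[OF h])
    fix z assume z: "z \<in> \<D>"
    show "norm (deriv f z) * (1 - (norm z)\<^sup>2) \<le> max 1 B"
    proof (cases "d < norm z")
      case False
      have "norm (deriv f z) * (1 - (norm z)\<^sup>2) \<le> B * 1"
        using one_minus_norm_sq[OF z] False B by (intro mult_mono) auto
      thus ?thesis by simp
    qed (use d(2)[of z] z in auto)
  qed
qed

lemma little_BlochI_bounded_deriv:
  assumes "f holomorphic_on \<D>" "\<And>z. z \<in> \<D> \<Longrightarrow> norm (deriv f z) \<le> B"
  shows "f \<in> little_Bloch"
  unfolding little_Bloch_iff
proof (intro conjI allI impI assms(1))
  fix e :: real assume e: "e > 0"
  define B' where "B' = max 1 B"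
  have B': "B' > 0" "B \<le> B'" by (auto simp: B'_def)
  \<comment> \<open>Chosen so that \<open>2 * (1 - norm z) < e / B'\<close> beyond radius
    \<open>d\<close>; the left side dominates \<open>1 - (norm z)^2\<close>.\<close>
  define d where "d = max 0 (1 - e / (2 * B'))"
  have d: "d \<in> {0..<1}" using e B' by (auto simp: d_def)
  show "\<exists>d\<in>{0..<1}. \<forall>z. d < norm z \<and> norm z < 1 \<longrightarrow> norm (deriv f z) * (1 - (norm z)\<^sup>2) < e"
  proof (intro bexI[OF _ d] allI impI)
    fix z :: complex assume z: "d < norm z \<and> norm z < 1"
    have "1 - (norm z)\<^sup>2 = (1 - norm z) * (1 + norm z)" by (simp add: power2_eq_square algebra_simps)
    also have "\<dots> \<le> (1 - norm z) * 2" using z by (intro mult_left_mono) auto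
    also have "\<dots> < e / B'" using z B' by (simp add: d_def field_simps)
    finally have "1 - (norm z)\<^sup>2 < e / B'" .
    have "norm (deriv f z) * (1 - (norm z)\<^sup>2) \<le> B' * (1 - (norm z)\<^sup>2)"
      using assms(2)[of z] z B' one_minus_norm_sq[of z] by (intro mult_right_mono) auto
    also have "\<dots> < B' * (e / B')" using \<open>1 - (norm z)\<^sup>2 < e / B'\<close> B' by (intro mult_strict_left_mono) auto
    finally show "norm (deriv f z) * (1 - (norm z)\<^sup>2) < e" using B' by simp
  qed
qed

lemma little_Bloch_diff:
  assumes "f \<in> little_Bloch" "g \<in> little_Bloch"
  shows "(\<lambda>z. f z - g z) \<in> little_Bloch"
  unfolding little_Bloch_iff
proof (intro conjI allI impI)
  have h: "f holomorphic_on \<D>" "g holomorphic_on \<D>" using assms by (auto simp: little_Bloch_iff)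
  show "(\<lambda>z. f z - g z) holomorphic_on \<D>" using h by (intro holomorphic_intros)
  fix e :: real assume e: "e > 0"
  from e have e2: "e / 2 > 0" by simp
  obtain d where d: "d \<in> {0..<1}" "\<And>z. d < norm z \<Longrightarrow> norm z < 1 \<Longrightarrow> norm (deriv f z) * (1 - (norm z)\<^sup>2) < e / 2"
    using assms(1) e2 unfolding little_Bloch_iff by metis
  obtain d' where d': "d' \<in> {0..<1}" "\<And>z. d' < norm z \<Longrightarrow> norm z < 1 \<Longrightarrow> norm (deriv g z) * (1 - (norm z)\<^sup>2) < e / 2"
    using assms(2) e2 unfolding little_Bloch_iff by metis
  show "\<exists>d\<in>{0..<1}. \<forall>z. d < norm z \<and> norm z < 1 \<longrightarrow> norm (deriv (\<lambda>z. f z - g z) z) * (1 - (norm z)\<^sup>2) < e"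
  proof (intro bexI[of _ "max d d'"] allI impI)
    fix z :: complex assume z: "max d d' < norm z \<and> norm z < 1"
    have "deriv (\<lambda>z. f z - g z) z = deriv f z - deriv g z"
      using h z by (intro deriv_diff) (auto intro!: holomorphic_on_imp_differentiable_at[of _ \<D>])
    hence "norm (deriv (\<lambda>z. f z - g z) z) * (1 - (norm z)\<^sup>2) \<le> (norm (deriv f z) + norm (deriv g z)) * (1 - (norm z)\<^sup>2)"
      using one_minus_norm_sq[of z] z by (intro mult_right_mono) (auto intro: norm_triangle_ineq4)
    also have "\<dots> < e / 2 + e / 2" using d(2)[of z] d'(2)[of z] z by (auto simp: distrib_right)
    finally show "norm (deriv (\<lambda>z. f z - g z) z) * (1 - (norm z)\<^sup>2) < e" by simp
  qed (use d d' in auto)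
qed

lemma strong_series_little_Bloch:
  assumes "strong_series c"
  shows "psum c \<in> little_Bloch" "Bloch_norm (psum c) \<le> (\<Sum>n. (real n + 1) * norm (c n))"
proof -
  note dc = strong_series_disc[OF assms]
  have S: "summable (\<lambda>n. (real n + 1) * norm (c n))" using assms by (simp add: strong_series_def)
  have S0: "summable (\<lambda>n. (real (Suc n) + 1) * norm (c (Suc n)))"
    using S by (subst summable_Suc_iff)
  have S': "summable (\<lambda>n. (real n + 1) * norm (c (Suc n)))"
    by (rule summable_comparison_test[OF _ S0]) (auto intro!: exI[of _ 0] mult_right_mono)
  define B where "B = (\<Sum>n. (real n + 1) * norm (c (Suc n)))"
  have bd: "norm (deriv (psum c) z) \<le> B" if z: "z \<in> \<D>" for z
  proof -
    have "norm (psum (diffs c) z) \<le> (\<Sum>n. norm (diffs c n * z ^ n))"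
      unfolding psum_def by (rule summable_norm) (rule disc_series_summable(1)[OF disc_series_diffs[OF dc] z])
    also have "\<dots> \<le> B" unfolding B_def
    proof (rule suminf_le)
      fix n
      have "norm (z ^ n) \<le> 1" using z by (simp add: norm_power power_le_one)
      hence "norm (diffs c n) * norm (z ^ n) \<le> norm (diffs c n) * 1" by (intro mult_left_mono) auto
      thus "norm (diffs c n * z ^ n) \<le> (real n + 1) * norm (c (Suc n))"
        by (simp add: norm_mult norm_diffs)
    qed (use S' disc_series_summable(1)[OF disc_series_diffs[OF dc] z] in auto)
    finally show ?thesis using z dc by (simp add: deriv_psum)
  qed
  show "psum c \<in> little_Bloch"
    using psum_holomorphic[OF dc] bd by (rule little_BlochI_bounded_deriv)
  have "Bloch_norm (psum c) \<le> B + norm (psum c 0)"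
  proof (rule BlochI(2)[OF psum_holomorphic[OF dc]])
    fix z assume z: "z \<in> \<D>"
    have "norm (deriv (psum c) z) * (1 - (norm z)\<^sup>2) \<le> B * 1"
      using bd[OF z] one_minus_norm_sq[OF z] order_trans[OF norm_ge_zero bd[OF z]] by (intro mult_mono) auto
    thus "norm (deriv (psum c) z) * (1 - (norm z)\<^sup>2) \<le> B" by simp
  qed
  also have "B \<le> (\<Sum>n. (real (Suc n) + 1) * norm (c (Suc n)))"
    unfolding B_def by (rule suminf_le[OF _ S' S0]) (auto intro!: mult_right_mono)
  also have "\<dots> + norm (psum c 0) = (\<Sum>n. (real n + 1) * norm (c n))"
    using suminf_split_head[OF S] by (simp add: psum_zero)
  finally show "Bloch_norm (psum c) \<le> (\<Sum>n. (real n + 1) * norm (c n))" by simp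
qed

lemma Bloch_dilate:
  assumes f: "f \<in> Bloch" and r: "0 \<le> r" "r \<le> 1"
  shows "dilate r f \<in> Bloch" "Bloch_norm (dilate r f) \<le> Bloch_norm f"
proof -
  have h: "f holomorphic_on \<D>" using f by (simp add: Bloch_def)
  have b: "norm (deriv (dilate r f) z) * (1 - (norm z)\<^sup>2) \<le> Bloch_norm f - norm (f 0)" if z: "z \<in> \<D>" for z
  proof -
    have rz: "of_real r * z \<in> \<D>" by (rule dilate_in_disc[OF r z])
    have "norm (deriv (dilate r f) z) * (1 - (norm z)\<^sup>2) = r * (norm (deriv f (of_real r * z)) * (1 - (norm z)\<^sup>2))"
      using r by (simp add: deriv_dilate[OF h r z] norm_mult)
    also have "\<dots> \<le> 1 * (norm (deriv f (of_real r * z)) * (1 - (norm (of_real r * z))\<^sup>2))"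
    proof (rule mult_mono)
      have "norm (of_real r * z) \<le> norm z" using r by (simp add: norm_mult mult_left_le_one_le)
      hence "(norm (of_real r * z))\<^sup>2 \<le> (norm z)\<^sup>2" by (rule power_mono) simp
      thus "norm (deriv f (of_real r * z)) * (1 - (norm z)\<^sup>2) \<le> norm (deriv f (of_real r * z)) * (1 - (norm (of_real r * z))\<^sup>2)"
        by (intro mult_left_mono) auto
      show "0 \<le> norm (deriv f (of_real r * z)) * (1 - (norm z)\<^sup>2)"
        using one_minus_norm_sq[OF z] by auto
    qed (use r in auto)
    also have "\<dots> \<le> Bloch_norm f - norm (f 0)" using Bloch_deriv[OF f rz] by simp
    finally show ?thesis .
  qed
  show "dilate r f \<in> Bloch" by (rule BlochI[OF dilate_holomorphic[OF h r] b])
  show "Bloch_norm (dilate r f) \<le> Bloch_norm f"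
    using BlochI(2)[OF dilate_holomorphic[OF h r] b] by (simp add: dilate_def)
qed

lemma dilate_little_Bloch:
  assumes "f holomorphic_on \<D>" "0 \<le> r" "r < 1"
  shows "dilate r f \<in> little_Bloch"
proof -
  obtain B where B: "B > 0" "\<And>z. norm z \<le> r \<Longrightarrow> norm (deriv f z) \<le> B"
    by (rule compact_deriv_bound[OF assms(1,3)]) blast
  show ?thesis
  proof (rule little_BlochI_bounded_deriv)
    fix z assume z: "z \<in> \<D>"
    have "norm (of_real r * z) \<le> r" using assms z by (simp add: norm_mult mult_left_le)
    hence "norm (deriv f (of_real r * z)) \<le> B" by (rule B(2))
    hence "r * norm (deriv f (of_real r * z)) \<le> 1 * B" using assms by (intro mult_mono) auto
    hence "norm (deriv (dilate r f) z) \<le> 1 * B"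
      using assms z by (subst deriv_dilate) (auto simp: norm_mult)
    thus "norm (deriv (dilate r f) z) \<le> B" by simp
  qed (use assms dilate_holomorphic in auto)
qed

text \<open>Away from the circle uniform continuity of the derivative makes the difference small;
  near the circle both derivatives are small separately, by the decay that defines the
  space.\<close>

lemma little_Bloch_dilate_tendsto:
  assumes f: "f \<in> little_Bloch" and e: "e > 0"
  shows "\<forall>\<^sub>F r in at_left 1. Bloch_norm (\<lambda>z. dilate r f z - f z) \<le> e"
proof -
  have h: "f holomorphic_on \<D>" using f by (simp add: little_Bloch_iff)
  from e have e2: "e / 2 > 0" by simp
  obtain d where d: "d \<in> {0..<1}" "\<And>z. d < norm z \<Longrightarrow> norm z < 1 \<Longrightarrow> norm (deriv f z) * (1 - (norm z)\<^sup>2) < e / 2"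
    using f e2 unfolding little_Bloch_iff by metis
  define \<rho> where "\<rho> = (1 + d) / 2"
  have \<rho>: "0 < \<rho>" "\<rho> < 1" "d < \<rho>" using d by (auto simp: \<rho>_def)
  obtain B where B: "B > 0" "\<And>z. norm z \<le> \<rho> \<Longrightarrow> norm (deriv f z) \<le> B"
    by (rule compact_deriv_bound[OF h \<rho>(2)]) blast
  have "uniformly_continuous_on (cball 0 \<rho>) (deriv f)"
    using \<rho> by (intro compact_uniformly_continuous holomorphic_on_imp_continuous_on
       holomorphic_on_subset[OF holomorphic_deriv[OF h]]) auto
  then obtain \<delta> where \<delta>: "\<delta> > 0" "\<And>x y. x \<in> cball 0 \<rho> \<Longrightarrow> y \<in> cball 0 \<rho> \<Longrightarrow> dist y x < \<delta> \<Longrightarrow> dist (deriv f y) (deriv f x) < e / 2"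
    using e2 unfolding uniformly_continuous_on_def by metis
  \<comment> \<open>The entry \<open>d / \<rho>\<close> keeps the dilated point beyond radius
    \<open>d\<close> when \<open>z\<close> is beyond \<rho>; \<open>1 - \<delta>\<close> serves
    uniform continuity; the last entry controls the factor \<open>r\<close> in front of the
    derivative.\<close>
  define r0 where "r0 = Max {0, d / \<rho>, 1 - \<delta>, 1 - e / (2 * B)}"
  have r0: "r0 < 1" "0 \<le> r0" "d / \<rho> \<le> r0" "1 - \<delta> \<le> r0" "1 - e / (2 * B) \<le> r0"
    using \<rho> \<delta> B e by (auto simp: r0_def)
  have "Bloch_norm (\<lambda>z. dilate r f z - f z) \<le> e" if r: "r0 < r" "r < 1" for r
  proof -
    have r': "0 \<le> r" "r \<le> 1" using r r0 by auto
    have "of_real r - 1 = (of_real (r - 1) :: complex)" by simp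
    hence n1r: "norm (of_real r - 1 :: complex) = 1 - r" using r by (simp only: norm_of_real)
    have hd: "(\<lambda>z. dilate r f z - f z) holomorphic_on \<D>"
      using dilate_holomorphic[OF h r'] h by (intro holomorphic_intros)
    have "Bloch_norm (\<lambda>z. dilate r f z - f z) \<le> e + norm (dilate r f 0 - f 0)"
    proof (rule BlochI(2)[OF hd])
      fix z assume z: "z \<in> \<D>"
      have rz: "of_real r * z \<in> \<D>" by (rule dilate_in_disc[OF r' z])
      have "deriv (\<lambda>z. dilate r f z - f z) z = deriv (dilate r f) z - deriv f z"
        using h dilate_holomorphic[OF h r'] z by (intro deriv_diff) (auto intro!: holomorphic_on_imp_differentiable_at[of _ \<D>])
      hence dd: "deriv (\<lambda>z. dilate r f z - f z) z = of_real r * deriv f (of_real r * z) - deriv f z"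
        using deriv_dilate[OF h r' z] by simp
      show "norm (deriv (\<lambda>z. dilate r f z - f z) z) * (1 - (norm z)\<^sup>2) \<le> e"
      proof (cases "norm z \<le> \<rho>")
        case True
        have nrz: "norm (of_real r * z) \<le> \<rho>" using True r' mult_left_le_one_le[of "norm z" r] by (simp add: norm_mult)
        have "dist (of_real r * z) z = norm ((1 - of_real r) * z)" by (simp add: dist_norm norm_minus_commute algebra_simps)
        also have "\<dots> = (1 - r) * norm z" using n1r by (simp only: norm_mult norm_minus_commute)
        also have "\<dots> \<le> 1 - r" using z r by (intro mult_left_le) auto
        also have "\<dots> < \<delta>" using r r0 by simp
        finally have n1: "norm (deriv f (of_real r * z) - deriv f z) < e / 2"
          using \<delta>(2)[of z "of_real r * z"] True nrz by (simp add: dist_norm)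
        have n2: "norm ((of_real r - 1) * deriv f (of_real r * z)) \<le> e / 2"
        proof -
          have "norm ((of_real r - 1) * deriv f (of_real r * z)) \<le> (1 - r) * B"
            using B(2)[OF nrz] r n1r unfolding norm_mult by (intro mult_mono) auto
          also have "\<dots> \<le> e / (2 * B) * B" using r r0 B by (intro mult_right_mono) auto
          finally show ?thesis using B by simp
        qed
        have eq: "of_real r * deriv f (of_real r * z) - deriv f z =
            (deriv f (of_real r * z) - deriv f z) + (of_real r - 1) * deriv f (of_real r * z)" by (simp add: algebra_simps)
        have "norm (deriv (\<lambda>z. dilate r f z - f z) z) \<le> e"
          unfolding dd eq using n1 n2 norm_triangle_ineq[of "deriv f (of_real r * z) - deriv f z" "(of_real r - 1) * deriv f (of_real r * z)"] by linarith
        hence "norm (deriv (\<lambda>z. dilate r f z - f z) z) * (1 - (norm z)\<^sup>2) \<le> e * 1"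
          using one_minus_norm_sq[OF z] e by (intro mult_mono) auto
        thus ?thesis by simp
      next
        case False
        have "d \<le> r0 * \<rho>" using r0 \<rho> by (simp add: field_simps)
        also have "\<dots> < r * norm z" using False r r0 \<rho> by (intro mult_strict_mono') auto
        finally have drz: "d < norm (of_real r * z)" using r' by (simp add: norm_mult)
        have "norm (of_real r * z) \<le> norm z" using r' by (simp add: norm_mult mult_left_le_one_le)
        hence sq: "(norm (of_real r * z))\<^sup>2 \<le> (norm z)\<^sup>2" by (rule power_mono) simp
        have "norm (deriv (\<lambda>z. dilate r f z - f z) z) * (1 - (norm z)\<^sup>2) \<le> (norm (of_real r * deriv f (of_real r * z)) + norm (deriv f z)) * (1 - (norm z)\<^sup>2)"
          unfolding dd using one_minus_norm_sq[OF z] by (intro mult_right_mono norm_triangle_ineq4) auto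
        also have "\<dots> \<le> 1 * norm (deriv f (of_real r * z)) * (1 - (norm (of_real r * z))\<^sup>2) + norm (deriv f z) * (1 - (norm z)\<^sup>2)"
          unfolding distrib_right norm_mult norm_of_real
          using sq r' one_minus_norm_sq[OF z] by (intro add_right_mono mult_mono) (auto simp: norm_mult)
        also have "\<dots> \<le> e / 2 + e / 2"
          using d(2)[OF drz] d(2)[of z] rz False \<rho> z by (intro add_mono) auto
        finally show ?thesis by simp
      qed
    qed
    thus ?thesis by (simp add: dilate_def)
  qed
  thus ?thesis unfolding eventually_at_left_field using r0 by blast
qed

section \<open>The kernel and its derivative\<close>

lemma power_two_between:
  assumes "x \<ge> (1::real)" obtains n where "x \<le> 2 ^ n" "2 ^ n \<le> 2 * x"
proof -
  define n where "n = (LEAST n. x \<le> 2 ^ n)"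
  have ex: "\<exists>n. x \<le> 2 ^ n" using real_arch_pow[of 2 x] by (auto intro: less_imp_le)
  have n: "x \<le> 2 ^ n" unfolding n_def by (rule LeastI_ex[OF ex])
  have "2 ^ n \<le> 2 * x"
  proof (cases n)
    case 0
    thus ?thesis using assms by simp
  next
    case (Suc m)
    hence "\<not> x \<le> 2 ^ m" using not_less_Least[of m "\<lambda>n. x \<le> 2 ^ n"] by (simp add: n_def)
    thus ?thesis using Suc by simp
  qed
  thus thesis using n that by blast
qed

context weighted_disc
begin

definition kernel_coeff :: "nat \<Rightarrow> real"
  where "kernel_coeff n = 1 / (2 * moment \<omega> (2 * real n + 1))"

lemma kernel_coeff_pos: "kernel_coeff n > 0"
  using moment_pos[of "2 * real n + 1"] by (simp add: kernel_coeff_def)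

text \<open>The moments decay more slowly than any geometric sequence, since
  \<open>moment_ge_tail\<close> applies at radii arbitrarily close to 1, where the tail is still
  positive.\<close>

lemma kernel_coeff_summable:
  assumes "0 \<le> \<rho>" "\<rho> < 1"
  shows "summable (\<lambda>n. kernel_coeff n * \<rho> ^ n)"
proof -
  define s where "s = (1 + \<rho>) / 2"
  have s: "0 < s" "s < 1" "\<rho> < s" using assms by (auto simp: s_def)
  \<comment> \<open>The root compensates the factor 2 in the order: \<open>t ^ (2 * n + 1)\<close>
    equals \<open>t * s ^ n\<close>.\<close>
  define t where "t = sqrt s"
  have t: "0 < t" "t < 1" "t * t = s" using s by (auto simp: t_def)
  define A where "A = 1 / (2 * t * tail \<omega> t)"
  have tp: "tail \<omega> t > 0" using t by (intro tail_pos) auto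
  have "kernel_coeff n * \<rho> ^ n \<le> A * (\<rho> / s) ^ n" for n
  proof -
    have "t powr (2 * real n + 1) = t * s ^ n"
    proof -
      have "t powr (2 * real n + 1) = t powr real (2 * n + 1)" by (simp add: add.commute)
      also have "\<dots> = t ^ (2 * n + 1)" using t by (simp only: powr_realpow)
      also have "\<dots> = t * s ^ n" using t(3) by (simp add: power_mult power2_eq_square)
      finally show ?thesis .
    qed
    hence m: "t * s ^ n * tail \<omega> t \<le> moment \<omega> (2 * real n + 1)"
      using moment_ge_tail[of t "2 * real n + 1"] t by simp
    have "kernel_coeff n \<le> 1 / (2 * (t * s ^ n * tail \<omega> t))"
      unfolding kernel_coeff_def using m t s tp by (intro divide_left_mono) (auto intro!: mult_pos_pos moment_pos)
    also have "\<dots> = A * (1 / s ^ n)" by (simp add: A_def)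
    finally have "kernel_coeff n * \<rho> ^ n \<le> A * (1 / s ^ n) * \<rho> ^ n" using assms by (intro mult_right_mono) auto
    thus ?thesis by (simp add: power_divide)
  qed
  hence le: "norm (kernel_coeff n * \<rho> ^ n) \<le> A * (\<rho> / s) ^ n" for n
    using kernel_coeff_pos[of n] assms by (simp add: abs_mult)
  have S: "summable (\<lambda>n. A * (\<rho> / s) ^ n)"
    using s assms by (intro summable_mult summable_geometric) auto
  show ?thesis by (rule summable_comparison_test[OF _ S], rule exI, rule allI, rule impI, rule le)
qed

abbreviation "kernel_coeffs \<equiv> \<lambda>n. complex_of_real (kernel_coeff n)"

lemma kernel_coeffs_series: "disc_series kernel_coeffs"
  using kernel_coeff_summable kernel_coeff_pos by (auto simp: disc_series_def less_imp_le)

lemma Bergman_kernel_eq: "Bergman_kernel \<omega> z \<zeta> = psum kernel_coeffs (cnj z * \<zeta>)"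
  unfolding Bergman_kernel_def psum_def kernel_coeff_def by (simp add: field_simps)

section \<open>Termwise integration and Parseval's identity\<close>

lemma integral_psum_cnj:
  assumes f: "integrable \<nu> f" and c: "summable (\<lambda>n. norm (c n))"
  shows "integrable \<nu> (\<lambda>\<zeta>. f \<zeta> * psum c (cnj \<zeta>))"
    and "(\<lambda>n. c n * (LINT \<zeta>|\<nu>. f \<zeta> * cnj \<zeta> ^ n)) sums (LINT \<zeta>|\<nu>. f \<zeta> * psum c (cnj \<zeta>))"
proof -
  have [measurable]: "f \<in> borel_measurable \<nu>" using f by simp
  have cm: "(\<lambda>\<zeta>. cnj \<zeta> ^ n) \<in> borel_measurable \<nu>" for n
    by (intro measurable_nu_continuous continuous_intros)
  note cm[measurable]
  have pw: "norm (f \<zeta> * (c n * cnj \<zeta> ^ n)) \<le> norm (c n) * norm (f \<zeta>)" if "\<zeta> \<in> \<D>" for \<zeta> n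
  proof -
    have "norm \<zeta> ^ n \<le> 1" using that by (intro power_le_one) auto
    hence "norm (f \<zeta>) * norm (c n) * norm \<zeta> ^ n \<le> norm (f \<zeta>) * norm (c n) * 1"
      by (intro mult_left_mono) auto
    thus ?thesis by (simp add: norm_mult norm_power mult_ac)
  qed
  have int: "integrable \<nu> (\<lambda>\<zeta>. f \<zeta> * (c n * cnj \<zeta> ^ n))" for n
    by (rule Bochner_Integration.integrable_bound[OF integrable_mult_right[OF integrable_norm[OF f], of "norm (c n)"]])
       (use pw in \<open>auto intro!: AE_I2\<close>)
  have summ: "summable (\<lambda>n. norm (f \<zeta> * (c n * cnj \<zeta> ^ n)))" if "\<zeta> \<in> \<D>" for \<zeta>
    by (rule summable_comparison_test[OF _ summable_mult2[OF c, of "norm (f \<zeta>)"]]) (use pw[OF that] in auto)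
  have sumi: "summable (\<lambda>n. LINT \<zeta>|\<nu>. norm (f \<zeta> * (c n * cnj \<zeta> ^ n)))"
  proof (rule summable_comparison_test[OF _ summable_mult2[OF c, of "LINT \<zeta>|\<nu>. norm (f \<zeta>)"]], intro exI[of _ 0] allI impI)
    fix n
    have "(LINT \<zeta>|\<nu>. norm (f \<zeta> * (c n * cnj \<zeta> ^ n))) \<le> (LINT \<zeta>|\<nu>. norm (c n) * norm (f \<zeta>))"
      using int pw by (intro integral_mono integrable_norm integrable_mult_right f) auto
    thus "norm (LINT \<zeta>|\<nu>. norm (f \<zeta> * (c n * cnj \<zeta> ^ n))) \<le> norm (c n) * (LINT \<zeta>|\<nu>. norm (f \<zeta>))"
      by simp
  qed
  have eq: "(\<Sum>n. f \<zeta> * (c n * cnj \<zeta> ^ n)) = f \<zeta> * psum c (cnj \<zeta>)" if "\<zeta> \<in> \<D>" for \<zeta>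
  proof -
    have "summable (\<lambda>n. c n * cnj \<zeta> ^ n)"
    proof (rule summable_norm_cancel, rule summable_comparison_test[OF _ c], intro exI[of _ 0] allI impI)
      fix n
      have "norm (c n) * norm \<zeta> ^ n \<le> norm (c n) * 1" using that by (intro mult_left_mono power_le_one) auto
      thus "norm (norm (c n * cnj \<zeta> ^ n)) \<le> norm (c n)" by (simp add: norm_mult norm_power)
    qed
    thus ?thesis unfolding psum_def by (rule suminf_mult)
  qed
  have "integrable \<nu> (\<lambda>\<zeta>. \<Sum>n. f \<zeta> * (c n * cnj \<zeta> ^ n))"
    by (rule integrable_suminf[OF int]) (use summ sumi in \<open>auto intro!: AE_I2\<close>)
  moreover have "integrable \<nu> (\<lambda>\<zeta>. \<Sum>n. f \<zeta> * (c n * cnj \<zeta> ^ n)) = integrable \<nu> (\<lambda>\<zeta>. f \<zeta> * psum c (cnj \<zeta>))"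
    by (rule Bochner_Integration.integrable_cong) (use eq in auto)
  ultimately show "integrable \<nu> (\<lambda>\<zeta>. f \<zeta> * psum c (cnj \<zeta>))" by simp
  have "(\<lambda>n. LINT \<zeta>|\<nu>. f \<zeta> * (c n * cnj \<zeta> ^ n)) sums (LINT \<zeta>|\<nu>. (\<Sum>n. f \<zeta> * (c n * cnj \<zeta> ^ n)))"
    by (rule sums_integral[OF int]) (use summ sumi in \<open>auto intro!: AE_I2\<close>)
  moreover have "(LINT \<zeta>|\<nu>. f \<zeta> * (c n * cnj \<zeta> ^ n)) = c n * (LINT \<zeta>|\<nu>. f \<zeta> * cnj \<zeta> ^ n)" for n
    by (subst integral_mult_right_zero[symmetric]) (simp add: mult_ac)
  moreover have "(LINT \<zeta>|\<nu>. (\<Sum>n. f \<zeta> * (c n * cnj \<zeta> ^ n))) = (LINT \<zeta>|\<nu>. f \<zeta> * psum c (cnj \<zeta>))"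
    by (rule Bochner_Integration.integral_cong) (use eq in auto)
  ultimately show "(\<lambda>n. c n * (LINT \<zeta>|\<nu>. f \<zeta> * cnj \<zeta> ^ n)) sums (LINT \<zeta>|\<nu>. f \<zeta> * psum c (cnj \<zeta>))"
    by simp
qed

lemma psum_scale: "psum (\<lambda>n. c n * z ^ n) w = psum c (z * w)"
  by (simp add: psum_def power_mult_distrib mult.assoc)

lemma bounded_radial_integrable:
  fixes h :: "real \<Rightarrow> real"
  assumes [measurable]: "h \<in> borel_measurable borel" and "\<And>r. r \<in> {0..<1} \<Longrightarrow> \<bar>h r\<bar> \<le> H"
  shows "integrable \<nu> (\<lambda>z. h (norm z))"
  by (rule disc.integrable_const_bound[of _ H]) (use assms(2) in \<open>auto intro!: AE_I2\<close>)

text \<open>The radial weight is absorbed into the coefficients, which yields a series to which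
  \<open>coefficient_integral\<close> applies; integrating it against the conjugate series gives the
  identity. Summability of \<open>norm (c n)\<close> justifies both exchanges of sum and
  integral.\<close>

lemma parseval:
  fixes h :: "real \<Rightarrow> real"
  assumes c: "summable (\<lambda>n. norm (c n))"
    and h[measurable]: "h \<in> borel_measurable borel" and H: "\<And>r. r \<in> {0..<1} \<Longrightarrow> 0 \<le> h r \<and> h r \<le> H"
  shows "integrable \<nu> (\<lambda>\<zeta>. (norm (psum c \<zeta>))\<^sup>2 * h (norm \<zeta>))"
    and "(\<lambda>n. (norm (c n))\<^sup>2 * (LINT \<zeta>|\<nu>. norm \<zeta> ^ (2 * n) * h (norm \<zeta>))) sums
      (LINT \<zeta>|\<nu>. (norm (psum c \<zeta>))\<^sup>2 * h (norm \<zeta>))"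
proof -
  define F where "F \<zeta> = (\<Sum>m. (c m * of_real (h (norm \<zeta>))) * \<zeta> ^ m)" for \<zeta>
  define c' where "c' n = cnj (c n)" for n
  have H0: "H \<ge> 0" using H[of 0] by auto
  have summ: "summable (\<lambda>m. c m * \<zeta> ^ m)" if "\<zeta> \<in> \<D>" for \<zeta>
  proof (rule summable_norm_cancel, rule summable_comparison_test[OF _ c], intro exI[of _ 0] allI impI)
    fix n
    have "norm (c n) * norm \<zeta> ^ n \<le> norm (c n) * 1" using that by (intro mult_left_mono power_le_one) auto
    thus "norm (norm (c n * \<zeta> ^ n)) \<le> norm (c n)" by (simp add: norm_mult norm_power)
  qed
  have F: "F \<zeta> = of_real (h (norm \<zeta>)) * psum c \<zeta>" if "\<zeta> \<in> \<D>" for \<zeta>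
    using suminf_mult[OF summ[OF that], of "of_real (h (norm \<zeta>))"] by (simp add: F_def psum_def mult_ac)
  have bound: "norm ((c m * complex_of_real (h (norm \<zeta>))) * \<zeta> ^ m) \<le> norm (c m) * H" if "\<zeta> \<in> \<D>" for m \<zeta>
  proof -
    have "norm (c m) * h (norm \<zeta>) * norm \<zeta> ^ m \<le> norm (c m) * H * 1"
      using H[of "norm \<zeta>"] H0 that by (intro mult_mono power_le_one) auto
    thus ?thesis using H[of "norm \<zeta>"] that by (simp add: norm_mult norm_power)
  qed
  have meas: "(\<lambda>r. c m * complex_of_real (h r)) \<in> borel_measurable borel" for m by measurable
  have sB: "summable (\<lambda>m. norm (c m) * H)" by (intro summable_mult2 c)
  note CI = coefficient_integral[of "\<lambda>m r. c m * complex_of_real (h r)" "\<lambda>m. norm (c m) * H", OF meas bound sB]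
  have FI: "integrable \<nu> F" unfolding F_def[abs_def] by (rule CI(1))
  have Fn: "(LINT \<zeta>|\<nu>. F \<zeta> * cnj \<zeta> ^ n) = c n * of_real (LINT \<zeta>|\<nu>. norm \<zeta> ^ (2 * n) * h (norm \<zeta>))" for n
  proof -
    have "(LINT \<zeta>|\<nu>. F \<zeta> * cnj \<zeta> ^ n) = (LINT \<zeta>|\<nu>. c n * of_real (norm \<zeta> ^ (2 * n) * h (norm \<zeta>)))"
      unfolding F_def using CI(2)[of n] by (simp add: mult_ac)
    also have "\<dots> = c n * of_real (LINT \<zeta>|\<nu>. norm \<zeta> ^ (2 * n) * h (norm \<zeta>))"
      by (simp only: integral_mult_right_zero integral_complex_of_real)
    finally show ?thesis .
  qed
  have c': "summable (\<lambda>n. norm (c' n))" using c by (simp add: c'_def)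
  note IP = integral_psum_cnj[OF FI c']
  have pc: "psum c' (cnj \<zeta>) = cnj (psum c \<zeta>)" if "\<zeta> \<in> \<D>" for \<zeta>
  proof -
    have "(\<lambda>n. cnj (c n * \<zeta> ^ n)) sums cnj (psum c \<zeta>)"
      unfolding sums_cnj psum_def by (rule summable_sums[OF summ[OF that]])
    thus ?thesis by (simp add: psum_def c'_def sums_iff)
  qed
  have eq: "F \<zeta> * psum c' (cnj \<zeta>) = of_real ((norm (psum c \<zeta>))\<^sup>2 * h (norm \<zeta>))" if "\<zeta> \<in> \<D>" for \<zeta>
    using F[OF that] pc[OF that] complex_norm_square[of "psum c \<zeta>"] by (simp add: mult_ac)
  have "integrable \<nu> (\<lambda>\<zeta>. F \<zeta> * psum c' (cnj \<zeta>)) = integrable \<nu> (\<lambda>\<zeta>. complex_of_real ((norm (psum c \<zeta>))\<^sup>2 * h (norm \<zeta>)))"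
    by (rule Bochner_Integration.integrable_cong) (use eq in auto)
  hence "integrable \<nu> (\<lambda>\<zeta>. complex_of_real ((norm (psum c \<zeta>))\<^sup>2 * h (norm \<zeta>)))" using IP(1) by simp
  thus "integrable \<nu> (\<lambda>\<zeta>. (norm (psum c \<zeta>))\<^sup>2 * h (norm \<zeta>))"
    by (simp only: complex_of_real_integrable_eq)
  have "(LINT \<zeta>|\<nu>. F \<zeta> * psum c' (cnj \<zeta>)) = (LINT \<zeta>|\<nu>. complex_of_real ((norm (psum c \<zeta>))\<^sup>2 * h (norm \<zeta>)))"
    by (rule Bochner_Integration.integral_cong) (use eq in auto)
  also have "\<dots> = of_real (LINT \<zeta>|\<nu>. (norm (psum c \<zeta>))\<^sup>2 * h (norm \<zeta>))" by (rule integral_complex_of_real)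
  finally have i: "(LINT \<zeta>|\<nu>. F \<zeta> * psum c' (cnj \<zeta>)) = of_real (LINT \<zeta>|\<nu>. (norm (psum c \<zeta>))\<^sup>2 * h (norm \<zeta>))" .
  have t: "c' n * (LINT \<zeta>|\<nu>. F \<zeta> * cnj \<zeta> ^ n) = of_real ((norm (c n))\<^sup>2 * (LINT \<zeta>|\<nu>. norm \<zeta> ^ (2 * n) * h (norm \<zeta>)))" for n
    unfolding Fn c'_def using complex_norm_square[of "c n"] by (simp add: mult_ac)
  show "(\<lambda>n. (norm (c n))\<^sup>2 * (LINT \<zeta>|\<nu>. norm \<zeta> ^ (2 * n) * h (norm \<zeta>))) sums
      (LINT \<zeta>|\<nu>. (norm (psum c \<zeta>))\<^sup>2 * h (norm \<zeta>))"
    using IP(2) unfolding i t sums_of_real_iff .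
qed

text \<open>The tail is known to be antitone from 0 on; cutting the argument off at 0 gives a
  function monotone on the whole line, hence Borel.\<close>

lemma tail_measurable: "(\<lambda>r. tail \<omega> (max 0 r)) \<in> borel_measurable borel"
proof -
  have "mono (\<lambda>r. - tail \<omega> (max 0 r))" by (auto intro!: monoI tail_antimono)
  hence "(\<lambda>r. - tail \<omega> (max 0 r)) \<in> borel_measurable borel" by (rule borel_measurable_mono)
  hence "(\<lambda>r. - (- tail \<omega> (max 0 r))) \<in> borel_measurable borel" by (rule borel_measurable_uminus)
  thus ?thesis by simp
qed

text \<open>Between \<open>1 - 2 ^ (- n)\<close> and the next such radius the mass is at most
  \<open>C\<close> times the tail at the right end, which cancels the tail in the denominator. Each
  interval contributes at most \<open>C * 2 ^ Suc n\<close>, so the last one dominates the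
  sum.\<close>

lemma dyadic_tail_integral:
  assumes C: "C \<ge> 1" "\<And>r. r \<in> {0..<1} \<Longrightarrow> tail \<omega> r \<le> C * tail \<omega> ((1 + r) / 2)"
    and \<rho>: "0 \<le> \<rho>" "\<rho> < 1"
  shows "(LINT r|\<sigma>. indicator {0..<\<rho>} r * (1 / (tail \<omega> (max 0 r) * (1 - r)))) \<le> 4 * C / (1 - \<rho>)"
    and "integrable \<sigma> (\<lambda>r. indicator {0..<\<rho>} r * (1 / (tail \<omega> (max 0 r) * (1 - r))))"
proof -
  define g where "g r = 1 / (tail \<omega> (max 0 r) * (1 - r))" for r
  note tail_measurable[measurable]
  have gm[measurable]: "g \<in> borel_measurable borel" unfolding g_def[abs_def] by measurable
  have gb: "0 \<le> g r" "s < 1 \<Longrightarrow> r \<le> s \<Longrightarrow> g r \<le> 1 / (tail \<omega> s * (1 - s))" if "r \<in> {0..<1}" for r s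
  proof -
    show "0 \<le> g r" using that tail_nonneg[of r] by (simp add: g_def)
    assume "s < 1" "r \<le> s"
    thus "g r \<le> 1 / (tail \<omega> s * (1 - s))" unfolding g_def using that tail_antimono[of r s] tail_pos[of s] tail_pos[of r]
      by (intro divide_left_mono mult_mono) auto
  qed
  have sets: "{a..<b} \<in> sets \<sigma>" if "0 \<le> a" "b \<le> 1" for a b
    using that by (auto simp: sets_line_measure sets_restrict_space_iff)
  have int: "integrable \<sigma> (\<lambda>r. indicator {a..<b} r * g r)" if "0 \<le> a" "b < 1" for a b
  proof (rule line.integrable_const_bound[of _ "1 / (tail \<omega> (max 0 b) * (1 - max 0 b))"])
    show "AE r in \<sigma>. norm (indicator {a..<b} r * g r) \<le> 1 / (tail \<omega> (max 0 b) * (1 - max 0 b))"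
      using gb(1) gb(2)[where s="max 0 b"] tail_nonneg[of "max 0 b"] that by (intro AE_I2) (auto split: split_indicator simp: abs_mult)
  qed measurable
  define G where "G b = (LINT r|\<sigma>. indicator {0..<b} r * g r)" for b
  define q where "q n = 1 - (1/2::real) ^ n" for n
  have q: "0 \<le> q n" "q n < 1" "q n \<le> q (Suc n)" "q (Suc n) = (1 + q n) / 2" for n
    by (auto simp: q_def power_le_one field_simps)
  have G: "G (q n) \<le> C * 2 ^ Suc n" for n
  proof (induction n)
    case 0
    have "q 0 = 0" by (simp add: q_def)
    thus ?case using C by (simp add: G_def)
  next
    case (Suc n)
    have tp: "tail \<omega> (q (Suc n)) > 0" using q by (intro tail_pos) auto
    have step: "(LINT r|\<sigma>. indicator {q n..<q (Suc n)} r * g r) \<le> C * 2 ^ Suc n"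
    proof -
      define A where "A = 1 / (tail \<omega> (q (Suc n)) * (1 - q (Suc n)))"
      have A0: "A \<ge> 0" using tp q(2)[of "Suc n"] by (simp add: A_def)
      have "(LINT r|\<sigma>. indicator {q n..<q (Suc n)} r * g r) \<le> (LINT r|\<sigma>. indicator {q n..<1} r * A)"
      proof (intro integral_mono int integrable_mult_left integrable_real_indicator)
        fix r assume r: "r \<in> space \<sigma>"
        show "indicator {q n..<q (Suc n)} r * g r \<le> indicator {q n..<1} r * A"
          using gb(2)[of r "q (Suc n)"] r q(2)[of "Suc n"] A0 by (auto split: split_indicator simp: A_def)
      qed (use q sets in \<open>auto simp: line.emeasure_finite less_top[symmetric]\<close>)
      also have "\<dots> = tail \<omega> (q n) * A" using sets[of "q n" 1] q by (simp add: tail_eq Int_absorb1)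
      also have "\<dots> \<le> (C * tail \<omega> (q (Suc n))) * A"
      proof (intro mult_right_mono A0)
        show "tail \<omega> (q n) \<le> C * tail \<omega> (q (Suc n))"
          using C(2)[of "q n"] q(1,2)[of n] by (simp only: q(4) atLeastLessThan_iff simp_thms)
      qed
      also have "\<dots> = C * 2 ^ Suc n" using tp by (simp add: A_def q_def field_simps)
      finally show ?thesis .
    qed
    have "G (q (Suc n)) = (LINT r|\<sigma>. indicator {0..<q n} r * g r + indicator {q n..<q (Suc n)} r * g r)"
      unfolding G_def using q[of n] by (intro Bochner_Integration.integral_cong) (auto split: split_indicator)
    also have "\<dots> = G (q n) + (LINT r|\<sigma>. indicator {q n..<q (Suc n)} r * g r)"
      unfolding G_def using q by (intro Bochner_Integration.integral_add int) auto
    finally show ?case using Suc step by simp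
  qed
  obtain n where n: "1 / (1 - \<rho>) \<le> 2 ^ n" "2 ^ n \<le> 2 * (1 / (1 - \<rho>))"
    using power_two_between[of "1 / (1 - \<rho>)"] \<rho> by auto
  have "\<rho> \<le> q n" using n(1) \<rho> by (simp add: q_def field_simps power_one_over)
  have "G \<rho> \<le> G (q n)" unfolding G_def
  proof (intro integral_mono int)
    fix r assume "r \<in> space \<sigma>"
    thus "indicator {0..<\<rho>} r * g r \<le> indicator {0..<q n} r * g r"
      using gb(1) \<open>\<rho> \<le> q n\<close> by (auto split: split_indicator)
  qed (use \<rho> q in auto)
  also have "\<dots> \<le> C * (2 * 2 ^ n)" using G[of n] by simp
  also have "\<dots> \<le> C * (2 * (2 * (1 / (1 - \<rho>))))" using n C by (intro mult_left_mono) auto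
  finally show "(LINT r|\<sigma>. indicator {0..<\<rho>} r * (1 / (tail \<omega> (max 0 r) * (1 - r)))) \<le> 4 * C / (1 - \<rho>)"
    unfolding G_def g_def by (simp add: mult.commute)
  show "integrable \<sigma> (\<lambda>r. indicator {0..<\<rho>} r * (1 / (tail \<omega> (max 0 r) * (1 - r))))"
    using int[of 0 \<rho>] \<rho> by (simp add: g_def)
qed

end

text \<open>The inequality of arithmetic and geometric means for \<open>b * a * sqrt h\<close> and
  \<open>1 / (b * sqrt h)\<close>, as a pointwise form of Cauchy-Schwarz. It is applied with
  \<open>b\<close> the norm of \<open>1 - u\<close>.\<close>

lemma le_weighted_squares:
  fixes a h :: real assumes "h > 0" "b \<noteq> 0"
  shows "a \<le> (1/2) * ((b * a)\<^sup>2 * h + (1 / b)\<^sup>2 * (1 / h))"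
proof -
  define p where "p = b\<^sup>2 * h"
  have p: "p > 0" using assms by (simp add: p_def)
  have "0 \<le> (p * a - 1)\<^sup>2" by simp
  hence "2 * (p * a) \<le> p\<^sup>2 * a\<^sup>2 + 1" by (simp add: power2_eq_square algebra_simps)
  hence "2 * (p * a) / p \<le> (p\<^sup>2 * a\<^sup>2 + 1) / p" using p by (intro divide_right_mono) auto
  hence "2 * a \<le> p * a\<^sup>2 + 1 / p" using p by (simp add: add_divide_distrib power2_eq_square)
  also have "p * a\<^sup>2 + 1 / p = (b * a)\<^sup>2 * h + (1 / b)\<^sup>2 * (1 / h)"
    by (simp add: p_def power_mult_distrib power_divide mult_ac)
  finally show ?thesis by simp
qed

lemma psum_cnj_real:
  fixes c :: "nat \<Rightarrow> complex"
  assumes real: "\<And>n. cnj (c n) = c n" and c: "disc_series c" and z: "z \<in> \<D>"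
  shows "psum c (cnj z) = cnj (psum c z)"
proof -
  have "(\<lambda>n. cnj (c n * z ^ n)) sums cnj (psum c z)"
    unfolding sums_cnj psum_def by (rule summable_sums[OF disc_series_summable(2)[OF c z]])
  thus ?thesis using real by (simp add: psum_def sums_iff)
qed

context weighted_disc
begin

text \<open>\<open>0 powr 0\<close> is 0, so the integrand equals 1 only off the origin; a single
  radius has no mass because the measure has a density.\<close>

lemma moment_0_eq_tail: "moment \<omega> 0 = tail \<omega> 0"
proof -
  obtain w where w: "AE r in lborel. r \<in> {0..<1} \<longrightarrow> \<omega> r = w r" "w \<in> borel_measurable borel"
    by (rule borel_version) blast
  have ae: "AE r in lebesgue. r \<noteq> (0::real)" by (rule AE_completion[OF AE_lborel_singleton])
  have "AE r in lebesgue_on {0..<1}. r \<noteq> (0::real)"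
    by (subst AE_restrict_space_iff) (use ae in \<open>auto elim: eventually_mono\<close>)
  hence ae': "AE r in \<sigma>. r \<noteq> 0"
    unfolding line_measure_def using weight_measurable by (subst AE_density) (auto elim: eventually_mono)
  have "moment \<omega> 0 = (LINT r|\<sigma>. 1)" unfolding moment_eq
    using ae' by (intro integral_cong_AE) (auto elim!: eventually_mono)
  thus ?thesis by (simp add: tail_eq)
qed

lemma moment_ge_tail_nat:
  assumes "0 \<le> \<rho>" "\<rho> < 1" shows "\<rho> ^ n * tail \<omega> \<rho> \<le> moment \<omega> (real n)"
proof (cases "n = 0")
  case True
  thus ?thesis using moment_0_eq_tail tail_antimono[of 0 \<rho>] assms by simp
next
  case False
  thus ?thesis using moment_ge_tail[of \<rho> "real n"] assms by (simp add: powr_realpow')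
qed

text \<open>For \<open>n >= 2\<close> two doublings lead to order \<open>4 * n\<close>, which
  exceeds \<open>2 * n + 3\<close>. For n = 0 and n = 1 the target order is at most 5, which
  explains the fixed quotient.\<close>

lemma moment_comparison:
  assumes D: "moment_doubling D"
  obtains E where "E > 0" "\<And>n. moment \<omega> (real n) \<le> E * moment \<omega> (2 * real n + 3)"
proof
  let ?E = "D\<^sup>2 + moment \<omega> 0 / moment \<omega> 5"
  have D1: "D \<ge> 1" using D by (simp add: moment_doubling_def)
  have q: "moment \<omega> 0 / moment \<omega> 5 > 0" using moment_pos by simp
  show "?E > 0" using q by (simp add: add_nonneg_pos)
  fix n :: nat
  have mp: "moment \<omega> (2 * real n + 3) > 0" by (rule moment_pos) simp
  show "moment \<omega> (real n) \<le> ?E * moment \<omega> (2 * real n + 3)"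
  proof (cases "n \<ge> 2")
    case True
    have "moment \<omega> (real n) \<le> D ^ 2 * moment \<omega> (2 ^ 2 * real n)"
      using True by (intro moment_doubling_iterate[OF D]) auto
    also have "\<dots> \<le> D ^ 2 * moment \<omega> (2 * real n + 3)"
      using True by (intro mult_left_mono moment_antimono) auto
    also have "\<dots> \<le> ?E * moment \<omega> (2 * real n + 3)" using q mp by (intro mult_right_mono) auto
    finally show ?thesis .
  next
    case False
    have "moment \<omega> (real n) \<le> moment \<omega> 0" by (rule moment_antimono) auto
    also have "\<dots> = moment \<omega> 0 / moment \<omega> 5 * moment \<omega> 5" using moment_pos[of 5] by simp
    also have "\<dots> \<le> moment \<omega> 0 / moment \<omega> 5 * moment \<omega> (2 * real n + 3)"
      using q False by (intro mult_left_mono moment_antimono) auto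
    also have "\<dots> \<le> ?E * moment \<omega> (2 * real n + 3)" using mp by (intro mult_right_mono) auto
    finally show ?thesis .
  qed
qed

text \<open>These are the coefficients of \<open>1 - u\<close> times the derivative of the kernel:
  each term has n times the size of a kernel coefficient, their difference only the size of one. The
  gain comes from \<open>n * r ^ n * (1 - r) <= 1\<close>, which spends half of the order; doubling
  restores it.\<close>

lemma kernel_coeff_difference:
  assumes D: "moment_doubling D"
  shows "\<bar>(real n + 1) * kernel_coeff (Suc n) - real n * kernel_coeff n\<bar> \<le> (1 + 2 * D) * kernel_coeff (Suc n)"
proof -
  have D1: "D \<ge> 1" using D by (simp add: moment_doubling_def)
  define a where "a = moment \<omega> (2 * real n + 1)"
  define b where "b = moment \<omega> (2 * real n + 3)"
  have ab: "a > 0" "b > 0" "b \<le> a" unfolding a_def b_def by (auto intro!: moment_pos moment_antimono)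
  have k: "kernel_coeff n = 1 / (2 * a)" "kernel_coeff (Suc n) = 1 / (2 * b)" by (simp_all add: kernel_coeff_def a_def b_def algebra_simps)
  have "real n * (a - b) \<le> 2 * moment \<omega> (real n + 1)"
  proof -
    have "real n * (a - b) = (LINT r|\<sigma>. real n * (r powr (2 * real n + 1) - r powr (2 * real n + 3)))"
      unfolding a_def b_def moment_eq by (subst Bochner_Integration.integral_diff[symmetric]) (auto intro!: powr_integrable)
    also have "\<dots> \<le> (LINT r|\<sigma>. 2 * r powr (real n + 1))"
    proof (intro integral_mono integrable_mult_right powr_integrable Bochner_Integration.integrable_diff)
      fix r assume "r \<in> space \<sigma>"
      hence r: "0 \<le> r" "r < 1" by auto
      have p: "r powr (2 * real n + 1) = r ^ (2 * n + 1)" "r powr (2 * real n + 3) = r ^ (2 * n + 3)"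
        "r powr (real n + 1) = r ^ (n + 1)"
        using powr_realpow'[OF r(1), of "2 * n + 1"] powr_realpow'[OF r(1), of "2 * n + 3"] powr_realpow'[OF r(1), of "n + 1"]
        by (simp_all add: add.commute)
      have "real n * r ^ n * (1 - r) \<le> (\<Sum>j<n. r ^ j) * (1 - r)"
      proof (intro mult_right_mono)
        have "(\<Sum>j<n. r ^ n) \<le> (\<Sum>j<n. r ^ j)" using r by (intro sum_mono power_decreasing) auto
        thus "real n * r ^ n \<le> (\<Sum>j<n. r ^ j)" by simp
      qed (use r in auto)
      also have "\<dots> = 1 - r ^ n" using r by (simp add: sum_gp_strict)
      also have "\<dots> \<le> 1" using r by simp
      finally have n1: "real n * r ^ n * (1 - r) \<le> 1" .
      have "real n * (r ^ (2 * n + 1) - r ^ (2 * n + 3)) = r ^ (n + 1) * (real n * r ^ n * (1 - r)) * (1 + r)"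
      proof -
        have "r ^ (2 * n) = r ^ n * r ^ n" by (simp add: mult_2 power_add)
        thus ?thesis by (simp add: power_add power3_eq_cube algebra_simps)
      qed
      also have "\<dots> \<le> r ^ (n + 1) * 1 * 2"
        using r n1 by (intro mult_mono mult_nonneg_nonneg) auto
      finally show "real n * (r powr (2 * real n + 1) - r powr (2 * real n + 3)) \<le> 2 * r powr (real n + 1)"
        unfolding p by simp
    qed auto
    also have "\<dots> = 2 * moment \<omega> (real n + 1)" by (simp add: moment_eq)
    finally show ?thesis .
  qed
  also have "moment \<omega> (real n + 1) \<le> D * moment \<omega> (2 * (real n + 1))"
    using D unfolding moment_doubling_def by (metis le_add_same_cancel2 of_nat_0_le_iff)
  also have "moment \<omega> (2 * (real n + 1)) \<le> a" unfolding a_def by (rule moment_antimono) auto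
  finally have nab: "real n * (a - b) \<le> 2 * D * a" using D1 by simp
  have "(real n + 1) * kernel_coeff (Suc n) - real n * kernel_coeff n = kernel_coeff (Suc n) * (1 + real n * (a - b) / a)"
    using ab by (simp add: k field_simps)
  moreover have "real n * (a - b) / a \<le> 2 * D" using nab ab by (simp add: pos_divide_le_eq)
  moreover have "real n * (a - b) / a \<ge> 0" using ab by simp
  ultimately show ?thesis using kernel_coeff_pos[of "Suc n"] D1
    by (simp add: abs_mult mult.commute)
qed

text \<open>With \<open>e\<close> the derivative of the kernel, \<open>norm (e u)\<close> is written
  as \<open>norm ((1 - u) * e u)\<close> times \<open>1 / norm (1 - u)\<close> and estimated by
  weighted Cauchy-Schwarz; Parseval evaluates both squares. In the first,
  \<open>r ^ n * tail \<omega> r <= moment \<omega> n\<close> turns the integrals into squares of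
  moments, which cancel the squared kernel coefficients. In the second, a geometric series leaves
  the integral of \<open>dyadic_tail_integral\<close>.\<close>

lemma kernel_derivative_L1:
  assumes hat: "\<omega> \<in> D_hat"
  obtains K where "K > 0"
    "\<And>w. w \<in> \<D> \<Longrightarrow> integrable \<nu> (\<lambda>\<zeta>. psum (diffs kernel_coeffs) (w * \<zeta>))"
    "\<And>w. w \<in> \<D> \<Longrightarrow> (LINT \<zeta>|\<nu>. norm (psum (diffs kernel_coeffs) (w * \<zeta>))) \<le> K / (1 - norm w)"
proof -
  obtain C where C: "C \<ge> 1" "\<And>r. r \<in> {0..<1} \<Longrightarrow> tail \<omega> r \<le> C * tail \<omega> ((1 + r) / 2)"
    using hat by (auto simp: D_hat_def)
  obtain D where D: "moment_doubling D" by (rule D_hat_moment_doubling[OF hat]) blast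
  have D1: "D \<ge> 1" using D by (simp add: moment_doubling_def)
  obtain E where E: "E > 0" "\<And>n. moment \<omega> (real n) \<le> E * moment \<omega> (2 * real n + 3)"
    by (rule moment_comparison[OF D]) blast
  define K where "K = (1/2) * ((1 + 2 * D)\<^sup>2 * E\<^sup>2 + 2 * (4 * C + 1))"
  have K0: "K > 0" unfolding K_def using C D1 E by (intro mult_pos_pos add_nonneg_pos) auto
  note tail_measurable[measurable]
  have main: "integrable \<nu> (\<lambda>\<zeta>. psum (diffs kernel_coeffs) (w * \<zeta>)) \<and>
      (LINT \<zeta>|\<nu>. norm (psum (diffs kernel_coeffs) (w * \<zeta>))) \<le> K / (1 - norm w)" if w: "w \<in> \<D>" for w
  proof -
    define \<rho> where "\<rho> = norm w"
    have \<rho>: "0 \<le> \<rho>" "\<rho> < 1" using w by (auto simp: \<rho>_def)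
    \<comment> \<open>Freezing the tail beyond \<rho> keeps \<open>1 / h\<close> bounded, as
      Parseval requires, and costs only a constant: beyond \<rho> the factor
      \<open>1 - \<rho> * r\<close> stays comparable to \<open>1 - \<rho>\<close>.\<close>
    define h where "h r = tail \<omega> (max 0 (min r \<rho>))" for r
    have tp: "tail \<omega> \<rho> > 0" using \<rho> by (rule tail_pos)
    have hm[measurable]: "h \<in> borel_measurable borel" unfolding h_def[abs_def] by measurable
    have hb: "tail \<omega> \<rho> \<le> h r" "h r \<le> tail \<omega> 0" for r
      unfolding h_def using \<rho> by (auto intro!: tail_antimono)
    have hpos: "h r > 0" for r using hb(1)[of r] tp by linarith
    define e where "e = diffs kernel_coeffs"
    define d where "d n = e n - (if n = 0 then 0 else e (n - 1))" for n
    have de: "disc_series e" unfolding e_def by (intro disc_series_diffs kernel_coeffs_series)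
    have en: "e n = of_real ((real n + 1) * kernel_coeff (Suc n))" for n by (simp add: e_def diffs_def add.commute)
    have dn: "norm (d n) \<le> (1 + 2 * D) * kernel_coeff (Suc n)" for n
    proof -
      have "d n = of_real ((real n + 1) * kernel_coeff (Suc n) - real n * kernel_coeff n)"
        by (cases n) (simp_all add: d_def en)
      thus ?thesis using kernel_coeff_difference[OF D, of n] by (simp only: norm_of_real)
    qed
    have dsum: "(\<lambda>n. d n * u ^ n) sums ((1 - u) * psum e u)" if u: "u \<in> \<D>" for u
    proof -
      have s: "(\<lambda>n. e n * u ^ n) sums psum e u"
        unfolding psum_def by (rule summable_sums[OF disc_series_summable(2)[OF de u]])
      define g where "g n = (if n = 0 then 0 else e (n - 1) * u ^ n)" for n
      have "(\<lambda>n. g (Suc n)) sums (u * psum e u)"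
        using sums_mult[OF s, of u] by (simp add: g_def mult_ac)
      hence gs: "g sums (u * psum e u)" unfolding sums_Suc_iff by (simp add: g_def)
      have "(\<lambda>n. d n * u ^ n) = (\<lambda>n. e n * u ^ n - g n)"
        by (auto simp: d_def g_def algebra_simps fun_eq_iff)
      moreover have "(1 - u) * psum e u = psum e u - u * psum e u" by (simp add: algebra_simps)
      ultimately show ?thesis using sums_diff[OF s gs] by (simp only:)
    qed
    have ds: "disc_series d" using dsum by (auto intro!: disc_seriesI simp: sums_iff)
    have pd: "psum d u = (1 - u) * psum e u" if "u \<in> \<D>" for u
      using dsum[OF that] by (simp add: psum_def sums_iff)
    have wz: "w * \<zeta> \<in> \<D>" if "\<zeta> \<in> \<D>" for \<zeta>
    proof -
      have "norm w * norm \<zeta> \<le> norm w * 1" using that by (intro mult_left_mono) auto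
      thus ?thesis using w by (simp add: norm_mult)
    qed
    have I1: "integrable \<nu> (\<lambda>\<zeta>. (norm (psum d (w * \<zeta>)))\<^sup>2 * h (norm \<zeta>))"
      "(LINT \<zeta>|\<nu>. (norm (psum d (w * \<zeta>)))\<^sup>2 * h (norm \<zeta>)) \<le> (1 + 2 * D)\<^sup>2 * E\<^sup>2 / (1 - \<rho>)"
    proof -
      have c: "summable (\<lambda>n. norm (d n * w ^ n))" by (rule disc_series_summable(1)[OF ds w])
      note P = parseval[OF c hm, of "tail \<omega> 0", unfolded psum_scale]
      have H: "0 \<le> h r \<and> h r \<le> tail \<omega> 0" for r using hb(2)[of r] hpos[of r] by simp
      show "integrable \<nu> (\<lambda>\<zeta>. (norm (psum d (w * \<zeta>)))\<^sup>2 * h (norm \<zeta>))" by (rule P(1)) (use H in auto)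
      have sums: "(\<lambda>n. (norm (d n * w ^ n))\<^sup>2 * (LINT \<zeta>|\<nu>. norm \<zeta> ^ (2 * n) * h (norm \<zeta>))) sums
         (LINT \<zeta>|\<nu>. (norm (psum d (w * \<zeta>)))\<^sup>2 * h (norm \<zeta>))" by (rule P(2)) (use H in auto)
      have bd: "(norm (d n * w ^ n))\<^sup>2 * (LINT \<zeta>|\<nu>. norm \<zeta> ^ (2 * n) * h (norm \<zeta>)) \<le> (1 + 2 * D)\<^sup>2 * E\<^sup>2 * \<rho> ^ n" for n
      proof -
        define M where "M = moment \<omega> (2 * real n + 3)"
        have M: "M > 0" unfolding M_def by (rule moment_pos) simp
        define N where "N = moment \<omega> (real n)"
        have N: "0 \<le> N" "N \<le> E * M" using E(2)[of n] moment_nonneg by (auto simp: N_def M_def)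
        have J: "(LINT \<zeta>|\<nu>. norm \<zeta> ^ (2 * n) * h (norm \<zeta>)) \<le> 2 * (N * moment \<omega> (real n + 1) + tail \<omega> \<rho> * moment \<omega> (2 * real n + 1))"
        proof -
          have j1: "(LINT \<zeta>|\<nu>. norm \<zeta> ^ (2 * n) * h (norm \<zeta>)) = 2 * (LINT r|\<sigma>. r * (r ^ (2 * n) * h r))"
            by (rule integral_nu_radial) (use H in \<open>auto simp: mult_nonneg_nonneg\<close>)
          have j2: "(LINT r|\<sigma>. r * (r ^ (2 * n) * h r)) \<le> (LINT r|\<sigma>. N * r powr (real n + 1) + tail \<omega> \<rho> * r powr (2 * real n + 1))"
          proof (intro integral_mono Bochner_Integration.integrable_add integrable_mult_right powr_integrable)
            show "integrable \<sigma> (\<lambda>r. r * (r ^ (2 * n) * h r))"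
            proof (rule line.integrable_const_bound[of _ "tail \<omega> 0"])
              show "AE r in \<sigma>. norm (r * (r ^ (2 * n) * h r)) \<le> tail \<omega> 0"
              proof (rule AE_I2)
                fix r assume r: "r \<in> space \<sigma>"
                have "r * (r ^ (2 * n) * h r) \<le> 1 * (1 * tail \<omega> 0)"
                  using r H[of r] by (intro mult_mono power_le_one) auto
                thus "norm (r * (r ^ (2 * n) * h r)) \<le> tail \<omega> 0" using r H[of r] by (simp add: abs_mult)
              qed
            qed measurable
            fix r assume "r \<in> space \<sigma>"
            hence r: "0 \<le> r" "r < 1" by auto
            have p: "r powr (2 * real n + 1) = r ^ (2 * n + 1)" "r powr (real n + 1) = r ^ (n + 1)"
              using powr_realpow'[OF r(1), of "2 * n + 1"] powr_realpow'[OF r(1), of "n + 1"]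
              by (simp_all add: add.commute)
            have "h r \<le> tail \<omega> r + tail \<omega> \<rho>"
              unfolding h_def using r \<rho> tail_nonneg[of r] tail_nonneg[of \<rho>] by (auto simp: min_def max_def)
            hence "r ^ (2 * n + 1) * h r \<le> r ^ (2 * n + 1) * (tail \<omega> r + tail \<omega> \<rho>)" using r by (intro mult_left_mono) auto
            also have "\<dots> = r ^ (n + 1) * (r ^ n * tail \<omega> r) + tail \<omega> \<rho> * r ^ (2 * n + 1)"
            proof -
              have "r ^ (2 * n) = r ^ n * r ^ n" by (simp add: mult_2 power_add)
              thus ?thesis by (simp add: power_add algebra_simps)
            qed
            also have "\<dots> \<le> r ^ (n + 1) * N + tail \<omega> \<rho> * r ^ (2 * n + 1)"
              unfolding N_def using r by (intro add_right_mono mult_left_mono moment_ge_tail_nat) auto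
            finally show "r * (r ^ (2 * n) * h r) \<le> N * r powr (real n + 1) + tail \<omega> \<rho> * r powr (2 * real n + 1)"
              unfolding p by (simp add: mult_ac)
          qed auto
          have j3: "(LINT r|\<sigma>. N * r powr (real n + 1) + tail \<omega> \<rho> * r powr (2 * real n + 1)) = N * moment \<omega> (real n + 1) + tail \<omega> \<rho> * moment \<omega> (2 * real n + 1)"
            unfolding moment_eq by (subst Bochner_Integration.integral_add) (auto intro!: powr_integrable)
          show ?thesis unfolding j1 by (rule mult_left_mono[OF j2[unfolded j3]]) simp
        qed
        have mn: "moment \<omega> (real n + 1) \<le> N" "moment \<omega> (2 * real n + 1) \<le> N" unfolding N_def by (auto intro!: moment_antimono)
        have "\<rho> ^ (2 * n) * (LINT \<zeta>|\<nu>. norm \<zeta> ^ (2 * n) * h (norm \<zeta>)) \<le> \<rho> ^ (2 * n) * (2 * (N * moment \<omega> (real n + 1) + tail \<omega> \<rho> * moment \<omega> (2 * real n + 1)))"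
          using J \<rho> by (intro mult_left_mono) auto
        also have "\<dots> = 2 * (\<rho> ^ n * (\<rho> ^ n * (N * moment \<omega> (real n + 1)))) + 2 * (\<rho> ^ n * ((\<rho> ^ n * tail \<omega> \<rho>) * moment \<omega> (2 * real n + 1)))"
        proof -
          have p2: "\<rho> ^ (2 * n) = \<rho> ^ n * \<rho> ^ n" by (simp add: mult_2 power_add)
          show ?thesis unfolding p2 by (simp add: distrib_left mult_ac)
        qed
        also have "\<dots> \<le> 2 * (\<rho> ^ n * (1 * (N * N))) + 2 * (\<rho> ^ n * (N * N))"
        proof (intro add_mono mult_left_mono)
          show "\<rho> ^ n * (N * moment \<omega> (real n + 1)) \<le> 1 * (N * N)"
            using \<rho> N mn moment_nonneg by (intro mult_mono power_le_one mult_nonneg_nonneg) auto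
          have "\<rho> ^ n * tail \<omega> \<rho> \<le> N" unfolding N_def by (rule moment_ge_tail_nat[OF \<rho>])
          thus "\<rho> ^ n * tail \<omega> \<rho> * moment \<omega> (2 * real n + 1) \<le> N * N"
            using N mn moment_nonneg by (intro mult_mono) auto
        qed (use \<rho> in auto)
        also have "\<dots> = 4 * (\<rho> ^ n * (N * N))" by simp
        also have "\<dots> \<le> 4 * (\<rho> ^ n * ((E * M) * (E * M)))" using N \<rho> E M by (intro mult_left_mono mult_mono) auto
        finally have A: "\<rho> ^ (2 * n) * (LINT \<zeta>|\<nu>. norm \<zeta> ^ (2 * n) * h (norm \<zeta>)) \<le> 4 * (\<rho> ^ n * (E * M)\<^sup>2)"
          by (simp add: power2_eq_square)
        have dn2: "(norm (d n))\<^sup>2 \<le> ((1 + 2 * D) / (2 * M))\<^sup>2"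
          using dn[of n] by (intro power_mono) (auto simp: kernel_coeff_def M_def algebra_simps)
        have "(norm (d n * w ^ n))\<^sup>2 * (LINT \<zeta>|\<nu>. norm \<zeta> ^ (2 * n) * h (norm \<zeta>)) = (norm (d n))\<^sup>2 * (\<rho> ^ (2 * n) * (LINT \<zeta>|\<nu>. norm \<zeta> ^ (2 * n) * h (norm \<zeta>)))"
          by (simp add: norm_mult norm_power power_mult_distrib \<rho>_def power_mult[symmetric] mult.commute)
        also have "\<dots> \<le> ((1 + 2 * D) / (2 * M))\<^sup>2 * (4 * (\<rho> ^ n * (E * M)\<^sup>2))"
        proof (rule mult_mono[OF dn2 A])
          have "0 \<le> (LINT \<zeta>|\<nu>. norm \<zeta> ^ (2 * n) * h (norm \<zeta>))" by (rule integral_nonneg_AE) (use H in auto)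
          thus "0 \<le> \<rho> ^ (2 * n) * (LINT \<zeta>|\<nu>. norm \<zeta> ^ (2 * n) * h (norm \<zeta>))" using \<rho> by simp
        qed simp
        also have "\<dots> = (1 + 2 * D)\<^sup>2 * E\<^sup>2 * \<rho> ^ n" using M by (simp add: power_divide power_mult_distrib)
        finally show ?thesis .
      qed
      have "(\<lambda>n. (1 + 2 * D)\<^sup>2 * E\<^sup>2 * \<rho> ^ n) sums ((1 + 2 * D)\<^sup>2 * E\<^sup>2 * (1 / (1 - \<rho>)))"
        using \<rho> by (intro sums_mult geometric_sums) auto
      from sums_le[OF bd sums this]
      show "(LINT \<zeta>|\<nu>. (norm (psum d (w * \<zeta>)))\<^sup>2 * h (norm \<zeta>)) \<le> (1 + 2 * D)\<^sup>2 * E\<^sup>2 / (1 - \<rho>)" by simp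
    qed
    have I2: "integrable \<nu> (\<lambda>\<zeta>. (norm (psum (\<lambda>n. w ^ n) \<zeta>))\<^sup>2 * (1 / h (norm \<zeta>)))"
      "(LINT \<zeta>|\<nu>. (norm (psum (\<lambda>n. w ^ n) \<zeta>))\<^sup>2 * (1 / h (norm \<zeta>))) \<le> 2 * (4 * C + 1) / (1 - \<rho>)"
    proof -
      have c: "summable (\<lambda>n. norm (w ^ n))" using w by (simp add: norm_power summable_geometric)
      have h2m[measurable]: "(\<lambda>r. 1 / h r) \<in> borel_measurable borel" by measurable
      have H: "0 \<le> 1 / h r \<and> 1 / h r \<le> 1 / tail \<omega> \<rho>" for r
        using hb(1)[of r] hpos[of r] tp by (auto intro!: divide_left_mono)
      note P = parseval[OF c h2m, of "1 / tail \<omega> \<rho>"]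
      show "integrable \<nu> (\<lambda>\<zeta>. (norm (psum (\<lambda>n. w ^ n) \<zeta>))\<^sup>2 * (1 / h (norm \<zeta>)))" by (rule P(1)) (use H in auto)
      define J where "J n = (LINT \<zeta>|\<nu>. norm \<zeta> ^ (2 * n) * (1 / h (norm \<zeta>)))" for n
      have sums: "(\<lambda>n. (norm (w ^ n))\<^sup>2 * J n) sums (LINT \<zeta>|\<nu>. (norm (psum (\<lambda>n. w ^ n) \<zeta>))\<^sup>2 * (1 / h (norm \<zeta>)))"
        unfolding J_def by (rule P(2)) (use H in auto)
      \<comment> \<open>Majorant of the summed series: in the geometric series the square of
        \<open>\<rho> * r\<close> is weakened to \<open>\<rho> * r\<close> itself.\<close>
      define g where "g r = (1 / h r) * (1 / (1 - \<rho> * min 1 r))" for r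
      have gm[measurable]: "g \<in> borel_measurable borel" unfolding g_def[abs_def] by measurable
      have rr: "\<rho> * r \<le> \<rho>" "\<rho> * r \<le> r" "0 \<le> \<rho> * r" "\<rho> * r < 1" if "r \<in> {0..<1}" for r
      proof -
        show "\<rho> * r \<le> \<rho>" "\<rho> * r \<le> r" "0 \<le> \<rho> * r" using that \<rho> by (auto simp: mult_left_le mult_left_le_one_le)
        thus "\<rho> * r < 1" using \<rho> by linarith
      qed
      have g0: "0 \<le> g r" if "r \<in> {0..<1}" for r using rr[OF that] H[of r] that by (auto simp: g_def min_def)
      have gbound: "g r \<le> (1 / tail \<omega> \<rho>) * (1 / (1 - \<rho>))" if "r \<in> {0..<1}" for r
        unfolding g_def using H[of r] hb(1)[of r] hpos[of r] tp \<rho> rr[OF that] that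
        by (intro mult_mono divide_left_mono) (auto simp: min_def intro!: mult_pos_pos)
      have gint: "integrable \<nu> (\<lambda>\<zeta>. g (norm \<zeta>))"
        by (rule bounded_radial_integrable[of _ "(1 / tail \<omega> \<rho>) * (1 / (1 - \<rho>))"]) (use g0 gbound in auto)
      have partial: "(\<Sum>n<N. (norm (w ^ n))\<^sup>2 * J n) \<le> (LINT \<zeta>|\<nu>. g (norm \<zeta>))" for N
      proof -
        have int: "integrable \<nu> (\<lambda>\<zeta>. \<rho> ^ (2 * n) * (norm \<zeta> ^ (2 * n) * (1 / h (norm \<zeta>))))" for n
        proof (rule bounded_radial_integrable[of "\<lambda>r. \<rho> ^ (2 * n) * (r ^ (2 * n) * (1 / h r))" "1 / tail \<omega> \<rho>"])
          fix r :: real assume r: "r \<in> {0..<1}"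
          have "\<rho> ^ (2 * n) * (r ^ (2 * n) * (1 / h r)) \<le> 1 * (1 * (1 / tail \<omega> \<rho>))"
            using r \<rho> H[of r] by (intro mult_mono power_le_one mult_nonneg_nonneg) auto
          thus "\<bar>\<rho> ^ (2 * n) * (r ^ (2 * n) * (1 / h r))\<bar> \<le> 1 / tail \<omega> \<rho>" using r \<rho> H[of r] by (simp add: abs_mult)
        qed measurable
        have "(\<Sum>n<N. (norm (w ^ n))\<^sup>2 * J n) = (\<Sum>n<N. LINT \<zeta>|\<nu>. \<rho> ^ (2 * n) * (norm \<zeta> ^ (2 * n) * (1 / h (norm \<zeta>))))"
        proof (rule sum.cong[OF refl])
          fix n
          have "(norm (w ^ n))\<^sup>2 = \<rho> ^ (2 * n)" by (simp add: norm_power \<rho>_def power_mult[symmetric] mult.commute)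
          thus "(norm (w ^ n))\<^sup>2 * J n = (LINT \<zeta>|\<nu>. \<rho> ^ (2 * n) * (norm \<zeta> ^ (2 * n) * (1 / h (norm \<zeta>))))"
            by (simp only: J_def integral_mult_right_zero)
        qed
        also have "\<dots> = (LINT \<zeta>|\<nu>. (\<Sum>n<N. \<rho> ^ (2 * n) * (norm \<zeta> ^ (2 * n) * (1 / h (norm \<zeta>)))))"
          by (rule Bochner_Integration.integral_sum[symmetric]) (rule int)
        also have "\<dots> \<le> (LINT \<zeta>|\<nu>. g (norm \<zeta>))"
        proof (intro integral_mono Bochner_Integration.integrable_sum int gint)
          fix \<zeta> assume "\<zeta> \<in> space \<nu>"
          hence r: "norm \<zeta> \<in> {0..<1}" by auto
          define x where "x = \<rho> * norm \<zeta>"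
          have x: "0 \<le> x" "x < 1" using rr[OF r] by (auto simp: x_def)
          have "(x\<^sup>2) ^ n = \<rho> ^ (2 * n) * norm \<zeta> ^ (2 * n)" for n
            by (simp add: x_def power_mult_distrib power_mult[symmetric])
          hence "(\<Sum>n<N. \<rho> ^ (2 * n) * (norm \<zeta> ^ (2 * n) * (1 / h (norm \<zeta>)))) = (\<Sum>n<N. (x\<^sup>2) ^ n) * (1 / h (norm \<zeta>))"
            unfolding sum_distrib_right by (simp add: mult.assoc)
          also have "\<dots> \<le> (\<Sum>n<N. x ^ n) * (1 / h (norm \<zeta>))"
            using x H[of "norm \<zeta>"] by (intro mult_right_mono sum_mono power_mono) (auto simp: power2_eq_square mult_left_le)
          also have "\<dots> \<le> (1 / (1 - x)) * (1 / h (norm \<zeta>))"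
            using x H[of "norm \<zeta>"] by (intro mult_right_mono) (auto simp: sum_gp_strict divide_right_mono)
          also have "\<dots> = g (norm \<zeta>)" using r by (simp add: g_def x_def min_def)
          finally show "(\<Sum>n<N. \<rho> ^ (2 * n) * (norm \<zeta> ^ (2 * n) * (1 / h (norm \<zeta>)))) \<le> g (norm \<zeta>)" .
        qed
        finally show ?thesis .
      qed
      have g2: "(LINT \<zeta>|\<nu>. g (norm \<zeta>)) = 2 * (LINT r|\<sigma>. r * g r)" by (rule integral_nu_radial) (use g0 in auto)
      have "(LINT r|\<sigma>. r * g r) \<le> (LINT r|\<sigma>. indicator {0..<\<rho>} r * (1 / (tail \<omega> (max 0 r) * (1 - r))) + indicator {\<rho>..<1} r * (1 / (tail \<omega> \<rho> * (1 - \<rho>))))"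
      proof (intro integral_mono Bochner_Integration.integrable_add dyadic_tail_integral(2)[OF C \<rho>] integrable_mult_left integrable_real_indicator)
        show "integrable \<sigma> (\<lambda>r. r * g r)" using integral_nu_radial(2)[OF gm] g0 gint by auto
        show "{\<rho>..<1} \<in> sets \<sigma>" using \<rho> by (intro atLeastLessThan_sets)
        fix r assume "r \<in> space \<sigma>"
        hence r: "r \<in> {0..<1}" by simp
        have "r * g r \<le> 1 * g r" using r g0[OF r] by (intro mult_right_mono) auto
        also have "1 * g r \<le> indicator {0..<\<rho>} r * (1 / (tail \<omega> (max 0 r) * (1 - r))) + indicator {\<rho>..<1} r * (1 / (tail \<omega> \<rho> * (1 - \<rho>)))"
        proof (cases "r < \<rho>")
          case True
          have "g r = 1 / (tail \<omega> r * (1 - \<rho> * r))" using True r by (simp add: g_def h_def min_def max_def)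
          also have "\<dots> \<le> 1 / (tail \<omega> r * (1 - r))"
            using rr[OF r] r tail_pos[of r] by (intro divide_left_mono mult_left_mono mult_pos_pos) auto
          finally show ?thesis using True r by simp
        next
          case False
          have "g r = 1 / (tail \<omega> \<rho> * (1 - \<rho> * r))" using False r \<rho> by (simp add: g_def h_def min_def max_def)
          also have "\<dots> \<le> 1 / (tail \<omega> \<rho> * (1 - \<rho>))"
            using rr[OF r] \<rho> tp by (intro divide_left_mono mult_left_mono mult_pos_pos) auto
          finally show ?thesis using False r by simp
        qed
        finally show "r * g r \<le> indicator {0..<\<rho>} r * (1 / (tail \<omega> (max 0 r) * (1 - r))) + indicator {\<rho>..<1} r * (1 / (tail \<omega> \<rho> * (1 - \<rho>)))" .
      qed (auto simp: line.emeasure_finite less_top[symmetric])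
      also have "\<dots> = (LINT r|\<sigma>. indicator {0..<\<rho>} r * (1 / (tail \<omega> (max 0 r) * (1 - r)))) + tail \<omega> \<rho> * (1 / (tail \<omega> \<rho> * (1 - \<rho>)))"
        using atLeastLessThan_sets[OF \<rho>(1)] \<rho>
        by (subst Bochner_Integration.integral_add[OF dyadic_tail_integral(2)[OF C \<rho>]])
           (auto simp: tail_eq Int_absorb1 line.emeasure_finite less_top[symmetric])
      also have "\<dots> \<le> 4 * C / (1 - \<rho>) + 1 / (1 - \<rho>)"
        using dyadic_tail_integral(1)[OF C \<rho>] tp by (intro add_mono) auto
      finally have "(LINT r|\<sigma>. r * g r) \<le> (4 * C + 1) / (1 - \<rho>)" by (simp only: add_divide_distrib)
      hence "2 * (LINT r|\<sigma>. r * g r) \<le> 2 * ((4 * C + 1) / (1 - \<rho>))" by (rule mult_left_mono) simp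
      hence G: "(LINT \<zeta>|\<nu>. g (norm \<zeta>)) \<le> 2 * (4 * C + 1) / (1 - \<rho>)" unfolding g2 by (simp only: times_divide_eq_right)
      have "(LINT \<zeta>|\<nu>. (norm (psum (\<lambda>n. w ^ n) \<zeta>))\<^sup>2 * (1 / h (norm \<zeta>))) = (\<Sum>n. (norm (w ^ n))\<^sup>2 * J n)"
        using sums by (simp add: sums_iff)
      also have "\<dots> \<le> (LINT \<zeta>|\<nu>. g (norm \<zeta>))"
        using sums partial by (intro suminf_le_const) (auto simp: sums_iff)
      finally show "(LINT \<zeta>|\<nu>. (norm (psum (\<lambda>n. w ^ n) \<zeta>))\<^sup>2 * (1 / h (norm \<zeta>))) \<le> 2 * (4 * C + 1) / (1 - \<rho>)"
        using G by linarith
    qed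
    define R where "R \<zeta> = (1/2) * ((norm (psum d (w * \<zeta>)))\<^sup>2 * h (norm \<zeta>) + (norm (psum (\<lambda>n. w ^ n) \<zeta>))\<^sup>2 * (1 / h (norm \<zeta>)))" for \<zeta>
    have RI: "integrable \<nu> R" unfolding R_def[abs_def] by (intro integrable_mult_right Bochner_Integration.integrable_add I1(1) I2(1))
    have pw: "norm (psum e (w * \<zeta>)) \<le> R \<zeta>" if z: "\<zeta> \<in> \<D>" for \<zeta>
    proof -
      have u: "w * \<zeta> \<in> \<D>" by (rule wz[OF z])
      have "psum (\<lambda>n. w ^ n) \<zeta> = (\<Sum>n. (w * \<zeta>) ^ n)" by (simp add: psum_def power_mult_distrib)
      also have "\<dots> = 1 / (1 - w * \<zeta>)" using u by (intro suminf_geometric) auto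
      finally have g: "norm (psum (\<lambda>n. w ^ n) \<zeta>) = 1 / norm (1 - w * \<zeta>)" by (simp add: norm_divide)
      have nz: "norm (1 - w * \<zeta>) \<noteq> 0" using u by auto
      show ?thesis using le_weighted_squares[OF hpos nz, of "norm (psum e (w * \<zeta>))" "norm \<zeta>"]
        unfolding R_def g pd[OF u] norm_mult[of "1 - w * \<zeta>"] .
    qed
    have cont: "continuous_on \<D> (\<lambda>\<zeta>. psum e (w * \<zeta>))"
      by (rule continuous_on_compose2[OF holomorphic_on_imp_continuous_on[OF psum_holomorphic[OF de]]])
         (use wz in \<open>auto intro!: continuous_intros\<close>)
    have int: "integrable \<nu> (\<lambda>\<zeta>. psum e (w * \<zeta>))"
    proof (rule Bochner_Integration.integrable_bound[OF RI])
      show "(\<lambda>\<zeta>. psum e (w * \<zeta>)) \<in> borel_measurable \<nu>" by (rule measurable_nu_continuous[OF cont])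
      show "AE \<zeta> in \<nu>. norm (psum e (w * \<zeta>)) \<le> norm (R \<zeta>)"
        using pw by (intro AE_I2) (force intro: order_trans)
    qed
    have "(LINT \<zeta>|\<nu>. norm (psum e (w * \<zeta>))) \<le> (LINT \<zeta>|\<nu>. R \<zeta>)"
      using pw by (intro integral_mono integrable_norm int RI) auto
    also have "\<dots> = (1/2) * ((LINT \<zeta>|\<nu>. (norm (psum d (w * \<zeta>)))\<^sup>2 * h (norm \<zeta>)) + (LINT \<zeta>|\<nu>. (norm (psum (\<lambda>n. w ^ n) \<zeta>))\<^sup>2 * (1 / h (norm \<zeta>))))"
      unfolding R_def by (subst Bochner_Integration.integral_add[symmetric, OF I1(1) I2(1)]) simp
    also have "\<dots> \<le> (1/2) * ((1 + 2 * D)\<^sup>2 * E\<^sup>2 / (1 - \<rho>) + 2 * (4 * C + 1) / (1 - \<rho>))"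
      using I1(2) I2(2) by (intro mult_left_mono add_mono) auto
    also have "\<dots> = K / (1 - \<rho>)" by (simp only: K_def add_divide_distrib[symmetric] times_divide_eq_right)
    finally show ?thesis using int by (simp add: e_def \<rho>_def)
  qed
  show thesis by (rule that[OF K0]) (use main in auto)
qed

end

section \<open>The Bergman projection\<close>

lemma diffs_of_real_cnj: "cnj (diffs (\<lambda>n. complex_of_real (c n)) k) = diffs (\<lambda>n. complex_of_real (c n)) k"
  by (simp add: diffs_def)

context weighted_disc
begin

definition proj_coeff :: "(complex \<Rightarrow> complex) \<Rightarrow> nat \<Rightarrow> complex"
  where "proj_coeff f n = of_real (kernel_coeff n) * (LINT \<zeta>|\<nu>. f \<zeta> * cnj \<zeta> ^ n)"

lemma cnj_power_measurable[measurable]: "(\<lambda>\<zeta>. cnj \<zeta> ^ n) \<in> borel_measurable \<nu>"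
  by (intro measurable_nu_continuous continuous_intros)

lemma integrable_mult_cnj_power:
  assumes "integrable \<nu> f" shows "integrable \<nu> (\<lambda>\<zeta>. f \<zeta> * cnj \<zeta> ^ n)"
proof (rule Bochner_Integration.integrable_bound[OF assms])
  have [measurable]: "f \<in> borel_measurable \<nu>" using assms by simp
  show "(\<lambda>\<zeta>. f \<zeta> * cnj \<zeta> ^ n) \<in> borel_measurable \<nu>" by measurable
  show "AE \<zeta> in \<nu>. norm (f \<zeta> * cnj \<zeta> ^ n) \<le> norm (f \<zeta>)"
    by (rule AE_I2) (auto simp: norm_mult norm_power intro!: mult_left_le power_le_one)
qed

lemma norm_integral_cnj_power_le:
  assumes "integrable \<nu> f" shows "norm (LINT \<zeta>|\<nu>. f \<zeta> * cnj \<zeta> ^ n) \<le> (LINT \<zeta>|\<nu>. norm (f \<zeta>))"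
proof -
  have "norm (LINT \<zeta>|\<nu>. f \<zeta> * cnj \<zeta> ^ n) \<le> (LINT \<zeta>|\<nu>. norm (f \<zeta> * cnj \<zeta> ^ n))"
    by (rule integral_norm_bound)
  also have "\<dots> \<le> (LINT \<zeta>|\<nu>. norm (f \<zeta>))"
    by (intro integral_mono integrable_norm assms integrable_mult_cnj_power)
       (auto simp: norm_mult norm_power intro!: mult_left_le power_le_one)
  finally show ?thesis .
qed

lemma proj_coeff_series:
  assumes "integrable \<nu> f" shows "disc_series (proj_coeff f)"
  unfolding disc_series_def
proof
  fix \<rho> :: real assume r: "\<rho> \<in> {0..<1}"
  define A where "A = (LINT \<zeta>|\<nu>. norm (f \<zeta>))"
  have S: "summable (\<lambda>n. kernel_coeff n * \<rho> ^ n * A)" using kernel_coeff_summable[of \<rho>] r by (intro summable_mult2) auto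
  show "summable (\<lambda>n. norm (proj_coeff f n) * \<rho> ^ n)"
  proof (rule summable_comparison_test[OF _ S], intro exI[of _ 0] allI impI)
    fix n
    have "norm (proj_coeff f n) \<le> kernel_coeff n * A"
      unfolding proj_coeff_def A_def norm_mult norm_of_real using norm_integral_cnj_power_le[OF assms, of n] kernel_coeff_pos[of n]
      by (intro mult_mono) auto
    hence "norm (proj_coeff f n) * \<rho> ^ n \<le> kernel_coeff n * A * \<rho> ^ n" using r by (intro mult_right_mono) auto
    thus "norm (norm (proj_coeff f n) * \<rho> ^ n) \<le> kernel_coeff n * \<rho> ^ n * A" using r by (simp add: mult_ac)
  qed
qed

text \<open>The kernel coefficients are real, so conjugating the kernel only conjugates its
  argument; the series is then integrated term by term.\<close>

lemma Bergman_proj_eq: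
  assumes f: "integrable \<nu> f" and z: "z \<in> \<D>"
  shows "Bergman_proj \<omega> f z = psum (proj_coeff f) z"
proof -
  have s: "summable (\<lambda>n. norm (kernel_coeffs n * z ^ n))" by (rule disc_series_summable(1)[OF kernel_coeffs_series z])
  note I = integral_psum_cnj[OF f s, unfolded psum_scale]
  have k: "cnj (psum kernel_coeffs (cnj z * \<zeta>)) = psum kernel_coeffs (z * cnj \<zeta>)" if "\<zeta> \<in> \<D>" for \<zeta>
  proof -
    have "norm z * norm \<zeta> \<le> norm z * 1" using that by (intro mult_left_mono) auto
    hence "cnj z * \<zeta> \<in> \<D>" using z by (simp add: norm_mult)
    from psum_cnj_real[of kernel_coeffs, OF _ kernel_coeffs_series this] show ?thesis by simp
  qed
  have "Bergman_proj \<omega> f z = (LINT \<zeta>|dA. \<omega> (norm \<zeta>) *\<^sub>R (f \<zeta> * psum kernel_coeffs (z * cnj \<zeta>)))"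
    unfolding Bergman_proj_def Bergman_kernel_eq
  proof (rule Bochner_Integration.integral_cong[OF refl])
    fix \<zeta> assume "\<zeta> \<in> space dA"
    hence z: "\<zeta> \<in> \<D>" by simp
    show "f \<zeta> * cnj (psum kernel_coeffs (cnj z * \<zeta>)) * of_real (\<omega> (norm \<zeta>)) = \<omega> (norm \<zeta>) *\<^sub>R (f \<zeta> * psum kernel_coeffs (z * cnj \<zeta>))"
      unfolding k[OF z] by (simp add: scaleR_conv_of_real)
  qed
  also have "\<dots> = (LINT \<zeta>|\<nu>. f \<zeta> * psum kernel_coeffs (z * cnj \<zeta>))"
    by (rule integral_nu(1)[symmetric]) (use I(1) in simp)
  also have "\<dots> = psum (proj_coeff f) z"
    using I(2) by (simp add: sums_iff psum_def proj_coeff_def mult_ac)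
  finally show ?thesis .
qed

lemma psum_summable_integrable:
  assumes c: "summable (\<lambda>n. norm (c n))"
  shows "integrable \<nu> (psum c)"
proof (rule disc.integrable_const_bound)
  have le: "norm (c n * z ^ n) \<le> norm (c n)" if "z \<in> \<D>" for z n
  proof -
    have "norm (c n) * norm z ^ n \<le> norm (c n) * 1" using that by (intro mult_left_mono power_le_one) auto
    thus ?thesis by (simp add: norm_mult norm_power)
  qed
  have s: "summable (\<lambda>n. norm (c n * z ^ n))" if "z \<in> \<D>" for z
    by (rule summable_comparison_test[OF _ c]) (use le[OF that] in auto)
  hence "disc_series c" by (intro disc_seriesI) (auto intro: summable_norm_cancel)
  thus "psum c \<in> borel_measurable \<nu>"
    by (intro measurable_nu_continuous holomorphic_on_imp_continuous_on psum_holomorphic)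
  show "AE z in \<nu>. norm (psum c z) \<le> (\<Sum>n. norm (c n))"
  proof (rule AE_I2)
    fix z assume "z \<in> space \<nu>"
    hence z: "z \<in> \<D>" by simp
    have "norm (psum c z) \<le> (\<Sum>n. norm (c n * z ^ n))" unfolding psum_def by (rule summable_norm[OF s[OF z]])
    also have "\<dots> \<le> (\<Sum>n. norm (c n))" by (rule suminf_le[OF le[OF z] s[OF z] c])
    finally show "norm (psum c z) \<le> (\<Sum>n. norm (c n))" .
  qed
qed

lemma kernel_derivative_integrable:
  assumes "w \<in> \<D>"
  shows "integrable \<nu> (\<lambda>\<zeta>. psum (diffs kernel_coeffs) (w * \<zeta>))" "integrable \<nu> (\<lambda>\<zeta>. \<zeta> * psum (diffs kernel_coeffs) (w * \<zeta>))"
proof -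
  have "summable (\<lambda>n. norm (diffs kernel_coeffs n * w ^ n))"
    by (rule disc_series_summable(1)[OF disc_series_diffs[OF kernel_coeffs_series] assms])
  from psum_summable_integrable[OF this] show i: "integrable \<nu> (\<lambda>\<zeta>. psum (diffs kernel_coeffs) (w * \<zeta>))"
    unfolding psum_scale[abs_def] .
  have [measurable]: "(\<lambda>\<zeta>. psum (diffs kernel_coeffs) (w * \<zeta>)) \<in> borel_measurable \<nu>" using i by simp
  show "integrable \<nu> (\<lambda>\<zeta>. \<zeta> * psum (diffs kernel_coeffs) (w * \<zeta>))"
    by (rule Bochner_Integration.integrable_bound[OF i], measurable, rule AE_I2)
       (auto simp: norm_mult intro!: mult_left_le_one_le)
qed

text \<open>Differentiating the kernel brings down a factor \<open>cnj \<zeta>\<close>. Its modulus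
  is kept inside the integral, because exactly this expression is later recognised as the norm of
  the function with coefficients \<open>kernel_deriv_coeff z\<close>.\<close>

lemma proj_deriv_bound:
  assumes f: "f \<in> borel_measurable \<nu>" "AE \<zeta> in \<nu>. norm (f \<zeta>) \<le> M" and z: "z \<in> \<D>"
  shows "norm (deriv (psum (proj_coeff f)) z) \<le> M * (LINT \<zeta>|\<nu>. norm (\<zeta> * psum (diffs kernel_coeffs) (cnj z * \<zeta>)))"
proof -
  have cz: "cnj z \<in> \<D>" using z by simp
  have fi: "integrable \<nu> f" using f by (rule disc.integrable_const_bound[rotated])
  define e where "e = diffs kernel_coeffs"
  have de: "disc_series e" unfolding e_def by (intro disc_series_diffs kernel_coeffs_series)
  have s: "summable (\<lambda>n. norm (e n * z ^ n))" by (rule disc_series_summable(1)[OF de z])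
  have fi1: "integrable \<nu> (\<lambda>\<zeta>. f \<zeta> * cnj \<zeta>)" using integrable_mult_cnj_power[OF fi, of 1] by simp
  note I = integral_psum_cnj[OF fi1 s, unfolded psum_scale]
  have nk: "norm (psum e (z * cnj \<zeta>)) = norm (psum e (cnj z * \<zeta>))" if "\<zeta> \<in> \<D>" for \<zeta>
  proof -
    have "norm z * norm \<zeta> \<le> norm z * 1" using that by (intro mult_left_mono) auto
    hence "cnj z * \<zeta> \<in> \<D>" using z by (simp add: norm_mult)
    from psum_cnj_real[of e, OF _ de this] have "psum e (z * cnj \<zeta>) = cnj (psum e (cnj z * \<zeta>))"
      unfolding e_def by (simp add: diffs_of_real_cnj)
    thus ?thesis by simp
  qed
  have "(\<lambda>n. diffs (proj_coeff f) n * z ^ n) sums (LINT \<zeta>|\<nu>. f \<zeta> * cnj \<zeta> * psum e (z * cnj \<zeta>))"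
    using I(2) by (simp add: diffs_def proj_coeff_def e_def mult_ac)
  hence "deriv (psum (proj_coeff f)) z = (LINT \<zeta>|\<nu>. f \<zeta> * cnj \<zeta> * psum e (z * cnj \<zeta>))"
    using proj_coeff_series[OF fi] z by (simp add: deriv_psum psum_def sums_iff)
  also have "norm \<dots> \<le> (LINT \<zeta>|\<nu>. norm (f \<zeta> * cnj \<zeta> * psum e (z * cnj \<zeta>)))" by (rule integral_norm_bound)
  also have "\<dots> \<le> (LINT \<zeta>|\<nu>. M * norm (\<zeta> * psum e (cnj z * \<zeta>)))"
  proof (rule integral_mono_AE)
    show "integrable \<nu> (\<lambda>\<zeta>. norm (f \<zeta> * cnj \<zeta> * psum e (z * cnj \<zeta>)))" by (rule integrable_norm[OF I(1)])
    show "integrable \<nu> (\<lambda>\<zeta>. M * norm (\<zeta> * psum e (cnj z * \<zeta>)))"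
      unfolding e_def by (intro integrable_mult_right integrable_norm kernel_derivative_integrable(2)[OF cz])
    have "AE \<zeta> in \<nu>. \<zeta> \<in> space \<nu>" by (rule AE_space)
    with f(2) show "AE \<zeta> in \<nu>. norm (f \<zeta> * cnj \<zeta> * psum e (z * cnj \<zeta>)) \<le> M * norm (\<zeta> * psum e (cnj z * \<zeta>))"
    proof eventually_elim
      case (elim \<zeta>)
      have z: "\<zeta> \<in> \<D>" using elim by simp
      have "norm (f \<zeta>) * (norm \<zeta> * norm (psum e (cnj z * \<zeta>))) \<le> M * (norm \<zeta> * norm (psum e (cnj z * \<zeta>)))"
        using elim by (intro mult_right_mono) auto
      thus ?case using nk[OF z] by (simp add: norm_mult mult.assoc)
    qed
  qed
  finally show ?thesis by (simp add: e_def)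
qed

lemma proj_bounded:
  assumes "\<omega> \<in> D_hat"
  obtains C where "C > 0" "\<And>(f :: complex \<Rightarrow> complex) M. f \<in> borel_measurable \<nu> \<Longrightarrow> AE \<zeta> in \<nu>. norm (f \<zeta>) \<le> M \<Longrightarrow> 0 \<le> M \<Longrightarrow>
    psum (proj_coeff f) \<in> Bloch \<and> Bloch_norm (psum (proj_coeff f)) \<le> C * M"
proof -
  obtain K where K: "K > 0"
    "\<And>w. w \<in> \<D> \<Longrightarrow> integrable \<nu> (\<lambda>\<zeta>. psum (diffs kernel_coeffs) (w * \<zeta>))"
    "\<And>w. w \<in> \<D> \<Longrightarrow> (LINT \<zeta>|\<nu>. norm (psum (diffs kernel_coeffs) (w * \<zeta>))) \<le> K / (1 - norm w)"
    by (rule kernel_derivative_L1[OF assms]) blast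
  define V where "V = measure \<nu> \<D>"
  show thesis
  \<comment> \<open>The 2 comes from \<open>1 - (norm z)^2 <= 2 * (1 - norm z)\<close>; the second
    summand takes care of the value at 0.\<close>
  proof (rule that[of "2 * K + kernel_coeff 0 * V"])
    show "2 * K + kernel_coeff 0 * V > 0" using K kernel_coeff_pos[of 0] by (auto simp: V_def intro!: add_pos_nonneg)
    fix f :: "complex \<Rightarrow> complex" and M assume f: "f \<in> borel_measurable \<nu>" "AE \<zeta> in \<nu>. norm (f \<zeta>) \<le> M" and M: "0 \<le> M"
    have fi: "integrable \<nu> f" using f by (rule disc.integrable_const_bound[rotated])
    have b: "norm (deriv (psum (proj_coeff f)) z) * (1 - (norm z)\<^sup>2) \<le> 2 * K * M" if z: "z \<in> \<D>" for z
    proof -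
      have cz: "cnj z \<in> \<D>" using z by simp
      have "norm (deriv (psum (proj_coeff f)) z) \<le> M * (LINT \<zeta>|\<nu>. norm (\<zeta> * psum (diffs kernel_coeffs) (cnj z * \<zeta>)))"
        by (rule proj_deriv_bound[OF f z])
      also have "\<dots> \<le> M * (LINT \<zeta>|\<nu>. norm (psum (diffs kernel_coeffs) (cnj z * \<zeta>)))"
        using M kernel_derivative_integrable[OF cz]
        by (intro mult_left_mono integral_mono integrable_norm) (auto simp: norm_mult intro!: mult_left_le_one_le)
      also have "\<dots> \<le> M * (K / (1 - norm z))" using K(3)[OF cz] M by (intro mult_left_mono) auto
      finally have "norm (deriv (psum (proj_coeff f)) z) * (1 - (norm z)\<^sup>2) \<le> M * (K / (1 - norm z)) * (1 - (norm z)\<^sup>2)"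
        using one_minus_norm_sq[OF z] by (intro mult_right_mono) auto
      also have "M * (K / (1 - norm z)) * (1 - (norm z)\<^sup>2) = M * K * (1 + norm z)"
      proof -
        have "1 - (norm z)\<^sup>2 = (1 - norm z) * (1 + norm z)" by (simp add: power2_eq_square algebra_simps)
        thus ?thesis using z by simp
      qed
      also have "\<dots> \<le> M * K * 2" using z M K by (intro mult_left_mono) auto
      finally show ?thesis by (simp add: mult_ac)
    qed
    note B = BlochI[OF psum_holomorphic[OF proj_coeff_series[OF fi]] b]
    have "norm (psum (proj_coeff f) 0) \<le> kernel_coeff 0 * (V * M)"
    proof -
      have "norm (LINT \<zeta>|\<nu>. f \<zeta> * cnj \<zeta> ^ 0) \<le> (LINT \<zeta>|\<nu>. norm (f \<zeta>))" by (rule norm_integral_cnj_power_le[OF fi])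
      also have "\<dots> \<le> (LINT \<zeta>|\<nu>. M)" by (rule integral_mono_AE[OF integrable_norm[OF fi] _ f(2)]) simp
      finally show ?thesis using kernel_coeff_pos[of 0]
        by (simp add: psum_zero proj_coeff_def norm_mult V_def)
    qed
    hence "Bloch_norm (psum (proj_coeff f)) \<le> (2 * K + kernel_coeff 0 * V) * M" using B(2) by (simp add: algebra_simps)
    thus "psum (proj_coeff f) \<in> Bloch \<and> Bloch_norm (psum (proj_coeff f)) \<le> (2 * K + kernel_coeff 0 * V) * M"
      using B(1) by blast
  qed
qed

text \<open>
  The bounded functions \<open>- 2 \<i> Im (Ln (1 - \<rho> \<zeta> / |\<zeta>|))\<close> have Fourier coefficients \<open>\<rho> ^ n / n\<close>;
  testing the projection on them is Hardy's inequality in disguise.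
\<close>

definition hardy_log :: "real \<Rightarrow> complex \<Rightarrow> complex"
  where "hardy_log \<rho> \<zeta> = - Ln (1 - of_real \<rho> * sgn \<zeta>)"

definition hardy_test :: "real \<Rightarrow> complex \<Rightarrow> complex"
  where "hardy_test \<rho> \<zeta> = hardy_log \<rho> \<zeta> - cnj (hardy_log \<rho> \<zeta>)"

text \<open>The imaginary part of a logarithm is bounded uniformly in \<rho>, while the logarithm
  itself is not as \<rho> tends to 1; this is why the conjugate is subtracted.\<close>

lemma hardy_test_bound:
  assumes "0 < \<rho>" "\<rho> < 1"
  shows "norm (hardy_test \<rho> \<zeta>) \<le> 2 * pi"
proof -
  define w where "w = 1 - of_real \<rho> * sgn \<zeta>"
  have "norm (of_real \<rho> * sgn \<zeta>) \<le> \<rho>" using assms by (simp add: norm_mult norm_sgn)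
  hence "w \<noteq> 0" using assms unfolding w_def by auto
  hence "\<bar>Im (Ln w)\<bar> \<le> pi" using mpi_less_Im_Ln[of w] Im_Ln_le_pi[of w] by auto
  moreover have "norm (hardy_test \<rho> \<zeta>) = 2 * \<bar>Im (Ln w)\<bar>"
  proof -
    have "hardy_test \<rho> \<zeta> = - (Ln w - cnj (Ln w))" by (simp add: hardy_test_def hardy_log_def w_def)
    also have "Ln w - cnj (Ln w) = of_real (2 * Im (Ln w)) * \<i>" by (rule complex_diff_cnj)
    finally show ?thesis by (simp add: norm_mult)
  qed
  ultimately show ?thesis by simp
qed

text \<open>Depends on the radius so that multiplication by \<open>\<zeta> ^ m\<close> yields
  \<open>(\<rho> * sgn \<zeta>) ^ m / m\<close>. Division by zero being 0, the term m = 0 vanishes,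
  and at the origin all terms do, in accordance with \<open>sgn 0 = 0\<close>.\<close>

definition hardy_coeff :: "real \<Rightarrow> nat \<Rightarrow> real \<Rightarrow> complex"
  where "hardy_coeff \<rho> m r = (of_real \<rho> / of_real r) ^ m / of_nat m"

lemma hardy_coeff_measurable: "hardy_coeff \<rho> m \<in> borel_measurable borel"
  unfolding hardy_coeff_def[abs_def] by measurable

lemma hardy_coeff_mult: "hardy_coeff \<rho> m (norm \<zeta>) * \<zeta> ^ m = (of_real \<rho> * sgn \<zeta>) ^ m / of_nat m"
  by (simp add: hardy_coeff_def sgn_div_norm scaleR_conv_of_real power_mult_distrib power_divide field_simps)

lemma hardy_log_sums:
  assumes "0 < \<rho>" "\<rho> < 1"
  shows "(\<lambda>m. hardy_coeff \<rho> m (norm \<zeta>) * \<zeta> ^ m) sums hardy_log \<rho> \<zeta>"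
    and "norm (hardy_coeff \<rho> m (norm \<zeta>) * \<zeta> ^ m) \<le> \<rho> ^ m"
proof -
  define w where "w = complex_of_real \<rho> * sgn \<zeta>"
  have w: "norm w \<le> \<rho>" using assms by (simp add: w_def norm_mult norm_sgn)
  have "(\<lambda>n. - ((- (- w)) ^ n) / of_nat n) sums ln (1 + (- w))"
    by (rule Ln_series') (use w assms in auto)
  hence "(\<lambda>n. - (- ((- (- w)) ^ n) / of_nat n)) sums (- ln (1 + (- w)))" by (rule sums_minus)
  thus "(\<lambda>m. hardy_coeff \<rho> m (norm \<zeta>) * \<zeta> ^ m) sums hardy_log \<rho> \<zeta>"
    by (simp add: hardy_coeff_mult hardy_log_def w_def)
  show "norm (hardy_coeff \<rho> m (norm \<zeta>) * \<zeta> ^ m) \<le> \<rho> ^ m"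
  proof (cases "m = 0")
    case True
    thus ?thesis by (simp add: hardy_coeff_def)
  next
    case False
    have "norm w ^ m / real m \<le> \<rho> ^ m / 1"
      using w assms False by (intro frac_le power_mono) auto
    thus ?thesis by (simp add: hardy_coeff_mult w_def[symmetric] norm_divide norm_power)
  qed
qed

text \<open>Subtracting the conjugate does no harm at positive frequencies: its contribution is the
  conjugate of the integral of \<open>hardy_log \<rho> \<zeta> * \<zeta> ^ n\<close>, a series
  without constant term.\<close>

lemma hardy_test_integral:
  assumes \<rho>: "0 < \<rho>" "\<rho> < 1" and n: "n > 0"
  shows "(LINT \<zeta>|\<nu>. hardy_test \<rho> \<zeta> * cnj \<zeta> ^ n) = of_real (\<rho> ^ n / real n * (2 * moment \<omega> (real n + 1)))"
    and "hardy_test \<rho> \<in> borel_measurable \<nu>"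
proof -
  have sg: "summable (\<lambda>m. \<rho> ^ m)" using \<rho> by (simp add: summable_geometric)
  note bd = hardy_log_sums(2)[OF \<rho>]
  have eq: "hardy_log \<rho> \<zeta> = (\<Sum>m. hardy_coeff \<rho> m (norm \<zeta>) * \<zeta> ^ m)" for \<zeta>
    using hardy_log_sums(1)[OF \<rho>, of \<zeta>] by (simp add: sums_iff)
  note CI = coefficient_integral[of "hardy_coeff \<rho>", OF hardy_coeff_measurable bd sg, folded eq]
  have li: "integrable \<nu> (hardy_log \<rho>)" using CI(1) by simp
  hence [measurable]: "hardy_log \<rho> \<in> borel_measurable \<nu>" by simp
  have cm[measurable]: "cnj \<in> borel_measurable borel" by (intro borel_measurable_continuous_onI continuous_intros)
  have [measurable]: "(\<lambda>\<zeta>. cnj (hardy_log \<rho> \<zeta>)) \<in> borel_measurable \<nu>" by measurable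
  show "hardy_test \<rho> \<in> borel_measurable \<nu>" unfolding hardy_test_def[abs_def] by measurable
  have A: "(LINT \<zeta>|\<nu>. hardy_log \<rho> \<zeta> * cnj \<zeta> ^ n) = of_real (\<rho> ^ n / real n * (2 * moment \<omega> (real n + 1)))"
  proof -
    have "(LINT \<zeta>|\<nu>. hardy_log \<rho> \<zeta> * cnj \<zeta> ^ n) = (LINT \<zeta>|\<nu>. hardy_coeff \<rho> n (norm \<zeta>) * of_real (norm \<zeta> ^ (2 * n)))"
      by (rule CI(2))
    also have "\<dots> = (LINT \<zeta>|\<nu>. of_real (\<rho> ^ n / real n * norm \<zeta> ^ n))"
    proof (rule Bochner_Integration.integral_cong[OF refl])
      fix \<zeta> :: complex
      show "hardy_coeff \<rho> n (norm \<zeta>) * of_real (norm \<zeta> ^ (2 * n)) = of_real (\<rho> ^ n / real n * norm \<zeta> ^ n)"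
        using n by (cases "\<zeta> = 0") (simp_all add: hardy_coeff_def power_divide mult_2 power_add)
    qed
    also have "\<dots> = of_real (\<rho> ^ n / real n * (LINT \<zeta>|\<nu>. norm \<zeta> ^ n))"
      by (simp only: integral_complex_of_real integral_mult_right_zero)
    finally show ?thesis by (simp only: nu_moment_nat)
  qed
  have B: "(LINT \<zeta>|\<nu>. hardy_log \<rho> \<zeta> * \<zeta> ^ n) = 0"
  proof -
    define \<beta> where "\<beta> m = (if m < n then (\<lambda>r. 0) else hardy_coeff \<rho> (m - n))" for m
    have bm: "\<beta> m \<in> borel_measurable borel" for m by (auto simp: \<beta>_def hardy_coeff_measurable)
    define B where "B m = (if m < n then 0 else \<rho> ^ (m - n))" for m
    have SB: "summable B"
      using sg by (subst summable_iff_shift[of _ n, symmetric]) (simp add: B_def)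
    have bb: "norm (\<beta> m (norm \<zeta>) * \<zeta> ^ m) \<le> B m" if "\<zeta> \<in> \<D>" for m \<zeta>
    proof (cases "m < n")
      case False
      have "\<zeta> ^ m = \<zeta> ^ (m - n) * \<zeta> ^ n" using False by (simp add: power_add[symmetric])
      hence "norm (\<beta> m (norm \<zeta>) * \<zeta> ^ m) = norm (hardy_coeff \<rho> (m - n) (norm \<zeta>) * \<zeta> ^ (m - n)) * norm \<zeta> ^ n"
        using False by (simp add: \<beta>_def norm_mult norm_power)
      also have "\<dots> \<le> \<rho> ^ (m - n) * 1" using bd[of "m - n" \<zeta>] that \<rho> by (intro mult_mono power_le_one) auto
      finally show ?thesis using False by (simp add: B_def)
    qed (simp add: \<beta>_def B_def)
    have s: "(\<lambda>m. \<beta> m (norm \<zeta>) * \<zeta> ^ m) sums (hardy_log \<rho> \<zeta> * \<zeta> ^ n)" for \<zeta>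
    proof -
      have "(\<lambda>m. \<beta> (m + n) (norm \<zeta>) * \<zeta> ^ (m + n)) sums (hardy_log \<rho> \<zeta> * \<zeta> ^ n)"
        using sums_mult2[OF hardy_log_sums(1)[OF \<rho>, of \<zeta>], of "\<zeta> ^ n"] by (simp add: \<beta>_def power_add mult_ac)
      moreover have "(\<Sum>m<n. \<beta> m (norm \<zeta>) * \<zeta> ^ m) = 0" by (rule sum.neutral) (auto simp: \<beta>_def)
      ultimately show ?thesis
        using sums_iff_shift[of "\<lambda>m. \<beta> m (norm \<zeta>) * \<zeta> ^ m" n "hardy_log \<rho> \<zeta> * \<zeta> ^ n"] by simp
    qed
    have "(LINT \<zeta>|\<nu>. (\<Sum>m. \<beta> m (norm \<zeta>) * \<zeta> ^ m) * cnj \<zeta> ^ 0) = (LINT \<zeta>|\<nu>. \<beta> 0 (norm \<zeta>) * of_real (norm \<zeta> ^ (2 * 0)))"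
      by (rule coefficient_integral(2)[OF bm bb SB])
    thus ?thesis using s n by (simp add: \<beta>_def sums_iff)
  qed
  have i1: "integrable \<nu> (\<lambda>\<zeta>. hardy_log \<rho> \<zeta> * cnj \<zeta> ^ n)" by (rule integrable_mult_cnj_power[OF li])
  have i2: "integrable \<nu> (\<lambda>\<zeta>. cnj (hardy_log \<rho> \<zeta>) * cnj \<zeta> ^ n)"
    using li by (intro integrable_mult_cnj_power) simp
  have "(LINT \<zeta>|\<nu>. cnj (hardy_log \<rho> \<zeta>) * cnj \<zeta> ^ n) = (LINT \<zeta>|\<nu>. cnj (hardy_log \<rho> \<zeta> * \<zeta> ^ n))" by simp
  also have "\<dots> = cnj (LINT \<zeta>|\<nu>. hardy_log \<rho> \<zeta> * \<zeta> ^ n)" using Bochner_Integration.integral_cnj[of \<nu> "\<lambda>\<zeta>. hardy_log \<rho> \<zeta> * \<zeta> ^ n"] by simp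
  also have "\<dots> = 0" by (simp add: B)
  finally have B': "(LINT \<zeta>|\<nu>. cnj (hardy_log \<rho> \<zeta>) * cnj \<zeta> ^ n) = 0" .
  have "(LINT \<zeta>|\<nu>. hardy_test \<rho> \<zeta> * cnj \<zeta> ^ n) = (LINT \<zeta>|\<nu>. hardy_log \<rho> \<zeta> * cnj \<zeta> ^ n - cnj (hardy_log \<rho> \<zeta>) * cnj \<zeta> ^ n)"
    by (simp add: hardy_test_def algebra_simps)
  also have "\<dots> = of_real (\<rho> ^ n / real n * (2 * moment \<omega> (real n + 1)))"
    by (subst Bochner_Integration.integral_diff[OF i1 i2]) (simp only: A B' diff_0_right)
  finally show "(LINT \<zeta>|\<nu>. hardy_test \<rho> \<zeta> * cnj \<zeta> ^ n) = of_real (\<rho> ^ n / real n * (2 * moment \<omega> (real n + 1)))" .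
qed

text \<open>For the logarithmic test functions the derivative of the projection has the positive
  coefficients \<open>\<rho> ^ (n + 1) * q n\<close>, so nothing cancels at a positive point
  \<open>x\<close> and the Bloch bound controls the sum of \<open>x ^ n * q n\<close> by
  \<open>B / (1 - x)\<close>. Restricting the sum to a window of n of length comparable to
  \<open>1 / (1 - x)\<close> bounds a single quotient of moments.\<close>

lemma proj_bounded_imp_D_hat:
  assumes B: "\<And>f z. f \<in> borel_measurable \<nu> \<Longrightarrow> (\<And>\<zeta>. norm (f \<zeta>) \<le> 2 * pi) \<Longrightarrow> z \<in> \<D> \<Longrightarrow>
    norm (deriv (psum (proj_coeff f)) z) * (1 - (norm z)\<^sup>2) \<le> B"
  shows "\<omega> \<in> D_hat"
proof -
  define q where "q n = moment \<omega> (real n + 2) / moment \<omega> (2 * real n + 3)" for n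
  have mp: "moment \<omega> (real n + 2) > 0" "moment \<omega> (2 * real n + 3) > 0" for n :: nat
    by (auto intro!: moment_pos)
  have q0: "q n > 0" for n using mp[of n] by (simp add: q_def)
  have B0: "B \<ge> 0"
  proof -
    have "norm (deriv (psum (proj_coeff (\<lambda>_. 0))) 0) * (1 - (norm (0::complex))\<^sup>2) \<le> B" by (rule B) auto
    thus ?thesis by (simp add: order_trans[OF norm_ge_zero])
  qed
  have part: "(\<Sum>n<N. \<rho> ^ (n + 1) * x ^ n * q n) \<le> B / (1 - x)" if \<rho>: "0 < \<rho>" "\<rho> < 1" and x: "0 \<le> x" "x < 1" for \<rho> x N
  proof -
    note HT = hardy_test_integral[OF \<rho>]
    have fm: "hardy_test \<rho> \<in> borel_measurable \<nu>" using HT(2)[of 1] by simp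
    have fi: "integrable \<nu> (hardy_test \<rho>)"
      by (rule disc.integrable_const_bound[of _ "2 * pi"]) (use fm hardy_test_bound[OF \<rho>] in auto)
    have xd: "complex_of_real x \<in> \<D>" using x by simp
    have co: "diffs (proj_coeff (hardy_test \<rho>)) n = of_real (\<rho> ^ (n + 1) * q n)" for n
    proof -
      have "proj_coeff (hardy_test \<rho>) (Suc n) = of_real (kernel_coeff (Suc n) * (\<rho> ^ (Suc n) / real (Suc n) * (2 * moment \<omega> (real (Suc n) + 1))))"
        unfolding proj_coeff_def by (subst HT(1)) (simp_all only: of_real_mult zero_less_Suc)
      hence "diffs (proj_coeff (hardy_test \<rho>)) n = of_real (real (Suc n) * (kernel_coeff (Suc n) * (\<rho> ^ (Suc n) / real (Suc n) * (2 * moment \<omega> (real (Suc n) + 1)))))"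
        by (simp only: diffs_def of_real_mult of_real_of_nat_eq)
      also have "real (Suc n) * (kernel_coeff (Suc n) * (\<rho> ^ (Suc n) / real (Suc n) * (2 * moment \<omega> (real (Suc n) + 1)))) = \<rho> ^ (n + 1) * q n"
      proof -
        have e: "s * (1 / (2 * Q) * (r / s * (2 * P))) = r * (P / Q)" if "s \<noteq> 0" for s r P Q :: real
          using that by simp
        have a: "2 * real (Suc n) + 1 = 2 * real n + 3" "real (Suc n) + 1 = real n + 2" by simp_all
        show ?thesis unfolding kernel_coeff_def q_def a by (subst e) simp_all
      qed
      finally show ?thesis .
    qed
    have S: "summable (\<lambda>n. norm (diffs (proj_coeff (hardy_test \<rho>)) n * of_real x ^ n))"
      by (rule disc_series_summable(1)[OF disc_series_diffs[OF proj_coeff_series[OF fi]] xd])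
    have nn: "norm (diffs (proj_coeff (hardy_test \<rho>)) n * of_real x ^ n) = \<rho> ^ (n + 1) * x ^ n * q n" for n
      unfolding co norm_mult norm_power norm_of_real using \<rho> x q0[of n] by (simp add: abs_mult mult_ac)
    have S': "summable (\<lambda>n. \<rho> ^ (n + 1) * x ^ n * q n)" using S unfolding nn .
    have "deriv (psum (proj_coeff (hardy_test \<rho>))) (of_real x) = (\<Sum>n. of_real (\<rho> ^ (n + 1) * x ^ n * q n))"
      using deriv_psum[OF proj_coeff_series[OF fi] xd] by (simp add: psum_def co mult_ac)
    also have "\<dots> = of_real (\<Sum>n. \<rho> ^ (n + 1) * x ^ n * q n)" by (rule suminf_of_real[OF S', symmetric])
    finally have d: "deriv (psum (proj_coeff (hardy_test \<rho>))) (of_real x) = of_real (\<Sum>n. \<rho> ^ (n + 1) * x ^ n * q n)" .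
    have "(\<Sum>n. \<rho> ^ (n + 1) * x ^ n * q n) \<le> norm (deriv (psum (proj_coeff (hardy_test \<rho>))) (of_real x))"
      unfolding d norm_of_real by simp
    also have "\<dots> \<le> B / (1 - x\<^sup>2)"
      using B[OF fm hardy_test_bound[OF \<rho>] xd] x power_less_one_iff[of x 2] by (simp add: pos_le_divide_eq)
    also have "\<dots> \<le> B / (1 - x)"
    proof (rule divide_left_mono)
      have "x\<^sup>2 \<le> x" using x by (simp add: power2_eq_square mult_left_le)
      thus "1 - x \<le> 1 - x\<^sup>2" "0 < (1 - x\<^sup>2) * (1 - x)" using x by auto
    qed (rule B0)
    finally have "(\<Sum>n. \<rho> ^ (n + 1) * x ^ n * q n) \<le> B / (1 - x)" .
    moreover have "(\<Sum>n<N. \<rho> ^ (n + 1) * x ^ n * q n) \<le> (\<Sum>n. \<rho> ^ (n + 1) * x ^ n * q n)"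
      using \<rho> x q0 by (intro sum_le_suminf[OF S']) (auto simp: less_imp_le)
    ultimately show ?thesis by linarith
  qed
  \<comment> \<open>The bound is uniform in \<rho>, and finite sums pass to the limit \<rho> =
    1.\<close>
  have part1: "(\<Sum>n<N. x ^ n * q n) \<le> B / (1 - x)" if x: "0 \<le> x" "x < 1" for x N
  proof (rule tendsto_upperbound)
    have "((\<lambda>\<rho>. \<Sum>n<N. \<rho> ^ (n + 1) * x ^ n * q n) \<longlongrightarrow> (\<Sum>n<N. 1 ^ (n + 1) * x ^ n * q n)) (at_left 1)"
      by (intro tendsto_intros)
    thus "((\<lambda>\<rho>. \<Sum>n<N. \<rho> ^ (n + 1) * x ^ n * q n) \<longlongrightarrow> (\<Sum>n<N. x ^ n * q n)) (at_left 1)" by simp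
    show "\<forall>\<^sub>F \<rho> in at_left 1. (\<Sum>n<N. \<rho> ^ (n + 1) * x ^ n * q n) \<le> B / (1 - x)"
      unfolding eventually_at_left_field using part x by (intro exI[of _ 0]) auto
  qed simp
  define A where "A = max 1 (64 * B)"
  have A: "A \<ge> 1" "64 * B \<le> A" by (auto simp: A_def)
  \<comment> \<open>For n from 4 m up to 5 m the numerator of \<open>q n\<close> is at least the
    moment of order \<open>5 * m + 2\<close>, the denominator at most that of order
    \<open>8 * m + 3\<close>. Twice the left end of the window must exceed its right end, or no gain
    in the order would remain.\<close>
  have key: "moment \<omega> (5 * real m + 2) \<le> A * moment \<omega> (8 * real m + 3)" if m: "m \<ge> 1" for m
  proof -
    \<comment> \<open>By Bernoulli's inequality \<open>x ^ (8 * m)\<close> is at least 1 / 16, while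
      \<open>1 / (1 - x)\<close> is just \<open>4 * m\<close>.\<close>
    define x where "x = 1 - 1 / (4 * real m)"
    have x: "0 \<le> x" "x < 1" using m by (auto simp: x_def field_simps)
    define M5 where "M5 = moment \<omega> (5 * real m + 2)"
    define M8 where "M8 = moment \<omega> (8 * real m + 3)"
    have M: "M5 > 0" "M8 > 0" by (auto simp: M5_def M8_def intro!: moment_pos)
    have x2: "x ^ (2 * m) \<ge> 1 / 2"
    proof -
      have "1 + real (2 * m) * (- (1 / (4 * real m))) \<le> (1 + (- (1 / (4 * real m)))) ^ (2 * m)"
        using m by (intro Bernoulli_inequality) (auto simp: field_simps)
      thus ?thesis using m by (simp add: x_def)
    qed
    have "(1 / 2) ^ 4 \<le> (x ^ (2 * m)) ^ 4" using x2 by (intro power_mono) auto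
    also have "(x ^ (2 * m)) ^ 4 = x ^ (8 * m)" by (simp add: power_mult[symmetric])
    finally have x8: "x ^ (8 * m) \<ge> 1 / 16" by (simp add: power4_eq_xxxx)
    have "real m * (1 / 16 * (M5 / M8)) = (\<Sum>n\<in>{4*m..<5*m}. 1 / 16 * (M5 / M8))" by simp
    also have "\<dots> \<le> (\<Sum>n\<in>{4*m..<5*m}. x ^ n * q n)"
    proof (rule sum_mono, rule mult_mono)
      fix n assume n: "n \<in> {4*m..<5*m}"
      have "x ^ (8 * m) \<le> x ^ n" using n x by (intro power_decreasing) auto
      thus "1 / 16 \<le> x ^ n" using x8 by linarith
      show "M5 / M8 \<le> q n" unfolding q_def M5_def M8_def
        using n mp[of n] by (intro frac_le moment_antimono moment_nonneg) auto
    qed (use M x in auto)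
    also have "\<dots> \<le> (\<Sum>n<5*m. x ^ n * q n)"
      using x q0 by (intro sum_mono2) (auto simp: less_imp_le)
    also have "\<dots> \<le> B / (1 - x)" by (rule part1[OF x])
    also have "\<dots> = 4 * B * real m" using m by (simp add: x_def)
    finally have "16 * (real m * (1 / 16 * (M5 / M8))) \<le> 16 * (4 * B * real m)" by (rule mult_left_mono) simp
    hence "real m * (M5 / M8) \<le> real m * (64 * B)" by (simp add: mult_ac)
    hence "M5 / M8 \<le> 64 * B" by (rule mult_left_le_imp_le) (use m in simp)
    hence "M5 \<le> 64 * B * M8" using M by (simp add: pos_divide_le_eq)
    also have "\<dots> \<le> A * M8" using A M by (intro mult_right_mono) auto
    finally show ?thesis by (simp add: M5_def M8_def)
  qed
  \<comment> \<open>Since 8 / 5 exceeds 3 / 2, rounding in \<open>m\<close> is absorbed once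
    \<open>8 / 5 * (y - 7) + 3 >= 3 / 2 * y\<close>, that is from 82 on. Two such steps multiply the
    order by 9 / 4, more than 2; orders below 82 are covered by the quotient
    \<open>R\<close>.\<close>
  have step: "moment \<omega> y \<le> A * moment \<omega> (3 / 2 * y)" if y: "y \<ge> 82" for y
  proof -
    define t where "t = (y - 2) / 5"
    define m where "m = nat \<lfloor>t\<rfloor>"
    have fl: "\<lfloor>t\<rfloor> \<ge> 1" using y by (simp add: le_floor_iff t_def)
    have mr: "real m = of_int \<lfloor>t\<rfloor>" "m \<ge> 1" unfolding m_def using fl by linarith+
    have "real m \<le> t" "t < real m + 1" unfolding mr(1) by linarith+
    hence m: "5 * real m + 2 \<le> y" "y < 5 * real m + 7" by (auto simp: t_def field_simps)
    have "moment \<omega> y \<le> moment \<omega> (5 * real m + 2)" using m by (intro moment_antimono) auto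
    also have "\<dots> \<le> A * moment \<omega> (8 * real m + 3)" by (rule key[OF mr(2)])
    also have "\<dots> \<le> A * moment \<omega> (3 / 2 * y)"
      using A y m by (intro mult_left_mono moment_antimono) auto
    finally show ?thesis .
  qed
  define R where "R = moment \<omega> 1 / moment \<omega> 164"
  have R: "R > 0" unfolding R_def using moment_pos by simp
  have "moment_doubling (max (A * A) R)"
    unfolding moment_doubling_def
  proof (intro conjI allI impI)
    have "1 * 1 \<le> A * A" using A by (intro mult_mono) auto
    thus "1 \<le> max (A * A) R" by simp
    fix x :: real assume x: "1 \<le> x"
    have m2: "moment \<omega> (2 * x) \<ge> 0" by (rule moment_nonneg)
    show "moment \<omega> x \<le> max (A * A) R * moment \<omega> (2 * x)"
    proof (cases "x \<ge> 82")
      case True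
      have "moment \<omega> x \<le> A * moment \<omega> (3 / 2 * x)" by (rule step[OF True])
      also have "\<dots> \<le> A * (A * moment \<omega> (3 / 2 * (3 / 2 * x)))" using A True by (intro mult_left_mono step) auto
      also have "\<dots> \<le> A * (A * moment \<omega> (2 * x))" using A x by (intro mult_left_mono moment_antimono) auto
      also have "\<dots> = (A * A) * moment \<omega> (2 * x)" by simp
      also have "\<dots> \<le> max (A * A) R * moment \<omega> (2 * x)" using m2 by (intro mult_right_mono) auto
      finally show ?thesis .
    next
      case False
      have "moment \<omega> x \<le> moment \<omega> 1" using x by (intro moment_antimono) auto
      also have "\<dots> = R * moment \<omega> 164" using moment_pos[of 164] by (simp add: R_def)
      also have "\<dots> \<le> R * moment \<omega> (2 * x)" using R False x by (intro mult_left_mono moment_antimono) auto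
      also have "\<dots> \<le> max (A * A) R * moment \<omega> (2 * x)" using m2 by (intro mult_right_mono) auto
      finally show ?thesis .
    qed
  qed
  thus ?thesis by (rule moment_doubling_D_hat)
qed

end

section \<open>Lacunary series\<close>

text \<open>Among the indices from p to 2 p - 1, p a power of two, only the last carries a term, and
  \<open>2 * p * x ^ (2 * p - 1)\<close> is at most twice the sum of \<open>x ^ n\<close> over these
  p indices. A geometric series thus dominates.\<close>

lemma lacunary_sum_le:
  fixes x :: real
  assumes x: "0 \<le> x" "x < 1"
  shows "(\<Sum>n<N. (if Suc n \<in> range (\<lambda>k. 2 ^ k) then (real n + 1) * x ^ n else 0)) \<le> 1 + 2 / (1 - x)"
proof -
  define a where "a n = (if Suc n \<in> range (\<lambda>k::nat. 2 ^ k) then (real n + 1) * x ^ n else 0)" for n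
  have a0: "a n \<ge> 0" for n using x by (simp add: a_def)
  have dy: "(\<Sum>n<2 ^ m. a n) \<le> 1 + 2 * (\<Sum>n<2 ^ m. x ^ n)" for m
  proof (induction m)
    case 0
    have "a 0 \<le> 1" by (simp add: a_def)
    thus ?case by simp
  next
    case (Suc m)
    define p where "p = (2::nat) ^ m"
    have p: "p \<ge> 1" by (simp add: p_def)
    have split: "{..<2 ^ Suc m} = {..<p} \<union> {p..<2 * p}" "{..<p} \<inter> {p..<2 * p} = {}" by (auto simp: p_def)
    have only: "a n = 0" if "n \<in> {p..<2 * p} - {2 * p - 1}" for n
    proof -
      have n: "p < Suc n" "Suc n < 2 * p" using that by auto
      have "Suc n \<noteq> 2 ^ k" for k :: nat
      proof
        assume e: "Suc n = 2 ^ k"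
        have "(2::nat) ^ m < 2 ^ k" "(2::nat) ^ k < 2 ^ Suc m" using n unfolding e p_def by simp_all
        hence "m < k" "k < Suc m" by (simp_all only: power_strict_increasing_iff one_less_numeral_iff semiring_norm)
        thus False by simp
      qed
      thus ?thesis by (auto simp: a_def)
    qed
    have "(\<Sum>n\<in>{p..<2 * p}. a n) = (\<Sum>n\<in>{2 * p - 1}. a n)"
      by (rule sum.mono_neutral_right) (use only p in auto)
    also have "\<dots> \<le> 2 * real p * x ^ (2 * p - 1)" using p x by (simp add: a_def of_nat_diff)
    also have "\<dots> = 2 * (\<Sum>n\<in>{p..<2 * p}. x ^ (2 * p - 1))" by simp
    also have "\<dots> \<le> 2 * (\<Sum>n\<in>{p..<2 * p}. x ^ n)"
      using x by (intro mult_left_mono sum_mono power_decreasing) auto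
    finally have "(\<Sum>n\<in>{p..<2 * p}. a n) \<le> 2 * (\<Sum>n\<in>{p..<2 * p}. x ^ n)" .
    with Suc show ?case unfolding split(1)
      by (subst (1 2) sum.union_disjoint) (use split(2) in \<open>auto simp: p_def\<close>)
  qed
  have "(\<Sum>n<N. a n) \<le> (\<Sum>n<2 ^ N. a n)"
    by (rule sum_mono2) (use a0 less_exp[of N] in \<open>auto intro: less_trans\<close>)
  also have "\<dots> \<le> 1 + 2 * (\<Sum>n<2 ^ N. x ^ n)" by (rule dy)
  also have "(\<Sum>n<2 ^ N. x ^ n) \<le> 1 / (1 - x)"
    using x by (simp add: sum_gp_strict divide_right_mono)
  finally show ?thesis by (simp add: a_def)
qed

definition lacunary :: "nat set \<Rightarrow> nat \<Rightarrow> complex"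
  where "lacunary S n = (if n \<in> S then 1 else 0)"

text \<open>One bound for all sets of powers of two, finite or infinite; 5 is the limit of
  \<open>1 + 2 * (1 + x)\<close> at the circle.\<close>

lemma lacunary_Bloch:
  assumes S: "S \<subseteq> range (\<lambda>k. 2 ^ k)"
  shows "disc_series (lacunary S)" "psum (lacunary S) \<in> Bloch" "Bloch_norm (psum (lacunary S)) \<le> 5"
proof -
  show ds: "disc_series (lacunary S)" unfolding disc_series_def
  proof
    fix \<rho> :: real assume "\<rho> \<in> {0..<1}"
    hence "summable (\<lambda>n. \<rho> ^ n)" "0 \<le> \<rho>" by (auto simp: summable_geometric)
    thus "summable (\<lambda>n. norm (lacunary S n) * \<rho> ^ n)"
      by (intro summable_comparison_test[OF _ \<open>summable (\<lambda>n. \<rho> ^ n)\<close>]) (auto simp: lacunary_def intro!: exI[of _ 0])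
  qed
  have b: "norm (deriv (psum (lacunary S)) z) * (1 - (norm z)\<^sup>2) \<le> 5" if z: "z \<in> \<D>" for z
  proof -
    define x where "x = norm z"
    have x: "0 \<le> x" "x < 1" using z by (auto simp: x_def)
    let ?f = "\<lambda>n. norm (diffs (lacunary S) n * z ^ n)"
    have sf: "summable ?f" by (rule disc_series_summable(1)[OF disc_series_diffs[OF ds] z])
    have "norm (psum (diffs (lacunary S)) z) \<le> (\<Sum>n. ?f n)"
      unfolding psum_def by (rule summable_norm[OF sf])
    also have "\<dots> \<le> 1 + 2 / (1 - x)"
    proof (rule suminf_le_const[OF sf])
      fix N
      have "(\<Sum>n<N. ?f n) \<le> (\<Sum>n<N. (if Suc n \<in> range (\<lambda>k::nat. 2 ^ k) then (real n + 1) * x ^ n else 0))"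
      proof (rule sum_mono)
        fix n
        have "?f n = (if Suc n \<in> S then (real n + 1) * x ^ n else 0)"
          unfolding norm_mult norm_diffs by (simp add: lacunary_def x_def norm_power)
        also have "\<dots> \<le> (if Suc n \<in> range (\<lambda>k::nat. 2 ^ k) then (real n + 1) * x ^ n else 0)"
          using S x by auto
        finally show "?f n \<le> (if Suc n \<in> range (\<lambda>k::nat. 2 ^ k) then (real n + 1) * x ^ n else 0)" .
      qed
      also have "\<dots> \<le> 1 + 2 / (1 - x)" by (rule lacunary_sum_le[OF x])
      finally show "(\<Sum>n<N. ?f n) \<le> 1 + 2 / (1 - x)" .
    qed
    finally have "norm (psum (diffs (lacunary S)) z) * (1 - x\<^sup>2) \<le> (1 + 2 / (1 - x)) * (1 - x\<^sup>2)"
      using one_minus_norm_sq[OF z] by (intro mult_right_mono) (auto simp: x_def)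
    also have "\<dots> = (1 - x\<^sup>2) + 2 * (1 + x)"
    proof -
      have "1 - x\<^sup>2 = (1 - x) * (1 + x)" by (simp add: power2_eq_square algebra_simps)
      hence "2 / (1 - x) * (1 - x\<^sup>2) = 2 * (1 + x)" using x by simp
      thus ?thesis by (simp only: distrib_right mult_1)
    qed
    also have "\<dots> \<le> 1 + 2 * 2" using x by (intro add_mono mult_left_mono) auto
    finally show ?thesis using z ds by (simp add: deriv_psum x_def)
  qed
  note B = BlochI[OF psum_holomorphic[OF ds] b]
  show "psum (lacunary S) \<in> Bloch" by (rule B(1))
  have "(0::nat) \<notin> range (\<lambda>k. 2 ^ k)" by auto
  hence "lacunary S 0 = 0" using S by (auto simp: lacunary_def)
  thus "Bloch_norm (psum (lacunary S)) \<le> 5" using B(2) by (simp add: psum_zero)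
qed

definition dyadic_block :: "nat \<Rightarrow> nat \<Rightarrow> nat set"
  where "dyadic_block j N = (\<lambda>k. 2 ^ (j + k)) ` {..<N}"

lemma dyadic_block: "finite (dyadic_block j N)" "card (dyadic_block j N) = N"
  "dyadic_block j N \<subseteq> range (\<lambda>k. 2 ^ k)" 
  "n \<in> dyadic_block j N \<Longrightarrow> 2 ^ j \<le> n \<and> n \<le> 2 ^ (j + N)"
proof -
  show "finite (dyadic_block j N)" by (simp add: dyadic_block_def)
  have "inj_on (\<lambda>k. (2::nat) ^ (j + k)) {..<N}" by (auto intro!: inj_onI)
  thus "card (dyadic_block j N) = N" by (simp add: dyadic_block_def card_image)
  show "dyadic_block j N \<subseteq> range (\<lambda>k. 2 ^ k)" by (auto simp: dyadic_block_def)
  show "n \<in> dyadic_block j N \<Longrightarrow> 2 ^ j \<le> n \<and> n \<le> 2 ^ (j + N)"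
    by (auto simp: dyadic_block_def intro!: power_increasing)
qed

lemma psum_lacunary_finite: "finite S \<Longrightarrow> psum (lacunary S) z = (\<Sum>n\<in>S. z ^ n)"
proof -
  assume S: "finite S"
  have "psum (lacunary S) z = (\<Sum>n. if n \<in> S then z ^ n else 0)"
    unfolding psum_def by (rule suminf_cong) (simp add: lacunary_def)
  also have "\<dots> = (\<Sum>n\<in>S. z ^ n)" using sums_If_finite_set[OF S, of "\<lambda>n. z ^ n"] by (simp add: sums_iff)
  finally show ?thesis .
qed

lemma strong_series_lacunary: "finite S \<Longrightarrow> strong_series (lacunary S)"
  by (rule strong_series_finite) (auto simp: lacunary_def elim: finite_subset[rotated])

context weighted_disc
begin

text \<open>The lowest power \<open>\<zeta> ^ p\<close> is factored out before Cauchy-Schwarz, so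
  that the weight \<open>norm \<zeta> ^ p\<close> and with it the moment of order
  \<open>p + 1\<close> occurs in both factors. Applied to the whole block, Cauchy-Schwarz would
  leave the total mass in one of them.\<close>

lemma lacunary_L1:
  assumes N: "N > 0"
  shows "(LINT \<zeta>|\<nu>. norm (psum (lacunary (dyadic_block j N)) \<zeta>)) \<le> 2 * sqrt (real N) * moment \<omega> (2 ^ j + 1)"
    and "integrable \<nu> (psum (lacunary (dyadic_block j N)))"
proof -
  define p where "p = (2::nat) ^ j"
  define T where "T = (\<lambda>n. n - p) ` dyadic_block j N"
  note db = dyadic_block[where j = j and N = N]
  have inj: "inj_on (\<lambda>n. n - p) (dyadic_block j N)"
  proof (rule inj_onI)
    fix x y assume "x \<in> dyadic_block j N" "y \<in> dyadic_block j N" "x - p = y - p"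
    moreover from this have "p \<le> x" "p \<le> y" using db(4) by (auto simp: p_def)
    ultimately show "x = y" by linarith
  qed
  have T: "finite T" "card T = N"
    unfolding T_def using db(1,2) card_image[OF inj] by simp_all
  define g where "g = psum (lacunary T)"
  have fac: "psum (lacunary (dyadic_block j N)) \<zeta> = \<zeta> ^ p * g \<zeta>" for \<zeta>
  proof -
    have "\<zeta> ^ p * g \<zeta> = (\<Sum>n\<in>T. \<zeta> ^ p * \<zeta> ^ n)" unfolding g_def psum_lacunary_finite[OF T(1)] by (simp add: sum_distrib_left)
    also have "\<dots> = (\<Sum>n\<in>dyadic_block j N. \<zeta> ^ p * \<zeta> ^ (n - p))" unfolding T_def by (subst sum.reindex[OF inj]) simp
    also have "\<dots> = (\<Sum>n\<in>dyadic_block j N. \<zeta> ^ n)"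
      using db(4) by (intro sum.cong) (auto simp: p_def power_add[symmetric])
    finally show ?thesis unfolding psum_lacunary_finite[OF db(1)] by simp
  qed
  define w where "w = 2 * moment \<omega> (real p + 1)"
  have w0: "w \<ge> 0" using moment_nonneg by (simp add: w_def)
  have h: "(\<lambda>r::real. min 1 \<bar>r\<bar> ^ p) \<in> borel_measurable borel" by measurable
  have H: "0 \<le> min 1 \<bar>r\<bar> ^ p \<and> min 1 \<bar>r\<bar> ^ p \<le> 1" for r :: real
    by (auto intro!: power_le_one)
  have mn: "min 1 \<bar>norm \<zeta>\<bar> ^ p = norm \<zeta> ^ p" if "\<zeta> \<in> \<D>" for \<zeta> :: complex using that by (simp add: min_def)
  note P = parseval[OF strong_series_norm[OF strong_series_lacunary[OF T(1)]] h, of 1, OF H, folded g_def]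
  define J where "J n = (LINT \<zeta>|\<nu>. norm \<zeta> ^ (2 * n) * min 1 \<bar>norm \<zeta>\<bar> ^ p)" for n
  have rad: "integrable \<nu> (\<lambda>\<zeta>. norm \<zeta> ^ k)" for k
    by (rule bounded_radial_integrable[of "\<lambda>r. r ^ k" 1]) (auto intro!: power_le_one simp: power_abs[symmetric])
  have J: "J n \<le> w" for n
  proof -
    have "J n = (LINT \<zeta>|\<nu>. norm \<zeta> ^ (2 * n + p))"
      unfolding J_def by (rule Bochner_Integration.integral_cong) (simp_all add: mn power_add)
    also have "\<dots> \<le> (LINT \<zeta>|\<nu>. norm \<zeta> ^ p)"
      by (intro integral_mono rad) (auto intro!: power_decreasing)
    also have "\<dots> = w" unfolding w_def by (rule nu_moment_nat)
    finally show ?thesis .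
  qed
  have "(\<lambda>n. (norm (lacunary T n))\<^sup>2 * J n) = (\<lambda>n. if n \<in> T then J n else 0)" by (auto simp: lacunary_def)
  hence "(LINT \<zeta>|\<nu>. (norm (g \<zeta>))\<^sup>2 * min 1 \<bar>norm \<zeta>\<bar> ^ p) = (\<Sum>n\<in>T. J n)"
    using P(2) sums_If_finite_set[OF T(1), of J] unfolding J_def[symmetric] by (simp add: sums_iff)
  also have "\<dots> \<le> real N * w" using sum_bounded_above[of T J w] J T by simp
  finally have G2: "(LINT \<zeta>|\<nu>. (norm (g \<zeta>))\<^sup>2 * min 1 \<bar>norm \<zeta>\<bar> ^ p) \<le> real N * w" .
  \<comment> \<open>The parameter of the weighted mean inequality; it balances
    \<open>real N * w / s\<close> against \<open>s * w\<close>.\<close>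
  define s where "s = sqrt (real N)"
  have s: "s > 0" "s * s = real N" using N by (auto simp: s_def)
  define R where "R \<zeta> = (1/2) * ((1 / s) * ((norm (g \<zeta>))\<^sup>2 * min 1 \<bar>norm \<zeta>\<bar> ^ p) + s * norm \<zeta> ^ p)" for \<zeta>
  have RI: "integrable \<nu> R" unfolding R_def[abs_def]
    by (intro integrable_mult_right Bochner_Integration.integrable_add P(1) rad)
  have pw: "norm (psum (lacunary (dyadic_block j N)) \<zeta>) \<le> R \<zeta>" if "\<zeta> \<in> \<D>" for \<zeta>
  proof -
    have "norm (g \<zeta>) \<le> (1/2) * ((1 / s) * (norm (g \<zeta>))\<^sup>2 + s)"
    proof -
      have "0 \<le> (norm (g \<zeta>) - s)\<^sup>2" by simp
      hence "2 * s * norm (g \<zeta>) \<le> (norm (g \<zeta>))\<^sup>2 + s * s" by (simp add: power2_eq_square algebra_simps)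
      hence "2 * s * norm (g \<zeta>) / s \<le> ((norm (g \<zeta>))\<^sup>2 + s * s) / s" using s by (intro divide_right_mono) auto
      thus ?thesis using s(1) by (simp add: add_divide_distrib)
    qed
    hence "norm \<zeta> ^ p * norm (g \<zeta>) \<le> norm \<zeta> ^ p * ((1/2) * ((1 / s) * (norm (g \<zeta>))\<^sup>2 + s))"
      by (intro mult_left_mono) auto
    also have "\<dots> = R \<zeta>" using mn[OF that] by (simp add: R_def algebra_simps)
    finally show ?thesis by (simp add: fac norm_mult norm_power)
  qed
  have ds: "disc_series (lacunary (dyadic_block j N))" using lacunary_Bloch(1)[OF db(3)] .
  show int: "integrable \<nu> (psum (lacunary (dyadic_block j N)))"
  proof (rule Bochner_Integration.integrable_bound[OF RI])
    show "psum (lacunary (dyadic_block j N)) \<in> borel_measurable \<nu>"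
      by (intro measurable_nu_continuous holomorphic_on_imp_continuous_on psum_holomorphic ds)
    show "AE \<zeta> in \<nu>. norm (psum (lacunary (dyadic_block j N)) \<zeta>) \<le> norm (R \<zeta>)"
      using pw by (intro AE_I2) (force intro: order_trans)
  qed
  have "(LINT \<zeta>|\<nu>. norm (psum (lacunary (dyadic_block j N)) \<zeta>)) \<le> (LINT \<zeta>|\<nu>. R \<zeta>)"
    using pw by (intro integral_mono integrable_norm int RI) auto
  also have "\<dots> = (1/2) * ((1 / s) * (LINT \<zeta>|\<nu>. (norm (g \<zeta>))\<^sup>2 * min 1 \<bar>norm \<zeta>\<bar> ^ p) + s * (LINT \<zeta>|\<nu>. norm \<zeta> ^ p))"
    unfolding R_def using P(1) rad by simp
  also have "\<dots> \<le> (1/2) * ((1 / s) * (real N * w) + s * w)"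
    using G2 s unfolding w_def nu_moment_nat by (intro mult_left_mono add_mono) auto
  also have "\<dots> = s * w" using s by (simp add: s(2)[symmetric])
  also have "\<dots> = 2 * sqrt (real N) * moment \<omega> (2 ^ j + 1)" by (simp add: s_def w_def p_def)
  finally show "(LINT \<zeta>|\<nu>. norm (psum (lacunary (dyadic_block j N)) \<zeta>)) \<le> 2 * sqrt (real N) * moment \<omega> (2 ^ j + 1)" .
qed

text \<open>
  On a block of \<open>N\<close> dyadic frequencies the pairing of the block with itself has size
  \<open>N\<close>, while its \<open>L\<^sup>1\<close> norm only has size \<open>sqrt N\<close>.
\<close>

lemma lacunary_pairing_imp_M:
  assumes B: "\<And>j N. N > 0 \<Longrightarrow> (\<Sum>n\<in>dyadic_block j N. 2 * moment \<omega> (2 * real n + 1)) \<le> 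
     B * (LINT \<zeta>|\<nu>. norm (psum (lacunary (dyadic_block j N)) \<zeta>))"
  shows "\<omega> \<in> M_class"
proof -
  define B' where "B' = max 1 B"
  have B': "B' \<ge> 1" "B \<le> B'" by (auto simp: B'_def)
  \<comment> \<open>Makes \<open>sqrt N\<close> at least \<open>2 * B'\<close>, which produces the
    gain of 2 in \<open>M_class\<close>.\<close>
  obtain N :: nat where N: "(2 * B')\<^sup>2 < real N" using reals_Archimedean2 by blast
  have "0 < (2 * B')\<^sup>2" using B' by auto
  hence N0: "N > 0" using N by (cases N) auto
  have sN: "2 * B' \<le> sqrt (real N)" using N by (intro real_le_rsqrt) simp
  \<comment> \<open>From \<open>2 * 2 ^ (j + N) + 1 <= K * x\<close>, given
    \<open>2 ^ j <= 2 * x\<close> and \<open>1 <= x\<close>.\<close>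
  define K where "K = (2::real) ^ (N + 2) + 1"
  have "(2::real) ^ (N + 2) > 0" by simp
  hence K: "K > 1" by (simp add: K_def)
  have "moment \<omega> x \<ge> 2 * moment \<omega> (K * x)" if x: "x \<ge> 1" for x
  proof -
    obtain j where j: "x \<le> 2 ^ j" "2 ^ j \<le> 2 * x" using power_two_between[OF x] by blast
    define m where "m = moment \<omega> (2 * 2 ^ (j + N) + 1)"
    have m0: "m \<ge> 0" by (simp add: m_def moment_nonneg)
    have "real N * (2 * m) = (\<Sum>n\<in>dyadic_block j N. 2 * m)" using dyadic_block(2)[of j N] by simp
    also have "\<dots> \<le> (\<Sum>n\<in>dyadic_block j N. 2 * moment \<omega> (2 * real n + 1))"
    proof (intro sum_mono mult_left_mono)
      fix n assume "n \<in> dyadic_block j N"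
      hence "n \<le> 2 ^ (j + N)" using dyadic_block(4) by blast
      hence "real n \<le> real (2 ^ (j + N))" by (simp only: of_nat_le_iff)
      thus "m \<le> moment \<omega> (2 * real n + 1)" unfolding m_def by (intro moment_antimono) auto
    qed simp
    also have "\<dots> \<le> B * (LINT \<zeta>|\<nu>. norm (psum (lacunary (dyadic_block j N)) \<zeta>))" by (rule B[OF N0])
    also have "\<dots> \<le> B' * (LINT \<zeta>|\<nu>. norm (psum (lacunary (dyadic_block j N)) \<zeta>))" using B' by (intro mult_right_mono) auto
    also have "\<dots> \<le> B' * (2 * sqrt (real N) * moment \<omega> (2 ^ j + 1))"
      using B' by (intro mult_left_mono lacunary_L1(1)[OF N0]) auto
    finally have "(2 * sqrt (real N)) * (sqrt (real N) * m) \<le> (2 * sqrt (real N)) * (B' * moment \<omega> (2 ^ j + 1))"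
      by (simp add: mult_ac)
    hence le: "sqrt (real N) * m \<le> B' * moment \<omega> (2 ^ j + 1)"
      by (rule mult_left_le_imp_le) (use N0 in simp)
    have "B' * (2 * m) \<le> sqrt (real N) * m" using mult_right_mono[OF sN m0] by (simp add: mult_ac)
    also note le
    finally have "2 * m \<le> moment \<omega> (2 ^ j + 1)" by (rule mult_left_le_imp_le) (use B' in simp)
    also have "\<dots> \<le> moment \<omega> x" using j x by (intro moment_antimono) auto
    finally have 1: "2 * m \<le> moment \<omega> x" .
    have "2 * 2 ^ (j + N) + 1 \<le> K * x"
    proof -
      have "2 * 2 ^ (j + N) + (1::real) = 2 ^ j * 2 ^ (N + 1) + 1" by (simp add: power_add)
      also have "\<dots> \<le> (2 * x) * 2 ^ (N + 1) + x" using j x by (intro add_mono mult_right_mono) auto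
      also have "\<dots> = K * x" by (simp add: K_def power_add algebra_simps)
      finally show ?thesis .
    qed
    hence "moment \<omega> (K * x) \<le> m" unfolding m_def by (intro moment_antimono) auto
    thus ?thesis using 1 by linarith
  qed
  thus ?thesis using radial K unfolding M_class_def by (intro CollectI conjI exI[of _ 2] exI[of _ K]) auto
qed

end

section \<open>Bounded preimages under the projection\<close>

lemma Bloch_ray_pair:
  assumes f: "f \<in> Bloch" and u: "norm u = 1" and h: "0 \<le> l" "h < 1"
    and x: "l \<le> x" "x \<le> h" and y: "l \<le> y" "y \<le> h"
  shows "norm (f (of_real x * u) - f (of_real y * u)) \<le> Bloch_norm f * ((h - l) / (1 - h))"
proof -
  have *: "norm (f (of_real t * u) - f (of_real s * u)) \<le> Bloch_norm f * ((h - l) / (1 - h))"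
    if "l \<le> s" "s \<le> t" "t \<le> h" for s t
  proof -
    have "norm (f (of_real t * u) - f (of_real s * u)) \<le> Bloch_norm f * ((t - s) / (1 - t))"
      by (rule Bloch_ray[OF f u]) (use that h in auto)
    also have "\<dots> \<le> Bloch_norm f * ((h - l) / (1 - h))"
      using that h Bloch_norm_ge[OF f] by (intro mult_left_mono frac_le) auto
    finally show ?thesis .
  qed
  show ?thesis
  proof (cases "y \<le> x")
    case True
    thus ?thesis using * x y by blast
  next
    case False
    hence "norm (f (of_real y * u) - f (of_real x * u)) \<le> Bloch_norm f * ((h - l) / (1 - h))"
      using * x y by auto
    thus ?thesis by (simp add: norm_minus_commute)
  qed
qed

lemma Bloch_growth:
  assumes f: "f \<in> Bloch" and z: "norm z \<le> h" "h < 1"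
  shows "norm (f z) \<le> Bloch_norm f * (1 / (1 - h))"
proof -
  have h0: "0 \<le> h" using z norm_ge_zero[of z] by linarith
  obtain u where u: "norm u = 1" "z = of_real (norm z) * u"
  proof (cases "z = 0")
    case False
    hence "norm (sgn z) = 1" by (simp add: norm_sgn)
    moreover have "z = of_real (norm z) * sgn z" using False by (simp add: sgn_div_norm scaleR_conv_of_real)
    ultimately show thesis by (rule that)
  qed (use that[of 1] in auto)
  have "norm (f (of_real (norm z) * u) - f (of_real 0 * u)) \<le> Bloch_norm f * ((h - 0) / (1 - h))"
    by (rule Bloch_ray_pair[OF f u(1)]) (use z h0 in auto)
  hence "norm (f z - f 0) \<le> Bloch_norm f * (h / (1 - h))" using u(2) by simp
  moreover have "norm (f z) \<le> norm (f z - f 0) + norm (f 0)" using norm_triangle_sub by (metis add.commute)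
  moreover have "norm (f 0) \<le> Bloch_norm f" by (rule Bloch_norm_ge[OF f])
  moreover have "Bloch_norm f * (1 / (1 - h)) = Bloch_norm f * (h / (1 - h)) + Bloch_norm f"
    using z by (simp add: field_simps)
  ultimately show ?thesis by linarith
qed

text \<open>Reflects \<open>f (\<rho> / s * u)\<close> to the circle of radius \<open>s\<close>; there its \<open>n\<close>-th moment does not depend on \<open>s\<close>.\<close>

definition reflect :: "real \<Rightarrow> (complex \<Rightarrow> complex) \<Rightarrow> complex \<Rightarrow> complex"
  where "reflect \<rho> f \<zeta> = f (of_real (\<rho> / (norm \<zeta>)\<^sup>2) * \<zeta>)"

lemma reflect_eq:
  assumes "\<zeta> \<noteq> 0" shows "reflect \<rho> f \<zeta> = f (of_real (\<rho> / norm \<zeta>) * sgn \<zeta>)"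
proof -
  have "of_real (\<rho> / (norm \<zeta>)\<^sup>2) * \<zeta> = of_real (\<rho> / norm \<zeta>) * sgn \<zeta>"
    using assms by (simp add: sgn_div_norm scaleR_conv_of_real power2_eq_square field_simps)
  thus ?thesis by (simp add: reflect_def)
qed

context weighted_disc
begin

lemma measure_annulus:
  assumes "0 \<le> a"
  shows "(LINT \<zeta>|\<nu>. indicator {a..<b} (norm \<zeta>)) = 2 * (LINT r|\<sigma>. r * indicator {a..<b} r)"
  by (rule integral_nu_radial) (auto simp: indicator_def)

lemma indicator_integrable: "integrable \<nu> (\<lambda>\<zeta>. indicator {a..<b} (norm \<zeta>) :: real)"
  by (rule bounded_radial_integrable[of _ 1]) (auto simp: indicator_def)

text \<open>The reflected point has modulus \<open>\<rho> / norm \<zeta>\<close>, at most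
  \<open>\<rho> / a < 1\<close> on the annulus, so the Taylor series converges uniformly there and
  \<open>coefficient_integral\<close> applies.\<close>

lemma reflect_integral:
  assumes g: "g holomorphic_on \<D>" and ab: "0 < a" and \<rho>: "0 \<le> \<rho>" "\<rho> < a"
  shows "integrable \<nu> (\<lambda>\<zeta>. indicator {a..<b} (norm \<zeta>) * reflect \<rho> g \<zeta>)"
    and "(LINT \<zeta>|\<nu>. indicator {a..<b} (norm \<zeta>) * reflect \<rho> g \<zeta> * cnj \<zeta> ^ n) =
      taylor g n * of_real (\<rho> ^ n * (LINT \<zeta>|\<nu>. indicator {a..<b} (norm \<zeta>)))"
proof -
  define q where "q = \<rho> / a"
  have q: "0 \<le> q" "q < 1" using \<rho> ab by (auto simp: q_def)
  define \<beta> where "\<beta> m s = indicator {a..<b} s * (taylor g m * complex_of_real (\<rho> / s\<^sup>2) ^ m)" for m s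
  have bm: "\<beta> m \<in> borel_measurable borel" for m unfolding \<beta>_def[abs_def] by measurable
  have w: "norm (complex_of_real (\<rho> / (norm \<zeta>)\<^sup>2) * \<zeta>) \<le> q" if "a \<le> norm \<zeta>" for \<zeta>
  proof -
    have "norm (complex_of_real (\<rho> / (norm \<zeta>)\<^sup>2) * \<zeta>) = \<rho> / norm \<zeta>"
      using \<rho> ab that unfolding norm_mult norm_of_real by (simp add: power2_eq_square)
    also have "\<dots> \<le> q" unfolding q_def using \<rho> ab that by (intro divide_left_mono mult_pos_pos) auto
    finally show ?thesis .
  qed
  have bb: "norm (\<beta> m (norm \<zeta>) * \<zeta> ^ m) \<le> norm (taylor g m) * q ^ m" for m \<zeta>
  proof (cases "norm \<zeta> \<in> {a..<b}")
    case True
    hence "\<beta> m (norm \<zeta>) * \<zeta> ^ m = taylor g m * (complex_of_real (\<rho> / (norm \<zeta>)\<^sup>2) * \<zeta>) ^ m"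
      unfolding \<beta>_def power_mult_distrib by simp
    hence "norm (\<beta> m (norm \<zeta>) * \<zeta> ^ m) = norm (taylor g m) * norm (complex_of_real (\<rho> / (norm \<zeta>)\<^sup>2) * \<zeta>) ^ m"
      by (simp only: norm_mult norm_power)
    also have "\<dots> \<le> norm (taylor g m) * q ^ m" using w[of \<zeta>] True by (intro mult_left_mono power_mono) auto
    finally show ?thesis .
  qed (use q in \<open>auto simp: \<beta>_def indicator_def\<close>)
  have SB: "summable (\<lambda>m. norm (taylor g m) * q ^ m)"
    using taylor_series(1)[OF g] q by (auto simp: disc_series_def)
  have eq: "(\<Sum>m. \<beta> m (norm \<zeta>) * \<zeta> ^ m) = indicator {a..<b} (norm \<zeta>) * reflect \<rho> g \<zeta>" for \<zeta>
  proof (cases "norm \<zeta> \<in> {a..<b}")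
    case True
    hence "norm (complex_of_real (\<rho> / (norm \<zeta>)\<^sup>2) * \<zeta>) < 1" using w[of \<zeta>] q by auto
    hence "complex_of_real (\<rho> / (norm \<zeta>)\<^sup>2) * \<zeta> \<in> \<D>" by simp
    from taylor_sums[OF g this]
    have "(\<Sum>m. taylor g m * (complex_of_real (\<rho> / (norm \<zeta>)\<^sup>2) * \<zeta>) ^ m) = reflect \<rho> g \<zeta>"
      by (simp only: sums_iff reflect_def)
    moreover have "\<beta> m (norm \<zeta>) * \<zeta> ^ m = taylor g m * (complex_of_real (\<rho> / (norm \<zeta>)\<^sup>2) * \<zeta>) ^ m" for m
      using True unfolding \<beta>_def power_mult_distrib by simp
    ultimately show ?thesis using True by simp
  qed (auto simp: \<beta>_def indicator_def)
  note CI = coefficient_integral[of \<beta>, OF bm bb SB, unfolded eq]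
  show "integrable \<nu> (\<lambda>\<zeta>. indicator {a..<b} (norm \<zeta>) * reflect \<rho> g \<zeta>)" by (rule CI(1))
  have "(LINT \<zeta>|\<nu>. indicator {a..<b} (norm \<zeta>) * reflect \<rho> g \<zeta> * cnj \<zeta> ^ n) = (LINT \<zeta>|\<nu>. \<beta> n (norm \<zeta>) * of_real (norm \<zeta> ^ (2 * n)))"
    by (rule CI(2))
  also have "\<dots> = (LINT \<zeta>|\<nu>. taylor g n * of_real (\<rho> ^ n * indicator {a..<b} (norm \<zeta>)))"
  proof (rule Bochner_Integration.integral_cong[OF refl])
    fix \<zeta> :: complex
    have "(\<rho> / (norm \<zeta>)\<^sup>2) ^ n * norm \<zeta> ^ (2 * n) = \<rho> ^ n" if "a \<le> norm \<zeta>"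
    proof -
      have "\<zeta> \<noteq> 0" using that ab by auto
      thus ?thesis by (simp add: power_divide power_mult)
    qed
    hence "complex_of_real ((\<rho> / (norm \<zeta>)\<^sup>2) ^ n * norm \<zeta> ^ (2 * n)) = of_real (\<rho> ^ n)" if "a \<le> norm \<zeta>"
      using that by simp
    thus "\<beta> n (norm \<zeta>) * of_real (norm \<zeta> ^ (2 * n)) = taylor g n * of_real (\<rho> ^ n * indicator {a..<b} (norm \<zeta>))"
      by (cases "norm \<zeta> \<in> {a..<b}") (simp_all add: \<beta>_def mult.assoc)
  qed
  also have "\<dots> = taylor g n * of_real (\<rho> ^ n * (LINT \<zeta>|\<nu>. indicator {a..<b} (norm \<zeta>)))"
    by (simp only: integral_mult_right_zero integral_complex_of_real)
  finally show "(LINT \<zeta>|\<nu>. indicator {a..<b} (norm \<zeta>) * reflect \<rho> g \<zeta> * cnj \<zeta> ^ n) =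
      taylor g n * of_real (\<rho> ^ n * (LINT \<zeta>|\<nu>. indicator {a..<b} (norm \<zeta>)))" .
qed

lemma annulus_integral:
  assumes g: "g holomorphic_on \<D>" and b: "b < 1"
  shows "integrable \<nu> (\<lambda>\<zeta>. indicator {a..<b} (norm \<zeta>) * g \<zeta>)"
    and "(LINT \<zeta>|\<nu>. indicator {a..<b} (norm \<zeta>) * g \<zeta> * cnj \<zeta> ^ n) =
      taylor g n * of_real (LINT \<zeta>|\<nu>. indicator {a..<b} (norm \<zeta>) * norm \<zeta> ^ (2 * n))"
proof -
  define q where "q = max 0 b"
  have q: "0 \<le> q" "q < 1" using b by (auto simp: q_def)
  define \<beta> where "\<beta> m s = indicator {a..<b} s * taylor g m" for m and s :: real
  have bm: "\<beta> m \<in> borel_measurable borel" for m unfolding \<beta>_def[abs_def] by measurable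
  have bb: "norm (\<beta> m (norm \<zeta>) * \<zeta> ^ m) \<le> norm (taylor g m) * q ^ m" for m \<zeta>
  proof (cases "norm \<zeta> \<in> {a..<b}")
    case True
    hence "norm (\<beta> m (norm \<zeta>) * \<zeta> ^ m) = norm (taylor g m) * norm \<zeta> ^ m" by (simp add: \<beta>_def norm_mult norm_power)
    also have "\<dots> \<le> norm (taylor g m) * q ^ m" using True by (intro mult_left_mono power_mono) (auto simp: q_def)
    finally show ?thesis .
  qed (use q in \<open>auto simp: \<beta>_def indicator_def\<close>)
  have SB: "summable (\<lambda>m. norm (taylor g m) * q ^ m)"
    using taylor_series(1)[OF g] q by (auto simp: disc_series_def)
  have eq: "(\<Sum>m. \<beta> m (norm \<zeta>) * \<zeta> ^ m) = indicator {a..<b} (norm \<zeta>) * g \<zeta>" for \<zeta>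
  proof (cases "norm \<zeta> \<in> {a..<b}")
    case True
    hence "\<zeta> \<in> \<D>" using b by simp
    from taylor_sums[OF g this] show ?thesis using True by (simp add: sums_iff \<beta>_def)
  qed (auto simp: \<beta>_def indicator_def)
  note CI = coefficient_integral[of \<beta>, OF bm bb SB, unfolded eq]
  show "integrable \<nu> (\<lambda>\<zeta>. indicator {a..<b} (norm \<zeta>) * g \<zeta>)" by (rule CI(1))
  have "(LINT \<zeta>|\<nu>. indicator {a..<b} (norm \<zeta>) * g \<zeta> * cnj \<zeta> ^ n) = (LINT \<zeta>|\<nu>. \<beta> n (norm \<zeta>) * of_real (norm \<zeta> ^ (2 * n)))"
    by (rule CI(2))
  also have "\<dots> = (LINT \<zeta>|\<nu>. taylor g n * of_real (indicator {a..<b} (norm \<zeta>) * norm \<zeta> ^ (2 * n)))"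
    by (rule Bochner_Integration.integral_cong) (auto simp: \<beta>_def indicator_def)
  also have "\<dots> = taylor g n * of_real (LINT \<zeta>|\<nu>. indicator {a..<b} (norm \<zeta>) * norm \<zeta> ^ (2 * n))"
    by (simp only: integral_mult_right_zero integral_complex_of_real)
  finally show "(LINT \<zeta>|\<nu>. indicator {a..<b} (norm \<zeta>) * g \<zeta> * cnj \<zeta> ^ n) =
      taylor g n * of_real (LINT \<zeta>|\<nu>. indicator {a..<b} (norm \<zeta>) * norm \<zeta> ^ (2 * n))" .
qed

definition annulus_mass :: "real \<Rightarrow> real"
  where "annulus_mass a = (LINT \<zeta>|\<nu>. indicator {a..<1} (norm \<zeta>))"

text \<open>The factor \<open>a\<close> lost in the lower bound is close to 1 near the circle;
  \<open>D_check_preimage\<close> starts far enough out to afford it.\<close>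

lemma annulus_mass_bounds:
  assumes "0 \<le> a" "a < 1"
  shows "2 * a * tail \<omega> a \<le> annulus_mass a" "annulus_mass a \<le> 2 * tail \<omega> a"
proof -
  have sa: "{a..<1} \<in> sets \<sigma>" by (rule atLeastLessThan_sets[OF assms(1)])
  have ind: "integrable \<sigma> (indicator {a..<1} :: real \<Rightarrow> real)"
    using sa by (intro integrable_real_indicator) (auto simp: line.emeasure_finite less_top[symmetric])
  have rind: "integrable \<sigma> (\<lambda>r. r * indicator {a..<1} r)"
    by (rule line.integrable_const_bound[of _ 1]) (use sa in \<open>auto intro!: AE_I2 borel_measurable_times borel_measurable_indicator simp: indicator_def\<close>)
  have t: "(LINT r|\<sigma>. indicator {a..<1} r) = tail \<omega> a" using sa assms by (simp add: tail_eq Int_absorb1)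
  have "a * tail \<omega> a = (LINT r|\<sigma>. a * indicator {a..<1} r)" using t by simp
  also have "\<dots> \<le> (LINT r|\<sigma>. r * indicator {a..<1} r)"
    by (intro integral_mono integrable_mult_right ind rind) (auto simp: indicator_def)
  finally show "2 * a * tail \<omega> a \<le> annulus_mass a" unfolding annulus_mass_def measure_annulus[OF assms(1)] by simp
  have "(LINT r|\<sigma>. r * indicator {a..<1} r) \<le> (LINT r|\<sigma>. indicator {a..<1} r)"
    by (intro integral_mono ind rind) (auto simp: indicator_def)
  thus "annulus_mass a \<le> 2 * tail \<omega> a" unfolding annulus_mass_def measure_annulus[OF assms(1)] t by simp
qed

lemma annulus_mass_diff:
  assumes "a \<le> b" "b \<le> 1"
  shows "(LINT \<zeta>|\<nu>. indicator {a..<b} (norm \<zeta>)) = annulus_mass a - annulus_mass b"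
proof -
  have "annulus_mass a - annulus_mass b = (LINT \<zeta>|\<nu>. indicator {a..<1} (norm \<zeta>) - indicator {b..<1} (norm \<zeta>))"
    unfolding annulus_mass_def by (rule Bochner_Integration.integral_diff[symmetric]) (rule indicator_integrable)+
  also have "\<dots> = (LINT \<zeta>|\<nu>. indicator {a..<b} (norm \<zeta>))"
    using assms by (intro Bochner_Integration.integral_cong) (auto simp: indicator_def)
  finally show ?thesis by simp
qed


text \<open>
  On each annulus \<open>R k \<le> |\<zeta>| < R (k + 1)\<close> the preimage is \<open>g\<close>,
  plus the mass received from the outer annuli, minus the mass passed on to the inner ones; both
  are carried by reflected dilations of \<open>g\<close> from comparable hyperbolic positions, so that the
  three terms nearly cancel.
\<close>

lemma D_check_preimage:
  assumes check: "\<omega> \<in> D_check"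
  obtains C where "C > 0" "\<And>g. g \<in> Bloch \<Longrightarrow> \<exists>f. f \<in> borel_measurable \<nu> \<and> (\<forall>\<zeta>\<in>\<D>. norm (f \<zeta>) \<le> C * Bloch_norm g) \<and>
     (\<forall>n. (LINT \<zeta>|\<nu>. f \<zeta> * cnj \<zeta> ^ n) = taylor g n * of_real (2 * moment \<omega> (2 * real n + 1)))"
proof -
  obtain K Cc where KC: "K > 1" "Cc > 1" "\<And>r. r \<in> {0..<1} \<Longrightarrow> tail \<omega> r \<ge> Cc * tail \<omega> (1 - (1 - r) / K)"
    using check by (auto simp: D_check_def)
  \<comment> \<open>The first entry makes \<open>r0 * Cc\<close> at least
    \<open>(1 + Cc) / 2\<close>, which exceeds 1, so the decay of tails survives the factor lost in
    \<open>annulus_mass_bounds\<close>; the second keeps \<open>1 - K * t k\<close> at least 1 /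
    2.\<close>
  define r0 where "r0 = max ((1 + Cc) / (2 * Cc)) (1 - 1 / (2 * K))"
  have r0: "1 / 2 \<le> r0" "r0 < 1" "K * (1 - r0) \<le> 1 / 2" "(1 + Cc) / 2 \<le> r0 * Cc"
  proof -
    show "1 / 2 \<le> r0" using KC by (auto simp: r0_def le_max_iff_disj field_simps)
    show "r0 < 1" using KC by (auto simp: r0_def field_simps)
    have "1 - 1 / (2 * K) \<le> r0" by (simp add: r0_def)
    thus "K * (1 - r0) \<le> 1 / 2" using KC(1) by (simp add: field_simps)
    have "(1 + Cc) / (2 * Cc) \<le> r0" by (simp add: r0_def)
    thus "(1 + Cc) / 2 \<le> r0 * Cc" using KC(2) by (simp add: field_simps)
  qed
  define la where "la = (1 + Cc) / 2"
  have la: "la > 1" using KC by (simp add: la_def)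
  define t where "t k = (1 - r0) / K ^ k" for k :: nat
  define R where "R k = 1 - t k" for k
  \<comment> \<open>Chosen so that \<open>\<rho> k / R k\<close> is \<open>1 - K * t k\<close>,
    which for positive k is \<open>R (k - 1)\<close>. On the annuli on both sides of radius
    \<open>R k\<close> the reflected dilation then samples \<open>g\<close> at radii hyperbolically
    close to \<open>R k\<close>.\<close>
  define \<rho> where "\<rho> k = R k * (1 - K * t k)" for k
  define M where "M k = annulus_mass (R k)" for k
  have t: "t k > 0" "t (Suc k) = t k / K" "t k \<le> 1 - r0" for k
  proof -
    show "t k > 0" "t (Suc k) = t k / K" using KC r0 by (auto simp: t_def)
    have "(1 - r0) / K ^ k \<le> (1 - r0) / 1" using KC r0 by (intro divide_left_mono) auto
    thus "t k \<le> 1 - r0" by (simp add: t_def)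
  qed
  have Kt: "K * t (Suc k) = t k" for k using KC by (simp add: t(2))
  have tS: "t (Suc k) < t k" for k
    using mult_strict_left_mono[of 1 K "t (Suc k)"] Kt[of k] t(1)[of "Suc k"] KC(1) by (simp add: mult.commute)
  have R: "r0 \<le> R k" "R k < 1" "R k < R (Suc k)" "1 / 2 \<le> R k" for k
    using t[of k] tS[of k] r0 by (auto simp: R_def)
  have R0: "R 0 = r0" by (simp add: R_def t_def)
  have Ktk: "K * t k \<le> 1 / 2" for k
  proof -
    have "K * t k \<le> K * (1 - r0)" using t(3) KC by (intro mult_left_mono) auto
    thus ?thesis using r0(3) by linarith
  qed
  have tK: "t k \<le> K * t k" for k using t(1)[of k] KC by simp
  have rho: "0 \<le> \<rho> k" "\<rho> k < R k" "\<rho> k / R k = 1 - K * t k" "1 - (K + 1) * t k \<le> \<rho> k" for k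
  proof -
    show "0 \<le> \<rho> k" unfolding \<rho>_def using R(4)[of k] Ktk[of k] by (intro mult_nonneg_nonneg) auto
    show d: "\<rho> k / R k = 1 - K * t k" using R(4)[of k] by (simp add: \<rho>_def)
    have "K * t k > 0" using t(1)[of k] KC by simp
    hence "\<rho> k < R k * 1" unfolding \<rho>_def using R(4)[of k] by (intro mult_strict_left_mono) auto
    thus "\<rho> k < R k" by simp
    have "0 \<le> K * t k * t k" using t(1)[of k] KC by simp
    thus "1 - (K + 1) * t k \<le> \<rho> k" by (simp add: \<rho>_def R_def algebra_simps)
  qed
  have rhoS: "\<rho> (Suc k) < R k" "\<rho> (Suc k) / R k = R (Suc k)" "1 - (K + 1) * t k \<le> \<rho> (Suc k)" for k
  proof -
    have e: "\<rho> (Suc k) = R (Suc k) * R k" by (simp add: \<rho>_def Kt) (simp add: R_def)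
    show "\<rho> (Suc k) / R k = R (Suc k)" using R(4)[of k] by (simp add: e)
    have "R (Suc k) * R k < 1 * R k" using R(2)[of "Suc k"] R(4)[of k] by (intro mult_strict_right_mono) auto
    thus "\<rho> (Suc k) < R k" by (simp add: e)
    have "R k * R k \<le> R (Suc k) * R k" using R(3)[of k] R(4)[of k] by (intro mult_right_mono) auto
    moreover have "R k * R k = 1 - 2 * t k + t k * t k" by (simp add: R_def algebra_simps)
    moreover have "0 \<le> t k * t k" by simp
    moreover have "(K + 1) * t k = K * t k + t k" by (simp add: algebra_simps)
    ultimately show "1 - (K + 1) * t k \<le> \<rho> (Suc k)" using tK[of k] e by linarith
  qed
  have Mpos: "M k > 0" for k
  proof -
    have "0 < 2 * R k * tail \<omega> (R k)" using R(4)[of k] tail_pos[of "R k"] R(2)[of k] by simp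
    also have "\<dots> \<le> M k" unfolding M_def using R(2,4)[of k] by (intro annulus_mass_bounds) auto
    finally show ?thesis .
  qed
  have Mdec: "la * M (Suc k) \<le> M k" for k
  proof -
    have rk: "0 \<le> R k" "R k < 1" "0 \<le> R (Suc k)" "R (Suc k) < 1" using R(2,4)[of k] R(2,4)[of "Suc k"] by auto
    have "1 - (1 - R k) / K = R (Suc k)" by (simp add: R_def t(2))
    hence c: "Cc * tail \<omega> (R (Suc k)) \<le> tail \<omega> (R k)" using KC(3)[of "R k"] rk by simp
    have "la \<le> R k * Cc"
    proof -
      have "r0 * Cc \<le> R k * Cc" using R(1)[of k] KC by (intro mult_right_mono) auto
      thus ?thesis using r0(4) by (simp add: la_def)
    qed
    hence "la * (2 * tail \<omega> (R (Suc k))) \<le> R k * Cc * (2 * tail \<omega> (R (Suc k)))"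
      using tail_nonneg[OF rk(3)] by (intro mult_right_mono) auto
    also have "\<dots> = 2 * R k * (Cc * tail \<omega> (R (Suc k)))" by simp
    also have "\<dots> \<le> 2 * R k * tail \<omega> (R k)" using c rk by (intro mult_left_mono) auto
    also have "\<dots> \<le> M k" unfolding M_def using rk by (intro annulus_mass_bounds) auto
    finally have "la * (2 * tail \<omega> (R (Suc k))) \<le> M k" .
    moreover have "la * M (Suc k) \<le> la * (2 * tail \<omega> (R (Suc k)))"
      unfolding M_def using la rk by (intro mult_left_mono annulus_mass_bounds) auto
    ultimately show ?thesis by linarith
  qed
  \<comment> \<open>The mass of the k-th annulus. The ratio bound says that it is at least a fixed
    multiple of all the mass beyond it, which keeps the multiplicities in \<open>F\<close>
    bounded.\<close>
  define m where "m k = M k - M (Suc k)" for k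
  have m: "m k > 0" "M (Suc k) / m k \<le> 1 / (la - 1)" for k
  proof -
    have "(la - 1) * M (Suc k) > 0" using la Mpos by simp
    moreover have mM: "(la - 1) * M (Suc k) \<le> m k" using Mdec[of k] by (simp add: m_def algebra_simps)
    ultimately show mp: "m k > 0" by linarith
    show "M (Suc k) / m k \<le> 1 / (la - 1)" using mM mp la by (simp add: field_simps)
  qed
  have Mlim: "M \<longlonglongrightarrow> 0"
  proof -
    have le: "M k \<le> M 0 * (1 / la) ^ k" for k
    proof (induction k)
      case (Suc k)
      have "M (Suc k) \<le> M k * (1 / la)" using Mdec[of k] la by (simp add: field_simps)
      also have "\<dots> \<le> M 0 * (1 / la) ^ k * (1 / la)" using Suc la by (intro mult_right_mono) auto
      finally show ?case by simp
    qed simp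
    have "(\<lambda>k. M 0 * (1 / la) ^ k) \<longlonglongrightarrow> M 0 * 0"
      using la by (intro tendsto_mult tendsto_const LIMSEQ_power_zero) auto
    thus ?thesis
      by (intro tendsto_sandwich[of "\<lambda>_. 0" M _ "\<lambda>k. M 0 * (1 / la) ^ k"]) (use le Mpos in \<open>auto intro!: always_eventually less_imp_le\<close>)
  qed
  have tlim: "t \<longlonglongrightarrow> 0"
  proof -
    have "(\<lambda>k. (1 - r0) * (1 / K) ^ k) \<longlonglongrightarrow> (1 - r0) * 0"
      using KC by (intro tendsto_mult tendsto_const LIMSEQ_power_zero) auto
    moreover have "(\<lambda>k. (1 - r0) * (1 / K) ^ k) = t" by (auto simp: t_def power_one_over)
    ultimately show ?thesis by simp
  qed
  have find: "\<exists>k. norm \<zeta> \<in> {R k..<R (Suc k)}" if "\<zeta> \<in> \<D>" "r0 \<le> norm \<zeta>" for \<zeta> :: complex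
  proof -
    have "\<forall>\<^sub>F k in sequentially. t k < 1 - norm \<zeta>" using that by (intro order_tendstoD(2)[OF tlim]) auto
    then obtain k1 where "t k1 < 1 - norm \<zeta>" by (auto simp: eventually_sequentially)
    hence ex: "\<exists>k. norm \<zeta> < R k" by (auto simp: R_def intro: exI[of _ k1])
    define k2 where "k2 = (LEAST k. norm \<zeta> < R k)"
    have k2: "norm \<zeta> < R k2" unfolding k2_def by (rule LeastI_ex[OF ex])
    have "k2 \<noteq> 0" using k2 that R0 by (intro notI) auto
    then obtain k where k: "k2 = Suc k" by (cases k2) auto
    hence "\<not> norm \<zeta> < R k" using not_less_Least[of k "\<lambda>k. norm \<zeta> < R k"] by (simp add: k2_def)
    thus ?thesis using k k2 by (intro exI[of _ k]) auto
  qed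
  have Rmono: "R k \<le> R l" if "k \<le> l" for k l
    by (rule lift_Suc_mono_le[of R, OF less_imp_le[OF R(3)] that])
  \<comment> \<open>Bounds \<open>(hi - lo) / (1 - hi)\<close> below: the radii to be compared lie
    at distances between \<open>t k / K\<close> and \<open>(K + 1) * t k\<close> from the
    circle.\<close>
  define L where "L = (K + 1) * K"
  have L: "L > 0" using KC by (simp add: L_def)
  define C where "C = (1 + 1 / (1 - r0)) + (L + 1 / (la - 1) * L) + 1 / (1 - r0) + 1"
  have C: "C > 0" unfolding C_def using L la r0 by (intro add_pos_pos add_pos_nonneg) auto
  have Cge: "1 / (1 - r0) \<le> C" "1 / (1 - r0) + (L + 1 / (la - 1) * L) \<le> C"
  proof -
    have "1 / (1 - r0) \<ge> 0" using r0 by simp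
    moreover have "1 / (la - 1) * L \<ge> 0" using la L by simp
    ultimately show "1 / (1 - r0) \<le> C" "1 / (1 - r0) + (L + 1 / (la - 1) * L) \<le> C"
      unfolding C_def using L by linarith+
  qed
  show thesis
  proof (rule that[OF C])
    fix g assume g: "g \<in> Bloch"
    have gh: "g holomorphic_on \<D>" using g by (simp add: Bloch_def)
    define G where "G = Bloch_norm g"
    have G: "G \<ge> 0" unfolding G_def by (rule Bloch_norm_ge[OF g])
    let ?I = "\<lambda>a b \<zeta>. indicator {a..<b} (norm \<zeta>) :: complex"
    \<comment> \<open>Integrated against \<open>cnj \<zeta> ^ n\<close>, the last two terms give the
      n-th coefficient of \<open>g\<close> times \<open>M (Suc k) * \<rho> (Suc k) ^ n\<close> and
      \<open>- M k * \<rho> k ^ n\<close>, so that the sum over k telescopes.\<close>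
    define F where "F k \<zeta> = ?I (R k) (R (Suc k)) \<zeta> * g \<zeta> 
        + of_real (M (Suc k) / m k) * (?I (R k) (R (Suc k)) \<zeta> * reflect (\<rho> (Suc k)) g \<zeta>)
        - of_real (M k / m k) * (?I (R k) (R (Suc k)) \<zeta> * reflect (\<rho> k) g \<zeta>)" for k \<zeta>
    \<comment> \<open>All the mass beyond \<open>r0\<close> is first paid by one reflected dilation;
      each \<open>F k\<close> replaces the payment at level k by \<open>g\<close> itself on one
      annulus and a payment at level k + 1.\<close>
    define F0 where "F0 \<zeta> = ?I 0 r0 \<zeta> * g \<zeta> + ?I r0 1 \<zeta> * reflect (\<rho> 0) g \<zeta>" for \<zeta>
    define S where "S N \<zeta> = F0 \<zeta> + (\<Sum>k<N. F k \<zeta>)" for N \<zeta>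
    define f where "f \<zeta> = F0 \<zeta> + (\<Sum>k. F k \<zeta>)" for \<zeta>
    have Rk0: "0 < R k" for k using R(4)[of k] by linarith
    note iF = annulus_integral(1)[OF gh R(2)] reflect_integral(1)[OF gh Rk0 rho(1) rhoS(1)] reflect_integral(1)[OF gh Rk0 rho(1,2)]
    have Fint: "integrable \<nu> (F k)" for k
      unfolding F_def[abs_def] by (intro Bochner_Integration.integrable_add Bochner_Integration.integrable_diff integrable_mult_right iF)
    have r00: "0 < r0" "\<rho> 0 < r0" using r0 rho(2)[of 0] R0 by auto
    have F0int: "integrable \<nu> F0"
      unfolding F0_def[abs_def]
      by (intro Bochner_Integration.integrable_add annulus_integral(1)[OF gh r0(2)] reflect_integral(1)[OF gh r00(1) rho(1) r00(2)])
    have zero: "F l \<zeta> = 0" if "norm \<zeta> \<notin> {R l..<R (Suc l)}" for l \<zeta>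
      using that by (simp add: F_def)
    have only: "F l \<zeta> = (if l = k then F k \<zeta> else 0)" if "norm \<zeta> \<in> {R k..<R (Suc k)}" for k l \<zeta>
    proof (cases "l = k")
      case False
      hence "Suc l \<le> k \<or> Suc k \<le> l" by linarith
      hence "R (Suc l) \<le> R k \<or> R (Suc k) \<le> R l" using Rmono by blast
      hence "norm \<zeta> \<notin> {R l..<R (Suc l)}" using that by auto
      thus ?thesis using False zero by simp
    qed simp
    have cases: "(\<lambda>k. F k \<zeta>) sums (\<Sum>k. F k \<zeta>) \<and> norm (S N \<zeta>) \<le> C * G" if z: "\<zeta> \<in> \<D>" for \<zeta> N
    proof (cases "norm \<zeta> < r0")
      case True
      hence "F k \<zeta> = 0" for k using R(1)[of k] by (intro zero) auto
      moreover have "F0 \<zeta> = g \<zeta>" using True by (simp add: F0_def indicator_def)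
      moreover have "norm (g \<zeta>) \<le> G * (1 / (1 - r0))" unfolding G_def by (rule Bloch_growth[OF g]) (use True r0 in auto)
      moreover have "G * (1 / (1 - r0)) \<le> C * G"
        using G Cge(1) by (subst mult.commute, intro mult_right_mono) auto
      ultimately show ?thesis by (simp add: S_def)
    next
      case False
      then obtain k where k: "norm \<zeta> \<in> {R k..<R (Suc k)}" using find[OF z] by auto
      define s where "s = norm \<zeta>"
      have s: "R k \<le> s" "s < R (Suc k)" "s < 1" "s > 0" using k z R(4)[of k] by (auto simp: s_def)
      have z0: "\<zeta> \<noteq> 0" using s by (auto simp: s_def)
      define u where "u = sgn \<zeta>"
      have u: "norm u = 1" using z0 by (simp add: u_def norm_sgn)
      have zu: "\<zeta> = of_real s * u" using z0 by (simp add: u_def s_def sgn_div_norm scaleR_conv_of_real)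
      define lo where "lo = 1 - (K + 1) * t k"
      define hi where "hi = 1 - t (Suc k)"
      have lohi: "0 \<le> lo" "hi < 1" "(hi - lo) / (1 - hi) \<le> L"
      proof -
        have e: "(K + 1) * t k = K * t k + t k" by (simp add: algebra_simps)
        show "0 \<le> lo" using Ktk[of k] tK[of k] e by (simp add: lo_def)
        show "hi < 1" using t(1) by (simp add: hi_def)
        have "(hi - lo) / (1 - hi) \<le> ((K + 1) * t k) / (1 - hi)"
          using t(1)[of "Suc k"] by (intro divide_right_mono) (auto simp: hi_def lo_def)
        also have "\<dots> = L" using t(1)[of k] KC by (simp add: hi_def t(2) L_def)
        finally show "(hi - lo) / (1 - hi) \<le> L" .
      qed
      have div: "x \<le> x / s" if "0 \<le> x" for x using that s by (simp add: field_simps mult_left_le_one_le)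
      have a: "lo \<le> s" "s \<le> hi"
      proof -
        have "(K + 1) * t k = K * t k + t k" by (simp add: algebra_simps)
        thus "lo \<le> s" using s(1) tK[of k] t(1)[of k] unfolding lo_def R_def by linarith
        show "s \<le> hi" using s(2) by (simp add: hi_def R_def)
      qed
      have b: "lo \<le> \<rho> (Suc k) / s" "\<rho> (Suc k) / s \<le> hi"
      proof -
        show "lo \<le> \<rho> (Suc k) / s" using div[OF rho(1)[of "Suc k"]] rhoS(3)[of k] by (simp add: lo_def)
        have "\<rho> (Suc k) / s \<le> \<rho> (Suc k) / R k" using s rho(1)[of "Suc k"] Rk0[of k] by (intro divide_left_mono) auto
        thus "\<rho> (Suc k) / s \<le> hi" using rhoS(2)[of k] by (simp add: hi_def R_def)
      qed
      have c: "lo \<le> \<rho> k / s" "\<rho> k / s \<le> hi"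
      proof -
        show "lo \<le> \<rho> k / s" using div[OF rho(1)[of k]] rho(4)[of k] by (simp add: lo_def)
        have "\<rho> k / s \<le> \<rho> k / R k" using s rho(1)[of k] Rk0[of k] by (intro divide_left_mono) auto
        also have "\<dots> = 1 - K * t k" by (rule rho(3))
        also have "\<dots> \<le> hi" using tK[of k] tS[of k] by (simp add: hi_def)
        finally show "\<rho> k / s \<le> hi" .
      qed
      define gb where "gb = g (of_real (\<rho> (Suc k) / s) * u)"
      define gc where "gc = g (of_real (\<rho> k / s) * u)"
      have GL: "G * ((hi - lo) / (1 - hi)) \<le> G * L" using G lohi by (intro mult_left_mono) auto
      have d1: "norm (g \<zeta> - gc) \<le> G * L"
        using Bloch_ray_pair[OF g u lohi(1,2) a c] GL unfolding G_def zu gc_def by linarith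
      have d2: "norm (gb - gc) \<le> G * L"
        using Bloch_ray_pair[OF g u lohi(1,2) b c] GL unfolding G_def gb_def gc_def by linarith
      \<comment> \<open>As \<open>M k / m k = 1 + M (Suc k) / m k\<close>, the three values of
        \<open>g\<close> enter with coefficients of sum 0, and only differences remain.\<close>
      have Fk: "F k \<zeta> = (g \<zeta> - gc) + of_real (M (Suc k) / m k) * (gb - gc)"
      proof -
        have rb: "reflect (\<rho> (Suc k)) g \<zeta> = gb" "reflect (\<rho> k) g \<zeta> = gc"
          unfolding gb_def gc_def u_def s_def by (rule reflect_eq[OF z0])+
        have "M k / m k = 1 + M (Suc k) / m k" using m(1)[of k] by (simp add: m_def field_simps)
        hence mm: "complex_of_real (M k / m k) = 1 + of_real (M (Suc k) / m k)" by (simp only: of_real_add of_real_1)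
        define q where "q = complex_of_real (M (Suc k) / m k)"
        have "F k \<zeta> = g \<zeta> + q * gb - (1 + q) * gc"
          unfolding F_def rb mm q_def[symmetric] using k by simp
        thus ?thesis unfolding q_def[symmetric] by (simp add: algebra_simps)
      qed
      have "norm (F k \<zeta>) \<le> norm (g \<zeta> - gc) + norm (of_real (M (Suc k) / m k) * (gb - gc))"
        unfolding Fk by (rule norm_triangle_ineq)
      also have "norm (of_real (M (Suc k) / m k) * (gb - gc)) = (M (Suc k) / m k) * norm (gb - gc)"
        using m(1)[of k] Mpos[of "Suc k"] unfolding norm_mult norm_of_real by simp
      also have "\<dots> \<le> 1 / (la - 1) * (G * L)"
        using m(2)[of k] d2 la by (intro mult_mono) auto
      finally have FB: "norm (F k \<zeta>) \<le> G * L + 1 / (la - 1) * (G * L)" using d1 by linarith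
      have F0B: "norm (F0 \<zeta>) \<le> G * (1 / (1 - r0))"
      proof -
        have "norm \<zeta> \<notin> {0..<r0}" "norm \<zeta> \<in> {r0..<1}" using False z by auto
        hence "F0 \<zeta> = reflect (\<rho> 0) g \<zeta>" by (simp add: F0_def)
        also have "\<dots> = g (of_real (\<rho> 0 / s) * u)" unfolding s_def u_def by (rule reflect_eq[OF z0])
        also have "norm \<dots> \<le> G * (1 / (1 - r0))" unfolding G_def
        proof (rule Bloch_growth[OF g _ r0(2)])
          have "norm (complex_of_real (\<rho> 0 / s) * u) = \<rho> 0 / s"
            using rho(1)[of 0] s u unfolding norm_mult norm_of_real by simp
          also have "\<dots> \<le> \<rho> 0 / R 0" using rho(1)[of 0] s Rk0[of 0] R0 False
            by (intro divide_left_mono) (auto simp: s_def)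
          also have "\<dots> = 1 - K * t 0" by (rule rho(3))
          also have "\<dots> \<le> r0" using tK[of 0] by (simp add: t_def)
          finally show "norm (complex_of_real (\<rho> 0 / s) * u) \<le> r0" .
        qed
        finally show ?thesis .
      qed
      have Feq: "(\<lambda>l. F l \<zeta>) = (\<lambda>l. if l = k then F k \<zeta> else 0)" using only[OF k] by auto
      have sm: "(\<lambda>l. F l \<zeta>) sums F k \<zeta>" unfolding Feq by (rule sums_single)
      have "(\<Sum>l<N. F l \<zeta>) = (\<Sum>l<N. if l = k then F k \<zeta> else 0)" unfolding Feq ..
      also have "\<dots> = (if k < N then F k \<zeta> else 0)" by (simp add: sum.delta)
      finally have "norm (\<Sum>l<N. F l \<zeta>) \<le> norm (F k \<zeta>)" by simp
      hence "norm (S N \<zeta>) \<le> norm (F0 \<zeta>) + norm (F k \<zeta>)"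
        unfolding S_def using norm_triangle_ineq[of "F0 \<zeta>" "\<Sum>l<N. F l \<zeta>"] by linarith
      also have "\<dots> \<le> G * (1 / (1 - r0)) + (G * L + 1 / (la - 1) * (G * L))" using F0B FB by linarith
      also have "\<dots> = (1 / (1 - r0) + (L + 1 / (la - 1) * L)) * G" by (simp only: distrib_left distrib_right mult_ac)
      also have "\<dots> \<le> C * G" using G Cge(2) by (intro mult_right_mono) auto
      finally show ?thesis using sm by (simp add: sums_iff)
    qed
    have lim: "(\<lambda>N. S N \<zeta>) \<longlonglongrightarrow> f \<zeta>" if "\<zeta> \<in> \<D>" for \<zeta>
      unfolding S_def f_def using cases[OF that] by (intro tendsto_intros) (auto simp: sums_def)
    have Sint: "integrable \<nu> (S N)" for N
      unfolding S_def[abs_def] by (intro Bochner_Integration.integrable_add F0int Bochner_Integration.integrable_sum Fint)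
    have fm: "f \<in> borel_measurable \<nu>"
      by (rule borel_measurable_LIMSEQ_metric[of S]) (use Sint lim in auto)
    have fb: "norm (f \<zeta>) \<le> C * G" if "\<zeta> \<in> \<D>" for \<zeta>
      by (rule LIMSEQ_le_const2[OF tendsto_norm[OF lim[OF that]]]) (use cases[OF that] in auto)
    have fc: "(LINT \<zeta>|\<nu>. f \<zeta> * cnj \<zeta> ^ n) = taylor g n * of_real (2 * moment \<omega> (2 * real n + 1))" for n
    proof -
      define J where "J a b = (LINT \<zeta>|\<nu>. indicator {a..<b} (norm \<zeta>) * norm \<zeta> ^ (2 * n))" for a b
      have Ji: "integrable \<nu> (\<lambda>\<zeta>. indicator {a..<b} (norm \<zeta>) * norm \<zeta> ^ (2 * n))" for a b
        by (rule bounded_radial_integrable[of "\<lambda>r. indicator {a..<b} r * r ^ (2 * n)" 1])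
           (auto simp: indicator_def power_le_one power_abs[symmetric])
      have JS: "(LINT \<zeta>|\<nu>. F k \<zeta> * cnj \<zeta> ^ n) = taylor g n * of_real (J (R k) (R (Suc k)) + M (Suc k) * \<rho> (Suc k) ^ n - M k * \<rho> k ^ n)" for k
      proof -
        have mm: "(LINT \<zeta>|\<nu>. indicator {R k..<R (Suc k)} (norm \<zeta>)) = m k"
          unfolding m_def M_def using R(2)[of "Suc k"] R(3)[of k] by (intro annulus_mass_diff) auto
        have "(LINT \<zeta>|\<nu>. F k \<zeta> * cnj \<zeta> ^ n) = (LINT \<zeta>|\<nu>. ?I (R k) (R (Suc k)) \<zeta> * g \<zeta> * cnj \<zeta> ^ n
           + of_real (M (Suc k) / m k) * (?I (R k) (R (Suc k)) \<zeta> * reflect (\<rho> (Suc k)) g \<zeta> * cnj \<zeta> ^ n)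
           - of_real (M k / m k) * (?I (R k) (R (Suc k)) \<zeta> * reflect (\<rho> k) g \<zeta> * cnj \<zeta> ^ n))"
          by (rule Bochner_Integration.integral_cong) (simp_all add: F_def algebra_simps)
        also have "\<dots> = (LINT \<zeta>|\<nu>. ?I (R k) (R (Suc k)) \<zeta> * g \<zeta> * cnj \<zeta> ^ n)
           + of_real (M (Suc k) / m k) * (LINT \<zeta>|\<nu>. ?I (R k) (R (Suc k)) \<zeta> * reflect (\<rho> (Suc k)) g \<zeta> * cnj \<zeta> ^ n)
           - of_real (M k / m k) * (LINT \<zeta>|\<nu>. ?I (R k) (R (Suc k)) \<zeta> * reflect (\<rho> k) g \<zeta> * cnj \<zeta> ^ n)"
          using iF[THEN integrable_mult_cnj_power]
          by (subst Bochner_Integration.integral_diff Bochner_Integration.integral_add;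
              (intro Bochner_Integration.integrable_add integrable_mult_right)?;
              simp add: Bochner_Integration.integral_add)+
        also have "\<dots> = taylor g n * of_real (J (R k) (R (Suc k))) + of_real (M (Suc k) / m k) * (taylor g n * of_real (\<rho> (Suc k) ^ n * m k))
           - of_real (M k / m k) * (taylor g n * of_real (\<rho> k ^ n * m k))"
          unfolding annulus_integral(2)[OF gh R(2)] reflect_integral(2)[OF gh Rk0 rho(1) rhoS(1)] reflect_integral(2)[OF gh Rk0 rho(1,2)] mm J_def ..
        also have "\<dots> = taylor g n * of_real (J (R k) (R (Suc k)) + M (Suc k) / m k * (\<rho> (Suc k) ^ n * m k) - M k / m k * (\<rho> k ^ n * m k))"
          by (simp only: of_real_add of_real_diff of_real_mult) (simp only: algebra_simps)
        also have "M (Suc k) / m k * (\<rho> (Suc k) ^ n * m k) = M (Suc k) * \<rho> (Suc k) ^ n" using m(1)[of k] by simp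
        also have "M k / m k * (\<rho> k ^ n * m k) = M k * \<rho> k ^ n" using m(1)[of k] by simp
        finally show ?thesis .
      qed
      have J0: "(LINT \<zeta>|\<nu>. F0 \<zeta> * cnj \<zeta> ^ n) = taylor g n * of_real (J 0 r0 + M 0 * \<rho> 0 ^ n)"
      proof -
        have "(LINT \<zeta>|\<nu>. F0 \<zeta> * cnj \<zeta> ^ n) = (LINT \<zeta>|\<nu>. ?I 0 r0 \<zeta> * g \<zeta> * cnj \<zeta> ^ n + ?I r0 1 \<zeta> * reflect (\<rho> 0) g \<zeta> * cnj \<zeta> ^ n)"
          by (rule Bochner_Integration.integral_cong) (simp_all add: F0_def algebra_simps)
        also have "\<dots> = (LINT \<zeta>|\<nu>. ?I 0 r0 \<zeta> * g \<zeta> * cnj \<zeta> ^ n) + (LINT \<zeta>|\<nu>. ?I r0 1 \<zeta> * reflect (\<rho> 0) g \<zeta> * cnj \<zeta> ^ n)"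
          by (rule Bochner_Integration.integral_add[OF integrable_mult_cnj_power[OF annulus_integral(1)[OF gh r0(2)]]
                integrable_mult_cnj_power[OF reflect_integral(1)[OF gh r00(1) rho(1) r00(2)]]])
        also have "\<dots> = taylor g n * of_real (J 0 r0) + taylor g n * of_real (\<rho> 0 ^ n * M 0)"
          unfolding annulus_integral(2)[OF gh r0(2)] reflect_integral(2)[OF gh r00(1) rho(1) r00(2)] J_def M_def annulus_mass_def R0 ..
        finally show ?thesis by (simp add: algebra_simps)
      qed
      have Jadd: "J a b + J b c = J a c" if "a \<le> b" "b \<le> c" for a b c
      proof -
        have "J a b + J b c = (LINT \<zeta>|\<nu>. indicator {a..<b} (norm \<zeta>) * norm \<zeta> ^ (2 * n) + indicator {b..<c} (norm \<zeta>) * norm \<zeta> ^ (2 * n))"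
          unfolding J_def by (rule Bochner_Integration.integral_add[symmetric]) (rule Ji)+
        also have "\<dots> = J a c" unfolding J_def
          by (rule Bochner_Integration.integral_cong) (use that in \<open>auto simp: indicator_def\<close>)
        finally show ?thesis .
      qed
      \<comment> \<open>The telescoped sum: \<open>g\<close> on the disc of radius
        \<open>R N\<close>, together with the outstanding payment \<open>M N * \<rho> N ^ n\<close>,
        which vanishes in the limit.\<close>
      have SN: "(LINT \<zeta>|\<nu>. S N \<zeta> * cnj \<zeta> ^ n) = taylor g n * of_real (J 0 (R N) + M N * \<rho> N ^ n)" for N
      proof (induction N)
        case 0
        thus ?case using J0 by (simp add: S_def R0)
      next
        case (Suc N)
        have "(LINT \<zeta>|\<nu>. S (Suc N) \<zeta> * cnj \<zeta> ^ n) = (LINT \<zeta>|\<nu>. S N \<zeta> * cnj \<zeta> ^ n + F N \<zeta> * cnj \<zeta> ^ n)"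
          by (rule Bochner_Integration.integral_cong) (simp_all add: S_def algebra_simps)
        also have "\<dots> = (LINT \<zeta>|\<nu>. S N \<zeta> * cnj \<zeta> ^ n) + (LINT \<zeta>|\<nu>. F N \<zeta> * cnj \<zeta> ^ n)"
          by (rule Bochner_Integration.integral_add[OF integrable_mult_cnj_power[OF Sint] integrable_mult_cnj_power[OF Fint]])
        also have "\<dots> = taylor g n * of_real ((J 0 (R N) + M N * \<rho> N ^ n) + (J (R N) (R (Suc N)) + M (Suc N) * \<rho> (Suc N) ^ n - M N * \<rho> N ^ n))"
          unfolding Suc JS by (simp only: of_real_add distrib_left)
        also have "(J 0 (R N) + M N * \<rho> N ^ n) + (J (R N) (R (Suc N)) + M (Suc N) * \<rho> (Suc N) ^ n - M N * \<rho> N ^ n) = J 0 (R (Suc N)) + M (Suc N) * \<rho> (Suc N) ^ n"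
          using Jadd[of 0 "R N" "R (Suc N)"] R(3)[of N] Rk0[of N] by simp
        finally show ?case .
      qed
      have l1: "(\<lambda>N. LINT \<zeta>|\<nu>. S N \<zeta> * cnj \<zeta> ^ n) \<longlonglongrightarrow> (LINT \<zeta>|\<nu>. f \<zeta> * cnj \<zeta> ^ n)"
      proof (rule integral_dominated_convergence[where w="\<lambda>_. C * G"])
        show "(\<lambda>\<zeta>. f \<zeta> * cnj \<zeta> ^ n) \<in> borel_measurable \<nu>" using fm by measurable
        show "(\<lambda>\<zeta>. S N \<zeta> * cnj \<zeta> ^ n) \<in> borel_measurable \<nu>" for N using integrable_mult_cnj_power[OF Sint[of N]] by auto
        show "AE \<zeta> in \<nu>. (\<lambda>N. S N \<zeta> * cnj \<zeta> ^ n) \<longlonglongrightarrow> f \<zeta> * cnj \<zeta> ^ n"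
          by (rule AE_I2) (auto intro!: tendsto_intros lim)
        show "AE \<zeta> in \<nu>. norm (S N \<zeta> * cnj \<zeta> ^ n) \<le> C * G" for N
        proof (rule AE_I2)
          fix \<zeta> assume "\<zeta> \<in> space \<nu>"
          hence z: "\<zeta> \<in> \<D>" by simp
          have "norm (S N \<zeta>) * norm \<zeta> ^ n \<le> (C * G) * 1"
            using cases[OF z, of N] z C G by (intro mult_mono power_le_one) auto
          thus "norm (S N \<zeta> * cnj \<zeta> ^ n) \<le> C * G" by (simp add: norm_mult norm_power)
        qed
      qed simp
      have l2: "(\<lambda>N. J 0 (R N)) \<longlonglongrightarrow> (LINT \<zeta>|\<nu>. norm \<zeta> ^ (2 * n))"
        unfolding J_def
      proof (rule integral_dominated_convergence[where w="\<lambda>_. 1"])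
        show "(\<lambda>\<zeta>. norm \<zeta> ^ (2 * n)) \<in> borel_measurable \<nu>" by measurable
        show "(\<lambda>\<zeta>. indicator {0..<R N} (norm \<zeta>) * norm \<zeta> ^ (2 * n) :: real) \<in> borel_measurable \<nu>" for N using Ji[of 0 "R N"] by auto
        show "AE \<zeta> in \<nu>. (\<lambda>N. indicator {0..<R N} (norm \<zeta>) * norm \<zeta> ^ (2 * n)) \<longlonglongrightarrow> norm \<zeta> ^ (2 * n)"
        proof (rule AE_I2)
          fix \<zeta> assume "\<zeta> \<in> space \<nu>"
          hence z: "\<zeta> \<in> \<D>" by simp
          have "\<forall>\<^sub>F N in sequentially. t N < 1 - norm \<zeta>" using z by (intro order_tendstoD(2)[OF tlim]) auto
          hence "\<forall>\<^sub>F N in sequentially. indicator {0..<R N} (norm \<zeta>) * norm \<zeta> ^ (2 * n) = norm \<zeta> ^ (2 * n)"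
            by eventually_elim (simp add: R_def)
          thus "(\<lambda>N. indicator {0..<R N} (norm \<zeta>) * norm \<zeta> ^ (2 * n)) \<longlonglongrightarrow> norm \<zeta> ^ (2 * n)"
            by (rule tendsto_eventually)
        qed
        show "AE \<zeta> in \<nu>. norm (indicator {0..<R N} (norm \<zeta>) * norm \<zeta> ^ (2 * n)) \<le> 1" for N
          by (rule AE_I2) (auto simp: indicator_def power_le_one)
      qed simp
      have l3: "(\<lambda>N. M N * \<rho> N ^ n) \<longlonglongrightarrow> 0"
      proof (rule tendsto_sandwich[of "\<lambda>_. 0" _ _ M])
        have "M N * \<rho> N ^ n \<le> M N * 1" for N
          using Mpos[of N] rho(1,2)[of N] R(2)[of N] by (intro mult_left_mono power_le_one) auto
        thus "\<forall>\<^sub>F N in sequentially. M N * \<rho> N ^ n \<le> M N" by simp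
        show "\<forall>\<^sub>F N in sequentially. 0 \<le> M N * \<rho> N ^ n" using Mpos rho(1) by (intro always_eventually allI mult_nonneg_nonneg) (auto simp: less_imp_le)
      qed (use Mlim in auto)
      have "(\<lambda>N. taylor g n * of_real (J 0 (R N) + M N * \<rho> N ^ n)) \<longlonglongrightarrow> taylor g n * of_real ((LINT \<zeta>|\<nu>. norm \<zeta> ^ (2 * n)) + 0)"
        by (intro tendsto_intros l2 l3)
      hence "(LINT \<zeta>|\<nu>. f \<zeta> * cnj \<zeta> ^ n) = taylor g n * of_real (LINT \<zeta>|\<nu>. norm \<zeta> ^ (2 * n))"
        using LIMSEQ_unique[OF l1[unfolded SN]] by simp
      thus ?thesis unfolding nu_moment_nat by simp
    qed
    show "\<exists>f. f \<in> borel_measurable \<nu> \<and> (\<forall>\<zeta>\<in>\<D>. norm (f \<zeta>) \<le> C * Bloch_norm g) \<and>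
     (\<forall>n. (LINT \<zeta>|\<nu>. f \<zeta> * cnj \<zeta> ^ n) = taylor g n * of_real (2 * moment \<omega> (2 * real n + 1)))"
      using fm fb fc unfolding G_def by blast
  qed
qed


section \<open>The Bergman space and the pairing\<close>

definition L1 :: "(complex \<Rightarrow> complex) \<Rightarrow> real"
  where "L1 f = (LINT \<zeta>|\<nu>. norm (f \<zeta>))"

lemma L1_nonneg: "0 \<le> L1 f"
  by (simp add: L1_def)

lemma holomorphic_measurable: "f holomorphic_on \<D> \<Longrightarrow> f \<in> borel_measurable \<nu>"
  by (intro measurable_nu_continuous holomorphic_on_imp_continuous_on)

lemma Bergman_1_iff: "f \<in> Bergman 1 \<omega> \<longleftrightarrow> f holomorphic_on \<D> \<and> integrable \<nu> f"
proof (cases "f holomorphic_on \<D>")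
  case True
  hence m: "f \<in> borel_measurable \<nu>" by (rule holomorphic_measurable)
  hence [measurable]: "(\<lambda>z. norm (f z)) \<in> borel_measurable \<nu>" by measurable
  have "integrable \<nu> f \<longleftrightarrow> integrable \<nu> (\<lambda>z. norm (f z))" using m by (simp add: integrable_norm_iff)
  also have "\<dots> \<longleftrightarrow> integrable dA (\<lambda>z. \<omega> (norm z) *\<^sub>R norm (f z))" by (rule integral_nu(2)) measurable
  finally show ?thesis using True m
    by (simp add: Bergman_def Lp_space_def measurable_nu mult.commute)
qed (simp add: Bergman_def)

lemma Lp_norm_1: assumes "f \<in> borel_measurable \<nu>" shows "Lp_norm 1 \<omega> f = L1 f"
proof -
  have "L1 f = (LINT z|dA. \<omega> (norm z) *\<^sub>R norm (f z))"
    unfolding L1_def by (rule integral_nu(1)) (use assms in measurable)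
  thus ?thesis using L1_nonneg[of f] by (simp add: Lp_norm_def mult.commute)
qed

lemma dilate_bounded:
  assumes f: "f holomorphic_on \<D>" and r: "0 \<le> r" "r < 1"
  obtains B where "\<And>\<zeta>. \<zeta> \<in> \<D> \<Longrightarrow> norm (dilate r f \<zeta>) \<le> B"
proof -
  have "compact (f ` cball 0 r)"
    using r by (intro compact_continuous_image continuous_on_subset[OF holomorphic_on_imp_continuous_on[OF f]]) auto
  hence "bounded (f ` cball 0 r)" by (rule compact_imp_bounded)
  then obtain B where B: "\<forall>x\<in>f ` cball 0 r. norm x \<le> B" unfolding bounded_iff by blast
  show thesis
  proof (rule that[of B])
    fix \<zeta> :: complex assume "\<zeta> \<in> \<D>"
    hence "of_real r * \<zeta> \<in> cball 0 r" using r by (simp add: norm_mult mult_left_le)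
    thus "norm (dilate r f \<zeta>) \<le> B" using B by (simp add: dilate_def)
  qed
qed

lemma dilate_integrable:
  assumes f: "f holomorphic_on \<D>" and r: "0 \<le> r" "r < 1"
  shows "integrable \<nu> (dilate r f)"
proof -
  obtain B where B: "\<And>\<zeta>. \<zeta> \<in> \<D> \<Longrightarrow> norm (dilate r f \<zeta>) \<le> B" by (rule dilate_bounded[OF assms]) blast
  show ?thesis
  proof (rule disc.integrable_const_bound[of _ B])
    show "AE \<zeta> in \<nu>. norm (dilate r f \<zeta>) \<le> B" by (rule AE_I2) (simp add: B)
    show "dilate r f \<in> borel_measurable \<nu>"
      by (rule holomorphic_measurable[OF dilate_holomorphic[OF f r(1) less_imp_le[OF r(2)]]])
  qed
qed

text \<open>
  Monotonicity of the means in the dilation parameter: by duality it reduces to the maximum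
  modulus principle, and rotation invariance of the measure makes the dual bound constant on
  the unit circle. The cut-off at radius \<open>b\<close> makes the pairing holomorphic beyond that circle.
\<close>

lemma mult_cnj_sgn: "x * cnj (sgn x) = of_real (norm x)" for x :: complex
proof (cases "x = 0")
  case False
  have "x * cnj (sgn x) = (x * cnj x) / of_real (norm x)"
    by (simp add: sgn_div_norm scaleR_conv_of_real divide_inverse mult.assoc mult.left_commute)
  also have "\<dots> = of_real (norm x)"
    using False by (simp only: complex_norm_square[symmetric]) (simp add: power2_eq_square)
  finally show ?thesis .
qed simp

lemma L1_dilate_cutoff:
  assumes f: "f holomorphic_on \<D>" "integrable \<nu> f" and r: "0 \<le> r" "r < 1" and b: "0 < b" "b < 1"
  shows "(LINT \<zeta>|\<nu>. indicator {0..<b} (norm \<zeta>) * norm (dilate r f \<zeta>)) \<le> L1 f"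
proof -
  \<comment> \<open>Dual to the dilation at the given \<open>r\<close>; it stays fixed while the
    dilation parameter in \<open>H\<close> runs through the closed unit disc.\<close>
  define \<psi> where "\<psi> \<zeta> = cnj (sgn (dilate r f \<zeta>)) * indicator {0..<b} (norm \<zeta>)" for \<zeta>
  have im[measurable]: "(\<lambda>\<zeta>. indicator {0..<b} (norm \<zeta>) :: complex) \<in> borel_measurable \<nu>" 
    by (rule measurable_nu_borel) measurable
  have dm[measurable]: "dilate r f \<in> borel_measurable \<nu>" using dilate_integrable[OF f(1) r] by simp
  have cm[measurable]: "cnj \<in> borel_measurable borel" by (intro borel_measurable_continuous_onI continuous_intros)
  have sm[measurable]: "(\<lambda>\<zeta>. sgn (dilate r f \<zeta>)) \<in> borel_measurable \<nu>"
    unfolding sgn_div_norm by measurable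
  have pm[measurable]: "\<psi> \<in> borel_measurable \<nu>" unfolding \<psi>_def[abs_def] by measurable
  have pb: "norm (\<psi> \<zeta>) \<le> indicator {0..<b} (norm \<zeta>)" for \<zeta>
    by (auto simp: \<psi>_def norm_mult norm_sgn indicator_def)
  have p0: "\<psi> \<zeta> = 0" if "b \<le> norm \<zeta>" for \<zeta> using that by (simp add: \<psi>_def)
  have pz: "(\<lambda>\<zeta>. \<psi> \<zeta> * \<zeta> ^ n) \<in> borel_measurable \<nu>" for n by measurable
  have fb: "summable (\<lambda>n. norm (taylor f n) * b ^ n)" using taylor_series(1)[OF f(1)] b by (auto simp: disc_series_def)
  have bound: "norm (taylor f n * w ^ n * (\<psi> \<zeta> * \<zeta> ^ n)) \<le> norm (taylor f n) * b ^ n" if "norm w \<le> 1" for w \<zeta> n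
  proof (cases "norm \<zeta> < b")
    case True
    have "norm w ^ n * (norm (\<psi> \<zeta>) * norm \<zeta> ^ n) \<le> 1 * (1 * b ^ n)"
      using that True b pb[of \<zeta>] by (intro mult_mono power_le_one power_mono) (auto simp: indicator_def split: if_splits)
    hence "norm (taylor f n) * (norm w ^ n * (norm (\<psi> \<zeta>) * norm \<zeta> ^ n)) \<le> norm (taylor f n) * b ^ n"
      by (intro mult_left_mono) auto
    thus ?thesis by (simp add: norm_mult norm_power mult.assoc)
  next
    case False
    thus ?thesis using b by (simp add: p0)
  qed
  have int: "integrable \<nu> (\<lambda>\<zeta>. taylor f n * w ^ n * (\<psi> \<zeta> * \<zeta> ^ n))" if "norm w \<le> 1" for w n
    by (rule disc.integrable_const_bound[of _ "norm (taylor f n) * b ^ n"]) (use bound[OF that] in auto)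
  define H where "H w = (LINT \<zeta>|\<nu>. f (w * \<zeta>) * \<psi> \<zeta>)" for w
  define c where "c n = (LINT \<zeta>|\<nu>. \<psi> \<zeta> * \<zeta> ^ n)" for n
  have Hs: "(\<lambda>n. taylor f n * w ^ n * c n) sums H w" if w: "norm w \<le> 1" for w
  proof -
    have "(\<lambda>n. LINT \<zeta>|\<nu>. taylor f n * w ^ n * (\<psi> \<zeta> * \<zeta> ^ n)) sums (LINT \<zeta>|\<nu>. (\<Sum>n. taylor f n * w ^ n * (\<psi> \<zeta> * \<zeta> ^ n)))"
    proof (rule sums_integral[OF int[OF w]])
      show "AE \<zeta> in \<nu>. summable (\<lambda>n. norm (taylor f n * w ^ n * (\<psi> \<zeta> * \<zeta> ^ n)))"
        by (rule AE_I2, rule summable_comparison_test[OF _ fb]) (use bound[OF w] in auto)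
      show "summable (\<lambda>n. LINT \<zeta>|\<nu>. norm (taylor f n * w ^ n * (\<psi> \<zeta> * \<zeta> ^ n)))"
      proof (rule summable_comparison_test[OF _ summable_mult2[OF fb, of "measure \<nu> \<D>"]], intro exI[of _ 0] allI impI)
        fix n
        have "(LINT \<zeta>|\<nu>. norm (taylor f n * w ^ n * (\<psi> \<zeta> * \<zeta> ^ n))) \<le> (LINT \<zeta>|\<nu>. norm (taylor f n) * b ^ n)"
          using bound[OF w] by (intro integral_mono integrable_norm int[OF w]) auto
        also have "\<dots> = norm (taylor f n) * b ^ n * measure \<nu> \<D>" by simp
        finally show "norm (LINT \<zeta>|\<nu>. norm (taylor f n * w ^ n * (\<psi> \<zeta> * \<zeta> ^ n))) \<le> norm (taylor f n) * b ^ n * measure \<nu> \<D>"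
          by (subst real_norm_def, subst abs_of_nonneg) (auto intro: integral_nonneg_AE)
      qed
    qed
    moreover have "(LINT \<zeta>|\<nu>. (\<Sum>n. taylor f n * w ^ n * (\<psi> \<zeta> * \<zeta> ^ n))) = H w"
      unfolding H_def
    proof (rule Bochner_Integration.integral_cong[OF refl])
      fix \<zeta> assume "\<zeta> \<in> space \<nu>"
      hence z: "norm \<zeta> < 1" by simp
      have "norm w * norm \<zeta> \<le> 1 * norm \<zeta>" using w by (intro mult_right_mono) auto
      hence "w * \<zeta> \<in> \<D>" using z by (simp add: norm_mult)
      from sums_mult2[OF taylor_sums[OF f(1) this], of "\<psi> \<zeta>"]
      show "(\<Sum>n. taylor f n * w ^ n * (\<psi> \<zeta> * \<zeta> ^ n)) = f (w * \<zeta>) * \<psi> \<zeta>"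
        by (simp add: sums_iff power_mult_distrib mult_ac)
    qed
    moreover have "(LINT \<zeta>|\<nu>. taylor f n * w ^ n * (\<psi> \<zeta> * \<zeta> ^ n)) = taylor f n * w ^ n * c n" for n
      unfolding c_def by (rule integral_mult_right_zero)
    ultimately show ?thesis by (simp add: c_def)
  qed
  \<comment> \<open>The function \<psi> lives within radius \<open>b\<close>, so its moments are of
    order \<open>b ^ n\<close>. Dividing by \<open>b ^ n\<close> exhibits \<open>H w\<close> as a
    power series at \<open>b * w\<close>, hence analytic past the unit circle.\<close>
  define d where "d n = taylor f n * (c n / of_real b ^ n)" for n
  have cb: "norm (c n) \<le> b ^ n * measure \<nu> \<D>" for n
  proof -
    have "norm (c n) \<le> (LINT \<zeta>|\<nu>. norm (\<psi> \<zeta> * \<zeta> ^ n))" unfolding c_def by (rule integral_norm_bound)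
    also have "\<dots> \<le> (LINT \<zeta>|\<nu>. b ^ n)"
    proof (rule integral_mono)
      have pz1: "norm (\<psi> \<zeta> * \<zeta> ^ n) \<le> b ^ n" for \<zeta>
      proof (cases "norm \<zeta> < b")
        case True
        have "norm (\<psi> \<zeta>) * norm \<zeta> ^ n \<le> 1 * b ^ n"
          using True b pb[of \<zeta>] by (intro mult_mono power_mono) (auto simp: indicator_def split: if_splits)
        thus ?thesis by (simp add: norm_mult norm_power)
      qed (use p0 b in auto)
      show "integrable \<nu> (\<lambda>\<zeta>. norm (\<psi> \<zeta> * \<zeta> ^ n))"
        by (intro integrable_norm disc.integrable_const_bound[of _ "b ^ n"]) (use pz1 in auto)
      show "norm (\<psi> \<zeta> * \<zeta> ^ n) \<le> b ^ n" for \<zeta> by (rule pz1)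
    qed simp
    finally show ?thesis by (simp add: mult.commute)
  qed
  have dd: "disc_series d"
    unfolding disc_series_def
  proof
    fix x :: real assume x: "x \<in> {0..<1}"
    have S: "summable (\<lambda>n. norm (taylor f n) * x ^ n * measure \<nu> \<D>)"
      using taylor_series(1)[OF f(1)] x by (intro summable_mult2) (auto simp: disc_series_def)
    show "summable (\<lambda>n. norm (d n) * x ^ n)"
    proof (rule summable_comparison_test[OF _ S], intro exI[of _ 0] allI impI)
      fix n
      have "norm (c n / of_real b ^ n) \<le> measure \<nu> \<D>"
        using cb[of n] b by (simp add: norm_divide norm_power pos_divide_le_eq mult.commute)
      hence "norm (d n) \<le> norm (taylor f n) * measure \<nu> \<D>"
        unfolding d_def norm_mult by (intro mult_left_mono) auto
      hence "norm (d n) * x ^ n \<le> norm (taylor f n) * measure \<nu> \<D> * x ^ n"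
        using x by (intro mult_right_mono) auto
      thus "norm (norm (d n) * x ^ n) \<le> norm (taylor f n) * x ^ n * measure \<nu> \<D>"
        using x by (simp add: mult_ac)
    qed
  qed
  have bw: "of_real b * w \<in> \<D>" if "norm w \<le> 1" for w :: complex
  proof -
    have "b * norm w \<le> b * 1" using that b by (intro mult_left_mono) auto
    hence "b * norm w < 1" using b by linarith
    thus ?thesis using b by (simp add: norm_mult)
  qed
  have Hd: "H w = psum d (of_real b * w)" if "norm w \<le> 1" for w
    using Hs[OF that] b by (simp add: sums_iff psum_def d_def power_mult_distrib field_simps)
  define H' where "H' w = psum d (of_real b * w)" for w
  have hol: "H' holomorphic_on \<D>" unfolding H'_def[abs_def]
    by (rule holomorphic_on_compose_gen[OF _ psum_holomorphic[OF dd], unfolded o_def]) (use bw in \<open>auto intro!: holomorphic_intros\<close>)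
  have cont: "continuous_on (cball 0 1) H'" unfolding H'_def[abs_def]
    by (rule continuous_on_compose2[OF holomorphic_on_imp_continuous_on[OF psum_holomorphic[OF dd]]])
       (use bw in \<open>auto intro!: continuous_intros\<close>)
  have circ: "norm (H' w) \<le> L1 f" if w: "norm w = 1" for w
  proof -
    have fw: "integrable \<nu> (\<lambda>\<zeta>. f (w * \<zeta>))" using integral_nu_rotation(2)[OF w holomorphic_measurable[OF f(1)]] f(2) by simp
    have "norm (H w) \<le> (LINT \<zeta>|\<nu>. norm (f (w * \<zeta>) * \<psi> \<zeta>))" unfolding H_def by (rule integral_norm_bound)
    also have "\<dots> \<le> (LINT \<zeta>|\<nu>. norm (f (w * \<zeta>)))"
    proof (rule integral_mono)
      have "norm (\<psi> \<zeta>) \<le> 1" for \<zeta> by (auto simp: \<psi>_def norm_mult norm_sgn indicator_def)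
      hence "norm (f (w * \<zeta>)) * norm (\<psi> \<zeta>) \<le> norm (f (w * \<zeta>)) * 1" for \<zeta>
        by (intro mult_left_mono) auto
      thus le: "norm (f (w * \<zeta>) * \<psi> \<zeta>) \<le> norm (f (w * \<zeta>))" for \<zeta> by (simp add: norm_mult)
      have [measurable]: "(\<lambda>\<zeta>. f (w * \<zeta>)) \<in> borel_measurable \<nu>" using fw by simp
      show "integrable \<nu> (\<lambda>\<zeta>. norm (f (w * \<zeta>) * \<psi> \<zeta>))"
        by (rule integrable_norm, rule Bochner_Integration.integrable_bound[OF fw]) (use le in \<open>auto intro!: AE_I2\<close>)
      show "integrable \<nu> (\<lambda>\<zeta>. norm (f (w * \<zeta>)))" using fw by simp
    qed
    also have "\<dots> = L1 f" unfolding L1_def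
      by (rule integral_nu_rotation(1)[OF w measurable_compose[OF holomorphic_measurable[OF f(1)] borel_measurable_norm]])
    finally show ?thesis using Hd[of w] w by (simp add: H'_def)
  qed
  have "norm (H' (of_real r)) \<le> L1 f"
  proof (rule maximum_modulus_frontier[of H' \<D>])
    show "H' holomorphic_on interior \<D>" using hol by simp
    show "continuous_on (closure \<D>) H'" using cont by simp
    show "bounded \<D>" by simp
    show "norm (H' z) \<le> L1 f" if "z \<in> frontier \<D>" for z using that by (intro circ) simp
    show "complex_of_real r \<in> \<D>" using r by simp
  qed
  hence "norm (H (of_real r)) \<le> L1 f" using Hd[of "of_real r"] r by (simp add: H'_def)
  moreover have "H (of_real r) = of_real (LINT \<zeta>|\<nu>. indicator {0..<b} (norm \<zeta>) * norm (dilate r f \<zeta>))"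
  proof -
    have e: "f (of_real r * \<zeta>) * \<psi> \<zeta> = of_real (indicator {0..<b} (norm \<zeta>) * norm (dilate r f \<zeta>))" for \<zeta>
    proof -
      have "dilate r f \<zeta> * cnj (sgn (dilate r f \<zeta>)) = of_real (norm (dilate r f \<zeta>))" by (rule mult_cnj_sgn)
      thus ?thesis by (auto simp: \<psi>_def dilate_def indicator_def)
    qed
    show ?thesis unfolding H_def e by (rule integral_complex_of_real)
  qed
  ultimately show ?thesis by (simp only: norm_of_real)
qed

lemma L1_dilate_le:
  assumes f: "f holomorphic_on \<D>" "integrable \<nu> f" and r: "0 \<le> r" "r < 1"
  shows "L1 (dilate r f) \<le> L1 f"
proof -
  define b where "b n = 1 - 1 / (real n + 2)" for n
  have b: "0 < b n" "b n < 1" for n by (auto simp: b_def field_simps)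
  have blim: "b \<longlonglongrightarrow> 1" unfolding b_def[abs_def] by real_asymp
  have di: "integrable \<nu> (\<lambda>\<zeta>. norm (dilate r f \<zeta>))" by (intro integrable_norm dilate_integrable f(1) r)
  have "(\<lambda>n. LINT \<zeta>|\<nu>. indicator {0..<b n} (norm \<zeta>) * norm (dilate r f \<zeta>)) \<longlonglongrightarrow> (LINT \<zeta>|\<nu>. norm (dilate r f \<zeta>))"
  proof (rule integral_dominated_convergence[where w="\<lambda>\<zeta>. norm (dilate r f \<zeta>)"])
    have [measurable]: "(\<lambda>\<zeta>. norm (dilate r f \<zeta>)) \<in> borel_measurable \<nu>" using di by simp
    show "(\<lambda>\<zeta>. norm (dilate r f \<zeta>)) \<in> borel_measurable \<nu>" by measurable
    show "(\<lambda>\<zeta>. indicator {0..<b n} (norm \<zeta>) * norm (dilate r f \<zeta>)) \<in> borel_measurable \<nu>" for n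
      using indicator_integrable[of 0 "b n"] by (intro borel_measurable_times) auto
    show "AE \<zeta> in \<nu>. (\<lambda>n. indicator {0..<b n} (norm \<zeta>) * norm (dilate r f \<zeta>)) \<longlonglongrightarrow> norm (dilate r f \<zeta>)"
    proof (rule AE_I2)
      fix \<zeta> assume "\<zeta> \<in> space \<nu>"
      hence "\<forall>\<^sub>F n in sequentially. norm \<zeta> < b n" by (intro order_tendstoD(1)[OF blim]) auto
      hence "\<forall>\<^sub>F n in sequentially. indicator {0..<b n} (norm \<zeta>) * norm (dilate r f \<zeta>) = norm (dilate r f \<zeta>)"
        by eventually_elim simp
      thus "(\<lambda>n. indicator {0..<b n} (norm \<zeta>) * norm (dilate r f \<zeta>)) \<longlonglongrightarrow> norm (dilate r f \<zeta>)" by (rule tendsto_eventually)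
    qed
  qed (use di in \<open>auto simp: indicator_def\<close>)
  hence "(LINT \<zeta>|\<nu>. norm (dilate r f \<zeta>)) \<le> L1 f"
    by (rule LIMSEQ_le_const2) (use L1_dilate_cutoff[OF f r b] in auto)
  thus ?thesis by (simp add: L1_def)
qed

text \<open>Scheffe's lemma: pointwise convergence together with the bound
  \<open>L1_dilate_le\<close> for the norms upgrades to convergence in norm.\<close>

lemma L1_dilate_tendsto:
  assumes f: "f holomorphic_on \<D>" "integrable \<nu> f"
  shows "((\<lambda>r. L1 (\<lambda>z. dilate r f z - f z)) \<longlongrightarrow> 0) (at_left 1)"
proof (rule tendsto_at_left_sequentially[of 0])
  fix S :: "nat \<Rightarrow> real" assume S: "\<And>n. S n < 1" "\<And>n. 0 < S n" "S \<longlonglongrightarrow> 1"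
  have di: "integrable \<nu> (dilate (S n) f)" for n by (rule dilate_integrable[OF f(1) less_imp_le[OF S(2)] S(1)])
  have n1: "(\<integral>\<^sup>+z. ennreal (norm (g z)) \<partial>\<nu>) = ennreal (L1 g)" if "integrable \<nu> g" for g :: "complex \<Rightarrow> complex"
    unfolding L1_def by (rule nn_integral_eq_integral) (use that in auto)
  have "(\<lambda>n. \<integral>\<^sup>+z. norm (dilate (S n) f z - f z) \<partial>\<nu>) \<longlonglongrightarrow> 0"
  proof (rule Scheffe_lemma2)
    show "dilate (S n) f \<in> borel_measurable \<nu>" for n using di by auto
    show "integrable \<nu> f" by (rule f(2))
    show "AE z in \<nu>. (\<lambda>n. dilate (S n) f z) \<longlonglongrightarrow> f z"
    proof (rule AE_I2)
      fix z assume "z \<in> space \<nu>"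
      hence z: "z \<in> \<D>" by simp
      have "isCont f z" using holomorphic_on_imp_continuous_on[OF f(1)] z by (simp add: continuous_on_eq_continuous_at)
      moreover have "(\<lambda>n. complex_of_real (S n) * z) \<longlonglongrightarrow> of_real 1 * z" by (intro tendsto_intros S(3))
      ultimately show "(\<lambda>n. dilate (S n) f z) \<longlonglongrightarrow> f z"
        unfolding dilate_def by (intro isCont_tendsto_compose[of z f]) auto
    qed
    show "(\<integral>\<^sup>+z. norm (dilate (S n) f z) \<partial>\<nu>) \<le> (\<integral>\<^sup>+z. norm (f z) \<partial>\<nu>)" for n
      unfolding n1[OF di] n1[OF f(2)] using L1_dilate_le[OF f less_imp_le[OF S(2)] S(1)] by (rule ennreal_leI)
  qed
  moreover have "(\<integral>\<^sup>+z. norm (dilate (S n) f z - f z) \<partial>\<nu>) = ennreal (L1 (\<lambda>z. dilate (S n) f z - f z))" for n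
    by (rule n1) (intro Bochner_Integration.integrable_diff di f(2))
  ultimately have "(\<lambda>n. ennreal (L1 (\<lambda>z. dilate (S n) f z - f z))) \<longlonglongrightarrow> ennreal 0" by simp
  thus "(\<lambda>n. L1 (\<lambda>z. dilate (S n) f z - f z)) \<longlonglongrightarrow> 0"
    by (subst (asm) tendsto_ennreal_iff) (auto simp: L1_nonneg)
qed simp

text \<open>Termwise integration is available on smaller discs, where the Taylor series converges
  uniformly; dominated convergence carries the identity to the full disc.\<close>

lemma integral_holomorphic_cnj_power:
  assumes g: "g holomorphic_on \<D>" "integrable \<nu> g"
  shows "(LINT \<zeta>|\<nu>. g \<zeta> * cnj \<zeta> ^ n) = taylor g n * of_real (2 * moment \<omega> (2 * real n + 1))"
proof -
  define b where "b k = 1 - 1 / (real k + 2)" for k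
  have b: "0 < b k" "b k < 1" for k by (auto simp: b_def field_simps)
  have blim: "b \<longlonglongrightarrow> 1" unfolding b_def[abs_def] by real_asymp
  have ev: "\<forall>\<^sub>F k in sequentially. norm \<zeta> < b k" if "\<zeta> \<in> \<D>" for \<zeta> :: complex
    using that by (intro order_tendstoD(1)[OF blim]) auto
  have gn: "integrable \<nu> (\<lambda>\<zeta>. g \<zeta> * cnj \<zeta> ^ n)" by (rule integrable_mult_cnj_power[OF g(2)])
  have [measurable]: "(\<lambda>\<zeta>. g \<zeta> * cnj \<zeta> ^ n) \<in> borel_measurable \<nu>" using gn by simp
  have im[measurable]: "(\<lambda>\<zeta>. indicator {0..<b k} (norm \<zeta>) :: complex) \<in> borel_measurable \<nu>" for k
    by (rule measurable_nu_borel) measurable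
  have l1: "(\<lambda>k. LINT \<zeta>|\<nu>. indicator {0..<b k} (norm \<zeta>) * (g \<zeta> * cnj \<zeta> ^ n)) \<longlonglongrightarrow> (LINT \<zeta>|\<nu>. g \<zeta> * cnj \<zeta> ^ n)"
  proof (rule integral_dominated_convergence[where w="\<lambda>\<zeta>. norm (g \<zeta> * cnj \<zeta> ^ n)"])
    show "AE \<zeta> in \<nu>. (\<lambda>k. indicator {0..<b k} (norm \<zeta>) * (g \<zeta> * cnj \<zeta> ^ n)) \<longlonglongrightarrow> g \<zeta> * cnj \<zeta> ^ n"
    proof (rule AE_I2)
      fix \<zeta> assume "\<zeta> \<in> space \<nu>"
      hence "\<forall>\<^sub>F k in sequentially. norm \<zeta> < b k" by (intro ev) simp
      hence "\<forall>\<^sub>F k in sequentially. indicator {0..<b k} (norm \<zeta>) * (g \<zeta> * cnj \<zeta> ^ n) = g \<zeta> * cnj \<zeta> ^ n"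
        by eventually_elim simp
      thus "(\<lambda>k. indicator {0..<b k} (norm \<zeta>) * (g \<zeta> * cnj \<zeta> ^ n)) \<longlonglongrightarrow> g \<zeta> * cnj \<zeta> ^ n" by (rule tendsto_eventually)
    qed
    show "integrable \<nu> (\<lambda>\<zeta>. norm (g \<zeta> * cnj \<zeta> ^ n))" by (rule integrable_norm[OF gn])
    show "AE \<zeta> in \<nu>. norm (indicator {0..<b k} (norm \<zeta>) * (g \<zeta> * cnj \<zeta> ^ n)) \<le> norm (g \<zeta> * cnj \<zeta> ^ n)" for k
      by (rule AE_I2) (simp add: indicator_def)
  qed measurable
  have e: "(LINT \<zeta>|\<nu>. indicator {0..<b k} (norm \<zeta>) * (g \<zeta> * cnj \<zeta> ^ n)) = 
      taylor g n * of_real (LINT \<zeta>|\<nu>. indicator {0..<b k} (norm \<zeta>) * norm \<zeta> ^ (2 * n))" for k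
    using annulus_integral(2)[OF g(1) b(2), of 0 k n] by (simp add: mult.assoc)
  have "(\<lambda>k. LINT \<zeta>|\<nu>. indicator {0..<b k} (norm \<zeta>) * norm \<zeta> ^ (2 * n)) \<longlonglongrightarrow> (LINT \<zeta>|\<nu>. norm \<zeta> ^ (2 * n))"
  proof (rule integral_dominated_convergence[where w="\<lambda>_. 1"])
    show "(\<lambda>\<zeta>. norm \<zeta> ^ (2 * n)) \<in> borel_measurable \<nu>" by measurable
    show "(\<lambda>\<zeta>. indicator {0..<b k} (norm \<zeta>) * norm \<zeta> ^ (2 * n) :: real) \<in> borel_measurable \<nu>" for k
      using indicator_integrable[of 0 "b k"] by (intro borel_measurable_times) auto
    show "AE \<zeta> in \<nu>. (\<lambda>k. indicator {0..<b k} (norm \<zeta>) * norm \<zeta> ^ (2 * n)) \<longlonglongrightarrow> norm \<zeta> ^ (2 * n)"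
    proof (rule AE_I2)
      fix \<zeta> assume "\<zeta> \<in> space \<nu>"
      hence "\<forall>\<^sub>F k in sequentially. norm \<zeta> < b k" by (intro ev) simp
      hence "\<forall>\<^sub>F k in sequentially. indicator {0..<b k} (norm \<zeta>) * norm \<zeta> ^ (2 * n) = norm \<zeta> ^ (2 * n)"
        by eventually_elim simp
      thus "(\<lambda>k. indicator {0..<b k} (norm \<zeta>) * norm \<zeta> ^ (2 * n)) \<longlonglongrightarrow> norm \<zeta> ^ (2 * n)" by (rule tendsto_eventually)
    qed
    show "AE \<zeta> in \<nu>. norm (indicator {0..<b k} (norm \<zeta>) * norm \<zeta> ^ (2 * n)) \<le> 1" for k
      by (rule AE_I2) (auto simp: indicator_def power_le_one)
  qed simp
  hence l2: "(\<lambda>k. taylor g n * of_real (LINT \<zeta>|\<nu>. indicator {0..<b k} (norm \<zeta>) * norm \<zeta> ^ (2 * n))) \<longlonglongrightarrow> taylor g n * of_real (LINT \<zeta>|\<nu>. norm \<zeta> ^ (2 * n))"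
    by (intro tendsto_intros)
  have "(LINT \<zeta>|\<nu>. g \<zeta> * cnj \<zeta> ^ n) = taylor g n * of_real (LINT \<zeta>|\<nu>. norm \<zeta> ^ (2 * n))"
    by (rule LIMSEQ_unique[OF l1[unfolded e] l2])
  thus ?thesis unfolding nu_moment_nat by simp
qed

section \<open>The pairing before the limit\<close>

definition dpair :: "(complex \<Rightarrow> complex) \<Rightarrow> (complex \<Rightarrow> complex) \<Rightarrow> real \<Rightarrow> complex"
  where "dpair f g r = (LINT \<zeta>|\<nu>. dilate r f \<zeta> * cnj (g \<zeta>))"

text \<open>Dilation makes the Taylor series of \<open>f\<close> absolutely summable, so any
  integrable \<phi> may be paired with it, and the result depends on \<phi> only through its moments
  against \<open>cnj \<zeta> ^ n\<close>. This makes a Bloch function and its bounded preimage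
  interchangeable.\<close>

lemma integral_dilate_cnj:
  assumes f: "f holomorphic_on \<D>" and r: "0 \<le> r" "r < 1" and \<phi>: "integrable \<nu> \<phi>"
  shows "integrable \<nu> (\<lambda>\<zeta>. dilate r f \<zeta> * cnj (\<phi> \<zeta>))"
    and "(\<lambda>n. taylor f n * of_real r ^ n * cnj (LINT \<zeta>|\<nu>. \<phi> \<zeta> * cnj \<zeta> ^ n)) sums dpair f \<phi> r"
proof -
  define c where "c n = cnj (taylor f n * of_real r ^ n)" for n
  have s: "summable (\<lambda>n. norm (c n))"
    using disc_series_summable(1)[OF taylor_series(1)[OF f], of "of_real r"] r
    unfolding c_def complex_mod_cnj by simp
  note I = integral_psum_cnj[OF \<phi> s]
  have eq: "psum c (cnj \<zeta>) = cnj (dilate r f \<zeta>)" if "\<zeta> \<in> \<D>" for \<zeta>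
  proof -
    have "of_real r * \<zeta> \<in> \<D>" using r that by (intro dilate_in_disc) auto
    from taylor_sums[OF f this] have "(\<lambda>n. cnj (taylor f n * (of_real r * \<zeta>) ^ n)) sums cnj (dilate r f \<zeta>)"
      unfolding sums_cnj dilate_def .
    thus ?thesis by (simp add: psum_def c_def sums_iff power_mult_distrib mult.assoc)
  qed
  have "integrable \<nu> (\<lambda>\<zeta>. \<phi> \<zeta> * psum c (cnj \<zeta>)) \<longleftrightarrow> integrable \<nu> (\<lambda>\<zeta>. cnj (dilate r f \<zeta> * cnj (\<phi> \<zeta>)))"
    by (rule Bochner_Integration.integrable_cong) (simp_all add: eq)
  thus "integrable \<nu> (\<lambda>\<zeta>. dilate r f \<zeta> * cnj (\<phi> \<zeta>))" using I(1) by (blast intro: complex_integrable_cnj[THEN iffD1])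
  have "(LINT \<zeta>|\<nu>. \<phi> \<zeta> * psum c (cnj \<zeta>)) = (LINT \<zeta>|\<nu>. cnj (dilate r f \<zeta> * cnj (\<phi> \<zeta>)))"
    by (rule Bochner_Integration.integral_cong) (simp_all add: eq)
  also have "\<dots> = cnj (dpair f \<phi> r)" unfolding dpair_def by (rule Bochner_Integration.integral_cnj)
  finally have "(\<lambda>n. c n * (LINT \<zeta>|\<nu>. \<phi> \<zeta> * cnj \<zeta> ^ n)) sums cnj (dpair f \<phi> r)" using I(2) by simp
  hence "(\<lambda>n. cnj (taylor f n * of_real r ^ n * cnj (LINT \<zeta>|\<nu>. \<phi> \<zeta> * cnj \<zeta> ^ n))) sums cnj (dpair f \<phi> r)"
    by (simp add: c_def)
  thus "(\<lambda>n. taylor f n * of_real r ^ n * cnj (LINT \<zeta>|\<nu>. \<phi> \<zeta> * cnj \<zeta> ^ n)) sums dpair f \<phi> r"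
    unfolding sums_cnj .
qed

lemma dpair_sums:
  assumes f: "f holomorphic_on \<D>" and r: "0 \<le> r" "r < 1" and g: "g holomorphic_on \<D>" "integrable \<nu> g"
  shows "(\<lambda>n. taylor f n * of_real r ^ n * cnj (taylor g n) * of_real (2 * moment \<omega> (2 * real n + 1))) sums dpair f g r"
  using integral_dilate_cnj(2)[OF f r g(2)] unfolding integral_holomorphic_cnj_power[OF g]
  by (simp add: mult.assoc)

text \<open>The power \<open>r ^ n\<close> can be attached to either factor, so the dilation moves
  from one function to the other. One pairing estimate thereby serves both dualities.\<close>

lemma dpair_swap:
  assumes "f holomorphic_on \<D>" "integrable \<nu> f" "g holomorphic_on \<D>" "integrable \<nu> g" "0 \<le> r" "r < 1"
  shows "dpair f g r = cnj (dpair g f r)"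
proof -
  have "(\<lambda>n. cnj (taylor g n * of_real r ^ n * cnj (taylor f n) * of_real (2 * moment \<omega> (2 * real n + 1)))) sums cnj (dpair g f r)"
    unfolding sums_cnj using assms by (intro dpair_sums)
  hence "(\<lambda>n. taylor f n * of_real r ^ n * cnj (taylor g n) * of_real (2 * moment \<omega> (2 * real n + 1))) sums cnj (dpair g f r)"
    by (simp add: mult_ac)
  moreover have "(\<lambda>n. taylor f n * of_real r ^ n * cnj (taylor g n) * of_real (2 * moment \<omega> (2 * real n + 1))) sums dpair f g r"
    using assms by (intro dpair_sums)
  ultimately show ?thesis using sums_unique2 by blast
qed

lemma at_left_1_unit: "\<forall>\<^sub>F r in at_left (1::real). 0 \<le> r \<and> r < 1"
  unfolding eventually_at_left_field by (intro exI[of _ 0]) auto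

lemma pairing_limit:
  assumes f: "f holomorphic_on \<D>" and g: "g holomorphic_on \<D>" "integrable \<nu> g"
    and lim: "(dpair f g \<longlongrightarrow> l) (at_left 1)"
  shows "A2_pairing_exists \<omega> f g" "A2_pairing \<omega> f g = l"
proof -
  have i: "integrable dA (pairing_integrand \<omega> f g r)" "(LINT z|dA. pairing_integrand \<omega> f g r z) = dpair f g r"
    if r: "0 \<le> r \<and> r < 1" for r
  proof -
    have I: "integrable \<nu> (\<lambda>\<zeta>. dilate r f \<zeta> * cnj (g \<zeta>))" using integral_dilate_cnj(1)[OF f _ _ g(2)] r by blast
    have m: "(\<lambda>\<zeta>. dilate r f \<zeta> * cnj (g \<zeta>)) \<in> borel_measurable \<nu>" using I by simp
    have e: "pairing_integrand \<omega> f g r z = \<omega> (norm z) *\<^sub>R (dilate r f z * cnj (g z))" for z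
      by (simp add: pairing_integrand_def dilate_def scaleR_conv_of_real)
    have e': "pairing_integrand \<omega> f g r = (\<lambda>z. \<omega> (norm z) *\<^sub>R (dilate r f z * cnj (g z)))" by (rule ext) (rule e)
    show "integrable dA (pairing_integrand \<omega> f g r)" unfolding e' using integral_nu(2)[OF m] I by simp
    show "(LINT z|dA. pairing_integrand \<omega> f g r z) = dpair f g r" unfolding e dpair_def by (rule integral_nu(1)[OF m, symmetric])
  qed
  have "\<forall>\<^sub>F r in at_left 1. dpair f g r = (LINT z|dA. pairing_integrand \<omega> f g r z)"
    using at_left_1_unit by eventually_elim (use i in auto)
  hence lim': "((\<lambda>r. LINT z|dA. pairing_integrand \<omega> f g r z) \<longlongrightarrow> l) (at_left 1)"
    using lim by (rule Lim_transform_eventually[rotated])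
  moreover have "\<forall>\<^sub>F r in at_left 1. integrable dA (pairing_integrand \<omega> f g r)"
    using at_left_1_unit by eventually_elim (use i in auto)
  ultimately show "A2_pairing_exists \<omega> f g" unfolding A2_pairing_exists_def by blast
  show "A2_pairing \<omega> f g = l" unfolding A2_pairing_def by (rule tendsto_Lim[OF _ lim']) simp
qed

text \<open>The radii \<open>1 - K powi - k\<close> count hyperbolic steps: a Bloch function grows by at most a constant per step, while the mass beyond them decays geometrically.\<close>

lemma Bloch_integrable:
  assumes check: "\<omega> \<in> D_check" and g: "g \<in> Bloch"
  shows "integrable \<nu> g"
proof -
  obtain K Cc where KC: "K > 1" "Cc > 1" "\<forall>r\<in>{0..<1}. tail \<omega> r \<ge> Cc * tail \<omega> (1 - (1 - r) / K)"
    using check by (auto simp: D_check_def)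
  define G where "G = Bloch_norm g"
  have G: "G \<ge> 0" unfolding G_def by (rule Bloch_norm_ge[OF g])
  define R where "R k = 1 - 1 / K ^ k" for k :: nat
  have R: "0 \<le> R k" "R k < 1" "R k \<le> R (Suc k)" for k
  proof -
    have "1 \<le> K ^ k" using KC by (intro one_le_power) auto
    thus "0 \<le> R k" "R k < 1" by (auto simp: R_def)
    have "1 / K ^ Suc k \<le> 1 / K ^ k" using KC by (intro divide_left_mono power_increasing) auto
    thus "R k \<le> R (Suc k)" by (simp add: R_def)
  qed
  have step: "norm (g \<zeta>) \<le> G * (1 + real k * K)" if "norm \<zeta> \<le> R k" for k \<zeta>
    using that
  proof (induction k arbitrary: \<zeta>)
    case 0
    hence "\<zeta> = 0" by (simp add: R_def)
    thus ?case using Bloch_norm_ge(1)[OF g] by (simp add: G_def)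
  next
    case (Suc k)
    show ?case
    proof (cases "norm \<zeta> \<le> R k")
      case True
      have "norm (g \<zeta>) \<le> G * (1 + real k * K)" by (rule Suc.IH[OF True])
      also have "\<dots> \<le> G * (1 + real (Suc k) * K)" using G KC by (intro mult_left_mono add_left_mono mult_right_mono) auto
      finally show ?thesis .
    next
      case False
      define u where "u = sgn \<zeta>"
      have z0: "\<zeta> \<noteq> 0" using False R(1)[of k] by auto
      have u: "norm u = 1" using z0 by (simp add: u_def norm_sgn)
      have zu: "\<zeta> = of_real (norm \<zeta>) * u" using z0 by (simp add: u_def sgn_div_norm scaleR_conv_of_real)
      have "norm (g (of_real (norm \<zeta>) * u) - g (of_real (R k) * u)) \<le> G * ((R (Suc k) - R k) / (1 - R (Suc k)))"
        unfolding G_def by (rule Bloch_ray_pair[OF g u R(1)[of k] R(2)[of "Suc k"]]) (use False Suc.prems R in auto)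
      also have "\<dots> \<le> G * K"
      proof (intro mult_left_mono G)
        have "(R (Suc k) - R k) / (1 - R (Suc k)) \<le> (1 - R k) / (1 - R (Suc k))"
          using R(2)[of "Suc k"] by (intro divide_right_mono) auto
        also have "\<dots> = K" using KC by (simp add: R_def)
        finally show "(R (Suc k) - R k) / (1 - R (Suc k)) \<le> K" .
      qed
      finally have "norm (g \<zeta> - g (of_real (R k) * u)) \<le> G * K" using zu by simp
      moreover have "norm (g (of_real (R k) * u)) \<le> G * (1 + real k * K)"
        by (rule Suc.IH) (use u R(1)[of k] in \<open>simp add: norm_mult\<close>)
      ultimately have "norm (g \<zeta>) \<le> G * (1 + real k * K) + G * K"
        using norm_triangle_sub[of "g \<zeta>" "g (of_real (R k) * u)"] by linarith
      thus ?thesis by (simp add: algebra_simps)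
    qed
  qed
  have Rmono: "R k \<le> R l" if "k \<le> l" for k l
    by (rule lift_Suc_mono_le[of R, OF R(3) that])
  have Rlim: "R \<longlonglongrightarrow> 1"
  proof -
    have "(\<lambda>k. 1 - (1 / K) ^ k) \<longlonglongrightarrow> 1 - 0" using KC by (intro tendsto_intros LIMSEQ_power_zero) auto
    moreover have "(\<lambda>k. 1 - (1 / K) ^ k) = R" by (auto simp: R_def power_one_over)
    ultimately show ?thesis by simp
  qed
  let ?I = "\<lambda>k \<zeta>. indicator {R k..<1} (norm \<zeta>) :: real"
  have find: "\<exists>k. norm \<zeta> \<in> {R k..<R (Suc k)}" if "\<zeta> \<in> \<D>" for \<zeta> :: complex
  proof -
    have "\<forall>\<^sub>F k in sequentially. norm \<zeta> < R k" using that by (intro order_tendstoD(1)[OF Rlim]) auto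
    hence ex: "\<exists>k. norm \<zeta> < R k" by (auto simp: eventually_sequentially)
    define k2 where "k2 = (LEAST k. norm \<zeta> < R k)"
    have k2: "norm \<zeta> < R k2" unfolding k2_def by (rule LeastI_ex[OF ex])
    have "k2 \<noteq> 0" using k2 by (intro notI) (simp add: R_def)
    then obtain k where k: "k2 = Suc k" by (cases k2) auto
    hence "\<not> norm \<zeta> < R k" using not_less_Least[of k "\<lambda>k. norm \<zeta> < R k"] by (simp add: k2_def)
    thus ?thesis using k k2 by (intro exI[of _ k]) auto
  qed
  have sumI: "(\<lambda>l. ?I l \<zeta>) = (\<lambda>l. if l \<in> {..k} then 1 else 0)" if z: "norm \<zeta> \<in> {R k..<R (Suc k)}" for \<zeta> k
  proof
    fix l
    show "?I l \<zeta> = (if l \<in> {..k} then 1 else 0)"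
    proof (cases "l \<le> k")
      case True
      thus ?thesis using Rmono[OF True] z R(2)[of "Suc k"] by auto
    next
      case False
      hence "R (Suc k) \<le> R l" by (intro Rmono) auto
      thus ?thesis using False z by auto
    qed
  qed
  \<comment> \<open>The sum counts the radii \<open>R l\<close> not exceeding
    \<open>norm \<zeta>\<close>: it is k + 1 on the k-th annulus and so dominates the growth of
    \<open>g\<close> up to a constant, while its integral is bounded by a geometric series of
    masses.\<close>
  have sI: "integrable \<nu> (\<lambda>\<zeta>. \<Sum>l. ?I l \<zeta>)"
  proof (rule integrable_suminf)
    show "integrable \<nu> (?I l)" for l by (rule indicator_integrable)
    show "AE \<zeta> in \<nu>. summable (\<lambda>l. norm (?I l \<zeta>))"
    proof (rule AE_I2)
      fix \<zeta> assume "\<zeta> \<in> space \<nu>"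
      then obtain k where k: "norm \<zeta> \<in> {R k..<R (Suc k)}" using find[of \<zeta>] by auto
      have "summable (\<lambda>l. if l \<in> {..k} then 1 else (0::real))" by (rule summable_If_finite_set) simp
      hence "summable (\<lambda>l. ?I l \<zeta>)" unfolding sumI[OF k] .
      thus "summable (\<lambda>l. norm (?I l \<zeta>))" by simp
    qed
    have S: "summable (\<lambda>k. 2 * tail \<omega> 0 * (1 / Cc) ^ k)" using KC by (intro summable_mult summable_geometric) auto
    show "summable (\<lambda>k. LINT \<zeta>|\<nu>. norm (?I k \<zeta>))"
    proof (rule summable_comparison_test[OF _ S], intro exI[of _ 0] allI impI)
      fix k
      have "Cc ^ k * tail \<omega> (R k) \<le> tail \<omega> 0"
        using D_check_iterate[OF KC, of 0 k] by (simp add: R_def)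
      hence "tail \<omega> (R k) \<le> tail \<omega> 0 * (1 / Cc) ^ k" using KC by (simp add: field_simps power_one_over)
      moreover have "(LINT \<zeta>|\<nu>. ?I k \<zeta>) \<le> 2 * tail \<omega> (R k)"
        using annulus_mass_bounds(2)[OF R(1,2)] by (simp add: annulus_mass_def)
      ultimately have "(LINT \<zeta>|\<nu>. ?I k \<zeta>) \<le> 2 * tail \<omega> 0 * (1 / Cc) ^ k" by simp
      thus "norm (LINT \<zeta>|\<nu>. norm (?I k \<zeta>)) \<le> 2 * tail \<omega> 0 * (1 / Cc) ^ k" by simp
    qed
  qed
  show ?thesis
  proof (rule Bochner_Integration.integrable_bound[OF integrable_mult_right[OF sI, of "G * (1 + K)"]])
    show "g \<in> borel_measurable \<nu>" using g by (intro holomorphic_measurable) (simp add: Bloch_def)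
    show "AE \<zeta> in \<nu>. norm (g \<zeta>) \<le> norm (G * (1 + K) * (\<Sum>l. ?I l \<zeta>))"
    proof (rule AE_I2)
      fix \<zeta> assume "\<zeta> \<in> space \<nu>"
      then obtain k where k: "norm \<zeta> \<in> {R k..<R (Suc k)}" using find[of \<zeta>] by auto
      have "(\<Sum>l. ?I l \<zeta>) = (\<Sum>l\<in>{..k}. 1)"
        unfolding sumI[OF k] using sums_If_finite_set[of "{..k}" "\<lambda>_. 1::real"] by (simp add: sums_iff)
      hence s: "(\<Sum>l. ?I l \<zeta>) = real (Suc k)" by simp
      have "norm (g \<zeta>) \<le> G * (1 + real (Suc k) * K)" using k by (intro step) auto
      also have "\<dots> \<le> G * (real (Suc k) + real (Suc k) * K)" using G by (intro mult_left_mono add_right_mono) auto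
      also have "\<dots> = G * (1 + K) * real (Suc k)" by (simp add: algebra_simps)
      finally show "norm (g \<zeta>) \<le> norm (G * (1 + K) * (\<Sum>l. ?I l \<zeta>))" unfolding s using G KC by simp
    qed
  qed
qed

end

section \<open>Functionals on spaces of power series\<close>

lemma psum_truncate: "psum (\<lambda>n. if n < k then c n else 0) z = (\<Sum>n<k. c n * z ^ n)"
proof -
  have "(\<lambda>n. (if n < k then c n else 0) * z ^ n) = (\<lambda>n. if n \<in> {..<k} then c n * z ^ n else 0)" by auto
  thus ?thesis using sums_If_finite_set[of "{..<k}" "\<lambda>n. c n * z ^ n"] by (simp add: psum_def sums_iff)
qed

lemma psum_monomial: "psum (lacunary {n}) = (\<lambda>z. z ^ n)"
  by (rule ext) (simp add: psum_lacunary_finite)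

lemma little_Bloch_cong:
  assumes "\<And>z. z \<in> \<D> \<Longrightarrow> f z = g z"
  shows "f \<in> little_Bloch \<longleftrightarrow> g \<in> little_Bloch"
proof -
  have d: "deriv f z = deriv g z" if "norm z < 1" for z using deriv_eq_on_disc[of f g z] assms that by simp
  have "f holomorphic_on \<D> \<longleftrightarrow> g holomorphic_on \<D>" by (rule holomorphic_cong) (use assms in auto)
  thus ?thesis unfolding little_Bloch_iff using d by simp
qed

lemma Bloch_scale_le:
  assumes f: "f \<in> Bloch"
  shows "(\<lambda>z. a * f z) \<in> Bloch" "Bloch_norm (\<lambda>z. a * f z) \<le> norm a * Bloch_norm f"
proof -
  have h: "f holomorphic_on \<D>" using f by (simp add: Bloch_def)
  have ah: "(\<lambda>z. a * f z) holomorphic_on \<D>" by (intro holomorphic_intros h)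
  have b: "norm (deriv (\<lambda>z. a * f z) z) * (1 - (norm z)\<^sup>2) \<le> norm a * (Bloch_norm f - norm (f 0))" if z: "z \<in> \<D>" for z
  proof -
    have "deriv (\<lambda>z. a * f z) z = a * deriv f z"
      by (intro deriv_cmult holomorphic_on_imp_differentiable_at[OF h]) (use z in auto)
    hence "norm (deriv (\<lambda>z. a * f z) z) * (1 - (norm z)\<^sup>2) = norm a * (norm (deriv f z) * (1 - (norm z)\<^sup>2))"
      by (simp add: norm_mult)
    also have "\<dots> \<le> norm a * (Bloch_norm f - norm (f 0))" by (intro mult_left_mono Bloch_deriv[OF f z]) simp
    finally show ?thesis .
  qed
  show "(\<lambda>z. a * f z) \<in> Bloch" by (rule BlochI[OF ah b])
  have "Bloch_norm (\<lambda>z. a * f z) \<le> norm a * (Bloch_norm f - norm (f 0)) + norm (a * f 0)" by (rule BlochI(2)[OF ah b])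
  thus "Bloch_norm (\<lambda>z. a * f z) \<le> norm a * Bloch_norm f" by (simp add: norm_mult algebra_simps)
qed

lemma Bloch_norm_scale:
  assumes f: "f \<in> Bloch"
  shows "Bloch_norm (\<lambda>z. a * f z) = norm a * Bloch_norm f"
proof (cases "a = 0")
  case True
  thus ?thesis using Bloch_scale_le(2)[OF f, of 0] Bloch_norm_ge(2)[OF Bloch_scale_le(1)[OF f, of 0]] by simp
next
  case False
  have "Bloch_norm f = Bloch_norm (\<lambda>z. (1 / a) * (a * f z))" using False by simp
  also have "\<dots> \<le> norm (1 / a) * Bloch_norm (\<lambda>z. a * f z)" by (rule Bloch_scale_le(2)[OF Bloch_scale_le(1)[OF f]])
  finally have "norm a * Bloch_norm f \<le> norm a * (norm (1 / a) * Bloch_norm (\<lambda>z. a * f z))" by (intro mult_left_mono) auto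
  also have "\<dots> = Bloch_norm (\<lambda>z. a * f z)" using False by (simp add: norm_divide)
  finally show ?thesis using Bloch_scale_le(2)[OF f, of a] by linarith
qed

lemma little_Bloch_scale:
  assumes f: "f \<in> little_Bloch"
  shows "(\<lambda>z. a * f z) \<in> little_Bloch"
  unfolding little_Bloch_iff
proof (intro conjI allI impI)
  have h: "f holomorphic_on \<D>" using f by (simp add: little_Bloch_iff)
  show "(\<lambda>z. a * f z) holomorphic_on \<D>" by (intro holomorphic_intros h)
  fix e :: real assume e: "e > 0"
  define e' where "e' = e / (norm a + 1)"
  have a1: "norm a + 1 > 0" by (simp add: add_nonneg_pos)
  have e': "e' > 0" using e a1 by (simp add: e'_def)
  obtain d where d: "d \<in> {0..<1}" "\<And>z. d < norm z \<Longrightarrow> norm z < 1 \<Longrightarrow> norm (deriv f z) * (1 - (norm z)\<^sup>2) < e'"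
    using f e' unfolding little_Bloch_iff by metis
  show "\<exists>d\<in>{0..<1}. \<forall>z. d < norm z \<and> norm z < 1 \<longrightarrow> norm (deriv (\<lambda>z. a * f z) z) * (1 - (norm z)\<^sup>2) < e"
  proof (intro bexI[OF _ d(1)] allI impI)
    fix z :: complex assume z: "d < norm z \<and> norm z < 1"
    have "deriv (\<lambda>z. a * f z) z = a * deriv f z"
      by (intro deriv_cmult holomorphic_on_imp_differentiable_at[OF h]) (use z in auto)
    hence "norm (deriv (\<lambda>z. a * f z) z) * (1 - (norm z)\<^sup>2) = norm a * (norm (deriv f z) * (1 - (norm z)\<^sup>2))"
      by (simp add: norm_mult)
    also have "\<dots> \<le> norm a * e'" using d(2)[of z] z by (intro mult_left_mono) auto
    also have "\<dots> < (norm a + 1) * e'" using e' by (intro mult_strict_right_mono) auto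
    also have "\<dots> = e" using a1 by (simp add: e'_def)
    finally show "norm (deriv (\<lambda>z. a * f z) z) * (1 - (norm z)\<^sup>2) < e" .
  qed
qed

text \<open>What the two spaces have in common, so that functionals are represented once for both:
  convergence of strong series, homogeneity, indifference to values off the disc, and norm
  convergence of dilations.\<close>

locale disc_space =
  fixes X :: "(complex \<Rightarrow> complex) set" and N :: "(complex \<Rightarrow> complex) \<Rightarrow> real" and A :: real
  assumes zero: "\<And>h. (\<And>z. z \<in> \<D> \<Longrightarrow> h z = 0) \<Longrightarrow> h \<in> X \<and> N h = 0"
    and series: "\<And>c. strong_series c \<Longrightarrow> psum c \<in> X \<and> N (psum c) \<le> A * (\<Sum>n. (real n + 1) * norm (c n))"
    and scale: "\<And>f a. f \<in> X \<Longrightarrow> (\<lambda>z. a * f z) \<in> X \<and> N (\<lambda>z. a * f z) = norm a * N f"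
    and hol: "\<And>f. f \<in> X \<Longrightarrow> f holomorphic_on \<D>"
    and nonneg: "\<And>f. f \<in> X \<Longrightarrow> 0 \<le> N f"
    and approx: "\<And>f e. f \<in> X \<Longrightarrow> e > 0 \<Longrightarrow>
      \<forall>\<^sub>F r in at_left 1. (\<lambda>z. dilate r f z - f z) \<in> X \<and> N (\<lambda>z. dilate r f z - f z) \<le> e"
begin

lemma monomial: "(\<lambda>z. z ^ n) \<in> X" "N (\<lambda>z. z ^ n) \<le> A * (real n + 1)"
proof -
  have s: "strong_series (lacunary {n})" by (rule strong_series_lacunary) simp
  have "(\<lambda>k. (real k + 1) * norm (lacunary {n} k)) = (\<lambda>k. if k \<in> {n} then real k + 1 else 0)"
    by (auto simp: lacunary_def)
  hence "(\<Sum>k. (real k + 1) * norm (lacunary {n} k)) = real n + 1"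
    using sums_If_finite_set[of "{n}" "\<lambda>k. real k + 1"] by (simp add: sums_iff)
  thus "(\<lambda>z. z ^ n) \<in> X" "N (\<lambda>z. z ^ n) \<le> A * (real n + 1)"
    using series[OF s] unfolding psum_monomial by auto
qed

lemma dual_bound:
  assumes "L \<in> dual_space X N"
  obtains C where "C \<ge> 0" "\<And>f. f \<in> X \<Longrightarrow> norm (L f) \<le> C * N f"
proof -
  obtain C where C: "\<forall>f\<in>X. norm (L f) \<le> C * N f" using assms by (auto simp: dual_space_def)
  have "norm (L f) \<le> max 0 C * N f" if "f \<in> X" for f
  proof -
    have "C * N f \<le> max 0 C * N f" using nonneg[OF that] by (intro mult_right_mono) auto
    thus ?thesis using C that by force
  qed
  thus thesis using that[of "max 0 C"] by auto
qed

lemma dual_zero: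
  assumes L: "L \<in> dual_space X N" and h: "\<And>z. z \<in> \<D> \<Longrightarrow> h z = 0"
  shows "L h = 0"
proof -
  obtain C where C: "C \<ge> 0" "\<And>f. f \<in> X \<Longrightarrow> norm (L f) \<le> C * N f" by (rule dual_bound[OF L]) blast
  moreover have "h \<in> X \<and> N h = 0" by (rule zero) (rule h)
  ultimately show ?thesis using C(2)[of h] by simp
qed

lemma dual_cong:
  assumes L: "L \<in> dual_space X N" and f: "f \<in> X" and eq: "\<And>z. z \<in> \<D> \<Longrightarrow> g z = f z"
  shows "L g = L f"
proof -
  define h where "h z = g z - f z" for z
  have h0: "h z = 0" if "z \<in> \<D>" for z using eq[OF that] by (simp add: h_def)
  have hX: "h \<in> X \<and> N h = 0" by (rule zero) (rule h0)
  have "L (\<lambda>z. f z + h z) = L f + L h" using L f hX unfolding dual_space_def by blast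
  moreover have "L h = 0" by (rule dual_zero[OF L]) (rule h0)
  moreover have "(\<lambda>z. f z + h z) = g" by (simp add: h_def)
  ultimately show ?thesis by simp
qed

text \<open>The remainders of a strong series tend to 0 in norm, so boundedness lets a functional
  act termwise; on such series it is determined by its values at monomials.\<close>

lemma dual_psum:
  assumes L: "L \<in> dual_space X N" and c: "strong_series c"
  shows "(\<lambda>n. c n * L (\<lambda>z. z ^ n)) sums L (psum c)"
proof -
  obtain C where C: "C \<ge> 0" "\<And>f. f \<in> X \<Longrightarrow> norm (L f) \<le> C * N f" by (rule dual_bound[OF L]) blast
  define P where "P k = psum (\<lambda>n. if n < k then c n else 0)" for k
  define T where "T k = psum (\<lambda>n. if n < k then 0 else c n)" for k
  have PX: "P k \<in> X" for k
    unfolding P_def by (rule series[THEN conjunct1], rule strong_series_finite) (auto intro: finite_subset[of _ "{..<k}"])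
  have Ts: "strong_series (\<lambda>n. if n < k then 0 else c n)" for k by (rule strong_series_tail[OF c])
  have TX: "T k \<in> X" for k unfolding T_def by (rule series[THEN conjunct1, OF Ts])
  have add: "L (\<lambda>z. f z + h z) = L f + L h" if "f \<in> X" "h \<in> X" for f h using L that by (auto simp: dual_space_def)
  have sc: "L (\<lambda>z. a * f z) = a * L f" if "f \<in> X" for f a using L that by (auto simp: dual_space_def)
  have LP: "L (P k) = (\<Sum>n<k. c n * L (\<lambda>z. z ^ n))" for k
  proof (induction k)
    case 0
    have "L (P 0) = 0" by (rule dual_zero[OF L]) (simp add: P_def psum_def)
    thus ?case by simp
  next
    case (Suc k)
    have "P (Suc k) = (\<lambda>z. P k z + c k * z ^ k)" by (rule ext) (simp add: P_def psum_truncate)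
    hence "L (P (Suc k)) = L (P k) + L (\<lambda>z. c k * z ^ k)"
      using add[OF PX[of k] conjunct1[OF scale[OF monomial(1)[of k], of "c k"]]] by simp
    thus ?case using Suc sc[OF monomial(1)[of k], of "c k"] by simp
  qed
  have split: "L (psum c) = L (P k) + L (T k)" for k
  proof -
    have "L (\<lambda>z. P k z + T k z) = L (psum c)"
    proof (rule dual_cong[OF L series[THEN conjunct1, OF c]])
      fix z assume z: "z \<in> \<D>"
      have d: "disc_series (\<lambda>n. if n < k then c n else 0)"
        by (rule strong_series_disc, rule strong_series_finite) (auto intro: finite_subset[of _ "{..<k}"])
      have "(\<lambda>n. (if n < k then c n else 0) * z ^ n + (if n < k then 0 else c n) * z ^ n) sums (P k z + T k z)"
        unfolding P_def T_def psum_def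
        by (intro sums_add summable_sums disc_series_summable(2)[OF d z] disc_series_summable(2)[OF strong_series_disc[OF Ts] z])
      moreover have "(if n < k then c n else 0) * z ^ n + (if n < k then 0 else c n) * z ^ n = c n * z ^ n" for n by simp
      ultimately show "P k z + T k z = psum c z" by (simp add: psum_def sums_iff)
    qed
    thus ?thesis using add[OF PX TX] by simp
  qed
  have "(\<lambda>k. L (T k)) \<longlonglongrightarrow> 0"
  proof (rule Lim_null_comparison)
    show "\<forall>\<^sub>F k in sequentially. norm (L (T k)) \<le> C * (A * (\<Sum>n. (real n + 1) * norm (if n < k then 0 else c n)))"
    proof (rule always_eventually, rule allI)
      fix k
      have "norm (L (T k)) \<le> C * N (T k)" by (rule C(2)[OF TX])
      also have "\<dots> \<le> C * (A * (\<Sum>n. (real n + 1) * norm (if n < k then 0 else c n)))"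
        unfolding T_def by (intro mult_left_mono series[THEN conjunct2, OF Ts] C(1))
      finally show "norm (L (T k)) \<le> C * (A * (\<Sum>n. (real n + 1) * norm (if n < k then 0 else c n)))" .
    qed
    have "(\<lambda>k. C * (A * (\<Sum>n. (real n + 1) * norm (if n < k then 0 else c n)))) \<longlonglongrightarrow> C * (A * 0)"
      by (intro tendsto_mult tendsto_const strong_sum_tail_tendsto[OF c])
    thus "(\<lambda>k. C * (A * (\<Sum>n. (real n + 1) * norm (if n < k then 0 else c n)))) \<longlonglongrightarrow> 0" by simp
  qed
  hence "(\<lambda>k. L (psum c) - L (T k)) \<longlonglongrightarrow> L (psum c) - 0" by (intro tendsto_intros)
  moreover have "(\<Sum>n<k. c n * L (\<lambda>z. z ^ n)) = L (psum c) - L (T k)" for k using split[of k] LP[of k] by simp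
  ultimately show ?thesis by (simp add: sums_def)
qed

text \<open>A dilated function always has a strong series; the limit then carries the expansion over
  to every element of the space.\<close>

lemma dual_dilate:
  assumes L: "L \<in> dual_space X N" and f: "f \<in> X"
  shows "0 \<le> r \<Longrightarrow> r < 1 \<Longrightarrow> (\<lambda>n. taylor f n * of_real r ^ n * L (\<lambda>z. z ^ n)) sums L (dilate r f)"
    and "((\<lambda>r. L (dilate r f)) \<longlongrightarrow> L f) (at_left 1)"
proof -
  note h = hol[OF f]
  {
    assume r: "0 \<le> r" "r < 1"
    have s: "strong_series (taylor (dilate r f))" by (rule strong_series_taylor_dilate[OF h r])
    have "L (dilate r f) = L (psum (taylor (dilate r f)))"
      by (rule dual_cong[OF L series[THEN conjunct1, OF s]])
         (use taylor_series(2)[OF dilate_holomorphic[OF h r(1)]] r in auto)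
    thus "(\<lambda>n. taylor f n * of_real r ^ n * L (\<lambda>z. z ^ n)) sums L (dilate r f)"
      using dual_psum[OF L s] r by (simp add: taylor_dilate[OF h])
  }
  obtain C where C: "C \<ge> 0" "\<And>f. f \<in> X \<Longrightarrow> norm (L f) \<le> C * N f" by (rule dual_bound[OF L]) blast
  have add: "L (\<lambda>z. f z + h z) = L f + L h" if "f \<in> X" "h \<in> X" for f h using L that by (auto simp: dual_space_def)
  show "((\<lambda>r. L (dilate r f)) \<longlongrightarrow> L f) (at_left 1)"
  proof (rule tendstoI)
    fix e :: real assume e: "e > 0"
    have C1: "C + 1 > 0" using C by simp
    have "e / (C + 1) > 0" using e C1 by simp
    from approx[OF f this] show "\<forall>\<^sub>F r in at_left 1. dist (L (dilate r f)) (L f) < e"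
    proof eventually_elim
      case (elim r)
      have "L (\<lambda>z. f z + (dilate r f z - f z)) = L f + L (\<lambda>z. dilate r f z - f z)"
        by (rule add) (use f elim in auto)
      hence "L (dilate r f) = L f + L (\<lambda>z. dilate r f z - f z)" by simp
      hence "dist (L (dilate r f)) (L f) = norm (L (\<lambda>z. dilate r f z - f z))" by (simp add: dist_norm)
      also have "\<dots> \<le> C * (e / (C + 1))" using elim C by (intro order_trans[OF C(2)] mult_left_mono) auto
      also have "\<dots> < (C + 1) * (e / (C + 1))" using e C1 by (intro mult_strict_right_mono) auto
      finally show ?case using C1 by simp
    qed
  qed
qed

lemma dual_norm_le:
  assumes B: "0 \<le> B" "\<And>f. f \<in> X \<Longrightarrow> norm (L f) \<le> B * N f"
  shows "dual_norm X N L \<le> B"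
  unfolding dual_norm_def
proof (rule cSUP_least)
  show "{f \<in> X. N f \<le> 1} \<noteq> {}" using zero[of "\<lambda>_. 0"] by auto
  fix f assume "f \<in> {f \<in> X. N f \<le> 1}"
  hence "norm (L f) \<le> B * N f" "B * N f \<le> B * 1" using B by (auto intro!: mult_left_mono simp del: mult_1_right)
  thus "norm (L f) \<le> B" by simp
qed

lemma dual_norm_ge:
  assumes L: "L \<in> dual_space X N"
  shows "f \<in> X \<Longrightarrow> norm (L f) \<le> dual_norm X N L * N f" "0 \<le> dual_norm X N L"
proof -
  obtain C where C: "C \<ge> 0" "\<And>f. f \<in> X \<Longrightarrow> norm (L f) \<le> C * N f" by (rule dual_bound[OF L]) blast
  have bdd: "bdd_above ((\<lambda>f. norm (L f)) ` {f \<in> X. N f \<le> 1})"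
  proof (rule bdd_aboveI2)
    fix f assume "f \<in> {f \<in> X. N f \<le> 1}"
    hence "norm (L f) \<le> C * N f" "C * N f \<le> C * 1" using C by (auto intro!: mult_left_mono simp del: mult_1_right)
    thus "norm (L f) \<le> C" by simp
  qed
  have up: "norm (L f) \<le> dual_norm X N L" if "f \<in> X" "N f \<le> 1" for f
    unfolding dual_norm_def by (rule cSUP_upper[OF _ bdd]) (use that in auto)
  show "0 \<le> dual_norm X N L"
    by (rule order_trans[OF norm_ge_zero up[of "\<lambda>_. 0"]]) (use zero[of "\<lambda>_. 0"] in auto)
  assume f: "f \<in> X"
  show "norm (L f) \<le> dual_norm X N L * N f"
  \<comment> \<open>A function of norm 0 cannot be rescaled to norm 1; boundedness gives the value 0
    directly.\<close>
  proof (cases "N f = 0")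
    case True
    thus ?thesis using C(2)[OF f] by simp
  next
    case False
    hence p: "N f > 0" using nonneg[OF f] by simp
    define a where "a = complex_of_real (1 / N f)"
    have na: "norm a = 1 / N f" using p unfolding a_def norm_of_real by simp
    have "norm (L (\<lambda>z. a * f z)) \<le> dual_norm X N L"
      using scale[OF f, of a] p na by (intro up) auto
    moreover have "L (\<lambda>z. a * f z) = a * L f" using L f by (auto simp: dual_space_def)
    ultimately have "norm (L f) / N f \<le> dual_norm X N L" by (simp add: norm_mult na)
    thus ?thesis using p by (simp add: pos_divide_le_eq)
  qed
qed

end

lemma little_Bloch_space: "disc_space little_Bloch Bloch_norm 1"
proof
  fix h :: "complex \<Rightarrow> complex" assume h: "\<And>z. z \<in> \<D> \<Longrightarrow> h z = 0"
  have s: "strong_series (\<lambda>_. 0)" by (simp add: strong_series_def)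
  note S = strong_series_little_Bloch[OF s]
  have e: "h z = psum (\<lambda>_. 0) z" if "z \<in> \<D>" for z using h[OF that] by (simp add: psum_def)
  have "h \<in> little_Bloch" using S(1) little_Bloch_cong[of h "psum (\<lambda>_. 0)", OF e] by simp
  moreover have "Bloch_norm h = 0"
    using Bloch_cong(2)[of h "psum (\<lambda>_. 0)", OF e] S(2) Bloch_norm_ge(2)[OF little_Bloch_subset[OF S(1)]] by simp
  ultimately show "h \<in> little_Bloch \<and> Bloch_norm h = 0" ..
next
  fix f :: "complex \<Rightarrow> complex" and e :: real assume f: "f \<in> little_Bloch" and e: "e > 0"
  have h: "f holomorphic_on \<D>" using f by (simp add: little_Bloch_iff)
  have "\<forall>\<^sub>F r in at_left (1::real). 0 \<le> r \<and> r < 1"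
    unfolding eventually_at_left_field by (intro exI[of _ 0]) auto
  with little_Bloch_dilate_tendsto[OF f e]
  show "\<forall>\<^sub>F r in at_left 1. (\<lambda>z. dilate r f z - f z) \<in> little_Bloch \<and> Bloch_norm (\<lambda>z. dilate r f z - f z) \<le> e"
    by eventually_elim (auto intro!: little_Bloch_diff f dilate_little_Bloch h)
next
  show "\<And>c. strong_series c \<Longrightarrow> psum c \<in> little_Bloch \<and> Bloch_norm (psum c) \<le> 1 * (\<Sum>n. (real n + 1) * norm (c n))"
    using strong_series_little_Bloch by simp
next
  fix f :: "complex \<Rightarrow> complex" and a assume f: "f \<in> little_Bloch"
  show "(\<lambda>z. a * f z) \<in> little_Bloch \<and> Bloch_norm (\<lambda>z. a * f z) = norm a * Bloch_norm f"
    using little_Bloch_scale[OF f] Bloch_norm_scale[OF little_Bloch_subset[OF f]] by blast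
next
  fix f assume f: "f \<in> little_Bloch"
  thus "f holomorphic_on \<D>" by (simp add: little_Bloch_iff)
  show "0 \<le> Bloch_norm f" by (rule Bloch_norm_ge(2)[OF little_Bloch_subset[OF f]])
qed

context weighted_disc
begin

lemma Bergman_space: "disc_space (Bergman 1 \<omega>) (Lp_norm 1 \<omega>) (measure \<nu> \<D>)"
proof
  fix h :: "complex \<Rightarrow> complex" assume h: "\<And>z. z \<in> \<D> \<Longrightarrow> h z = 0"
  have hh: "h holomorphic_on \<D>" using holomorphic_cong[of \<D> \<D> h "\<lambda>_. 0"] h by auto
  have i: "integrable \<nu> h"
    by (rule disc.integrable_const_bound[of _ 0]) (use h hh in \<open>auto intro!: AE_I2 holomorphic_measurable\<close>)
  have "L1 h = (LINT z|\<nu>. 0)" unfolding L1_def by (rule Bochner_Integration.integral_cong) (use h in auto)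
  thus "h \<in> Bergman 1 \<omega> \<and> Lp_norm 1 \<omega> h = 0" using hh i by (simp add: Bergman_1_iff Lp_norm_1)
next
  fix c assume c: "strong_series c"
  note dc = strong_series_disc[OF c]
  note sn = strong_series_norm[OF c]
  have i: "integrable \<nu> (psum c)" by (rule psum_summable_integrable[OF sn])
  have S: "summable (\<lambda>n. (real n + 1) * norm (c n))" using c by (simp add: strong_series_def)
  have "L1 (psum c) \<le> (LINT z|\<nu>. (\<Sum>n. (real n + 1) * norm (c n)))"
    unfolding L1_def
  proof (intro integral_mono integrable_norm i)
    fix z assume "z \<in> space \<nu>"
    hence z: "z \<in> \<D>" by simp
    have "norm (psum c z) \<le> (\<Sum>n. norm (c n * z ^ n))"
      unfolding psum_def by (rule summable_norm[OF disc_series_summable(1)[OF dc z]])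
    also have "\<dots> \<le> (\<Sum>n. (real n + 1) * norm (c n))"
    proof (rule suminf_le[OF _ disc_series_summable(1)[OF dc z] S])
      fix n
      have "norm z ^ n * norm (c n) \<le> (real n + 1) * norm (c n)"
        using power_le_one[of "norm z" n] z by (intro mult_right_mono) auto
      thus "norm (c n * z ^ n) \<le> (real n + 1) * norm (c n)" by (simp add: norm_mult norm_power mult.commute)
    qed
    finally show "norm (psum c z) \<le> (\<Sum>n. (real n + 1) * norm (c n))" .
  qed simp
  thus "psum c \<in> Bergman 1 \<omega> \<and> Lp_norm 1 \<omega> (psum c) \<le> measure \<nu> \<D> * (\<Sum>n. (real n + 1) * norm (c n))"
    using i psum_holomorphic[OF dc] by (simp add: Bergman_1_iff Lp_norm_1)
next
  fix f :: "complex \<Rightarrow> complex" and a assume f: "f \<in> Bergman 1 \<omega>"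
  hence "f holomorphic_on \<D>" "integrable \<nu> f" by (auto simp: Bergman_1_iff)
  moreover from this have "(\<lambda>z. a * f z) holomorphic_on \<D>" by (intro holomorphic_intros)
  moreover have "L1 (\<lambda>z. a * f z) = norm a * L1 f" by (simp add: L1_def norm_mult)
  ultimately show "(\<lambda>z. a * f z) \<in> Bergman 1 \<omega> \<and> Lp_norm 1 \<omega> (\<lambda>z. a * f z) = norm a * Lp_norm 1 \<omega> f"
    by (simp add: Bergman_1_iff Lp_norm_1)
next
  fix f :: "complex \<Rightarrow> complex" assume f: "f \<in> Bergman 1 \<omega>"
  thus "f holomorphic_on \<D>" by (simp add: Bergman_1_iff)
  show "0 \<le> Lp_norm 1 \<omega> f" by (simp add: Lp_norm_def)
next
  fix f :: "complex \<Rightarrow> complex" and e :: real assume f: "f \<in> Bergman 1 \<omega>" and e: "e > 0"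
  hence h: "f holomorphic_on \<D>" "integrable \<nu> f" by (auto simp: Bergman_1_iff)
  have "\<forall>\<^sub>F r in at_left 1. dist (L1 (\<lambda>z. dilate r f z - f z)) 0 < e" by (rule tendstoD[OF L1_dilate_tendsto[OF h] e])
  with at_left_1_unit
  show "\<forall>\<^sub>F r in at_left 1. (\<lambda>z. dilate r f z - f z) \<in> Bergman 1 \<omega> \<and> Lp_norm 1 \<omega> (\<lambda>z. dilate r f z - f z) \<le> e"
  proof eventually_elim
    case (elim r)
    have i: "integrable \<nu> (\<lambda>z. dilate r f z - f z)"
      by (intro Bochner_Integration.integrable_diff dilate_integrable h) (use elim in auto)
    have "(\<lambda>z. dilate r f z - f z) holomorphic_on \<D>"
      by (intro holomorphic_intros dilate_holomorphic h) (use elim in auto)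
    moreover have "Lp_norm 1 \<omega> (\<lambda>z. dilate r f z - f z) \<le> e"
      using elim i L1_nonneg[of "\<lambda>z. dilate r f z - f z"] by (subst Lp_norm_1) auto
    ultimately show ?case using i by (simp add: Bergman_1_iff)
  qed
qed

section \<open>Functionals induced by the pairing and their representing functions\<close>

lemma pairing_functional:
  assumes g: "g holomorphic_on \<D>" "integrable \<nu> g" and X: "\<And>f. f \<in> X \<Longrightarrow> f holomorphic_on \<D>"
    and lim: "\<And>f. f \<in> X \<Longrightarrow> \<exists>l. (dpair f g \<longlongrightarrow> l) (at_left 1) \<and> norm l \<le> B * N f"
  shows "\<And>f. f \<in> X \<Longrightarrow> A2_pairing_exists \<omega> f g" "(\<lambda>f. A2_pairing \<omega> f g) \<in> dual_space X N"
    "\<And>f. f \<in> X \<Longrightarrow> norm (A2_pairing \<omega> f g) \<le> B * N f"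
proof -
  have P: "(dpair f g \<longlongrightarrow> A2_pairing \<omega> f g) (at_left 1) \<and> norm (A2_pairing \<omega> f g) \<le> B * N f \<and> A2_pairing_exists \<omega> f g"
    if f: "f \<in> X" for f
  proof -
    obtain l where l: "(dpair f g \<longlongrightarrow> l) (at_left 1)" "norm l \<le> B * N f" using lim[OF f] by blast
    show ?thesis using pairing_limit[OF X[OF f] g l(1)] l by auto
  qed
  show "A2_pairing_exists \<omega> f g" "norm (A2_pairing \<omega> f g) \<le> B * N f" if "f \<in> X" for f using P[OF that] by auto
  have int: "integrable \<nu> (\<lambda>\<zeta>. dilate r f \<zeta> * cnj (g \<zeta>))" if "f \<in> X" "0 \<le> r \<and> r < 1" for f r
    using integral_dilate_cnj(1)[OF X[OF that(1)] _ _ g(2)] that by blast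
  show "(\<lambda>f. A2_pairing \<omega> f g) \<in> dual_space X N"
    unfolding dual_space_def
  proof (intro CollectI conjI ballI allI exI[of _ B])
    fix f h assume fh: "f \<in> X" "h \<in> X"
    have "\<forall>\<^sub>F r in at_left 1. dpair f g r + dpair h g r = dpair (\<lambda>z. f z + h z) g r"
      using at_left_1_unit
    proof eventually_elim
      case (elim r)
      show ?case unfolding dpair_def
        by (subst Bochner_Integration.integral_add[symmetric, OF int[OF fh(1) elim] int[OF fh(2) elim]])
           (simp add: dilate_def algebra_simps)
    qed
    moreover have "((\<lambda>r. dpair f g r + dpair h g r) \<longlongrightarrow> A2_pairing \<omega> f g + A2_pairing \<omega> h g) (at_left 1)"
      using P[OF fh(1)] P[OF fh(2)] by (intro tendsto_add) auto
    ultimately have "(dpair (\<lambda>z. f z + h z) g \<longlongrightarrow> A2_pairing \<omega> f g + A2_pairing \<omega> h g) (at_left 1)"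
      by (rule Lim_transform_eventually[rotated])
    thus "A2_pairing \<omega> (\<lambda>z. f z + h z) g = A2_pairing \<omega> f g + A2_pairing \<omega> h g"
      using X[OF fh(1)] X[OF fh(2)] by (intro pairing_limit(2) g holomorphic_intros)
  next
    fix c f assume f: "f \<in> X"
    have "dpair (\<lambda>z. c * f z) g = (\<lambda>r. c * dpair f g r)"
      by (rule ext) (simp add: dpair_def dilate_def mult.assoc)
    moreover have "((\<lambda>r. c * dpair f g r) \<longlongrightarrow> c * A2_pairing \<omega> f g) (at_left 1)"
      using P[OF f] by (intro tendsto_mult tendsto_const) auto
    ultimately have "(dpair (\<lambda>z. c * f z) g \<longlongrightarrow> c * A2_pairing \<omega> f g) (at_left 1)" by simp
    thus "A2_pairing \<omega> (\<lambda>z. c * f z) g = c * A2_pairing \<omega> f g"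
      using X[OF f] by (intro pairing_limit(2) g holomorphic_intros)
  qed (use P in auto)
qed

lemma pairing_finite:
  assumes c: "finite {n. c n \<noteq> 0}" and g: "g holomorphic_on \<D>" "integrable \<nu> g"
  shows "A2_pairing \<omega> (psum c) g = (\<Sum>n\<in>{n. c n \<noteq> 0}. c n * cnj (taylor g n) * of_real (2 * moment \<omega> (2 * real n + 1)))"
proof -
  have dc: "disc_series c" by (rule strong_series_disc[OF strong_series_finite[OF c]])
  let ?t = "\<lambda>r n. c n * of_real r ^ n * cnj (taylor g n) * of_real (2 * moment \<omega> (2 * real n + 1))"
  have "\<forall>\<^sub>F r in at_left 1. (\<Sum>n\<in>{n. c n \<noteq> 0}. ?t r n) = dpair (psum c) g r"
    using at_left_1_unit
  proof eventually_elim
    case (elim r)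
    have "?t r sums dpair (psum c) g r" using dpair_sums[OF psum_holomorphic[OF dc] _ _ g, of r] elim by (simp add: taylor_psum[OF dc])
    moreover have "?t r sums (\<Sum>n\<in>{n. c n \<noteq> 0}. ?t r n)" by (rule sums_finite[OF c]) auto
    ultimately show ?case using sums_unique2 by blast
  qed
  moreover have "((\<lambda>r. \<Sum>n\<in>{n. c n \<noteq> 0}. ?t r n) \<longlongrightarrow> (\<Sum>n\<in>{n. c n \<noteq> 0}. ?t 1 n)) (at_left 1)"
    by (intro tendsto_intros)
  ultimately have "(dpair (psum c) g \<longlongrightarrow> (\<Sum>n\<in>{n. c n \<noteq> 0}. ?t 1 n)) (at_left 1)"
    by (rule Lim_transform_eventually[rotated])
  from pairing_limit(2)[OF psum_holomorphic[OF dc] g this] show ?thesis by simp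
qed

lemma pairing_monomial:
  assumes g: "g holomorphic_on \<D>" "integrable \<nu> g"
  shows "A2_pairing \<omega> (\<lambda>z. z ^ n) g = cnj (taylor g n) * of_real (2 * moment \<omega> (2 * real n + 1))"
proof -
  have "{k. lacunary {n} k \<noteq> 0} = {n}" by (auto simp: lacunary_def)
  thus ?thesis using pairing_finite[OF _ g, of "lacunary {n}"] unfolding psum_monomial by (simp add: lacunary_def)
qed

lemma moment_kernel_coeff: "2 * moment \<omega> (2 * real n + 1) * kernel_coeff n = 1"
  using moment_pos[of "2 * real n + 1"] by (simp add: kernel_coeff_def)

text \<open>Monomials belong to the space and recover the Taylor coefficients, because the moments
  do not vanish.\<close>

lemma pairing_unique:
  assumes X: "disc_space X N A" and g: "g holomorphic_on \<D>" "integrable \<nu> g" and h: "h holomorphic_on \<D>" "integrable \<nu> h"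
    and eq: "\<And>f. f \<in> X \<Longrightarrow> A2_pairing \<omega> f g = A2_pairing \<omega> f h" and z: "z \<in> \<D>"
  shows "g z = h z"
proof -
  have "taylor g n = taylor h n" for n
  proof -
    have "cnj (taylor g n) * of_real (2 * moment \<omega> (2 * real n + 1)) = cnj (taylor h n) * of_real (2 * moment \<omega> (2 * real n + 1))"
      using eq[OF disc_space.monomial(1)[OF X, of n]] unfolding pairing_monomial[OF g] pairing_monomial[OF h] .
    moreover have "complex_of_real (2 * moment \<omega> (2 * real n + 1)) \<noteq> 0" using moment_pos[of "2 * real n + 1"] by simp
    ultimately show ?thesis by (metis complex_cnj_cnj mult_right_cancel)
  qed
  hence "taylor g = taylor h" by (rule ext)
  thus ?thesis using taylor_series(2)[OF g(1) z] taylor_series(2)[OF h(1) z] by simp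
qed

text \<open>Forced by \<open>pairing_monomial\<close>: no other coefficients can represent
  \<open>L\<close>. The conjugate is due to the pairing being antilinear in its second
  argument.\<close>

definition repr_coeff :: "((complex \<Rightarrow> complex) \<Rightarrow> complex) \<Rightarrow> nat \<Rightarrow> complex"
  where "repr_coeff L n = cnj (L (\<lambda>z. z ^ n)) * of_real (kernel_coeff n)"

lemma repr_series:
  assumes X: "disc_space X N A" and L: "L \<in> dual_space X N"
  shows "disc_series (repr_coeff L)"
proof -
  interpret disc_space X N A by (rule X)
  obtain C where C: "C \<ge> 0" "\<And>f. f \<in> X \<Longrightarrow> norm (L f) \<le> C * N f" by (rule dual_bound[OF L]) blast
  have b: "norm (repr_coeff L n) \<le> C * A * ((real n + 1) * kernel_coeff n)" for n
  proof -
    have "norm (L (\<lambda>z. z ^ n)) \<le> C * N (\<lambda>z. z ^ n)" by (rule C(2)[OF monomial(1)])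
    also have "\<dots> \<le> C * (A * (real n + 1))" by (intro mult_left_mono monomial C(1))
    finally have "norm (L (\<lambda>z. z ^ n)) * kernel_coeff n \<le> C * (A * (real n + 1)) * kernel_coeff n" using kernel_coeff_pos[of n] by (intro mult_right_mono) auto
    thus ?thesis using kernel_coeff_pos[of n] by (simp add: repr_coeff_def norm_mult mult_ac)
  qed
  show ?thesis unfolding disc_series_def
  proof
    fix \<rho> :: real assume \<rho>: "\<rho> \<in> {0..<1}"
    define s where "s = (1 + \<rho>) / 2"
    have s: "0 < s" "s < 1" "\<rho> < s" using \<rho> by (auto simp: s_def)
    have "strong_series (\<lambda>n. kernel_coeffs n * of_real (\<rho>) ^ n)" using \<rho> by (intro strong_series_dilate kernel_coeffs_series) auto
    hence "summable (\<lambda>n. (real n + 1) * (kernel_coeff n * \<rho> ^ n))"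
      using \<rho> kernel_coeff_pos by (simp add: strong_series_def norm_mult norm_power abs_of_pos)
    hence S: "summable (\<lambda>n. C * A * ((real n + 1) * (kernel_coeff n * \<rho> ^ n)))" by (rule summable_mult)
    show "summable (\<lambda>n. norm (repr_coeff L n) * \<rho> ^ n)"
    proof (rule summable_comparison_test[OF _ S], intro exI[of _ 0] allI impI)
      fix n
      have "norm (repr_coeff L n) * \<rho> ^ n \<le> C * A * ((real n + 1) * kernel_coeff n) * \<rho> ^ n" using b[of n] \<rho> by (intro mult_right_mono) auto
      thus "norm (norm (repr_coeff L n) * \<rho> ^ n) \<le> C * A * ((real n + 1) * (kernel_coeff n * \<rho> ^ n))" using \<rho> by (simp add: mult.assoc)
    qed
  qed
qed

text \<open>For \<open>r\<close> below 1 the pairing with the candidate is exactly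
  \<open>L (dilate r f)\<close>, as moments cancel against kernel coefficients; norm convergence of
  dilations does the rest.\<close>

lemma repr_limit:
  assumes X: "disc_space X N A" and L: "L \<in> dual_space X N" and i: "integrable \<nu> (psum (repr_coeff L))" and f: "f \<in> X"
  shows "(dpair f (psum (repr_coeff L)) \<longlongrightarrow> L f) (at_left 1)"
proof -
  interpret disc_space X N A by (rule X)
  note d = repr_series[OF X L]
  have "\<forall>\<^sub>F r in at_left 1. L (dilate r f) = dpair f (psum (repr_coeff L)) r"
    using at_left_1_unit
  proof eventually_elim
    case (elim r)
    have e: "cnj (repr_coeff L n) * of_real (2 * moment \<omega> (2 * real n + 1)) = L (\<lambda>z. z ^ n)" for n
    proof -
      have "cnj (repr_coeff L n) * of_real (2 * moment \<omega> (2 * real n + 1)) = L (\<lambda>z. z ^ n) * of_real (2 * moment \<omega> (2 * real n + 1) * kernel_coeff n)"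
        unfolding repr_coeff_def by (simp add: mult_ac)
      thus ?thesis unfolding moment_kernel_coeff by simp
    qed
    have "(\<lambda>n. taylor f n * of_real r ^ n * cnj (repr_coeff L n) * of_real (2 * moment \<omega> (2 * real n + 1))) sums dpair f (psum (repr_coeff L)) r"
      using dpair_sums[OF hol[OF f] _ _ psum_holomorphic[OF d] i, of r] elim unfolding taylor_psum[OF d] by blast
    hence "(\<lambda>n. taylor f n * of_real r ^ n * L (\<lambda>z. z ^ n)) sums dpair f (psum (repr_coeff L)) r"
      by (simp only: mult.assoc e)
    moreover have "(\<lambda>n. taylor f n * of_real r ^ n * L (\<lambda>z. z ^ n)) sums L (dilate r f)"
      using dual_dilate(1)[OF L f, of r] elim by blast
    ultimately show ?case using sums_unique2 by blast
  qed
  thus ?thesis using dual_dilate(2)[OF L f] by (rule Lim_transform_eventually[rotated])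
qed

text \<open>Reduces a duality to two estimates: \<open>b\<close> bounds the pairing,
  \<open>a\<close> the representing function. The lower norm estimate then follows from uniqueness,
  since every \<open>g\<close> is the representing function of its own functional. Adding 1 makes
  the constants strictly positive.\<close>

lemma dual_viaI:
  assumes X: "disc_space X N A"
    and Y: "\<And>g. g \<in> Y \<Longrightarrow> g holomorphic_on \<D> \<and> integrable \<nu> g \<and> 0 \<le> NY g"
    and cong: "\<And>g h. g \<in> Y \<Longrightarrow> h \<in> Y \<Longrightarrow> (\<And>z. z \<in> \<D> \<Longrightarrow> g z = h z) \<Longrightarrow> NY g = NY h"
    and b: "b \<ge> 0" "\<And>f g. f \<in> X \<Longrightarrow> g \<in> Y \<Longrightarrow> \<exists>l. (dpair f g \<longlongrightarrow> l) (at_left 1) \<and> norm l \<le> b * NY g * N f"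
    and a: "a \<ge> 0" "\<And>L B. L \<in> dual_space X N \<Longrightarrow> B \<ge> 0 \<Longrightarrow> (\<And>f. f \<in> X \<Longrightarrow> norm (L f) \<le> B * N f) \<Longrightarrow>
       psum (repr_coeff L) \<in> Y \<and> NY (psum (repr_coeff L)) \<le> a * B"
  shows "dual_via_A2_pairing \<omega> X N Y NY"
proof -
  interpret disc_space X N A by (rule X)
  have F: "\<And>f. f \<in> X \<Longrightarrow> A2_pairing_exists \<omega> f g" "(\<lambda>f. A2_pairing \<omega> f g) \<in> dual_space X N"
    "\<And>f. f \<in> X \<Longrightarrow> norm (A2_pairing \<omega> f g) \<le> (b * NY g) * N f" if g: "g \<in> Y" for g
    using pairing_functional[of g X "b * NY g" N] Y[OF g] hol b(2)[OF _ g] by blast+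
  have rep: "psum (repr_coeff L) \<in> Y" "\<And>f. f \<in> X \<Longrightarrow> A2_pairing \<omega> f (psum (repr_coeff L)) = L f"
    if L: "L \<in> dual_space X N" for L
  proof -
    have "psum (repr_coeff L) \<in> Y \<and> NY (psum (repr_coeff L)) \<le> a * dual_norm X N L"
      using dual_norm_ge[OF L] by (intro a(2)[OF L]) auto
    thus y: "psum (repr_coeff L) \<in> Y" ..
    show "A2_pairing \<omega> f (psum (repr_coeff L)) = L f" if f: "f \<in> X" for f
      using Y[OF y] pairing_limit(2)[OF hol[OF f] _ _ repr_limit[OF X L _ f]] by blast
  qed
  have uniq: "g z = h z" if "g \<in> Y" "h \<in> Y" "\<And>f. f \<in> X \<Longrightarrow> A2_pairing \<omega> f g = A2_pairing \<omega> f h" "z \<in> \<D>" for g h z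
    using pairing_unique[OF X, of g h z] Y[OF that(1)] Y[OF that(2)] that by blast
  have lower: "(1 / (a + 1)) * NY g \<le> dual_norm X N (\<lambda>f. A2_pairing \<omega> f g)" if g: "g \<in> Y" for g
  proof -
    define L where "L = (\<lambda>f. A2_pairing \<omega> f g)"
    have L: "L \<in> dual_space X N" unfolding L_def by (rule F(2)[OF g])
    have dn: "0 \<le> dual_norm X N L" by (rule dual_norm_ge(2)[OF L])
    have "NY (psum (repr_coeff L)) \<le> a * dual_norm X N L"
      using a(2)[OF L dn] dual_norm_ge(1)[OF L] by blast
    moreover have "NY g = NY (psum (repr_coeff L))"
      by (rule cong[OF g rep(1)[OF L]], rule uniq[OF g rep(1)[OF L]]) (use rep(2)[OF L] in \<open>auto simp: L_def\<close>)
    ultimately have "NY g \<le> (a + 1) * dual_norm X N L" using dn by (simp add: algebra_simps)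
    thus ?thesis using a(1) by (simp add: L_def field_simps)
  qed
  have upper: "dual_norm X N (\<lambda>f. A2_pairing \<omega> f g) \<le> (b + 1) * NY g" if g: "g \<in> Y" for g
  proof -
    have "dual_norm X N (\<lambda>f. A2_pairing \<omega> f g) \<le> b * NY g"
      using F(3)[OF g] Y[OF g] b(1) by (intro dual_norm_le) auto
    also have "\<dots> \<le> (b + 1) * NY g" using Y[OF g] by (intro mult_right_mono) auto
    finally show ?thesis .
  qed
  show ?thesis
    unfolding dual_via_A2_pairing_def
  proof (intro conjI ballI)
    show "\<exists>a>0. \<exists>b>0. \<forall>g\<in>Y. a * NY g \<le> dual_norm X N (\<lambda>f. A2_pairing \<omega> f g) \<and>
      dual_norm X N (\<lambda>f. A2_pairing \<omega> f g) \<le> b * NY g"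
      by (rule exI[of _ "1 / (a + 1)"], rule conjI, use a(1) in simp, rule exI[of _ "b + 1"])
         (use lower upper b(1) in auto)
    fix L assume L: "L \<in> dual_space X N"
    show "\<exists>g\<in>Y. (\<forall>f\<in>X. L f = A2_pairing \<omega> f g) \<and> (\<forall>h\<in>Y. (\<forall>f\<in>X. L f = A2_pairing \<omega> f h) \<longrightarrow> (\<forall>z\<in>\<D>. h z = g z))"
    proof (intro bexI[OF _ rep(1)[OF L]] conjI ballI impI)
      show "L f = A2_pairing \<omega> f (psum (repr_coeff L))" if "f \<in> X" for f using rep(2)[OF L that] by simp
      show "h z = psum (repr_coeff L) z" if "h \<in> Y" "\<forall>f\<in>X. L f = A2_pairing \<omega> f h" "z \<in> \<D>" for h z
        by (rule uniq[OF that(1) rep(1)[OF L] _ that(3)]) (use rep(2)[OF L] that(2) in auto)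
    qed
  qed (use F in auto)
qed

text \<open>The coefficients of the derivative in \<open>cnj z\<close> of the reproducing kernel at \<open>z\<close>.\<close>

definition kernel_deriv_coeff :: "complex \<Rightarrow> nat \<Rightarrow> complex"
  where "kernel_deriv_coeff z n = of_nat n * kernel_coeffs n * cnj z ^ (n - 1)"

text \<open>Weighting the coefficients by n + 1 amounts to one more differentiation: the comparison
  series is that of the second derivative of the kernel, after using that the kernel coefficients
  increase.\<close>

lemma kernel_deriv_coeff_strong:
  assumes z: "z \<in> \<D>" shows "strong_series (kernel_deriv_coeff z)"
proof -
  have dd: "disc_series (diffs (diffs kernel_coeffs))" by (intro disc_series_diffs kernel_coeffs_series)
  have S: "summable (\<lambda>n. norm (diffs (diffs kernel_coeffs) n * z ^ n))" by (rule disc_series_summable(1)[OF dd z])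
  have "summable (\<lambda>n. (real (Suc n) + 1) * norm (kernel_deriv_coeff z (Suc n)))"
  proof (rule summable_comparison_test[OF _ S], intro exI[of _ 0] allI impI)
    fix n
    have k: "kernel_coeff (Suc n) \<le> kernel_coeff (Suc (Suc n))" unfolding kernel_coeff_def
      by (intro divide_left_mono mult_left_mono moment_antimono mult_pos_pos moment_pos) auto
    have "(real (Suc n) + 1) * norm (kernel_deriv_coeff z (Suc n)) = (real n + 1) * (real n + 2) * kernel_coeff (Suc n) * norm z ^ n"
      using kernel_coeff_pos[of "Suc n"] unfolding kernel_deriv_coeff_def norm_mult norm_of_nat norm_power norm_of_real complex_mod_cnj by simp (simp add: algebra_simps)
    also have "\<dots> \<le> (real n + 1) * (real n + 2) * kernel_coeff (Suc (Suc n)) * norm z ^ n"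
      using k by (intro mult_right_mono mult_left_mono) auto
    also have "\<dots> = norm (diffs (diffs kernel_coeffs) n * z ^ n)"
      using kernel_coeff_pos[of "Suc (Suc n)"] unfolding norm_mult norm_diffs norm_power by (simp add: algebra_simps)
    finally show "norm ((real (Suc n) + 1) * norm (kernel_deriv_coeff z (Suc n))) \<le> norm (diffs (diffs kernel_coeffs) n * z ^ n)" by simp
  qed
  thus ?thesis unfolding strong_series_def by (subst summable_Suc_iff[symmetric])
qed

lemma kernel_deriv_coeff_psum:
  assumes z: "z \<in> \<D>" and zeta: "\<zeta> \<in> \<D>"
  shows "psum (kernel_deriv_coeff z) \<zeta> = \<zeta> * psum (diffs kernel_coeffs) (cnj z * \<zeta>)"
proof -
  have "norm z * norm \<zeta> \<le> norm z * 1" using zeta by (intro mult_left_mono) auto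
  hence u: "cnj z * \<zeta> \<in> \<D>" using z by (simp add: norm_mult)
  have "(\<lambda>n. diffs kernel_coeffs n * (cnj z * \<zeta>) ^ n) sums psum (diffs kernel_coeffs) (cnj z * \<zeta>)"
    unfolding psum_def by (rule summable_sums[OF disc_series_summable(2)[OF disc_series_diffs[OF kernel_coeffs_series] u]])
  hence "(\<lambda>n. \<zeta> * (diffs kernel_coeffs n * (cnj z * \<zeta>) ^ n)) sums (\<zeta> * psum (diffs kernel_coeffs) (cnj z * \<zeta>))" by (rule sums_mult)
  hence "(\<lambda>n. kernel_deriv_coeff z (Suc n) * \<zeta> ^ Suc n) sums (\<zeta> * psum (diffs kernel_coeffs) (cnj z * \<zeta>))"
    by (simp add: kernel_deriv_coeff_def diffs_def power_mult_distrib mult_ac)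
  hence "(\<lambda>n. kernel_deriv_coeff z n * \<zeta> ^ n) sums (\<zeta> * psum (diffs kernel_coeffs) (cnj z * \<zeta>))"
    unfolding sums_Suc_iff[of "\<lambda>n. kernel_deriv_coeff z n * \<zeta> ^ n"] by (simp add: kernel_deriv_coeff_def)
  thus ?thesis by (simp add: psum_def sums_iff)
qed

lemma kernel_L1: "z \<in> \<D> \<Longrightarrow> L1 (psum (kernel_deriv_coeff z)) = (LINT \<zeta>|\<nu>. norm (\<zeta> * psum (diffs kernel_coeffs) (cnj z * \<zeta>)))"
  unfolding L1_def by (rule Bochner_Integration.integral_cong) (simp_all add: kernel_deriv_coeff_psum)

text \<open>Turns a bound for \<open>L\<close> and for the norm of the differentiated kernel into a
  bound for the derivative of the representing function.\<close>

lemma repr_deriv: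
  assumes X: "disc_space X N A" and L: "L \<in> dual_space X N" and z: "z \<in> \<D>"
  shows "cnj (deriv (psum (repr_coeff L)) z) = L (psum (kernel_deriv_coeff z))"
proof -
  interpret disc_space X N A by (rule X)
  note d = repr_series[OF X L]
  have "(\<lambda>n. kernel_deriv_coeff z n * L (\<lambda>z. z ^ n)) sums L (psum (kernel_deriv_coeff z))"
    by (rule dual_psum[OF L kernel_deriv_coeff_strong[OF z]])
  hence "(\<lambda>n. kernel_deriv_coeff z (Suc n) * L (\<lambda>z. z ^ Suc n)) sums L (psum (kernel_deriv_coeff z))"
    using sums_Suc_iff[of "\<lambda>n. kernel_deriv_coeff z n * L (\<lambda>z. z ^ n)"] by (simp add: kernel_deriv_coeff_def)
  moreover have "cnj (diffs (repr_coeff L) n * z ^ n) = kernel_deriv_coeff z (Suc n) * L (\<lambda>z. z ^ Suc n)" for n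
    by (simp add: diffs_def repr_coeff_def kernel_deriv_coeff_def mult_ac)
  ultimately have "(\<lambda>n. cnj (diffs (repr_coeff L) n * z ^ n)) sums L (psum (kernel_deriv_coeff z))" by simp
  moreover have "(\<lambda>n. cnj (diffs (repr_coeff L) n * z ^ n)) sums cnj (psum (diffs (repr_coeff L)) z)"
    unfolding sums_cnj psum_def by (rule summable_sums[OF disc_series_summable(2)[OF disc_series_diffs[OF d] z]])
  ultimately show ?thesis using sums_unique2 by (simp add: deriv_psum[OF d z]) blast
qed

lemma bounded_pairing:
  fixes h \<phi> :: "complex \<Rightarrow> complex"
  assumes h: "integrable \<nu> h" and \<phi>: "\<phi> \<in> borel_measurable \<nu>" "AE \<zeta> in \<nu>. norm (\<phi> \<zeta>) \<le> B"
  shows "integrable \<nu> (\<lambda>\<zeta>. h \<zeta> * \<phi> \<zeta>)" "norm (LINT \<zeta>|\<nu>. h \<zeta> * \<phi> \<zeta>) \<le> B * L1 h"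
proof -
  have [measurable]: "h \<in> borel_measurable \<nu>" "\<phi> \<in> borel_measurable \<nu>" using h \<phi>(1) by auto
  have le: "AE \<zeta> in \<nu>. norm (h \<zeta> * \<phi> \<zeta>) \<le> B * norm (h \<zeta>)"
    using \<phi>(2) by eventually_elim (simp add: norm_mult mult.commute[of B] mult_left_mono)
  show i: "integrable \<nu> (\<lambda>\<zeta>. h \<zeta> * \<phi> \<zeta>)"
  proof (rule Bochner_Integration.integrable_bound[OF integrable_mult_right[OF integrable_norm[OF h], of B]])
    show "(\<lambda>\<zeta>. h \<zeta> * \<phi> \<zeta>) \<in> borel_measurable \<nu>" by measurable
    show "AE \<zeta> in \<nu>. norm (h \<zeta> * \<phi> \<zeta>) \<le> norm (B * norm (h \<zeta>))" using le by eventually_elim auto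
  qed
  have "norm (LINT \<zeta>|\<nu>. h \<zeta> * \<phi> \<zeta>) \<le> (LINT \<zeta>|\<nu>. norm (h \<zeta> * \<phi> \<zeta>))" by (rule integral_norm_bound)
  also have "\<dots> \<le> (LINT \<zeta>|\<nu>. B * norm (h \<zeta>))"
    by (intro integral_mono_AE integrable_norm i integrable_mult_right h le)
  finally show "norm (LINT \<zeta>|\<nu>. h \<zeta> * \<phi> \<zeta>) \<le> B * L1 h" by (simp add: L1_def)
qed

lemma cnj_measurable: "f \<in> borel_measurable \<nu> \<Longrightarrow> (\<lambda>\<zeta>. cnj (f \<zeta>)) \<in> borel_measurable \<nu>"
  by (rule measurable_compose[OF _ borel_measurable_continuous_onI]) (auto intro!: continuous_intros)

text \<open>The Bloch function is exchanged for its bounded preimage, which has the same moments.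
  Against a bounded function integration is continuous for \<open>L1\<close>, and the dilations of
  \<open>f\<close> converge in \<open>L1\<close>.\<close>

lemma dpair_limit_D:
  assumes check: "\<omega> \<in> D_check"
  obtains C where "C \<ge> 0" "\<And>f g. f holomorphic_on \<D> \<Longrightarrow> integrable \<nu> f \<Longrightarrow> g \<in> Bloch \<Longrightarrow>
     \<exists>l. (dpair f g \<longlongrightarrow> l) (at_left 1) \<and> norm l \<le> C * Bloch_norm g * L1 f"
proof -
  obtain C where C: "C > 0" "\<And>g. g \<in> Bloch \<Longrightarrow> \<exists>f. f \<in> borel_measurable \<nu> \<and> (\<forall>\<zeta>\<in>\<D>. norm (f \<zeta>) \<le> C * Bloch_norm g) \<and>
     (\<forall>n. (LINT \<zeta>|\<nu>. f \<zeta> * cnj \<zeta> ^ n) = taylor g n * of_real (2 * moment \<omega> (2 * real n + 1)))"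
    by (rule D_check_preimage[OF check]) blast
  show thesis
  proof (rule that[of C])
    fix f g assume f: "f holomorphic_on \<D>" "integrable \<nu> f" and g: "g \<in> Bloch"
    have gh: "g holomorphic_on \<D>" using g by (simp add: Bloch_def)
    have gi: "integrable \<nu> g" by (rule Bloch_integrable[OF check g])
    obtain \<phi> where \<phi>: "\<phi> \<in> borel_measurable \<nu>" "\<And>\<zeta>. \<zeta> \<in> \<D> \<Longrightarrow> norm (\<phi> \<zeta>) \<le> C * Bloch_norm g"
      "\<And>n. (LINT \<zeta>|\<nu>. \<phi> \<zeta> * cnj \<zeta> ^ n) = taylor g n * of_real (2 * moment \<omega> (2 * real n + 1))"
      using C(2)[OF g] by blast
    define B where "B = C * Bloch_norm g"
    have B: "B \<ge> 0" unfolding B_def using C Bloch_norm_ge(2)[OF g] by simp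
    have \<phi>i: "integrable \<nu> \<phi>"
      by (rule disc.integrable_const_bound[of _ B]) (use \<phi> in \<open>auto intro!: AE_I2 simp: B_def\<close>)
    have \<phi>b: "AE \<zeta> in \<nu>. norm (cnj (\<phi> \<zeta>)) \<le> B" by (rule AE_I2) (use \<phi> in \<open>auto simp: B_def\<close>)
    note bi = bounded_pairing[OF _ cnj_measurable[OF \<phi>(1)] \<phi>b]
    define l where "l = (LINT \<zeta>|\<nu>. f \<zeta> * cnj (\<phi> \<zeta>))"
    have eq: "dpair f g r = dpair f \<phi> r" if r: "0 \<le> r" "r < 1" for r
    proof -
      have "(\<lambda>n. taylor f n * of_real r ^ n * cnj (LINT \<zeta>|\<nu>. g \<zeta> * cnj \<zeta> ^ n)) sums dpair f g r"
        by (rule integral_dilate_cnj(2)[OF f(1) r gi])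
      moreover have "(\<lambda>n. taylor f n * of_real r ^ n * cnj (LINT \<zeta>|\<nu>. \<phi> \<zeta> * cnj \<zeta> ^ n)) sums dpair f \<phi> r"
        by (rule integral_dilate_cnj(2)[OF f(1) r \<phi>i])
      ultimately show ?thesis unfolding \<phi>(3) integral_holomorphic_cnj_power[OF gh gi] using sums_unique2 by blast
    qed
    have "((\<lambda>r. dpair f g r - l) \<longlongrightarrow> 0) (at_left 1)"
    proof (rule Lim_null_comparison)
      show "\<forall>\<^sub>F r in at_left 1. norm (dpair f g r - l) \<le> B * L1 (\<lambda>z. dilate r f z - f z)"
        using at_left_1_unit
      proof eventually_elim
        case (elim r)
        have di: "integrable \<nu> (dilate r f)" using dilate_integrable[OF f(1)] elim by blast
        have "dpair f g r - l = (LINT \<zeta>|\<nu>. dilate r f \<zeta> * cnj (\<phi> \<zeta>) - f \<zeta> * cnj (\<phi> \<zeta>))"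
          using eq[of r] elim unfolding l_def dpair_def
          by (simp add: Bochner_Integration.integral_diff[OF bi(1)[OF di] bi(1)[OF f(2)]])
        also have "\<dots> = (LINT \<zeta>|\<nu>. (dilate r f \<zeta> - f \<zeta>) * cnj (\<phi> \<zeta>))" by (simp add: algebra_simps)
        also have "norm \<dots> \<le> B * L1 (\<lambda>z. dilate r f z - f z)"
          by (intro bi(2) Bochner_Integration.integrable_diff di f(2))
        finally show ?case .
      qed
      have "((\<lambda>r. B * L1 (\<lambda>z. dilate r f z - f z)) \<longlongrightarrow> B * 0) (at_left 1)"
        by (intro tendsto_mult tendsto_const L1_dilate_tendsto[OF f])
      thus "((\<lambda>r. B * L1 (\<lambda>z. dilate r f z - f z)) \<longlongrightarrow> 0) (at_left 1)" by simp
    qed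
    hence "(dpair f g \<longlongrightarrow> l) (at_left 1)" by (simp add: LIM_zero_iff)
    moreover have "norm l \<le> C * Bloch_norm g * L1 f" unfolding l_def using bi(2)[OF f(2)] by (simp add: B_def)
    ultimately show "\<exists>l. (dpair f g \<longlongrightarrow> l) (at_left 1) \<and> norm l \<le> C * Bloch_norm g * L1 f" by blast
  qed (use C in auto)
qed

end

section \<open>The equivalences\<close>

text \<open>\<open>real_of_ereal\<close> sends infinite values to 0, so the essential supremum must
  first be seen to be finite: it is at most the given bound and, the measure being nonzero, at least
  0.\<close>

lemma Linf_norm_bound:
  assumes f: "f \<in> Linf_space"
  shows "AE z in dA. norm (f z) \<le> Linf_norm f" "0 \<le> Linf_norm f"
proof -
  obtain C where C: "AE z in dA. norm (f z) \<le> C" using f by (auto simp: Linf_space_def)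
  have [measurable]: "f \<in> borel_measurable dA" using f by (simp add: Linf_space_def)
  have m: "(\<lambda>z. ereal (norm (f z))) \<in> borel_measurable dA" by measurable
  define s where "s = esssup dA (\<lambda>z. ereal (norm (f z)))"
  have up: "s \<le> ereal C" unfolding s_def by (rule esssup_I[OF m]) (use C in auto)
  have "emeasure dA (space dA) \<noteq> 0"
    using emeasure_dA[OF sets.top] by (simp add: emeasure_ball unit_ball_vol_2)
  hence "(0::ereal) = esssup dA (\<lambda>z. 0)" by (rule esssup_const[symmetric])
  also have "\<dots> \<le> s" unfolding s_def by (rule esssup_mono) auto
  finally have low: "0 \<le> s" .
  have s: "s = ereal (Linf_norm f)" using up low by (cases s) (auto simp: Linf_norm_def s_def[symmetric])
  show "0 \<le> Linf_norm f" using low s by simp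
  have "AE z in dA. ereal (norm (f z)) \<le> s" unfolding s_def by (rule esssup_AE)
  thus "AE z in dA. norm (f z) \<le> Linf_norm f" unfolding s by simp
qed

lemma Linf_spaceI:
  assumes f: "f \<in> borel_measurable dA" "\<And>z. z \<in> \<D> \<Longrightarrow> norm (f z) \<le> C"
  shows "f \<in> Linf_space" "Linf_norm f \<le> C"
proof -
  have ae: "AE z in dA. norm (f z) \<le> C" by (rule AE_I2) (use f in auto)
  thus F: "f \<in> Linf_space" using f by (auto simp: Linf_space_def)
  have [measurable]: "f \<in> borel_measurable dA" by (rule f)
  have "esssup dA (\<lambda>z. ereal (norm (f z))) \<le> ereal C" by (rule esssup_I) (use ae in auto)
  moreover have "0 \<le> C" using f(2)[of 0] norm_ge_zero[of "f 0"] by (simp del: norm_ge_zero)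
  ultimately show "Linf_norm f \<le> C"
    unfolding Linf_norm_def by (cases "esssup dA (\<lambda>z. ereal (norm (f z)))") auto
qed

context weighted_disc
begin

lemma AE_nu: "AE z in dA. P z \<Longrightarrow> AE z in \<nu>. P z"
  unfolding \<nu>_def by (subst AE_density) auto

lemma Linf_bound:
  assumes "f \<in> Linf_space"
  shows "f \<in> borel_measurable \<nu>" "AE z in \<nu>. norm (f z) \<le> Linf_norm f" "integrable \<nu> f"
proof -
  show m: "f \<in> borel_measurable \<nu>" using assms by (simp add: Linf_space_def measurable_nu)
  show b: "AE z in \<nu>. norm (f z) \<le> Linf_norm f" by (rule AE_nu[OF Linf_norm_bound(1)[OF assms]])
  show "integrable \<nu> f" by (rule disc.integrable_const_bound[OF b m])
qed

section \<open>Sufficiency of the conditions on the weight\<close>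

lemma projection_bounded:
  assumes hat: "\<omega> \<in> D_hat"
  shows "bounded_op (Bergman_proj \<omega>) Linf_space Linf_norm Bloch Bloch_norm"
proof -
  obtain C where C: "C > 0" "\<And>(f :: complex \<Rightarrow> complex) M. f \<in> borel_measurable \<nu> \<Longrightarrow> AE \<zeta> in \<nu>. norm (f \<zeta>) \<le> M \<Longrightarrow> 0 \<le> M \<Longrightarrow>
    psum (proj_coeff f) \<in> Bloch \<and> Bloch_norm (psum (proj_coeff f)) \<le> C * M"
    by (rule proj_bounded[OF hat]) blast
  have "Bergman_proj \<omega> f \<in> Bloch \<and> Bloch_norm (Bergman_proj \<omega> f) \<le> C * Linf_norm f" if f: "f \<in> Linf_space" for f
  proof -
    note F = Linf_bound[OF f]
    have e: "Bergman_proj \<omega> f z = psum (proj_coeff f) z" if "z \<in> \<D>" for z by (rule Bergman_proj_eq[OF F(3) that])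
    have "Bloch_norm (Bergman_proj \<omega> f) = Bloch_norm (psum (proj_coeff f))" by (rule Bloch_cong(2)) (rule e)
    moreover have "Bergman_proj \<omega> f \<in> Bloch \<longleftrightarrow> psum (proj_coeff f) \<in> Bloch" by (rule Bloch_cong(1)) (rule e)
    ultimately show ?thesis using C(2)[OF F(1,2) Linf_norm_bound(2)[OF f]] by simp
  qed
  thus ?thesis unfolding bounded_op_def by blast
qed

lemma projection_onto:
  assumes check: "\<omega> \<in> D_check"
  shows "onto_op (Bergman_proj \<omega>) Linf_space Bloch"
  unfolding onto_op_def
proof
  fix g assume g: "g \<in> Bloch"
  hence gh: "g holomorphic_on \<D>" by (simp add: Bloch_def)
  obtain C where C: "C > 0" "\<And>g. g \<in> Bloch \<Longrightarrow> \<exists>f. f \<in> borel_measurable \<nu> \<and> (\<forall>\<zeta>\<in>\<D>. norm (f \<zeta>) \<le> C * Bloch_norm g) \<and>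
     (\<forall>n. (LINT \<zeta>|\<nu>. f \<zeta> * cnj \<zeta> ^ n) = taylor g n * of_real (2 * moment \<omega> (2 * real n + 1)))"
    by (rule D_check_preimage[OF check]) blast
  obtain f where f: "f \<in> borel_measurable \<nu>" "\<And>\<zeta>. \<zeta> \<in> \<D> \<Longrightarrow> norm (f \<zeta>) \<le> C * Bloch_norm g"
    "\<And>n. (LINT \<zeta>|\<nu>. f \<zeta> * cnj \<zeta> ^ n) = taylor g n * of_real (2 * moment \<omega> (2 * real n + 1))"
    using C(2)[OF g] by blast
  have F: "f \<in> Linf_space" by (rule Linf_spaceI(1)[of f "C * Bloch_norm g"]) (use f in \<open>auto simp: measurable_nu\<close>)
  have "proj_coeff f n = taylor g n" for n
  proof -
    have "proj_coeff f n = taylor g n * of_real (2 * moment \<omega> (2 * real n + 1) * kernel_coeff n)"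
      unfolding proj_coeff_def f(3) by (simp add: mult_ac)
    thus ?thesis unfolding moment_kernel_coeff by simp
  qed
  hence "proj_coeff f = taylor g" by (rule ext)
  hence "\<forall>z\<in>\<D>. Bergman_proj \<omega> f z = g z"
    using Bergman_proj_eq[OF Linf_bound(3)[OF F]] taylor_series(2)[OF gh] by simp
  thus "\<exists>f\<in>Linf_space. \<forall>z\<in>\<D>. Bergman_proj \<omega> f z = g z" using F by blast
qed

text \<open>The pairing estimate comes from \<open>D_check\<close> through bounded preimages, the
  estimate of the representing function from \<open>D_hat\<close> through the \<open>L1\<close> norm
  of the differentiated kernel.\<close>

lemma Bergman_dual_Bloch:
  assumes hat: "\<omega> \<in> D_hat" and check: "\<omega> \<in> D_check"
  shows "dual_via_A2_pairing \<omega> (Bergman 1 \<omega>) (Lp_norm 1 \<omega>) Bloch Bloch_norm"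
proof -
  obtain C where C: "C \<ge> 0" "\<And>f g. f holomorphic_on \<D> \<Longrightarrow> integrable \<nu> f \<Longrightarrow> g \<in> Bloch \<Longrightarrow>
     \<exists>l. (dpair f g \<longlongrightarrow> l) (at_left 1) \<and> norm l \<le> C * Bloch_norm g * L1 f"
    by (rule dpair_limit_D[OF check]) blast
  obtain K where K: "K > 0"
    "\<And>w. w \<in> \<D> \<Longrightarrow> (LINT \<zeta>|\<nu>. norm (psum (diffs kernel_coeffs) (w * \<zeta>))) \<le> K / (1 - norm w)"
    by (rule kernel_derivative_L1[OF hat]) blast
  define A where "A = measure \<nu> \<D>"
  interpret disc_space "Bergman 1 \<omega>" "Lp_norm 1 \<omega>" A unfolding A_def by (rule Bergman_space)
  show ?thesis
  proof (rule dual_viaI[OF Bergman_space, where b=C and a="2 * K + A * kernel_coeff 0"])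
    show "g holomorphic_on \<D> \<and> integrable \<nu> g \<and> 0 \<le> Bloch_norm g" if "g \<in> Bloch" for g
      using that Bloch_integrable[OF check that] Bloch_norm_ge(2)[OF that] by (simp add: Bloch_def)
    show "Bloch_norm g = Bloch_norm h" if "\<And>z. z \<in> \<D> \<Longrightarrow> g z = h z" for g h by (rule Bloch_cong(2)) (rule that)
    show "\<exists>l. (dpair f g \<longlongrightarrow> l) (at_left 1) \<and> norm l \<le> C * Bloch_norm g * Lp_norm 1 \<omega> f"
      if "f \<in> Bergman 1 \<omega>" "g \<in> Bloch" for f g
      using C(2)[of f g] that by (simp add: Bergman_1_iff Lp_norm_1 holomorphic_measurable)
    show "C \<ge> 0" by (rule C(1))
    show "0 \<le> 2 * K + A * kernel_coeff 0" using K(1) kernel_coeff_pos[of 0] by (simp add: A_def)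
  next
    fix L B assume L: "L \<in> dual_space (Bergman 1 \<omega>) (Lp_norm 1 \<omega>)" and B: "B \<ge> 0"
      "\<And>f. f \<in> Bergman 1 \<omega> \<Longrightarrow> norm (L f) \<le> B * Lp_norm 1 \<omega> f"
    define g where "g = psum (repr_coeff L)"
    have gh: "g holomorphic_on \<D>" unfolding g_def by (rule psum_holomorphic[OF repr_series[OF Bergman_space L]])
    have d: "norm (deriv g z) * (1 - (norm z)\<^sup>2) \<le> 2 * K * B" if z: "z \<in> \<D>" for z
    proof -
      let ?k = "psum (kernel_deriv_coeff z)"
      have k: "?k \<in> Bergman 1 \<omega>" using series[OF kernel_deriv_coeff_strong[OF z]] by blast
      have z': "cnj z \<in> \<D>" "norm z < 1" using z by auto
      note ki = kernel_derivative_integrable[OF z'(1)]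
      have "L1 ?k \<le> (LINT \<zeta>|\<nu>. norm (psum (diffs kernel_coeffs) (cnj z * \<zeta>)))"
        unfolding kernel_L1[OF z]
      proof (rule integral_mono)
        show "integrable \<nu> (\<lambda>\<zeta>. norm (\<zeta> * psum (diffs kernel_coeffs) (cnj z * \<zeta>)))" by (rule integrable_norm[OF ki(2)])
        show "integrable \<nu> (\<lambda>\<zeta>. norm (psum (diffs kernel_coeffs) (cnj z * \<zeta>)))" by (rule integrable_norm[OF ki(1)])
        fix \<zeta> :: complex assume "\<zeta> \<in> space \<nu>"
        hence "norm \<zeta> * norm (psum (diffs kernel_coeffs) (cnj z * \<zeta>)) \<le> 1 * norm (psum (diffs kernel_coeffs) (cnj z * \<zeta>))"
          by (intro mult_right_mono) auto
        thus "norm (\<zeta> * psum (diffs kernel_coeffs) (cnj z * \<zeta>)) \<le> norm (psum (diffs kernel_coeffs) (cnj z * \<zeta>))" by (simp add: norm_mult)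
      qed
      also have "\<dots> \<le> K / (1 - norm z)" using K(2)[OF z'(1)] by simp
      finally have k1: "L1 ?k \<le> K / (1 - norm z)" .
      have "norm (deriv g z) = norm (L ?k)"
        unfolding repr_deriv[OF Bergman_space L z, symmetric] g_def by simp
      also have "\<dots> \<le> B * L1 ?k" using B(2)[OF k] hol[OF k] by (simp add: Lp_norm_1 holomorphic_measurable)
      also have "\<dots> \<le> B * (K / (1 - norm z))" by (intro mult_left_mono k1 B(1))
      finally have "norm (deriv g z) * (1 - (norm z)\<^sup>2) \<le> B * (K / (1 - norm z)) * (1 - (norm z)\<^sup>2)"
        using z' power_le_one[of "norm z" 2] by (intro mult_right_mono) auto
      also have "\<dots> = B * K * (1 + norm z)"
        using z'(2) by (simp add: power2_eq_square field_simps)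
      also have "\<dots> \<le> B * K * 2" using z' B(1) K(1) by (intro mult_left_mono) auto
      finally show ?thesis by (simp only: mult_ac)
    qed
    have "norm (g 0) = norm (L (\<lambda>z. z ^ 0)) * kernel_coeff 0"
      using kernel_coeff_pos[of 0] unfolding g_def psum_zero repr_coeff_def norm_mult by simp
    also have "\<dots> \<le> B * (A * (real 0 + 1)) * kernel_coeff 0"
    proof (intro mult_right_mono)
      have "norm (L (\<lambda>z. z ^ 0)) \<le> B * Lp_norm 1 \<omega> (\<lambda>z. z ^ 0)" by (rule B(2)[OF monomial(1)])
      also have "\<dots> \<le> B * (A * (real 0 + 1))" by (intro mult_left_mono monomial(2) B(1))
      finally show "norm (L (\<lambda>z. z ^ 0)) \<le> B * (A * (real 0 + 1))" .
    qed (use kernel_coeff_pos[of 0] in auto)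
    finally have g0: "norm (g 0) \<le> B * A * kernel_coeff 0" by simp
    have "g \<in> Bloch" "Bloch_norm g \<le> 2 * K * B + norm (g 0)" using BlochI[OF gh d] by auto
    thus "psum (repr_coeff L) \<in> Bloch \<and> Bloch_norm (psum (repr_coeff L)) \<le> (2 * K + A * kernel_coeff 0) * B"
      using g0 unfolding g_def[symmetric] by (simp add: algebra_simps)
  qed
qed

text \<open>Here the representing function has to be shown integrable. Its dilations are tested
  against their own signs: the outcome is, up to conjugation, \<open>L\<close> at a dilated
  projection of a bounded function, whose Bloch norm \<open>proj_bounded\<close> controls. Fatou's
  lemma removes the dilation.\<close>

lemma little_Bloch_dual_Bergman:
  assumes hat: "\<omega> \<in> D_hat" and check: "\<omega> \<in> D_check"
  shows "dual_via_A2_pairing \<omega> little_Bloch Bloch_norm (Bergman 1 \<omega>) (Lp_norm 1 \<omega>)"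
proof -
  obtain C where C: "C \<ge> 0" "\<And>f g. f holomorphic_on \<D> \<Longrightarrow> integrable \<nu> f \<Longrightarrow> g \<in> Bloch \<Longrightarrow>
     \<exists>l. (dpair f g \<longlongrightarrow> l) (at_left 1) \<and> norm l \<le> C * Bloch_norm g * L1 f"
    by (rule dpair_limit_D[OF check]) blast
  obtain D where D: "D > 0" "\<And>(f :: complex \<Rightarrow> complex) M. f \<in> borel_measurable \<nu> \<Longrightarrow> AE \<zeta> in \<nu>. norm (f \<zeta>) \<le> M \<Longrightarrow> 0 \<le> M \<Longrightarrow>
    psum (proj_coeff f) \<in> Bloch \<and> Bloch_norm (psum (proj_coeff f)) \<le> D * M"
    by (rule proj_bounded[OF hat]) blast
  interpret disc_space little_Bloch Bloch_norm 1 by (rule little_Bloch_space)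
  have lp: "Lp_norm 1 \<omega> g = L1 g" if "g holomorphic_on \<D>" for g by (rule Lp_norm_1[OF holomorphic_measurable[OF that]])
  show ?thesis
  proof (rule dual_viaI[OF little_Bloch_space, where b=C and a=D])
    show "g holomorphic_on \<D> \<and> integrable \<nu> g \<and> 0 \<le> Lp_norm 1 \<omega> g" if "g \<in> Bergman 1 \<omega>" for g
      using that by (simp add: Bergman_1_iff Lp_norm_def)
    show "Lp_norm 1 \<omega> g = Lp_norm 1 \<omega> h" if "g \<in> Bergman 1 \<omega>" "h \<in> Bergman 1 \<omega>" "\<And>z. z \<in> \<D> \<Longrightarrow> g z = h z" for g h
      unfolding Lp_norm_def by (rule arg_cong[where f="\<lambda>x. x powr (1 / 1)"], rule Bochner_Integration.integral_cong) (use that in auto)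
    show "C \<ge> 0" by (rule C(1))
    show "D \<ge> 0" using D(1) by simp
    fix f g assume f: "f \<in> little_Bloch" and g: "g \<in> Bergman 1 \<omega>"
    have fB: "f \<in> Bloch" by (rule little_Bloch_subset[OF f])
    have fi: "integrable \<nu> f" by (rule Bloch_integrable[OF check fB])
    have gh: "g holomorphic_on \<D>" "integrable \<nu> g" using g by (auto simp: Bergman_1_iff)
    obtain l where l: "(dpair g f \<longlongrightarrow> l) (at_left 1)" "norm l \<le> C * Bloch_norm f * L1 g"
      using C(2)[OF gh fB] by blast
    have "\<forall>\<^sub>F r in at_left 1. cnj (dpair g f r) = dpair f g r"
      using at_left_1_unit by eventually_elim (use dpair_swap[OF hol[OF f] fi gh] in auto)
    hence "(dpair f g \<longlongrightarrow> cnj l) (at_left 1)" by (rule Lim_transform_eventually[OF tendsto_cnj[OF l(1)]])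
    moreover have "norm (cnj l) \<le> C * Lp_norm 1 \<omega> g * Bloch_norm f" using l(2) by (simp add: lp[OF gh(1)] mult_ac)
    ultimately show "\<exists>l. (dpair f g \<longlongrightarrow> l) (at_left 1) \<and> norm l \<le> C * Lp_norm 1 \<omega> g * Bloch_norm f" by blast
  next
    fix L B assume L: "L \<in> dual_space little_Bloch Bloch_norm" and B: "B \<ge> 0"
      "\<And>f. f \<in> little_Bloch \<Longrightarrow> norm (L f) \<le> B * Bloch_norm f"
    define g where "g = psum (repr_coeff L)"
    have ds: "disc_series (repr_coeff L)" by (rule repr_series[OF little_Bloch_space L])
    have gh: "g holomorphic_on \<D>" unfolding g_def by (rule psum_holomorphic[OF ds])
    have tg: "taylor g = repr_coeff L" unfolding g_def by (rule taylor_psum[OF ds])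
    have dil: "L1 (dilate r g) \<le> D * B" if r: "0 \<le> r" "r < 1" for r
    proof -
      define \<psi> where "\<psi> \<zeta> = sgn (dilate r g \<zeta>)" for \<zeta>
      have \<psi>m: "\<psi> \<in> borel_measurable \<nu>" unfolding \<psi>_def[abs_def]
        using dilate_integrable[OF gh r] by measurable
      have \<psi>1: "AE \<zeta> in \<nu>. norm (\<psi> \<zeta>) \<le> 1" by (rule AE_I2) (simp add: \<psi>_def norm_sgn)
      have \<psi>i: "integrable \<nu> \<psi>" by (rule disc.integrable_const_bound[OF \<psi>1 \<psi>m])
      \<comment> \<open>The dilation is moved from \<open>g\<close> to the projection of \<psi>,
        where it makes the series strong and thus admissible for \<open>L\<close>.\<close>
      define c where "c n = proj_coeff \<psi> n * of_real r ^ n" for n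
      have cs: "strong_series c" unfolding c_def[abs_def] by (rule strong_series_dilate[OF proj_coeff_series[OF \<psi>i] r])
      have "of_real (L1 (dilate r g)) = dpair g \<psi> r"
        unfolding dpair_def L1_def \<psi>_def mult_cnj_sgn by (rule integral_complex_of_real[symmetric])
      moreover have "(\<lambda>n. cnj (c n * L (\<lambda>z. z ^ n))) sums cnj (L (psum c))"
        unfolding sums_cnj by (rule dual_psum[OF L cs])
      moreover have "(\<lambda>n. cnj (c n * L (\<lambda>z. z ^ n))) sums dpair g \<psi> r"
        using integral_dilate_cnj(2)[OF gh r \<psi>i] by (simp add: tg c_def repr_coeff_def proj_coeff_def mult_ac)
      ultimately have "of_real (L1 (dilate r g)) = cnj (L (psum c))" using sums_unique2 by metis
      hence "norm (complex_of_real (L1 (dilate r g))) = norm (L (psum c))" by simp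
      hence "L1 (dilate r g) = norm (L (psum c))" using L1_nonneg[of "dilate r g"] by simp
      also have "\<dots> \<le> B * Bloch_norm (psum c)" using series[OF cs] by (intro B(2)) blast
      also have "\<dots> \<le> B * D"
      proof (intro mult_left_mono B(1))
        have "psum c = dilate r (psum (proj_coeff \<psi>))"
          by (rule ext) (simp add: c_def[abs_def] psum_scale dilate_def)
        moreover have "psum (proj_coeff \<psi>) \<in> Bloch \<and> Bloch_norm (psum (proj_coeff \<psi>)) \<le> D * 1"
          by (rule D(2)[OF \<psi>m \<psi>1]) simp
        ultimately show "Bloch_norm (psum c) \<le> D" using Bloch_dilate(2)[of "psum (proj_coeff \<psi>)" r] r by simp
      qed
      finally show ?thesis by (simp add: mult.commute)
    qed
    define b where "b n = 1 - 1 / (real n + 2)" for n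
    have b: "0 < b n" "b n < 1" for n by (auto simp: b_def field_simps)
    have blim: "b \<longlonglongrightarrow> 1" unfolding b_def[abs_def] by real_asymp
    have di: "integrable \<nu> (dilate (b n) g)" for n using dilate_integrable[OF gh] b[of n] by simp
    have lim: "(\<lambda>n. dilate (b n) g z) \<longlonglongrightarrow> g z" if z: "z \<in> \<D>" for z
    proof -
      have "isCont g z" using holomorphic_on_imp_continuous_on[OF gh] z by (simp add: continuous_on_eq_continuous_at)
      moreover have "(\<lambda>n. complex_of_real (b n) * z) \<longlonglongrightarrow> of_real 1 * z" by (intro tendsto_intros blim)
      ultimately show ?thesis unfolding dilate_def by (intro isCont_tendsto_compose[of z g]) auto
    qed
    have "(\<integral>\<^sup>+z. ennreal (norm (g z)) \<partial>\<nu>) = (\<integral>\<^sup>+z. liminf (\<lambda>n. ennreal (norm (dilate (b n) g z))) \<partial>\<nu>)"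
    proof (rule nn_integral_cong)
      fix z assume "z \<in> space \<nu>"
      hence "(\<lambda>n. ennreal (norm (dilate (b n) g z))) \<longlonglongrightarrow> ennreal (norm (g z))"
        using lim[of z] by (intro tendsto_ennrealI tendsto_norm) simp
      thus "ennreal (norm (g z)) = liminf (\<lambda>n. ennreal (norm (dilate (b n) g z)))"
        by (rule lim_imp_Liminf[OF sequentially_bot, symmetric])
    qed
    also have "\<dots> \<le> liminf (\<lambda>n. \<integral>\<^sup>+z. ennreal (norm (dilate (b n) g z)) \<partial>\<nu>)"
      by (rule nn_integral_liminf) (use di in measurable)
    also have "\<dots> \<le> ennreal (D * B)"
    proof (rule Liminf_le)
      have "(\<integral>\<^sup>+z. ennreal (norm (dilate (b n) g z)) \<partial>\<nu>) \<le> ennreal (D * B)" for n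
      proof -
        have "(\<integral>\<^sup>+z. ennreal (norm (dilate (b n) g z)) \<partial>\<nu>) = ennreal (L1 (dilate (b n) g))"
          unfolding L1_def by (rule nn_integral_eq_integral) (use di in auto)
        also have "\<dots> \<le> ennreal (D * B)" using b[of n] by (intro ennreal_leI dil) auto
        finally show ?thesis .
      qed
      thus "\<forall>\<^sub>F n in sequentially. (\<integral>\<^sup>+z. ennreal (norm (dilate (b n) g z)) \<partial>\<nu>) \<le> ennreal (D * B)" by simp
    qed simp
    finally have le: "(\<integral>\<^sup>+z. ennreal (norm (g z)) \<partial>\<nu>) \<le> ennreal (D * B)" .
    have gi: "integrable \<nu> g"
      by (rule integrableI_bounded[OF holomorphic_measurable[OF gh]]) (use le in \<open>auto intro: le_less_trans\<close>)
    have "ennreal (L1 g) = (\<integral>\<^sup>+z. ennreal (norm (g z)) \<partial>\<nu>)"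
      unfolding L1_def by (rule nn_integral_eq_integral[symmetric]) (use gi in auto)
    hence "ennreal (L1 g) \<le> ennreal (D * B)" using le by simp
    hence "L1 g \<le> D * B" by (rule ennreal_le_iff[THEN iffD1, rotated]) (use D(1) B(1) in simp)
    thus "psum (repr_coeff L) \<in> Bergman 1 \<omega> \<and> Lp_norm 1 \<omega> (psum (repr_coeff L)) \<le> D * B"
      using gh gi unfolding g_def[symmetric] by (simp add: Bergman_1_iff lp)
  qed
qed

section \<open>Necessity of the conditions on the weight\<close>

lemma projection_imp_D_hat:
  assumes "bounded_op (Bergman_proj \<omega>) Linf_space Linf_norm Bloch Bloch_norm"
  shows "\<omega> \<in> D_hat"
proof -
  obtain C where C: "\<And>f. f \<in> Linf_space \<Longrightarrow> Bergman_proj \<omega> f \<in> Bloch"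
    "\<And>f. f \<in> Linf_space \<Longrightarrow> Bloch_norm (Bergman_proj \<omega> f) \<le> C * Linf_norm f"
    using assms by (auto simp: bounded_op_def)
  show ?thesis
  proof (rule proj_bounded_imp_D_hat[where B="max 0 C * (2 * pi)"])
    fix f :: "complex \<Rightarrow> complex" and z assume f: "f \<in> borel_measurable \<nu>" "\<And>\<zeta>. norm (f \<zeta>) \<le> 2 * pi" and z: "z \<in> \<D>"
    have F: "f \<in> Linf_space" "Linf_norm f \<le> 2 * pi"
      using Linf_spaceI[of f "2 * pi"] f by (auto simp: measurable_nu)
    have "norm (deriv (Bergman_proj \<omega> f) z) * (1 - (norm z)\<^sup>2) \<le> Bloch_norm (Bergman_proj \<omega> f)"
      using Bloch_deriv[OF C(1)[OF F(1)] z] norm_ge_zero[of "Bergman_proj \<omega> f 0"] by linarith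
    also have "\<dots> \<le> C * Linf_norm f" by (rule C(2)[OF F(1)])
    also have "\<dots> \<le> max 0 C * Linf_norm f" using Linf_norm_bound(2)[OF F(1)] by (intro mult_right_mono) auto
    also have "\<dots> \<le> max 0 C * (2 * pi)" by (intro mult_left_mono F(2)) auto
    finally show "norm (deriv (psum (proj_coeff f)) z) * (1 - (norm z)\<^sup>2) \<le> max 0 C * (2 * pi)"
      using deriv_eq_on_disc[OF Bergman_proj_eq[OF Linf_bound(3)[OF F(1)]] z] by simp
  qed
qed

text \<open>Surjectivity yields a bounded preimage of the infinite sum of all
  \<open>z ^ (2 ^ k)\<close>. Paired with any finite block it returns the sum of the squared norms
  of the monomials in the block, so the norm of this one preimage bounds all blocks, without an open
  mapping argument.\<close>

lemma projection_imp_M: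
  assumes "onto_op (Bergman_proj \<omega>) Linf_space Bloch"
  shows "\<omega> \<in> M_class"
proof -
  define R where "R = range (\<lambda>k::nat. 2 ^ k :: nat)"
  have R: "disc_series (lacunary R)" "psum (lacunary R) \<in> Bloch" using lacunary_Bloch[of R] by (auto simp: R_def)
  obtain \<phi> where \<phi>: "\<phi> \<in> Linf_space" "\<And>z. z \<in> \<D> \<Longrightarrow> Bergman_proj \<omega> \<phi> z = psum (lacunary R) z"
    using assms R(2) unfolding onto_op_def by blast
  note F = Linf_bound[OF \<phi>(1)]
  have ds: "disc_series (proj_coeff \<phi>)" by (rule proj_coeff_series[OF F(3)])
  have "taylor (psum (lacunary R)) = taylor (psum (proj_coeff \<phi>))"
    by (rule taylor_cong[OF _ psum_holomorphic[OF ds]]) (use \<phi>(2) Bergman_proj_eq[OF F(3)] in auto)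
  hence pc: "proj_coeff \<phi> = lacunary R" by (simp add: taylor_psum ds R(1))
  have mom: "(LINT \<zeta>|\<nu>. \<phi> \<zeta> * cnj \<zeta> ^ n) = of_real (2 * moment \<omega> (2 * real n + 1))" if "n \<in> R" for n
  proof -
    have "of_real (kernel_coeff n) * (LINT \<zeta>|\<nu>. \<phi> \<zeta> * cnj \<zeta> ^ n) = 1"
      using fun_cong[OF pc, of n] that by (simp add: proj_coeff_def lacunary_def)
    hence "complex_of_real (2 * moment \<omega> (2 * real n + 1) * kernel_coeff n) * (LINT \<zeta>|\<nu>. \<phi> \<zeta> * cnj \<zeta> ^ n) = of_real (2 * moment \<omega> (2 * real n + 1))"
      unfolding of_real_mult mult.assoc by simp
    thus ?thesis unfolding moment_kernel_coeff by simp
  qed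
  show ?thesis
  proof (rule lacunary_pairing_imp_M[where B="Linf_norm \<phi>"])
    fix j N :: nat assume N: "N > 0"
    define S where "S = dyadic_block j N"
    define h where "h = psum (lacunary S)"
    have S: "finite S" "S \<subseteq> R" unfolding S_def R_def using dyadic_block by auto
    have ss: "strong_series (lacunary S)" by (rule strong_series_lacunary[OF S(1)])
    have hi: "integrable \<nu> h" unfolding h_def S_def by (rule lacunary_L1(2)[OF N])
    have cj: "psum (lacunary S) (cnj \<zeta>) = cnj (h \<zeta>)" if "\<zeta> \<in> \<D>" for \<zeta>
      unfolding h_def by (rule psum_cnj_real[OF _ strong_series_disc[OF ss] that]) (simp add: lacunary_def)
    have "(\<lambda>n. lacunary S n * (LINT \<zeta>|\<nu>. \<phi> \<zeta> * cnj \<zeta> ^ n)) sums (LINT \<zeta>|\<nu>. \<phi> \<zeta> * psum (lacunary S) (cnj \<zeta>))"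
      by (rule integral_psum_cnj(2)[OF F(3) strong_series_norm[OF ss]])
    moreover have "(\<lambda>n. lacunary S n * (LINT \<zeta>|\<nu>. \<phi> \<zeta> * cnj \<zeta> ^ n)) sums (\<Sum>n\<in>S. lacunary S n * (LINT \<zeta>|\<nu>. \<phi> \<zeta> * cnj \<zeta> ^ n))"
      by (rule sums_finite[OF S(1)]) (simp add: lacunary_def)
    ultimately have "(\<Sum>n\<in>S. lacunary S n * (LINT \<zeta>|\<nu>. \<phi> \<zeta> * cnj \<zeta> ^ n)) = (LINT \<zeta>|\<nu>. \<phi> \<zeta> * psum (lacunary S) (cnj \<zeta>))"
      by (rule sums_unique2[rotated])
    moreover have "(\<Sum>n\<in>S. lacunary S n * (LINT \<zeta>|\<nu>. \<phi> \<zeta> * cnj \<zeta> ^ n)) = of_real (\<Sum>n\<in>S. 2 * moment \<omega> (2 * real n + 1))"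
      unfolding of_real_sum by (rule sum.cong) (use S mom in \<open>auto simp: lacunary_def\<close>)
    ultimately have e: "of_real (\<Sum>n\<in>S. 2 * moment \<omega> (2 * real n + 1)) = (LINT \<zeta>|\<nu>. \<phi> \<zeta> * psum (lacunary S) (cnj \<zeta>))" by simp
    also have "\<dots> = (LINT \<zeta>|\<nu>. cnj (h \<zeta>) * \<phi> \<zeta>)" by (rule Bochner_Integration.integral_cong) (simp_all add: cj mult.commute)
    finally have "norm (complex_of_real (\<Sum>n\<in>S. 2 * moment \<omega> (2 * real n + 1))) = norm (LINT \<zeta>|\<nu>. cnj (h \<zeta>) * \<phi> \<zeta>)" by simp
    also have "\<dots> \<le> Linf_norm \<phi> * L1 (\<lambda>\<zeta>. cnj (h \<zeta>))"
      by (rule bounded_pairing(2)[OF _ F(1,2)]) (use hi in simp)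
    finally have "\<bar>\<Sum>n\<in>S. 2 * moment \<omega> (2 * real n + 1)\<bar> \<le> Linf_norm \<phi> * L1 h" by (simp only: norm_of_real L1_def complex_mod_cnj)
    thus "(\<Sum>n\<in>dyadic_block j N. 2 * moment \<omega> (2 * real n + 1)) \<le> Linf_norm \<phi> * (LINT \<zeta>|\<nu>. norm (psum (lacunary (dyadic_block j N)) \<zeta>))"
      by (simp add: S_def h_def L1_def)
  qed
qed

lemma lacunary_block_pairing:
  fixes j N :: nat
  assumes N: "N > 0"
  defines "h \<equiv> psum (lacunary (dyadic_block j N))"
  shows "A2_pairing \<omega> h h = of_real (\<Sum>n\<in>dyadic_block j N. 2 * moment \<omega> (2 * real n + 1))"
    "h \<in> Bergman 1 \<omega>" "h \<in> little_Bloch" "Bloch_norm h \<le> 5" "Lp_norm 1 \<omega> h = L1 h"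
proof -
  define S where "S = dyadic_block j N"
  have S: "finite S" "S \<subseteq> range (\<lambda>k. 2 ^ k)" unfolding S_def using dyadic_block by auto
  have ss: "strong_series (lacunary S)" by (rule strong_series_lacunary[OF S(1)])
  have hh: "h holomorphic_on \<D>" unfolding h_def S_def[symmetric] by (rule psum_holomorphic[OF strong_series_disc[OF ss]])
  have hi: "integrable \<nu> h" unfolding h_def by (rule lacunary_L1(2)[OF N])
  show "h \<in> Bergman 1 \<omega>" using hh hi by (simp add: Bergman_1_iff)
  show "h \<in> little_Bloch" unfolding h_def S_def[symmetric] by (rule strong_series_little_Bloch(1)[OF ss])
  show "Bloch_norm h \<le> 5" unfolding h_def S_def[symmetric] by (rule lacunary_Bloch(3)[OF S(2)])
  show "Lp_norm 1 \<omega> h = L1 h" by (rule Lp_norm_1[OF holomorphic_measurable[OF hh]])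
  have supp: "{n. lacunary S n \<noteq> 0} = S" by (auto simp: lacunary_def)
  have t: "taylor h = lacunary S" unfolding h_def S_def[symmetric] by (rule taylor_psum[OF strong_series_disc[OF ss]])
  have "A2_pairing \<omega> h h = (\<Sum>n\<in>S. lacunary S n * cnj (lacunary S n) * of_real (2 * moment \<omega> (2 * real n + 1)))"
    using pairing_finite[of "lacunary S", OF _ hh hi] S(1) unfolding supp t by (simp add: h_def S_def)
  also have "\<dots> = of_real (\<Sum>n\<in>S. 2 * moment \<omega> (2 * real n + 1))"
    unfolding of_real_sum by (rule sum.cong) (auto simp: lacunary_def)
  finally show "A2_pairing \<omega> h h = of_real (\<Sum>n\<in>dyadic_block j N. 2 * moment \<omega> (2 * real n + 1))" unfolding S_def .
qed

text \<open>A dyadic block lies in both spaces, so pairing it with itself tests either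
  duality.\<close>

lemma pairing_bound_imp_M:
  assumes "\<And>f. f \<in> Bergman 1 \<omega> \<Longrightarrow> f \<in> little_Bloch \<Longrightarrow> norm (A2_pairing \<omega> f f) \<le> b * Bloch_norm f * Lp_norm 1 \<omega> f"
    and b: "b \<ge> 0"
  shows "\<omega> \<in> M_class"
proof (rule lacunary_pairing_imp_M[where B="b * 5"])
  fix j N :: nat assume N: "N > 0"
  define h where "h = psum (lacunary (dyadic_block j N))"
  note H = lacunary_block_pairing[OF N, of j, folded h_def]
  have "norm (A2_pairing \<omega> h h) \<le> b * Bloch_norm h * L1 h" using assms(1)[OF H(2,3)] H(5) by simp
  also have "\<dots> \<le> b * 5 * L1 h" by (intro mult_right_mono mult_left_mono H(4) b L1_nonneg)
  finally show "(\<Sum>n\<in>dyadic_block j N. 2 * moment \<omega> (2 * real n + 1)) \<le> b * 5 * (LINT \<zeta>|\<nu>. norm (psum (lacunary (dyadic_block j N)) \<zeta>))"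
    unfolding H(1) norm_of_real by (simp add: L1_def h_def)
qed

lemma dual_via_pairing_bound:
  assumes X: "disc_space X N A" and dual: "dual_via_A2_pairing \<omega> X N Y NY"
  obtains b where "b > 0" "\<And>f g. f \<in> X \<Longrightarrow> g \<in> Y \<Longrightarrow> norm (A2_pairing \<omega> f g) \<le> b * NY g * N f"
proof -
  interpret disc_space X N A by (rule X)
  obtain b where b: "b > 0" "\<And>g. g \<in> Y \<Longrightarrow> dual_norm X N (\<lambda>f. A2_pairing \<omega> f g) \<le> b * NY g"
    using dual unfolding dual_via_A2_pairing_def by blast
  show thesis
  proof (rule that[OF b(1)])
    fix f g assume f: "f \<in> X" and g: "g \<in> Y"
    have "(\<lambda>f. A2_pairing \<omega> f g) \<in> dual_space X N" using dual g unfolding dual_via_A2_pairing_def by blast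
    hence "norm (A2_pairing \<omega> f g) \<le> dual_norm X N (\<lambda>f. A2_pairing \<omega> f g) * N f" using f by (rule dual_norm_ge(1))
    also have "\<dots> \<le> b * NY g * N f" by (intro mult_right_mono b(2)[OF g] nonneg[OF f])
    finally show "norm (A2_pairing \<omega> f g) \<le> b * NY g * N f" .
  qed
qed

lemma Bergman_dual_imp_M:
  assumes "dual_via_A2_pairing \<omega> (Bergman 1 \<omega>) (Lp_norm 1 \<omega>) Bloch Bloch_norm"
  shows "\<omega> \<in> M_class"
proof -
  obtain b where "b > 0" "\<And>f g. f \<in> Bergman 1 \<omega> \<Longrightarrow> g \<in> Bloch \<Longrightarrow> norm (A2_pairing \<omega> f g) \<le> b * Bloch_norm g * Lp_norm 1 \<omega> f"
    by (rule dual_via_pairing_bound[OF Bergman_space assms]) blast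
  thus ?thesis by (intro pairing_bound_imp_M[of b]) (auto dest: little_Bloch_subset)
qed

lemma little_Bloch_dual_imp_M:
  assumes "dual_via_A2_pairing \<omega> little_Bloch Bloch_norm (Bergman 1 \<omega>) (Lp_norm 1 \<omega>)"
  shows "\<omega> \<in> M_class"
proof -
  obtain b where b: "b > 0" "\<And>f g. f \<in> little_Bloch \<Longrightarrow> g \<in> Bergman 1 \<omega> \<Longrightarrow> norm (A2_pairing \<omega> f g) \<le> b * Lp_norm 1 \<omega> g * Bloch_norm f"
    by (rule dual_via_pairing_bound[OF little_Bloch_space assms]) blast
  show ?thesis
    by (rule pairing_bound_imp_M[of b]) (use b in \<open>auto simp: mult_ac\<close>)
qed

text \<open>A bounded \<open>f\<close> acts on the Bergman space by integration; the Bloch function representing this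
  functional is the Bergman projection of \<open>f\<close>.\<close>

lemma Bergman_dual_imp_D_hat:
  assumes dual: "dual_via_A2_pairing \<omega> (Bergman 1 \<omega>) (Lp_norm 1 \<omega>) Bloch Bloch_norm"
  shows "\<omega> \<in> D_hat"
proof -
  interpret disc_space "Bergman 1 \<omega>" "Lp_norm 1 \<omega>" "measure \<nu> \<D>" by (rule Bergman_space)
  obtain a where a: "a > 0" "\<And>g. g \<in> Bloch \<Longrightarrow> a * Bloch_norm g \<le> dual_norm (Bergman 1 \<omega>) (Lp_norm 1 \<omega>) (\<lambda>f. A2_pairing \<omega> f g)"
    using dual unfolding dual_via_A2_pairing_def by blast
  \<comment> \<open>The duality itself forces this: the pairing of the constant 1 with
    \<open>g\<close> must exist, and its integrand does not depend on \<open>r\<close>.\<close>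
  have gi: "integrable \<nu> g" if g: "g \<in> Bloch" for g
  proof -
    have gm: "g \<in> borel_measurable \<nu>" using g by (intro holomorphic_measurable) (simp add: Bloch_def)
    have "A2_pairing_exists \<omega> (\<lambda>z. z ^ 0) g"
      using dual g monomial(1)[of 0] unfolding dual_via_A2_pairing_def by blast
    hence "\<forall>\<^sub>F r in at_left 1. integrable dA (pairing_integrand \<omega> (\<lambda>z. z ^ 0) g r)" by (simp add: A2_pairing_exists_def)
    then obtain r where "integrable dA (pairing_integrand \<omega> (\<lambda>z. z ^ 0) g r)"
      using eventually_happens[of _ "at_left (1::real)"] by force
    moreover have "pairing_integrand \<omega> (\<lambda>z. z ^ 0) g r = (\<lambda>z. \<omega> (norm z) *\<^sub>R cnj (g z))"
      by (rule ext) (simp add: pairing_integrand_def scaleR_conv_of_real)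
    ultimately have "integrable \<nu> (\<lambda>z. cnj (g z))" using integral_nu(2)[OF cnj_measurable[OF gm]] by simp
    thus ?thesis by simp
  qed
  show ?thesis
  proof (rule proj_bounded_imp_D_hat[where B="2 * pi / a"])
    fix f :: "complex \<Rightarrow> complex" and z assume f: "f \<in> borel_measurable \<nu>" "\<And>\<zeta>. norm (f \<zeta>) \<le> 2 * pi" and z: "z \<in> \<D>"
    define L where "L h = (LINT \<zeta>|\<nu>. h \<zeta> * cnj (f \<zeta>))" for h
    have fb: "AE \<zeta> in \<nu>. norm (f \<zeta>) \<le> 2 * pi" by (rule AE_I2) (rule f(2))
    have fi: "integrable \<nu> f" by (rule disc.integrable_const_bound[OF fb f(1)])
    have cb: "AE \<zeta> in \<nu>. norm (cnj (f \<zeta>)) \<le> 2 * pi" using fb by simp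
    note P = bounded_pairing[OF _ cnj_measurable[OF f(1)] cb]
    have Lb: "norm (L h) \<le> 2 * pi * Lp_norm 1 \<omega> h" if "h \<in> Bergman 1 \<omega>" for h
      using P(2)[of h] that by (simp add: L_def Bergman_1_iff Lp_norm_1 holomorphic_measurable)
    have "L \<in> dual_space (Bergman 1 \<omega>) (Lp_norm 1 \<omega>)"
      unfolding dual_space_def
    proof (intro CollectI conjI ballI allI exI[of _ "2 * pi"])
      fix h k assume "h \<in> Bergman 1 \<omega>" "k \<in> Bergman 1 \<omega>"
      hence "integrable \<nu> h" "integrable \<nu> k" by (auto simp: Bergman_1_iff)
      from Bochner_Integration.integral_add[OF P(1)[OF this(1)] P(1)[OF this(2)]]
      show "L (\<lambda>z. h z + k z) = L h + L k" by (simp add: L_def distrib_right)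
    next
      show "L (\<lambda>z. c * h z) = c * L h" for c h by (simp add: L_def mult.assoc)
    qed (rule Lb)
    then obtain g where g: "g \<in> Bloch" "\<And>h. h \<in> Bergman 1 \<omega> \<Longrightarrow> L h = A2_pairing \<omega> h g"
      using dual unfolding dual_via_A2_pairing_def by blast
    have gh: "g holomorphic_on \<D>" using g by (simp add: Bloch_def)
    have "proj_coeff f n = taylor g n" for n
    proof -
      have "cnj (LINT \<zeta>|\<nu>. f \<zeta> * cnj \<zeta> ^ n) = (LINT \<zeta>|\<nu>. cnj (f \<zeta> * cnj \<zeta> ^ n))" by (rule Bochner_Integration.integral_cnj[symmetric])
      also have "\<dots> = L (\<lambda>z. z ^ n)" by (simp add: L_def mult.commute)
      also have "\<dots> = cnj (taylor g n) * of_real (2 * moment \<omega> (2 * real n + 1))"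
        unfolding g(2)[OF monomial(1)] by (rule pairing_monomial[OF gh gi[OF g(1)]])
      finally have "cnj (cnj (LINT \<zeta>|\<nu>. f \<zeta> * cnj \<zeta> ^ n)) = cnj (cnj (taylor g n) * of_real (2 * moment \<omega> (2 * real n + 1)))" by (rule arg_cong)
      hence e: "(LINT \<zeta>|\<nu>. f \<zeta> * cnj \<zeta> ^ n) = taylor g n * of_real (2 * moment \<omega> (2 * real n + 1))"
        by (simp only: complex_cnj_mult complex_cnj_cnj complex_cnj_complex_of_real)
      have "proj_coeff f n = taylor g n * of_real (2 * moment \<omega> (2 * real n + 1) * kernel_coeff n)"
        unfolding proj_coeff_def e by (simp add: mult_ac)
      thus ?thesis unfolding moment_kernel_coeff by simp
    qed
    hence "proj_coeff f = taylor g" by (rule ext)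
    hence "deriv (psum (proj_coeff f)) z = deriv g z"
      using deriv_eq_on_disc[OF taylor_series(2)[OF gh] z] by simp
    hence "norm (deriv (psum (proj_coeff f)) z) * (1 - (norm z)\<^sup>2) \<le> Bloch_norm g"
      using Bloch_deriv[OF g(1) z] norm_ge_zero[of "g 0"] by (simp del: norm_ge_zero)
    also have "\<dots> \<le> 2 * pi / a"
    proof -
      have "dual_norm (Bergman 1 \<omega>) (Lp_norm 1 \<omega>) (\<lambda>f. A2_pairing \<omega> f g) \<le> 2 * pi"
        by (rule dual_norm_le) (use Lb g(2) in auto)
      thus ?thesis using a(2)[OF g(1)] a(1) by (simp add: pos_le_divide_eq mult.commute)
    qed
    finally show "norm (deriv (psum (proj_coeff f)) z) * (1 - (norm z)\<^sup>2) \<le> 2 * pi / a" .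
  qed
qed

text \<open>The moments cancel the kernel coefficients and leave the Taylor series of the derivative
  at \<open>r * z\<close>. As \<open>deriv f\<close> is continuous at \<open>z\<close>, the limit
  exists for every holomorphic function.\<close>

lemma pairing_kernel_coeff:
  assumes f: "f holomorphic_on \<D>" and z: "z \<in> \<D>"
  shows "A2_pairing \<omega> f (psum (kernel_deriv_coeff z)) = deriv f z"
proof -
  let ?g = "psum (kernel_deriv_coeff z)"
  have ds: "disc_series (kernel_deriv_coeff z)" by (rule strong_series_disc[OF kernel_deriv_coeff_strong[OF z]])
  have g: "?g holomorphic_on \<D>" "integrable \<nu> ?g"
    using disc_space.series[OF Bergman_space kernel_deriv_coeff_strong[OF z]] by (auto simp: Bergman_1_iff)
  have eq: "dpair f ?g r = of_real r * deriv f (of_real r * z)" if r: "0 \<le> r \<and> r < 1" for r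
  proof -
    let ?t = "\<lambda>n. taylor f n * of_real r ^ n * cnj (kernel_deriv_coeff z n) * of_real (2 * moment \<omega> (2 * real n + 1))"
    have rz: "of_real r * z \<in> \<D>" using r z by (intro dilate_in_disc) auto
    have "?t sums dpair f ?g r" using dpair_sums[OF f _ _ g, of r] r by (simp add: taylor_psum[OF ds])
    hence "(\<lambda>n. ?t (Suc n)) sums dpair f ?g r"
      using sums_Suc_iff[of ?t] by (simp add: kernel_deriv_coeff_def)
    moreover have "?t (Suc n) = of_real r * (diffs (taylor f) n * (of_real r * z) ^ n)" for n
    proof -
      have "?t (Suc n) = of_real r * (diffs (taylor f) n * (of_real r * z) ^ n) * of_real (2 * moment \<omega> (2 * real (Suc n) + 1) * kernel_coeff (Suc n))"
        by (simp add: kernel_deriv_coeff_def diffs_def power_mult_distrib mult_ac)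
      thus ?thesis unfolding moment_kernel_coeff by simp
    qed
    moreover have "(\<lambda>n. of_real r * (diffs (taylor f) n * (of_real r * z) ^ n)) sums (of_real r * psum (diffs (taylor f)) (of_real r * z))"
      unfolding psum_def
      by (rule sums_mult[OF summable_sums[OF disc_series_summable(2)[OF disc_series_diffs[OF taylor_series(1)[OF f]] rz]]])
    ultimately have "dpair f ?g r = of_real r * psum (diffs (taylor f)) (of_real r * z)" by (simp only: sums_unique2)
    thus ?thesis
      using deriv_psum[OF taylor_series(1)[OF f] rz] deriv_eq_on_disc[OF taylor_series(2)[OF f] rz] by simp
  qed
  have "isCont (deriv f) z"
    using holomorphic_on_imp_continuous_on[OF holomorphic_deriv[OF f open_ball]] z by (simp add: continuous_on_eq_continuous_at)
  moreover have "((\<lambda>r. of_real r * z) \<longlongrightarrow> of_real 1 * z) (at_left (1::real))" by (intro tendsto_intros)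
  ultimately have "((\<lambda>r. of_real r * deriv f (of_real r * z)) \<longlongrightarrow> of_real 1 * deriv f z) (at_left (1::real))"
    by (intro tendsto_intros isCont_tendsto_compose[of z "deriv f"]) auto
  moreover have "\<forall>\<^sub>F r in at_left 1. of_real r * deriv f (of_real r * z) = dpair f ?g r"
    using at_left_1_unit by eventually_elim (simp add: eq)
  ultimately have "(dpair f ?g \<longlongrightarrow> of_real 1 * deriv f z) (at_left 1)" by (rule Lim_transform_eventually)
  from pairing_limit(2)[OF f g this] show ?thesis by simp
qed

text \<open>Evaluating the derivative at z has norm at most \<open>1 / (1 - (norm z)^2)\<close> on
  the little Bloch space by the definition of the Bloch norm, and it is represented by the
  differentiated kernel. Equivalence of norms converts this into the \<open>L1\<close> bound for the
  kernel that makes the projection bounded.\<close>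

lemma little_Bloch_dual_imp_D_hat:
  assumes dual: "dual_via_A2_pairing \<omega> little_Bloch Bloch_norm (Bergman 1 \<omega>) (Lp_norm 1 \<omega>)"
  shows "\<omega> \<in> D_hat"
proof -
  interpret disc_space little_Bloch Bloch_norm 1 by (rule little_Bloch_space)
  obtain a where a: "a > 0" "\<And>g. g \<in> Bergman 1 \<omega> \<Longrightarrow> a * Lp_norm 1 \<omega> g \<le> dual_norm little_Bloch Bloch_norm (\<lambda>f. A2_pairing \<omega> f g)"
    using dual unfolding dual_via_A2_pairing_def by blast
  show ?thesis
  proof (rule proj_bounded_imp_D_hat[where B="2 * pi / a"])
    fix f :: "complex \<Rightarrow> complex" and z assume f: "f \<in> borel_measurable \<nu>" "\<And>\<zeta>. norm (f \<zeta>) \<le> 2 * pi" and z: "z \<in> \<D>"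
    let ?g = "psum (kernel_deriv_coeff z)"
    have g: "?g \<in> Bergman 1 \<omega>" using disc_space.series[OF Bergman_space kernel_deriv_coeff_strong[OF z]] by blast
    hence gh: "?g holomorphic_on \<D>" by (simp add: Bergman_1_iff)
    define q where "q = 1 - (norm z)\<^sup>2"
    have q: "q > 0" using z by (simp add: q_def power_less_one_iff abs_square_less_1)
    have "dual_norm little_Bloch Bloch_norm (\<lambda>f. A2_pairing \<omega> f ?g) \<le> 1 / q"
    proof (rule dual_norm_le)
      show "0 \<le> 1 / q" using q by simp
      fix h assume h: "h \<in> little_Bloch"
      have "norm (deriv h z) * q \<le> Bloch_norm h"
        using Bloch_deriv[OF little_Bloch_subset[OF h] z] norm_ge_zero[of "h 0"] unfolding q_def by linarith
      thus "norm (A2_pairing \<omega> h ?g) \<le> 1 / q * Bloch_norm h"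
        unfolding pairing_kernel_coeff[OF hol[OF h] z] using q by (simp add: pos_le_divide_eq)
    qed
    hence "a * L1 ?g \<le> 1 / q" using a(2)[OF g] Lp_norm_1[OF holomorphic_measurable[OF gh]] by simp
    hence l1: "L1 ?g * q \<le> 1 / a" using q a(1) by (simp add: field_simps)
    have "norm (deriv (psum (proj_coeff f)) z) \<le> 2 * pi * L1 ?g"
      unfolding kernel_L1[OF z] by (rule proj_deriv_bound[OF f(1) _ z]) (use f(2) in auto)
    hence "norm (deriv (psum (proj_coeff f)) z) * q \<le> 2 * pi * L1 ?g * q" using q by (intro mult_right_mono) auto
    also have "\<dots> = 2 * pi * (L1 ?g * q)" by simp
    also have "\<dots> \<le> 2 * pi * (1 / a)" by (intro mult_left_mono l1) simp
    finally show "norm (deriv (psum (proj_coeff f)) z) * (1 - (norm z)\<^sup>2) \<le> 2 * pi / a" unfolding q_def by simp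
  qed
qed

end

theorem theorem3:
  fixes \<omega> :: "real \<Rightarrow> real"
  assumes "radial_weight \<omega>"
  shows
    "((bounded_op (Bergman_proj \<omega>) Linf_space Linf_norm Bloch Bloch_norm \<and>
        onto_op (Bergman_proj \<omega>) Linf_space Bloch)
      \<longleftrightarrow> dual_via_A2_pairing \<omega> (Bergman 1 \<omega>) (Lp_norm 1 \<omega>) Bloch Bloch_norm) \<and>
     (dual_via_A2_pairing \<omega> (Bergman 1 \<omega>) (Lp_norm 1 \<omega>) Bloch Bloch_norm
      \<longleftrightarrow> dual_via_A2_pairing \<omega> little_Bloch Bloch_norm (Bergman 1 \<omega>) (Lp_norm 1 \<omega>)) \<and>
     (dual_via_A2_pairing \<omega> little_Bloch Bloch_norm (Bergman 1 \<omega>) (Lp_norm 1 \<omega>)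
      \<longleftrightarrow> \<omega> \<in> D_class) \<and>
     (\<omega> \<in> D_class \<longleftrightarrow> \<omega> \<in> D_hat \<inter> M_class)"
proof -
  interpret weighted_disc \<omega> by unfold_locales (rule assms)
  have D: "\<omega> \<in> D_class \<longleftrightarrow> \<omega> \<in> D_hat \<and> \<omega> \<in> D_check" by (simp add: D_class_def)
  \<comment> \<open>The chain of equivalences is proved as a star with centre
    \<open>\<omega> \<in> D_class\<close>.\<close>
  have "\<omega> \<in> D_class" if "bounded_op (Bergman_proj \<omega>) Linf_space Linf_norm Bloch Bloch_norm"
    "onto_op (Bergman_proj \<omega>) Linf_space Bloch"
    using projection_imp_D_hat projection_imp_M D_class_iff that by blast
  moreover have "\<omega> \<in> D_class" if "dual_via_A2_pairing \<omega> (Bergman 1 \<omega>) (Lp_norm 1 \<omega>) Bloch Bloch_norm"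
    using Bergman_dual_imp_D_hat Bergman_dual_imp_M D_class_iff that by blast
  moreover have "\<omega> \<in> D_class" if "dual_via_A2_pairing \<omega> little_Bloch Bloch_norm (Bergman 1 \<omega>) (Lp_norm 1 \<omega>)"
    using little_Bloch_dual_imp_D_hat little_Bloch_dual_imp_M D_class_iff that by blast
  ultimately show ?thesis
    using D D_class_iff projection_bounded projection_onto Bergman_dual_Bloch little_Bloch_dual_Bergman by blast
qed

end
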